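(* Suppose that $r\in\mathbb N_0$, $N\in\mathbb N$, $1\le p\le\infty$, $\alpha,\beta\in J_p$ are such that $r/2+\alpha\ge0$ and $r/2+\beta\ge0$, and $\phi\in\Phi$ is such that $$\int_0^1\frac{r\phi(u)}{u^{r+1}}\,du<+\infty$$ (if $r=0$ this condition is vacuous). If $f\in L_p^{\alpha,\beta}$ is such that $$E_n(f)_{\alpha,\beta,p}\le\phi\left(\frac1{n+1}\right)\quad\text{for all } n\ge N,$$ then $f\in\mathbb B_p^r(w_{\alpha,\beta})$, and for all $k\in\mathbb N$ and $0<t\le1/2$, $$\omega_{k,r}^{\varphi}(f^{(r)},t)_{\alpha,\beta,p}\le c\int_0^t\frac{r\phi(u)}{u^{r+1}}\,du+c\,t^k\int_t^1\frac{\phi(u)}{u^{k+r+1}}\,du+c(N)\,t^kE_{k+r}(f)_{\alpha,\beta,p}.$$ In particular, if $N\le k+r$, then $$\omega_{k,r}^{\varphi}(f^{(r)},t)_{\alpha,\beta,p}\le c\int_0^t\frac{r\phi(u)}{u^{r+1}}\,du+c\,t^k\int_t^1\frac{\phi(u)}{u^{k+r+1}}\,du.$$ Here the constants $c$ depend only on $k,r,p,\alpha,\beta$, and $c(N)$ depends only on $k,r,p,\alpha,\beta$ and $N$.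
   Context: $\Phi$ is the set of nondecreasing functions $\phi:[0,\infty)\to[0,\infty)$ satisfying $\lim_{t\to0^+}\phi(t)=0$. $J_p=(-1/p,\infty)$ if $0<p<\infty$ and $J_\infty=[0,\infty)$. Jacobi weight: $w_{\alpha,\beta}(x)=(1-x)^\alpha(1+x)^\beta$. $\varphi(x)=\sqrt{1-x^2}$. $\|\cdot\|_p$ is the usual $L_p$ norm on $[-1,1]$ (essential supremum if $p=\infty$). $L_p^{\alpha,\beta}=\{f:\|w_{\alpha,\beta}f\|_p<\infty\}$ (functions on $[-1,1]$, identified if equal a.e.). $\mathbb P_n$ is the set of algebraic polynomials of degree not more than $n-1$, and $E_n(f)_{\alpha,\beta,p}=\inf_{p_n\in\mathbb P_n}\|w_{\alpha,\beta}(f-p_n)\|_p$ (also written $E_n(f)_{w_{\alpha,\beta},p}$). $\mathbb B_p^0(w_{\alpha,\beta})=L_p^{\alpha,\beta}$ and, for $r\ge1$, $\mathbb B_p^r(w_{\alpha,\beta})=\{f: f^{(r-1)}\in AC_{loc}(-1,1)\text{ and }\varphi^rf^{(r)}\in L_p^{\alpha,\beta}\}$, where $AC_{loc}(-1,1)$ is the set of functions locally absolutely continuous in $(-1,1)$. A function in $\mathbb B_p^r(w_{\alpha,\beta})$ is not distinguished from functions equal to it a.e. (so "$f\in\mathbb B_p^r(w_{\alpha,\beta})$" means that $f$ coincides a.e. with such a function). Symmetric difference: $\Delta_h^k(g,x)=\sum_{i=0}^k\binom ki(-1)^{k-i}g(x-\frac{kh}2+ih)$ if $[x-\frac{kh}2,x+\frac{kh}2]\subseteq[-1,1]$,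 and $\Delta_h^k(g,x)=0$ otherwise. $\mathcal W_\delta^{\xi,\zeta}(x)=(1-x-\delta\varphi(x)/2)^\xi(1+x-\delta\varphi(x)/2)^\zeta$. Modulus: for $k\in\mathbb N$, $r\in\mathbb N_0$, $f\in\mathbb B_p^r(w_{\alpha,\beta})$ and $t>0$, $$\omega_{k,r}^{\varphi}(f^{(r)},t)_{\alpha,\beta,p}=\sup_{0\le h\le t}\big\|\mathcal W_{kh}^{r/2+\alpha,r/2+\beta}(\cdot)\,\Delta_{h\varphi(\cdot)}^k(f^{(r)},\cdot)\big\|_p,$$ where the expression under the norm is understood to be $0$ at points $x$ where $\Delta^k_{h\varphi(x)}(f^{(r)},x)$ is set to $0$ because $[x-\frac{kh\varphi(x)}{2},x+\frac{kh\varphi(x)}{2}]\not\subseteq[-1,1]$. *)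

theory Defs
  imports
    "HOL-Probability.Essential_Supremum"
    "HOL-Computational_Algebra.Polynomial"
begin

definition Phi_class :: "(real \<Rightarrow> real) set" where
  "Phi_class = {\<phi>. mono_on {0..} \<phi> \<and> (\<forall>t\<ge>0. 0 \<le> \<phi> t) \<and> (\<phi> \<longlongrightarrow> 0) (at_right 0)}"

definition J_exp :: "ennreal \<Rightarrow> real set" where
  "J_exp p = (if p = \<infinity> then {0..} else {- 1 / enn2real p <..})"

(* Isabelle sets 0 powr 0 = 0, so weights with a zero exponent vanish instead of being 1
   where the base is 0.  In jacobi_w and in shifted_w (for each fixed d) this concerns
   finitely many x only and is invisible to the norms below. *)
definition jacobi_w :: "real \<Rightarrow> real \<Rightarrow> real \<Rightarrow> real" where
  "jacobi_w \<alpha> \<beta> x = (1 - x) powr \<alpha> * (1 + x) powr \<beta>"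

definition vphi :: "real \<Rightarrow> real" where
  "vphi x = sqrt (1 - x\<^sup>2)"

definition shifted_w :: "real \<Rightarrow> real \<Rightarrow> real \<Rightarrow> real \<Rightarrow> real" where
  "shifted_w d \<xi> \<zeta> x = (1 - x - d * vphi x / 2) powr \<xi> * (1 + x - d * vphi x / 2) powr \<zeta>"

(* The L_p norm on [-1,1], with values in [0,\<infinity>]; meaningful for Lebesgue measurable g. *)
definition Lp_norm :: "ennreal \<Rightarrow> (real \<Rightarrow> real) \<Rightarrow> ennreal" where
  "Lp_norm p g =
     (if p = \<infinity> then esssup (lebesgue_on {-1..1}) (\<lambda>x. ennreal \<bar>g x\<bar>)
      else let I = (\<integral>\<^sup>+x. ennreal (\<bar>g x\<bar> powr enn2real p) \<partial>lebesgue_on {-1..1})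
           in if I = \<infinity> then \<infinity> else ennreal (enn2real I powr (1 / enn2real p)))"

(* Elements are functions, not classes; a.e. equality is handled explicitly where it matters. *)
definition Lp_weighted :: "ennreal \<Rightarrow> real \<Rightarrow> real \<Rightarrow> (real \<Rightarrow> real) set" where
  "Lp_weighted p \<alpha> \<beta> = {f. f \<in> borel_measurable (lebesgue_on {-1..1}) \<and>
     Lp_norm p (\<lambda>x. jacobi_w \<alpha> \<beta> x * f x) < \<infinity>}"

definition polys_below :: "nat \<Rightarrow> real poly set" where
  "polys_below n = {q. q = 0 \<or> degree q < n}"

definition best_approx :: "nat \<Rightarrow> (real \<Rightarrow> real) \<Rightarrow> ennreal \<Rightarrow> real \<Rightarrow> real \<Rightarrow> ennreal" where
  "best_approx n f p \<alpha> \<beta> =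
     (INF q\<in>polys_below n. Lp_norm p (\<lambda>x. jacobi_w \<alpha> \<beta> x * (f x - poly q x)))"

(* The members of D are nonoverlapping compact intervals {Inf K..Sup K}. *)
definition abs_cont_on :: "real \<Rightarrow> real \<Rightarrow> (real \<Rightarrow> real) \<Rightarrow> bool" where
  "abs_cont_on a b f \<longleftrightarrow>
     (\<forall>\<epsilon>>0. \<exists>\<delta>>0. \<forall>D S. D division_of S \<and> S \<subseteq> {a..b} \<and> (\<Sum>K\<in>D. Sup K - Inf K) < \<delta> \<longrightarrow>
        (\<Sum>K\<in>D. \<bar>f (Sup K) - f (Inf K)\<bar>) < \<epsilon>)"

definition AC_loc :: "(real \<Rightarrow> real) \<Rightarrow> bool" where
  "AC_loc f \<longleftrightarrow> (\<forall>a b. -1 < a \<and> a \<le> b \<and> b < 1 \<longrightarrow> abs_cont_on a b f)"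

(* For r \<ge> 1 the derivatives of order < r exist everywhere in (-1,1) and the r-th one exists a.e.,
   by local absolute continuity; (deriv ^^ r) f has unspecified values on the exceptional null set. *)
definition B_rep :: "ennreal \<Rightarrow> nat \<Rightarrow> real \<Rightarrow> real \<Rightarrow> (real \<Rightarrow> real) set" where
  "B_rep p r \<alpha> \<beta> =
     (if r = 0 then Lp_weighted p \<alpha> \<beta>
      else {f. (\<forall>j<r - 1. \<forall>x\<in>{-1<..<1}. (deriv ^^ j) f differentiable (at x)) \<and>
               AC_loc ((deriv ^^ (r - 1)) f) \<and>
               (\<lambda>x. vphi x ^ r * (deriv ^^ r) f x) \<in> Lp_weighted p \<alpha> \<beta>})"

definition ae_eq :: "(real \<Rightarrow> real) \<Rightarrow> (real \<Rightarrow> real) \<Rightarrow> bool" where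
  "ae_eq f g \<longleftrightarrow> (AE x in lebesgue_on {-1..1}. f x = g x)"

definition B_space :: "ennreal \<Rightarrow> nat \<Rightarrow> real \<Rightarrow> real \<Rightarrow> (real \<Rightarrow> real) set" where
  "B_space p r \<alpha> \<beta> = {f. \<exists>g\<in>B_rep p r \<alpha> \<beta>. ae_eq f g}"

definition sym_diff :: "nat \<Rightarrow> real \<Rightarrow> (real \<Rightarrow> real) \<Rightarrow> real \<Rightarrow> real" where
  "sym_diff k h g x =
     (if {x - real k * h / 2 .. x + real k * h / 2} \<subseteq> {-1..1}
      then \<Sum>i\<le>k. real (k choose i) * (-1) ^ (k - i) * g (x - real k * h / 2 + real i * h)
      else 0)"

(* Here g plays the role of the r-th derivative.  Outside the domain of the difference sym_diff
   is 0, so the product is 0 there whatever value powr takes at a negative base. *)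
definition modulus :: "nat \<Rightarrow> nat \<Rightarrow> (real \<Rightarrow> real) \<Rightarrow> real \<Rightarrow> ennreal \<Rightarrow> real \<Rightarrow> real \<Rightarrow> ennreal" where
  "modulus k r g t p \<alpha> \<beta> =
     (SUP h\<in>{0..t}. Lp_norm p (\<lambda>x. shifted_w (real k * h) (real r / 2 + \<alpha>) (real r / 2 + \<beta>) x
                                     * sym_diff k (h * vphi x) g x))"

definition approx_rate_hyp ::
  "nat \<Rightarrow> nat \<Rightarrow> ennreal \<Rightarrow> real \<Rightarrow> real \<Rightarrow> (real \<Rightarrow> real) \<Rightarrow> (real \<Rightarrow> real) \<Rightarrow> bool" where
  "approx_rate_hyp r N p \<alpha> \<beta> \<phi> f \<longleftrightarrow>
     \<phi> \<in> Phi_class \<and>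
     (\<integral>\<^sup>+u\<in>{0<..1}. ennreal (real r * \<phi> u / u ^ (r + 1)) \<partial>lborel) < \<infinity> \<and>
     f \<in> Lp_weighted p \<alpha> \<beta> \<and>
     (\<forall>n\<ge>N. best_approx n f p \<alpha> \<beta> \<le> ennreal (\<phi> (1 / (real n + 1))))"

definition inverse_bound :: "nat \<Rightarrow> nat \<Rightarrow> (real \<Rightarrow> real) \<Rightarrow> real \<Rightarrow> real \<Rightarrow> ennreal" where
  "inverse_bound k r \<phi> c t =
     ennreal c * (\<integral>\<^sup>+u\<in>{0<..t}. ennreal (real r * \<phi> u / u ^ (r + 1)) \<partial>lborel) +
     ennreal (c * t ^ k) * (\<integral>\<^sup>+u\<in>{t..1}. ennreal (\<phi> u / u ^ (k + r + 1)) \<partial>lborel)"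

end

(* Telescope near-best polynomials P_n of degree below 2^n. The Bernstein inequality
   |w vphi^r Q^(r)|_p <= C m^r |w Q|_p for polynomials Q of degree below m makes the weighted L_p
   norms of the r-th derivatives of P_(n+1) - P_n summable, and monotonicity of \<phi> turns the dyadic
   sums into the integrals of the claim. For the modulus, take 2^L about 1/t: the part
   f^(r) - P_L^(r) is bounded by its weighted norm, since the shift x -> x + s vphi(x) costs only a
   constant factor, and the part P_L^(r) by t^k times the weighted norm of P_L^(k+r).

   For the Bernstein inequality substitute x = cos y. The derivative of a trigonometric polynomial
   is reproduced by integration against a localised kernel, and a further factor can be inserted
   that vanishes at the zeros and singularities of the Jacobi weight. Jensen's inequality for
   kernels then gives all finite p, and a pointwise bound gives p = \<infinity>.

   The r-th derivatives converge in the local L_1 sense only, so the last differentiation of the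
   limit holds almost everywhere; this uses a Vitali maximal inequality. *)

theory Submission
  imports Defs
begin

section \<open>Norms and Jensen's inequality for kernels\<close>

text \<open>The obstacle in the Bernstein inequality is that the Jacobi weight may vanish or blow up
  at the endpoints. Moving it from \<theta> to y costs a power of 1 + n |\<theta> - y|, which the
  decay of the kernel pays for, except within 1/n of an endpoint. There a vanishing weight at y is
  compensated by the inserted factor, which is at most a constant times min(1, n |sin y|)^(2K), and
  a singular weight at \<theta> is integrated. This is possible because its exponent after the
  substitution exceeds -1, which for finite p is the condition
  \<open>\<alpha> \<in> J_exp p\<close>.

  The conditions r/2 + \<alpha> \<ge> 0 and r/2 + \<beta> \<ge> 0 enter with the modulus: for
  nonnegative exponents \<open>shifted_w\<close> is dominated by the Jacobi weight at every node of
  the difference.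

  The polynomials P_n are optimal only up to a slack \<epsilon> / 2^(n (k+r+1)), whose contribution
  to all dyadic sums is a multiple of \<epsilon> and disappears in the end. The term with E_(k+r)
  comes from the first polynomial of the telescope. For N \<le> k+r it is absorbed by the second
  integral, because then E_(k+r) \<le> \<phi>(1/2).\<close>

lemma ennreal_exponent_cases:
  fixes p :: ennreal
  assumes "1 \<le> p"
  obtains (infinite) "p = top" | (finite) q where "1 \<le> q" "p = ennreal q"
proof (cases p)
  case (real r)
  then have "1 \<le> r" using assms by (metis ennreal_1 ennreal_le_iff)
  then show ?thesis using real finite by blast
qed (use infinite in auto)

text \<open>Completion and restriction are stripped here once, so that substitution and Fubini can
  be used for \<open>lborel\<close>.\<close>

lemma nn_integral_interval_lborel:
  "(\<integral>\<^sup>+x. f x \<partial>lebesgue_on {-1..1::real}) = (\<integral>\<^sup>+x. f x * indicator {-1..1} x \<partial>lborel)"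
  by (simp add: nn_integral_restrict_space nn_integral_completion)

lemma AE_interval_lborel:
  "(AE x in lebesgue_on {-1..1::real}. P x) \<longleftrightarrow> (AE x in lborel. x \<in> {-1..1} \<longrightarrow> P x)"
  by (simp add: AE_restrict_space_iff AE_completion_iff)

lemma AE_open_interval: "AE x in lebesgue_on {-1..1::real}. -1 < x \<and> x < 1"
proof -
  have "AE x in lborel. x \<noteq> (-1::real)" "AE x in lborel. x \<noteq> (1::real)"
    by (rule AE_lborel_singleton)+
  then show ?thesis
    unfolding AE_interval_lborel by eventually_elim auto
qed

lemma borel_measurable_lebesgue_onI:
  "f \<in> borel_measurable borel \<Longrightarrow> f \<in> borel_measurable (lebesgue_on (S::real set))"
  by (intro measurable_restrict_space1 measurable_completion) simp

text \<open>Completeness of the measure lets functions be changed on null sets; this serves for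
  derivatives and limits that are known almost everywhere only.\<close>

lemma borel_measurable_lebesgue_on_AE:
  fixes f g :: "real \<Rightarrow> real"
  assumes "f \<in> borel_measurable (lebesgue_on {-1..1})" "AE x in lebesgue_on {-1..1}. f x = g x"
  shows "g \<in> borel_measurable (lebesgue_on {-1..1})"
proof -
  have "(\<lambda>x. if x \<in> {-1..1} then f x else 0) \<in> borel_measurable lebesgue"
    using assms(1) by (subst borel_measurable_if) auto
  then have "(\<lambda>x. if x \<in> {-1..1} then g x else 0) \<in> borel_measurable lebesgue"
  proof (rule borel_measurable_AE)
    show "AE x in lebesgue. (if x \<in> {-1..1} then f x else 0) = (if x \<in> {-1..1} then g x else 0)"
      using assms(2) by (auto simp: AE_restrict_space_iff)
  qed
  then show ?thesis by (subst (asm) borel_measurable_if) auto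
qed

text \<open>Norm bounds for finite exponents are handled through this equivalence, which replaces
  the q-th root and the infinite case of \<open>Lp_norm\<close> by one inequality between
  integrals.\<close>

lemma Lp_norm_le_iff_finite:
  assumes "1 \<le> q" "0 \<le> B"
  shows "Lp_norm (ennreal q) f \<le> ennreal B \<longleftrightarrow>
    (\<integral>\<^sup>+x. ennreal (\<bar>f x\<bar> powr q) \<partial>lebesgue_on {-1..1}) \<le> ennreal (B powr q)"
proof -
  define I where "I = (\<integral>\<^sup>+x. ennreal (\<bar>f x\<bar> powr q) \<partial>lebesgue_on {-1..1})"
  show ?thesis
  proof (cases I)
    case (real r)
    have "r powr (1/q) \<le> B \<longleftrightarrow> r \<le> B powr q"
    proof
      assume "r powr (1/q) \<le> B"
      then have "(r powr (1/q)) powr q \<le> B powr q" using assms by (intro powr_mono2) auto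
      then show "r \<le> B powr q" using real assms by (simp add: powr_powr)
    next
      assume "r \<le> B powr q"
      then have "r powr (1/q) \<le> (B powr q) powr (1/q)" using assms real by (intro powr_mono2) auto
      then show "r powr (1/q) \<le> B" using real assms by (simp add: powr_powr)
    qed
    then show ?thesis using assms real unfolding Lp_norm_def I_def[symmetric]
      by (simp add: Let_def I_def[symmetric])
  next
    case top
    then show ?thesis using assms unfolding Lp_norm_def
      by (simp add: Let_def I_def[symmetric] top_unique)
  qed
qed

lemma Lp_norm_le_iff_infinite:
  assumes "f \<in> borel_measurable (lebesgue_on {-1..1})" "0 \<le> B"
  shows "Lp_norm top f \<le> ennreal B \<longleftrightarrow> (AE x in lebesgue_on {-1..1}. \<bar>f x\<bar> \<le> B)"
proof
  assume "Lp_norm top f \<le> ennreal B"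
  then have le: "esssup (lebesgue_on {-1..1}) (\<lambda>x. ennreal \<bar>f x\<bar>) \<le> ennreal B" by (simp add: Lp_norm_def)
  have "AE x in lebesgue_on {-1..1}. ennreal \<bar>f x\<bar> \<le> esssup (lebesgue_on {-1..1}) (\<lambda>x. ennreal \<bar>f x\<bar>)"
    by (rule esssup_AE)
  then show "AE x in lebesgue_on {-1..1}. \<bar>f x\<bar> \<le> B"
    by eventually_elim (use le assms(2) in \<open>metis ennreal_le_iff order_trans\<close>)
next
  assume "AE x in lebesgue_on {-1..1}. \<bar>f x\<bar> \<le> B"
  then show "Lp_norm top f \<le> ennreal B"
    unfolding Lp_norm_def using assms by (auto intro!: esssup_I elim!: eventually_mono simp: ennreal_leI)
qed

text \<open>If the right-hand norm is infinite, so is its product with a positive constant; hence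
  only finite bounds B have to be transported.\<close>

lemma Lp_norm_le_mult:
  assumes "0 < C"
    and "\<And>B. 0 \<le> B \<Longrightarrow> Lp_norm p g \<le> ennreal B \<Longrightarrow> Lp_norm p f \<le> ennreal (C * B)"
  shows "Lp_norm p f \<le> ennreal C * Lp_norm p g"
proof (cases "Lp_norm p g")
  case (real B)
  then show ?thesis using assms by (simp add: ennreal_mult)
next
  case top
  then show ?thesis using assms by (simp add: ennreal_mult_top)
qed

lemma Lp_norm_mono:
  assumes "1 \<le> p" "f \<in> borel_measurable (lebesgue_on {-1..1})"
    and "AE x in lebesgue_on {-1..1}. \<bar>f x\<bar> \<le> \<bar>g x\<bar>"
  shows "Lp_norm p f \<le> Lp_norm p g"
  using \<open>1 \<le> p\<close>
proof (cases rule: ennreal_exponent_cases)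
  case infinite
  then show ?thesis using assms by (auto simp: Lp_norm_def intro!: esssup_AE_mono elim!: eventually_mono)
next
  case (finite q)
  have *: "(\<integral>\<^sup>+x. ennreal (\<bar>f x\<bar> powr q) \<partial>lebesgue_on {-1..1}) \<le> (\<integral>\<^sup>+x. ennreal (\<bar>g x\<bar> powr q) \<partial>lebesgue_on {-1..1})"
    using assms(3) finite
    by (intro nn_integral_mono_AE) (auto elim!: eventually_mono intro!: ennreal_leI powr_mono2)
  have "Lp_norm p f \<le> ennreal 1 * Lp_norm p g"
  proof (rule Lp_norm_le_mult)
    fix B :: real assume "0 \<le> B" "Lp_norm p g \<le> ennreal B"
    then show "Lp_norm p f \<le> ennreal (1 * B)"
      using * finite by (auto simp: Lp_norm_le_iff_finite)
  qed auto
  then show ?thesis by simp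
qed

lemma Lp_norm_cong_AE:
  assumes "1 \<le> p" "f \<in> borel_measurable (lebesgue_on {-1..1})"
    and "AE x in lebesgue_on {-1..1}. \<bar>f x\<bar> = \<bar>g x\<bar>" "g \<in> borel_measurable (lebesgue_on {-1..1})"
  shows "Lp_norm p f = Lp_norm p g"
  using assms by (intro antisym Lp_norm_mono) (auto elim!: eventually_mono)

lemma Lp_norm_scale:
  assumes "1 \<le> p" "f \<in> borel_measurable (lebesgue_on {-1..1})" "0 < C"
    and "AE x in lebesgue_on {-1..1}. \<bar>f x\<bar> \<le> C * \<bar>g x\<bar>" "g \<in> borel_measurable (lebesgue_on {-1..1})"
  shows "Lp_norm p f \<le> ennreal C * Lp_norm p g"
proof (rule Lp_norm_le_mult)
  fix B :: real assume B: "0 \<le> B" "Lp_norm p g \<le> ennreal B"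
  from \<open>1 \<le> p\<close> show "Lp_norm p f \<le> ennreal (C * B)"
  proof (cases rule: ennreal_exponent_cases)
    case infinite
    have "AE x in lebesgue_on {-1..1}. \<bar>g x\<bar> \<le> B"
      using B infinite Lp_norm_le_iff_infinite[OF assms(5)] by auto
    with assms(4) have "AE x in lebesgue_on {-1..1}. \<bar>f x\<bar> \<le> C * B"
      by eventually_elim (use assms(3) in \<open>meson mult_left_mono less_imp_le order_trans\<close>)
    then show ?thesis using B infinite assms Lp_norm_le_iff_infinite[OF assms(2)] by auto
  next
    case (finite q)
    have "(\<integral>\<^sup>+x. ennreal (\<bar>f x\<bar> powr q) \<partial>lebesgue_on {-1..1}) \<le>
        (\<integral>\<^sup>+x. ennreal (C powr q) * ennreal (\<bar>g x\<bar> powr q) \<partial>lebesgue_on {-1..1})"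
    proof (rule nn_integral_mono_AE, use assms(4) in eventually_elim)
      fix x assume "\<bar>f x\<bar> \<le> C * \<bar>g x\<bar>"
      then have "\<bar>f x\<bar> powr q \<le> (C * \<bar>g x\<bar>) powr q" using finite by (intro powr_mono2) auto
      then show "ennreal (\<bar>f x\<bar> powr q) \<le> ennreal (C powr q) * ennreal (\<bar>g x\<bar> powr q)"
        using assms(3) by (simp add: powr_mult ennreal_mult[symmetric] ennreal_leI)
    qed
    also have "\<dots> = ennreal (C powr q) * (\<integral>\<^sup>+x. ennreal (\<bar>g x\<bar> powr q) \<partial>lebesgue_on {-1..1})"
      using assms(5) by (intro nn_integral_cmult) measurable
    also have "\<dots> \<le> ennreal (C powr q) * ennreal (B powr q)"
      using B finite by (intro mult_left_mono) (auto simp: Lp_norm_le_iff_finite)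
    also have "\<dots> = ennreal ((C * B) powr q)" using assms(3) B by (simp add: powr_mult ennreal_mult)
    finally show ?thesis using B finite assms(3) by (auto simp: Lp_norm_le_iff_finite)
  qed
qed (use assms in auto)

text \<open>Convexity of the power at the mean of a/A and b/B with weights A/(A+B) and B/(A+B). With
  A and B norm bounds of two functions, integrating this gives Minkowski's inequality without a
  duality argument.\<close>

lemma powr_sum_le_convex:
  fixes a b A B q :: real
  assumes "1 \<le> q" "0 < A" "0 < B" "0 \<le> a" "0 \<le> b"
  shows "(a + b) powr q \<le> (A + B) powr q * (A / (A + B) * (a powr q / A powr q) + B / (A + B) * (b powr q / B powr q))"
proof -
  have conv: "((A'::real) * x + B' * y) powr q \<le> A' * x powr q + B' * y powr q"
    if "0 \<le> x" "0 \<le> y" "0 < A'" "0 < B'" "A' + B' = 1" for x y A' B'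
  proof -
    have le: "t powr q \<le> t" if "0 < t" "t < 1" for t :: real
      using that assms(1) powr_mono_both'[of 1 q t t] by auto
    \<comment> \<open>Zero arguments are treated apart from convexity on the positive axis; the
      claim then reduces to t^q \<le> t for a weight t in (0,1).\<close>
    consider "x = 0" | "y = 0" | "0 < x" "0 < y" using \<open>0 \<le> x\<close> \<open>0 \<le> y\<close> by (metis order_le_less)
    then show ?thesis
    proof cases
      case 1
      have "(B' * y) powr q = B' powr q * y powr q" using that by (simp add: powr_mult)
      also have "\<dots> \<le> B' * y powr q" using le[of B'] that by (intro mult_right_mono) auto
      finally show ?thesis using 1 assms by simp
    next
      case 2
      have "(A' * x) powr q = A' powr q * x powr q" using that by (simp add: powr_mult)
      also have "\<dots> \<le> A' * x powr q" using le[of A'] that by (intro mult_right_mono) auto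
      finally show ?thesis using 2 assms by simp
    next
      case 3
      then show ?thesis using powr_convex[OF assms(1)] that unfolding convex_on_def by auto
    qed
  qed
  have s: "A / (A + B) + B / (A + B) = 1" using assms by (simp add: add_divide_distrib[symmetric])
  have "(A/(A+B) * (a/A) + B/(A+B) * (b/B)) powr q \<le> A/(A+B) * (a/A) powr q + B/(A+B) * (b/B) powr q"
    using conv[of "a/A" "b/B" "A/(A+B)" "B/(A+B)"] s assms by auto
  moreover have "(a + b) = (A + B) * (A/(A+B) * (a/A) + B/(A+B) * (b/B))"
    using assms by (simp add: field_simps add_divide_distrib[symmetric])
  ultimately have "(a + b) powr q \<le> (A + B) powr q * (A/(A+B) * (a/A) powr q + B/(A+B) * (b/B) powr q)"
    using assms by (metis add_nonneg_nonneg divide_nonneg_nonneg less_imp_le mult_left_mono mult_nonneg_nonneg powr_ge_zero powr_mult)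
  then show ?thesis using assms by (simp add: powr_divide)
qed

lemma Lp_norm_triangle_aux:
  assumes "1 \<le> p" and [measurable]: "f \<in> borel_measurable (lebesgue_on {-1..1})" "g \<in> borel_measurable (lebesgue_on {-1..1})"
    and AB: "0 < A" "0 < B" "Lp_norm p f \<le> ennreal A" "Lp_norm p g \<le> ennreal B"
  shows "Lp_norm p (\<lambda>x. f x + g x) \<le> ennreal (A + B)"
  using \<open>1 \<le> p\<close>
proof (cases rule: ennreal_exponent_cases)
  case infinite
  have "AE x in lebesgue_on {-1..1}. \<bar>f x\<bar> \<le> A" "AE x in lebesgue_on {-1..1}. \<bar>g x\<bar> \<le> B"
    using AB infinite by (auto simp: Lp_norm_le_iff_infinite)
  then have "AE x in lebesgue_on {-1..1}. \<bar>f x + g x\<bar> \<le> A + B" by eventually_elim auto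
  then show ?thesis using AB infinite Lp_norm_le_iff_infinite[of "\<lambda>x. f x + g x" "A + B"] by auto
next
  case (finite q)
  let ?F = "\<lambda>x. ennreal (\<bar>f x\<bar> powr q)" and ?G = "\<lambda>x. ennreal (\<bar>g x\<bar> powr q)"
  \<comment> \<open>The coefficients of |f|^q and |g|^q in \<open>powr_sum_le_convex\<close>; they
    satisfy c A^q + d B^q = (A+B)^q.\<close>
  define c d where "c = (A + B) powr q * (A / (A + B)) / A powr q" and "d = (A + B) powr q * (B / (A + B)) / B powr q"
  have cd: "0 \<le> c" "0 \<le> d" using AB by (auto simp: c_def d_def)
  have I: "(\<integral>\<^sup>+x. ?F x \<partial>lebesgue_on {-1..1}) \<le> ennreal (A powr q)" "(\<integral>\<^sup>+x. ?G x \<partial>lebesgue_on {-1..1}) \<le> ennreal (B powr q)"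
    using AB finite by (auto simp: Lp_norm_le_iff_finite)
  have "(\<integral>\<^sup>+x. ennreal (\<bar>f x + g x\<bar> powr q) \<partial>lebesgue_on {-1..1}) \<le>
      (\<integral>\<^sup>+x. ennreal c * ?F x + ennreal d * ?G x \<partial>lebesgue_on {-1..1})"
  proof (rule nn_integral_mono)
    fix x
    have "\<bar>f x + g x\<bar> powr q \<le> (\<bar>f x\<bar> + \<bar>g x\<bar>) powr q" using finite by (intro powr_mono2) auto
    also have "\<dots> \<le> (A + B) powr q * (A / (A + B) * (\<bar>f x\<bar> powr q / A powr q) + B / (A + B) * (\<bar>g x\<bar> powr q / B powr q))"
      using finite AB by (intro powr_sum_le_convex) auto
    also have "\<dots> = c * \<bar>f x\<bar> powr q + d * \<bar>g x\<bar> powr q" by (simp add: c_def d_def algebra_simps)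
    finally show "ennreal (\<bar>f x + g x\<bar> powr q) \<le> ennreal c * ?F x + ennreal d * ?G x"
      using cd by (simp add: ennreal_mult[symmetric] ennreal_plus[symmetric] ennreal_leI del: ennreal_plus)
  qed
  also have "\<dots> = ennreal c * (\<integral>\<^sup>+x. ?F x \<partial>lebesgue_on {-1..1}) + ennreal d * (\<integral>\<^sup>+x. ?G x \<partial>lebesgue_on {-1..1})"
    by (simp add: nn_integral_add nn_integral_cmult)
  also have "\<dots> \<le> ennreal c * ennreal (A powr q) + ennreal d * ennreal (B powr q)"
    using I by (intro add_mono mult_left_mono) auto
  also have "\<dots> = ennreal (c * A powr q + d * B powr q)" using cd by (simp add: ennreal_mult)
  also have "c * A powr q + d * B powr q = (A + B) powr q"
    using AB by (simp add: c_def d_def distrib_left[symmetric] add_divide_distrib[symmetric])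
  finally show ?thesis unfolding finite using AB finite(1)
    by (subst Lp_norm_le_iff_finite) auto
qed

lemma Lp_norm_triangle:
  assumes "1 \<le> p" "f \<in> borel_measurable (lebesgue_on {-1..1})" "g \<in> borel_measurable (lebesgue_on {-1..1})"
  shows "Lp_norm p (\<lambda>x. f x + g x) \<le> Lp_norm p f + Lp_norm p g"
proof (cases "Lp_norm p f = \<infinity> \<or> Lp_norm p g = \<infinity>")
  case False
  then obtain A B where AB: "0 \<le> A" "0 \<le> B" "Lp_norm p f = ennreal A" "Lp_norm p g = ennreal B"
    by (metis ennreal_cases infinity_ennreal_def)
  show ?thesis
  proof (rule ennreal_le_epsilon)
    fix e :: real assume "0 < e"
    \<comment> \<open>The auxiliary lemma divides by its bounds and needs them positive; the slack
      e/2 covers functions of norm zero.\<close>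
    have "Lp_norm p (\<lambda>x. f x + g x) \<le> ennreal ((A + e/2) + (B + e/2))"
      using AB \<open>0 < e\<close> by (intro Lp_norm_triangle_aux assms) (auto intro!: ennreal_leI)
    also have "(A + e/2) + (B + e/2) = A + B + e" by simp
    finally show "Lp_norm p (\<lambda>x. f x + g x) \<le> Lp_norm p f + Lp_norm p g + ennreal e"
      using AB \<open>0 < e\<close> by simp
  qed
qed auto

lemma Lp_norm_zero: "1 \<le> p \<Longrightarrow> Lp_norm p (\<lambda>x. 0) = 0"
proof -
  assume "1 \<le> p"
  then have "Lp_norm p (\<lambda>x. 0) \<le> ennreal 0"
  proof (cases rule: ennreal_exponent_cases)
    case infinite
    show ?thesis unfolding infinite by (subst Lp_norm_le_iff_infinite) auto
  next
    case (finite q)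
    then show ?thesis unfolding finite by (subst Lp_norm_le_iff_finite) auto
  qed
  then show ?thesis by simp
qed

lemma Lp_norm_sum:
  assumes "1 \<le> p" "finite I" "\<And>i. i \<in> I \<Longrightarrow> f i \<in> borel_measurable (lebesgue_on {-1..1})"
  shows "Lp_norm p (\<lambda>x. \<Sum>i\<in>I. f i x) \<le> (\<Sum>i\<in>I. Lp_norm p (f i))"
  using assms(2,3)
proof (induction I rule: finite_induct)
  case empty
  then show ?case using Lp_norm_zero[OF assms(1)] by simp
next
  case (insert i I)
  have "Lp_norm p (\<lambda>x. f i x + (\<Sum>i\<in>I. f i x)) \<le> Lp_norm p (f i) + Lp_norm p (\<lambda>x. \<Sum>i\<in>I. f i x)"
    using insert.prems by (intro Lp_norm_triangle assms(1) borel_measurable_sum) auto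
  then show ?case using insert by (simp add: add_left_mono order.trans)
qed

lemma Lp_norm_Fatou:
  assumes "1 \<le> p" "\<And>i::nat. f i \<in> borel_measurable (lebesgue_on {-1..1})"
    and lim: "AE x in lebesgue_on {-1..1}. (\<lambda>i. f i x) \<longlonglongrightarrow> g x"
    and g: "g \<in> borel_measurable (lebesgue_on {-1..1})"
    and bound: "\<forall>\<^sub>F i in sequentially. Lp_norm p (f i) \<le> B"
  shows "Lp_norm p g \<le> B"
proof (cases B)
  case (real b)
  from bound obtain n where n: "\<And>i. i \<ge> n \<Longrightarrow> Lp_norm p (f i) \<le> ennreal b"
    using real by (auto simp: eventually_sequentially)
  from \<open>1 \<le> p\<close> show ?thesis
  proof (cases rule: ennreal_exponent_cases)
    case infinite
    have "AE x in lebesgue_on {-1..1}. \<bar>f i x\<bar> \<le> b" if "i \<ge> n" for i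
      using n[OF that] real infinite Lp_norm_le_iff_infinite[OF assms(2)] by auto
    then have "AE x in lebesgue_on {-1..1}. \<forall>i. i \<ge> n \<longrightarrow> \<bar>f i x\<bar> \<le> b"
      by (subst AE_all_countable) auto
    with lim have "AE x in lebesgue_on {-1..1}. \<bar>g x\<bar> \<le> b"
    proof eventually_elim
      case (elim x)
      then show ?case by (intro LIMSEQ_le_const2[of "\<lambda>i. \<bar>f i x\<bar>"] tendsto_rabs) auto
    qed
    then show ?thesis using real infinite Lp_norm_le_iff_infinite[OF g] by auto
  next
    case (finite q)
    have "(\<integral>\<^sup>+x. ennreal (\<bar>g x\<bar> powr q) \<partial>lebesgue_on {-1..1}) =
       (\<integral>\<^sup>+x. liminf (\<lambda>i. ennreal (\<bar>f i x\<bar> powr q)) \<partial>lebesgue_on {-1..1})"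
    proof (rule nn_integral_cong_AE, use lim in eventually_elim)
      case (elim x)
      have "(\<lambda>i. ennreal (\<bar>f i x\<bar> powr q)) \<longlonglongrightarrow> ennreal (\<bar>g x\<bar> powr q)"
        using elim finite by (intro tendsto_ennrealI tendsto_powr2 tendsto_rabs tendsto_const) auto
      then show ?case by (intro lim_imp_Liminf[symmetric]) auto
    qed
    also have "\<dots> \<le> liminf (\<lambda>i. \<integral>\<^sup>+x. ennreal (\<bar>f i x\<bar> powr q) \<partial>lebesgue_on {-1..1})"
      using assms(2) by (intro nn_integral_liminf) measurable
    also have "\<dots> \<le> ennreal (b powr q)"
    proof (rule Liminf_le)
      show "\<forall>\<^sub>F i in sequentially. (\<integral>\<^sup>+x. ennreal (\<bar>f i x\<bar> powr q) \<partial>lebesgue_on {-1..1}) \<le> ennreal (b powr q)"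
        unfolding eventually_sequentially using n finite real by (auto simp: Lp_norm_le_iff_finite)
    qed auto
    finally show ?thesis using finite real by (auto simp: Lp_norm_le_iff_finite)
  qed
qed auto

text \<open>Pointwise |f| \<le> L + L^(1-q) |f|^q: the first term is large enough where |f| \<le> L,
  the second one elsewhere. Integration over an interval of length 2, with L a norm bound, gives 2 L
  + L, whence the constant 3.\<close>

lemma nn_integral_abs_le_Lp_norm:
  assumes "1 \<le> p" "f \<in> borel_measurable (lebesgue_on {-1..1})"
  shows "(\<integral>\<^sup>+x. ennreal \<bar>f x\<bar> \<partial>lebesgue_on {-1..1}) \<le> 3 * Lp_norm p f"
proof (cases "Lp_norm p f")
  case (real B)
  have *: "(\<integral>\<^sup>+x. ennreal \<bar>f x\<bar> \<partial>lebesgue_on {-1..1}) \<le> ennreal (3 * L)" if "L > 0" "B \<le> L" for L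
    using \<open>1 \<le> p\<close>
  proof (cases rule: ennreal_exponent_cases)
    case infinite
    have "AE x in lebesgue_on {-1..1}. \<bar>f x\<bar> \<le> L"
      using real that infinite Lp_norm_le_iff_infinite[OF assms(2)] by (auto intro!: ennreal_leI)
    then have "(\<integral>\<^sup>+x. ennreal \<bar>f x\<bar> \<partial>lebesgue_on {-1..1}) \<le> (\<integral>\<^sup>+x. ennreal L \<partial>lebesgue_on {-1..1::real})"
      by (intro nn_integral_mono_AE) (auto elim!: eventually_mono intro!: ennreal_leI)
    also have "\<dots> = ennreal L * 2" by (simp add: emeasure_restrict_space space_restrict_space)
    also have "\<dots> \<le> ennreal (3 * L)" using that
      by (simp flip: ennreal_numeral ennreal_mult add: ennreal_leI)
    finally show ?thesis .
  next
    case (finite q)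
    have "(\<integral>\<^sup>+x. ennreal (\<bar>f x\<bar> powr q) \<partial>lebesgue_on {-1..1}) \<le> ennreal (L powr q)"
      using real finite that by (subst Lp_norm_le_iff_finite[symmetric]) (auto intro!: ennreal_leI)
    have "(\<integral>\<^sup>+x. ennreal \<bar>f x\<bar> \<partial>lebesgue_on {-1..1}) \<le>
       (\<integral>\<^sup>+x. ennreal L + ennreal (L / L powr q) * ennreal (\<bar>f x\<bar> powr q) \<partial>lebesgue_on {-1..1})"
    proof (rule nn_integral_mono)
      fix x
      have "\<bar>f x\<bar> \<le> L + L / L powr q * \<bar>f x\<bar> powr q"
      proof (cases "\<bar>f x\<bar> \<le> L")
        case True
        then show ?thesis using that by (intro add_increasing2) auto
      next
        case False
        then have "(\<bar>f x\<bar> / L) powr 1 \<le> (\<bar>f x\<bar> / L) powr q" using that finite by (intro powr_mono) auto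
        then have "\<bar>f x\<bar> / L \<le> \<bar>f x\<bar> powr q / L powr q" using that False by (simp add: powr_divide)
        then have "\<bar>f x\<bar> \<le> L * (\<bar>f x\<bar> powr q / L powr q)" using that by (simp add: field_simps)
        then show ?thesis using that by simp
      qed
      then show "ennreal \<bar>f x\<bar> \<le> ennreal L + ennreal (L / L powr q) * ennreal (\<bar>f x\<bar> powr q)"
        using that by (simp add: ennreal_mult[symmetric] ennreal_plus[symmetric] ennreal_leI del: ennreal_plus)
    qed
    also have "\<dots> = ennreal L * 2 + ennreal (L / L powr q) * (\<integral>\<^sup>+x. ennreal (\<bar>f x\<bar> powr q) \<partial>lebesgue_on {-1..1})"
      using assms(2) by (subst nn_integral_add; (subst nn_integral_cmult)?)
        (auto simp: emeasure_restrict_space space_restrict_space)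
    also have "\<dots> \<le> ennreal L * 2 + ennreal (L / L powr q) * ennreal (L powr q)"
      by (intro add_mono mult_left_mono) (fact | simp)+
    also have "\<dots> = ennreal (L * 2 + L / L powr q * L powr q)"
    proof -
      have "ennreal L * 2 = ennreal (L * 2)" using that by (simp add: ennreal_mult)
      moreover have "ennreal (L / L powr q) * ennreal (L powr q) = ennreal (L / L powr q * L powr q)"
        using that by (intro ennreal_mult[symmetric]) auto
      moreover have "ennreal (L * 2 + L / L powr q * L powr q) = ennreal (L * 2) + ennreal (L / L powr q * L powr q)"
        using that by (intro ennreal_plus) auto
      ultimately show ?thesis by (simp only:)
    qed
    also have "\<dots> = ennreal (3 * L)" using that by simp
    finally show ?thesis .
  qed
  show ?thesis
  proof (rule ennreal_le_epsilon)
    fix e :: real assume "0 < e"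
    have "(\<integral>\<^sup>+x. ennreal \<bar>f x\<bar> \<partial>lebesgue_on {-1..1}) \<le> ennreal (3 * (B + e/3))"
      using real \<open>0 < e\<close> by (intro *) auto
    also have "3 * (B + e/3) = 3 * B + e" by simp
    also have "ennreal (3 * B + e) = 3 * Lp_norm p f + ennreal e"
      using real \<open>0 < e\<close> by (simp add: ennreal_plus ennreal_mult)
    finally show "(\<integral>\<^sup>+x. ennreal \<bar>f x\<bar> \<partial>lebesgue_on {-1..1}) \<le> 3 * Lp_norm p f + ennreal e" .
  qed
qed (auto simp: ennreal_mult_top)

section \<open>Young's inequality and Jensen's inequality for kernels of bounded mass\<close>

lemma Young_powr:
  fixes F m q :: real
  assumes "1 \<le> q" "0 \<le> F" "0 \<le> m"
  shows "F * m powr (q - 1) \<le> F powr q / q + (1 - 1/q) * m powr q"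
proof (cases "q = 1")
  \<comment> \<open>The conjugate exponent q/(q-1) does not exist for q = 1, where the claim is
    immediate.\<close>
  case True
  then show ?thesis using assms by (cases "m = 0") auto
next
  case False
  then have q: "q > 1" using assms by auto
  have "F * m powr (q - 1) \<le> F powr q / q + (m powr (q - 1)) powr (q / (q - 1)) / (q / (q - 1))"
    using q assms by (intro Youngs_inequality) (auto simp: field_simps)
  also have "(m powr (q - 1)) powr (q / (q - 1)) = m powr q" using q by (simp add: powr_powr)
  finally show ?thesis using q by (simp add: field_simps)
qed

text \<open>Follows by integrating Young's inequality against k. A mass bound C takes the place of a
  probability measure, and A enters through an upper bound only, so it can be a pointwise value
  dominated by an integral.\<close>

lemma Jensen_kernel:
  fixes k F :: "'a \<Rightarrow> real"
  assumes "1 \<le> q" "0 < C" "0 \<le> A" and [measurable]: "k \<in> borel_measurable M" "F \<in> borel_measurable M"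
    and nn: "\<And>y. 0 \<le> k y" "\<And>y. 0 \<le> F y"
    and A: "ennreal A \<le> (\<integral>\<^sup>+y. ennreal (k y * F y) \<partial>M)" and C: "(\<integral>\<^sup>+y. ennreal (k y) \<partial>M) \<le> ennreal C"
  shows "ennreal (A powr q) \<le> ennreal (C powr (q - 1)) * (\<integral>\<^sup>+y. ennreal (k y * F y powr q) \<partial>M)"
proof (cases "\<integral>\<^sup>+y. ennreal (k y * F y powr q) \<partial>M")
  case (real I)
  \<comment> \<open>The value at which Young's inequality loses nothing: A m^(q-1) = C m^q, so the
    term (1 - 1/q) C m^q cancels and C m^q \<le> I remains.\<close>
  define m where "m = A / C"
  have m: "0 \<le> m" using assms by (simp add: m_def)
  have "ennreal (A * m powr (q - 1)) \<le> (\<integral>\<^sup>+y. ennreal (k y * F y) \<partial>M) * ennreal (m powr (q - 1))"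
    using A assms by (simp add: ennreal_mult mult_right_mono)
  also have "\<dots> = (\<integral>\<^sup>+y. ennreal (k y * F y) * ennreal (m powr (q - 1)) \<partial>M)"
    by (simp add: nn_integral_multc)
  also have "\<dots> \<le> (\<integral>\<^sup>+y. ennreal (k y * F y powr q) * ennreal (1 / q) + ennreal (k y) * ennreal ((1 - 1/q) * m powr q) \<partial>M)"
  proof (rule nn_integral_mono)
    fix y
    have "k y * (F y * m powr (q - 1)) \<le> k y * (F y powr q / q + (1 - 1/q) * m powr q)"
      using assms m by (intro mult_left_mono Young_powr) auto
    then have "k y * F y * m powr (q - 1) \<le> k y * F y powr q * (1 / q) + k y * ((1 - 1/q) * m powr q)"
      by (simp add: algebra_simps)
    then show "ennreal (k y * F y) * ennreal (m powr (q - 1)) \<le>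
        ennreal (k y * F y powr q) * ennreal (1 / q) + ennreal (k y) * ennreal ((1 - 1/q) * m powr q)"
      using nn assms(1) by (simp add: ennreal_mult[symmetric] ennreal_plus[symmetric] ennreal_leI del: ennreal_plus)
  qed
  also have "\<dots> = ennreal I * ennreal (1 / q) + (\<integral>\<^sup>+y. ennreal (k y) \<partial>M) * ennreal ((1 - 1/q) * m powr q)"
    using real by (simp add: nn_integral_add nn_integral_multc)
  also have "\<dots> \<le> ennreal I * ennreal (1 / q) + ennreal C * ennreal ((1 - 1/q) * m powr q)"
    by (intro add_mono mult_right_mono C) auto
  also have "\<dots> = ennreal (I / q + C * ((1 - 1/q) * m powr q))"
    using real assms(1,2) by (simp add: ennreal_mult[symmetric] ennreal_plus[symmetric] del: ennreal_plus)
  finally have "A * m powr (q - 1) \<le> I / q + C * ((1 - 1/q) * m powr q)"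
    using real assms(1,2) by (subst (asm) ennreal_le_iff) auto
  moreover have "A * m powr (q - 1) = C * m powr q"
    using assms(2,3) by (cases "A = 0") (auto simp: m_def powr_diff)
  ultimately have "C * m powr q / q \<le> I / q" by (simp add: algebra_simps)
  then have "C * m powr q \<le> I" using assms(1) by (simp add: divide_le_cancel)
  moreover have "A powr q = C powr (q - 1) * (C * m powr q)"
    using assms(2,3) by (simp add: m_def powr_divide powr_diff)
  ultimately have "A powr q \<le> C powr (q - 1) * I" by (simp add: mult_left_mono)
  then show ?thesis using real by (simp add: ennreal_mult[symmetric] ennreal_leI)
next
  case top
  then show ?thesis using assms(2) by (simp add: ennreal_mult_top)
qed

section \<open>Localised reproducing kernels for trigonometric polynomials\<close>

text \<open>The number d only bounds the degree. In complex exponentials products add frequencies,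
  and orthogonality becomes a condition on integers.\<close>

definition trig_poly :: "nat \<Rightarrow> (real \<Rightarrow> complex) \<Rightarrow> bool" where
  "trig_poly d F \<longleftrightarrow> (\<exists>c::int \<Rightarrow> complex. \<forall>v. F v = (\<Sum>m=-int d..int d. c m * cis (of_int m * v)))"

lemma trig_poly_cis:
  assumes "\<bar>k\<bar> \<le> int d"
  shows "trig_poly d (\<lambda>v. a * cis (of_int k * v))"
  unfolding trig_poly_def
proof (intro exI allI)
  fix v
  have "(\<Sum>m=-int d..int d. (if m = k then a else 0) * cis (of_int m * v)) =
      (\<Sum>m=-int d..int d. if m = k then a * cis (of_int m * v) else 0)" by (intro sum.cong) auto
  also have "\<dots> = a * cis (of_int k * v)" using assms by (auto simp: abs_le_iff)
  finally show "a * cis (of_int k * v) = (\<Sum>m=-int d..int d. (if m = k then a else 0) * cis (of_int m * v))" by simp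
qed

lemma trig_poly_const: "trig_poly d (\<lambda>v. a)"
  using trig_poly_cis[of 0 d a] by simp

lemma trig_poly_add:
  assumes "trig_poly d F" "trig_poly d G"
  shows "trig_poly d (\<lambda>v. F v + G v)"
proof -
  obtain c e where "\<And>v. F v = (\<Sum>m=-int d..int d. c m * cis (of_int m * v))"
    "\<And>v. G v = (\<Sum>m=-int d..int d. e m * cis (of_int m * v))"
    using assms unfolding trig_poly_def by auto
  then have "F v + G v = (\<Sum>m=-int d..int d. (c m + e m) * cis (of_int m * v))" for v
    by (simp add: sum.distrib distrib_right)
  then show ?thesis unfolding trig_poly_def by (intro exI[of _ "\<lambda>m. c m + e m"]) auto
qed

lemma trig_poly_sum:
  assumes "finite I" "\<And>i. i \<in> I \<Longrightarrow> trig_poly d (F i)"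
  shows "trig_poly d (\<lambda>v. \<Sum>i\<in>I. F i v)"
  using assms by (induction I rule: finite_induct) (auto intro: trig_poly_const trig_poly_add)

lemma trig_poly_mult:
  assumes "trig_poly d F" "trig_poly e G"
  shows "trig_poly (d + e) (\<lambda>v. F v * G v)"
proof -
  obtain b c where "\<And>v. F v = (\<Sum>m=-int d..int d. b m * cis (of_int m * v))"
    "\<And>v. G v = (\<Sum>m=-int e..int e. c m * cis (of_int m * v))"
    using assms unfolding trig_poly_def by auto
  then have "(\<lambda>v. F v * G v) = (\<lambda>v. \<Sum>m=-int d..int d. \<Sum>k=-int e..int e. (b m * c k) * cis (of_int (m + k) * v))"
    by (simp add: sum_product fun_eq_iff cis_mult[symmetric] distrib_right algebra_simps)
  moreover have "trig_poly (d + e) \<dots>"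
    by (intro trig_poly_sum trig_poly_cis) auto
  ultimately show ?thesis by simp
qed

lemma trig_poly_scale: "trig_poly d F \<Longrightarrow> trig_poly d (\<lambda>v. a * F v)"
  using trig_poly_mult[OF trig_poly_const[of 0 a]] by auto

lemma trig_poly_mono:
  assumes "trig_poly d F" "d \<le> e"
  shows "trig_poly e F"
  using trig_poly_mult[OF assms(1) trig_poly_const[of "e - d" 1]] assms(2) by simp

lemma trig_poly_power: "trig_poly d F \<Longrightarrow> trig_poly (k * d) (\<lambda>v. F v ^ k)"
  by (induction k) (auto intro: trig_poly_const trig_poly_mult)

lemma trig_poly_cos: "trig_poly 1 (\<lambda>v. of_real (cos v))"
proof -
  have "(\<lambda>v. complex_of_real (cos v)) = (\<lambda>v. 1/2 * cis (of_int 1 * v) + 1/2 * cis (of_int (-1) * v))"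
    by (auto simp: fun_eq_iff complex_eq_iff)
  moreover have "trig_poly 1 \<dots>" by (intro trig_poly_add trig_poly_cis) auto
  ultimately show ?thesis by simp
qed

lemma trig_poly_poly_cos: "trig_poly (degree P) (\<lambda>v. of_real (poly P (cos v)))"
proof -
  have "(\<lambda>v. complex_of_real (poly P (cos v))) =
      (\<lambda>v. \<Sum>i\<le>degree P. of_real (coeff P i) * of_real (cos v) ^ i)"
    by (simp add: poly_altdef)
  moreover have "trig_poly (degree P) \<dots>"
  proof (intro trig_poly_sum)
    fix i assume "i \<in> {..degree P}"
    then show "trig_poly (degree P) (\<lambda>v. complex_of_real (coeff P i) * of_real (cos v) ^ i)"
      using trig_poly_mult[OF trig_poly_const[of 0] trig_poly_power[OF trig_poly_cos, of i]]
      by (auto intro: trig_poly_mono)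
  qed auto
  ultimately show ?thesis by simp
qed

section \<open>Orthogonality and integral formulas for the derivative\<close>

lemma has_integral_cis:
  "((\<lambda>y. cis (of_int j * y)) has_integral (if j = 0 then 2 * of_real pi else 0)) {-pi..pi}"
proof (cases "j = 0")
  case True
  then show ?thesis
    using has_integral_const_real[of "1::complex" "-pi" pi] by (simp add: scaleR_conv_of_real)
next
  case False
  have "((\<lambda>y. cis (of_int j * y)) has_integral
      (cis (of_int j * pi) / (\<i> * of_int j) - cis (of_int j * (-pi)) / (\<i> * of_int j))) {-pi..pi}"
  proof (intro fundamental_theorem_of_calculus)
    fix y
    have "((\<lambda>y. cis (of_int j * y)) has_vector_derivative \<i> * of_int j * cis (of_int j * y)) (at y within {-pi..pi})"
      unfolding has_vector_derivative_def
      by (auto intro!: derivative_eq_intros simp: fun_eq_iff scaleR_conv_of_real algebra_simps)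
    from has_vector_derivative_mult_right[OF this, of "1 / (\<i> * of_int j)"]
    show "((\<lambda>y. cis (of_int j * y) / (\<i> * of_int j)) has_vector_derivative cis (of_int j * y)) (at y within {-pi..pi})"
      using False by (simp add: field_simps)
  qed simp
  moreover have "cis (of_int j * pi) = cis (of_int j * (-pi))"
    using sin_npi_int[of j] by (auto simp: complex_eq_iff mult.commute)
  ultimately show ?thesis using False by simp
qed

text \<open>The weight \<open>(2 - 2 cos (N y))\<^sup>K\<close> has period \<open>2\<pi>/N\<close>, so its only frequency below \<open>N\<close> is the
  constant one. Inserting it into the reproducing integral makes the integrand vanish at the
  zeros and singularities of the Jacobi weight.\<close>

lemma reproducing_weight:
  obtains a :: "int \<Rightarrow> complex" where "a 0 \<noteq> 0"
    "\<And>N y. complex_of_real ((2 - 2 * cos (real N * y)) ^ K) =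
      (\<Sum>m=-int K..int K. a m * cis (of_int (m * int N) * y))"
proof -
  have "trig_poly (K * 1) (\<lambda>v. (of_real 2 + of_real (-2) * of_real (cos v)) ^ K)"
    by (intro trig_poly_power trig_poly_add trig_poly_const trig_poly_scale trig_poly_cos)
  then obtain a where a: "\<And>v. complex_of_real ((2 - 2 * cos v) ^ K) = (\<Sum>m=-int K..int K. a m * cis (of_int m * v))"
    unfolding trig_poly_def by auto
  \<comment> \<open>\<open>a 0\<close> is the mean over a period of a continuous nonnegative
    function. A zero mean would force the function to vanish everywhere, but at pi its value is
    4^K.\<close>
  have "a 0 \<noteq> 0"
  proof
    assume "a 0 = 0"
    have "((\<lambda>v. \<Sum>m=-int K..int K. a m * cis (of_int m * v)) has_integral
        (\<Sum>m=-int K..int K. a m * (if m = 0 then 2 * of_real pi else 0))) {-pi..pi}"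
      by (intro has_integral_sum has_integral_mult_right has_integral_cis) auto
    also have "(\<Sum>m=-int K..int K. a m * (if m = 0 then 2 * of_real pi else 0)) = 0"
      using \<open>a 0 = 0\<close> by (intro sum.neutral) auto
    finally have I0: "((\<lambda>v. complex_of_real ((2 - 2 * cos v) ^ K)) has_integral 0) {-pi..pi}"
      by (simp only: a)
    have "((\<lambda>v. (2 - 2 * cos v) ^ K) has_integral 0) {-pi..pi}"
      using has_integral_linear[OF I0 bounded_linear_Re]
      by (simp add: o_def del: of_real_power of_real_diff of_real_mult)
    moreover have "continuous_on {-pi..pi} (\<lambda>v. (2 - 2 * cos v) ^ K)" by (intro continuous_intros)
    ultimately have "(2 - 2 * cos pi) ^ K = 0"
      by (intro has_integral_0_cbox_imp_0[of "-pi" pi "\<lambda>v. (2 - 2 * cos v) ^ K"]) (auto simp: box_real dest: order.strict_trans1[OF _ pi_gt_zero])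
    then show False by simp
  qed
  moreover have "complex_of_real ((2 - 2 * cos (real N * y)) ^ K) =
      (\<Sum>m=-int K..int K. a m * cis (of_int (m * int N) * y))" for N y
    unfolding a by (simp add: mult.assoc)
  ultimately show thesis using that by blast
qed

lemma sum_product3:
  fixes f :: "'a \<Rightarrow> 'd::comm_semiring_0"
  shows "sum f A * sum g B * sum h C = (\<Sum>i\<in>A. \<Sum>j\<in>B. \<Sum>k\<in>C. f i * g j * h k)"
proof -
  have "sum f A * sum g B * sum h C = (\<Sum>i\<in>A. \<Sum>j\<in>B. f i * g j * sum h C)"
    unfolding sum_product[of f A g B] by (simp only: sum_distrib_right)
  then show ?thesis by (simp only: sum_distrib_left)
qed

text \<open>\<open>E\<close> is the derivative of the Dirichlet kernel of degree d. In the product,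
  the frequencies k of \<open>F\<close>, l N of the weight and m of \<open>E\<close> contribute only
  where k + l N = m. Since |m - k| \<le> 2d < N, this leaves l = 0 and m = k: the weight acts as the
  constant \<open>a 0\<close>, and convolution with \<open>E\<close> differentiates
  \<open>F\<close>.\<close>

lemma trig_poly_derivative_reproducing:
  assumes a: "\<And>N y. complex_of_real ((2 - 2 * cos (real N * y)) ^ K) =
      (\<Sum>m=-int K..int K. a m * cis (of_int (m * int N) * y))"
    and F: "trig_poly d F" and N: "2 * d < N"
  defines "E \<equiv> \<lambda>u. \<Sum>m=-int d..int d. (\<i> * of_int m) * cis (of_int m * u)"
  shows "\<exists>D. (F has_vector_derivative D) (at \<theta>) \<and>
    ((\<lambda>y. F y * of_real ((2 - 2 * cos (real N * y)) ^ K) * E (\<theta> - y)) has_integral (2 * of_real pi * a 0 * D)) {-pi..pi}"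
proof -
  obtain c where c: "\<And>v. F v = (\<Sum>k=-int d..int d. c k * cis (of_int k * v))"
    using F unfolding trig_poly_def by auto
  define D where "D = (\<Sum>k=-int d..int d. c k * (\<i> * of_int k * cis (of_int k * \<theta>)))"
  have "((\<lambda>v. \<Sum>k=-int d..int d. c k * cis (of_int k * v)) has_vector_derivative D) (at \<theta>)"
    unfolding D_def
  proof (intro has_vector_derivative_sum has_vector_derivative_mult_right)
    fix k show "((\<lambda>v. cis (of_int k * v)) has_vector_derivative \<i> * of_int k * cis (of_int k * \<theta>)) (at \<theta>)"
      unfolding has_vector_derivative_def
      by (auto intro!: derivative_eq_intros simp: fun_eq_iff scaleR_conv_of_real algebra_simps)
  qed
  then have 1: "(F has_vector_derivative D) (at \<theta>)" using c by presburger
  let ?S = "{-int d..int d}" and ?L = "{-int K..int K}"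
  have "((\<lambda>y. \<Sum>k\<in>?S. \<Sum>l\<in>?L. \<Sum>m\<in>?S. (c k * a l * (\<i> * of_int m) * cis (of_int m * \<theta>)) * cis (of_int (k + l * int N - m) * y)) has_integral
     (\<Sum>k\<in>?S. \<Sum>l\<in>?L. \<Sum>m\<in>?S. (c k * a l * (\<i> * of_int m) * cis (of_int m * \<theta>)) * (if k + l * int N - m = 0 then 2 * of_real pi else 0))) {-pi..pi}"
    by (intro has_integral_sum has_integral_mult_right has_integral_cis) auto
  also have "(\<lambda>y. \<Sum>k\<in>?S. \<Sum>l\<in>?L. \<Sum>m\<in>?S. (c k * a l * (\<i> * of_int m) * cis (of_int m * \<theta>)) * cis (of_int (k + l * int N - m) * y)) =
    (\<lambda>y. F y * of_real ((2 - 2 * cos (real N * y)) ^ K) * E (\<theta> - y))"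
  proof
    fix y
    have e: "cis (of_int m * \<theta>) * cis (of_int (k + l * int N - m) * y) =
      cis (of_int k * y) * cis (of_int (l * int N) * y) * cis (of_int m * (\<theta> - y))" for k l m
      by (simp add: cis_mult algebra_simps)
    have "F y * of_real ((2 - 2 * cos (real N * y)) ^ K) * E (\<theta> - y) =
      (\<Sum>k\<in>?S. \<Sum>l\<in>?L. \<Sum>m\<in>?S. (c k * a l * (\<i> * of_int m)) * (cis (of_int k * y) * cis (of_int (l * int N) * y) * cis (of_int m * (\<theta> - y))))"
      unfolding a c E_def sum_product3 by (simp only: mult_ac)
    then show "(\<Sum>k\<in>?S. \<Sum>l\<in>?L. \<Sum>m\<in>?S. (c k * a l * (\<i> * of_int m) * cis (of_int m * \<theta>)) * cis (of_int (k + l * int N - m) * y)) =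
      F y * of_real ((2 - 2 * cos (real N * y)) ^ K) * E (\<theta> - y)"
      unfolding e[symmetric] by (simp only: mult.assoc)
  qed
  also have "(\<Sum>k\<in>?S. \<Sum>l\<in>?L. \<Sum>m\<in>?S. (c k * a l * (\<i> * of_int m) * cis (of_int m * \<theta>)) * (if k + l * int N - m = 0 then 2 * of_real pi else 0))
     = (\<Sum>k\<in>?S. c k * a 0 * (\<i> * of_int k) * cis (of_int k * \<theta>) * (2 * of_real pi))"
  proof (rule sum.cong[OF refl])
    fix k assume k: "k \<in> ?S"
    have z: "k + l * int N - m = 0 \<longleftrightarrow> l = 0 \<and> m = k" if m: "m \<in> ?S" for l m
    proof
      assume e: "k + l * int N - m = 0"
      have "l = 0"
      proof (rule ccontr)
        assume "l \<noteq> 0"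
        then have "int N \<le> \<bar>l\<bar> * int N" using mult_right_mono[of 1 "\<bar>l\<bar>" "int N"] by simp
        also have "\<dots> = \<bar>l * int N\<bar>" by (simp add: abs_mult)
        also have "l * int N = m - k" using e by simp
        also have "\<bar>m - k\<bar> \<le> 2 * int d" using k m by (simp add: abs_if)
        finally show False using N by simp
      qed
      then show "l = 0 \<and> m = k" using e by simp
    qed simp
    have "(\<Sum>l\<in>?L. \<Sum>m\<in>?S. (c k * a l * (\<i> * of_int m) * cis (of_int m * \<theta>)) * (if k + l * int N - m = 0 then 2 * of_real pi else 0))
      = (\<Sum>l\<in>?L. \<Sum>m\<in>?S. if m = k then (if l = 0 then (c k * a l * (\<i> * of_int m) * cis (of_int m * \<theta>)) * (2 * of_real pi) else 0) else 0)"
      using z by (intro sum.cong) auto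
    also have "\<dots> = c k * a 0 * (\<i> * of_int k) * cis (of_int k * \<theta>) * (2 * of_real pi)"
      using k by simp
    finally show "(\<Sum>l\<in>?L. \<Sum>m\<in>?S. (c k * a l * (\<i> * of_int m) * cis (of_int m * \<theta>)) * (if k + l * int N - m = 0 then 2 * of_real pi else 0))
      = c k * a 0 * (\<i> * of_int k) * cis (of_int k * \<theta>) * (2 * of_real pi)" .
  qed
  also have "\<dots> = 2 * of_real pi * a 0 * D"
    unfolding D_def sum_distrib_left by (intro sum.cong) (auto simp: algebra_simps)
  finally show ?thesis using 1 by blast
qed

lemma trig_poly_continuous: "trig_poly d F \<Longrightarrow> continuous_on A F"
  unfolding trig_poly_def by (auto intro!: continuous_intros)

text \<open>The bound (2d+1)^2 for the kernel \<open>E\<close> is crude and carries no decay. It has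
  the right order nevertheless: once f is multiplied by a localising factor, one power of the degree
  normalises the kernel and the other one is the Bernstein factor.\<close>

lemma trig_poly_derivative_bound:
  obtains C where "0 < C" "\<And>d N f f' \<theta>. trig_poly d (\<lambda>v. complex_of_real (f v)) \<Longrightarrow> 2 * d < N \<Longrightarrow>
    (f has_real_derivative f') (at \<theta>) \<Longrightarrow>
    ennreal \<bar>f'\<bar> \<le> (\<integral>\<^sup>+y. ennreal (C * (2 * real d + 1)\<^sup>2 * (2 - 2 * cos (real N * y)) ^ K * \<bar>f y\<bar>) * indicator {-pi..pi} y \<partial>lborel)"
proof -
  obtain a where a0: "a 0 \<noteq> 0" and a: "\<And>N y. complex_of_real ((2 - 2 * cos (real N * y)) ^ K) =
      (\<Sum>m=-int K..int K. a m * cis (of_int (m * int N) * y))"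
    using reproducing_weight[of K] by blast
  define C where "C = 1 / (2 * pi * cmod (a 0))"
  have C: "C > 0" using a0 by (simp add: C_def)
  show thesis
  proof (rule that[OF C])
    fix d N :: nat and f :: "real \<Rightarrow> real" and f' \<theta>
    assume F: "trig_poly d (\<lambda>v. complex_of_real (f v))" and N: "2 * d < N" and f': "(f has_real_derivative f') (at \<theta>)"
    define E where "E = (\<lambda>u. \<Sum>m=-int d..int d. (\<i> * of_int m) * cis (of_int m * u))"
    obtain D where D: "((\<lambda>v. complex_of_real (f v)) has_vector_derivative D) (at \<theta>)"
      and I: "((\<lambda>y. of_real (f y) * of_real ((2 - 2 * cos (real N * y)) ^ K) * E (\<theta> - y)) has_integral (2 * of_real pi * a 0 * D)) {-pi..pi}"
      using trig_poly_derivative_reproducing[OF a F N, of \<theta>] unfolding E_def by blast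
    have "((\<lambda>v. complex_of_real (f v)) has_vector_derivative of_real f') (at \<theta>)"
      using f' by (intro has_vector_derivative_of_real) (simp add: has_real_derivative_iff_has_vector_derivative)
    then have Df: "D = of_real f'" using D vector_derivative_unique_at by blast
    have E: "cmod (E u) \<le> (2 * real d + 1)\<^sup>2" for u
    proof -
      have "cmod (E u) \<le> (\<Sum>m=-int d..int d. real d)" unfolding E_def
        by (rule sum_norm_le) (auto simp: norm_mult)
      also have "\<dots> = (2 * real d + 1) * real d" by (simp add: algebra_simps)
      also have "\<dots> \<le> (2 * real d + 1)\<^sup>2" unfolding power2_eq_square by (intro mult_left_mono) auto
      finally show ?thesis .
    qed
    have nn: "0 \<le> 2 - 2 * cos x" for x :: real using cos_le_one[of x] by linarith
    let ?g = "\<lambda>y. (2 * real d + 1)\<^sup>2 * (2 - 2 * cos (real N * y)) ^ K * \<bar>f y\<bar>"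
    have cf: "continuous_on {-pi..pi} f"
      using continuous_on_Re[OF trig_poly_continuous[OF F, of "{-pi..pi}"]] by simp
    have int: "?g integrable_on {-pi..pi}"
      by (intro integrable_continuous_real continuous_intros cf)
    have "cmod (integral {-pi..pi} (\<lambda>y. of_real (f y) * of_real ((2 - 2 * cos (real N * y)) ^ K) * E (\<theta> - y)))
       \<le> integral {-pi..pi} ?g"
    proof (rule integral_norm_bound_integral)
      fix y assume "y \<in> {-pi..pi}"
      have "\<bar>f y\<bar> * (2 - 2 * cos (real N * y)) ^ K * cmod (E (\<theta> - y)) \<le> \<bar>f y\<bar> * (2 - 2 * cos (real N * y)) ^ K * (2 * real d + 1)\<^sup>2"
        using nn by (intro mult_left_mono E) auto
      then show "cmod (of_real (f y) * of_real ((2 - 2 * cos (real N * y)) ^ K) * E (\<theta> - y)) \<le> ?g y"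
        using nn by (simp add: norm_mult norm_power mult_ac flip: of_real_power)
    qed (use I int in auto)
    also have "integral {-pi..pi} (\<lambda>y. of_real (f y) * of_real ((2 - 2 * cos (real N * y)) ^ K) * E (\<theta> - y)) = 2 * of_real pi * a 0 * D"
      using I by (rule integral_unique)
    finally have "2 * pi * cmod (a 0) * \<bar>f'\<bar> \<le> integral {-pi..pi} ?g" by (simp add: norm_mult Df)
    then have "\<bar>f'\<bar> \<le> C * integral {-pi..pi} ?g" using a0 by (simp add: C_def field_simps)
    also have "\<dots> = integral {-pi..pi} (\<lambda>y. C * ?g y)" by simp
    finally have *: "\<bar>f'\<bar> \<le> integral {-pi..pi} (\<lambda>y. C * ?g y)" .
    have "(\<integral>\<^sup>+y. ennreal (C * ?g y) * indicator {-pi..pi} y \<partial>lborel) = ennreal (integral {-pi..pi} (\<lambda>y. C * ?g y))"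
    proof (rule nn_integral_has_integral_lebesgue')
      show "((\<lambda>y. C * ?g y) has_integral integral {-pi..pi} (\<lambda>y. C * ?g y)) {-pi..pi}"
        using integrable_on_cmult_left[OF int, of C] by (intro integrable_integral) (simp add: mult.assoc)
    qed (use C nn in auto)
    then show "ennreal \<bar>f'\<bar> \<le> (\<integral>\<^sup>+y. ennreal (C * (2 * real d + 1)\<^sup>2 * (2 - 2 * cos (real N * y)) ^ K * \<bar>f y\<bar>) * indicator {-pi..pi} y \<partial>lborel)"
      using ennreal_leI[OF *] by (simp add: mult.assoc)
  qed
qed

section \<open>Localisation by powers of the Fejer kernel, scaled to 1 at the origin\<close>

definition jackson_kernel :: "nat \<Rightarrow> nat \<Rightarrow> real \<Rightarrow> real" where
  "jackson_kernel M n u = (cmod (\<Sum>j<n. cis (real j * u)) / real n) ^ (2 * M)"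

lemma jackson_kernel_0: "0 < n \<Longrightarrow> jackson_kernel M n 0 = 1"
  by (simp add: jackson_kernel_def)

lemma jackson_kernel_nonneg: "0 \<le> jackson_kernel M n u"
  by (simp add: jackson_kernel_def)

lemma jackson_kernel_le_1: "0 < n \<Longrightarrow> jackson_kernel M n u \<le> 1"
proof -
  assume n: "0 < n"
  have "cmod (\<Sum>j<n. cis (real j * u)) \<le> (\<Sum>j<n. 1)" by (rule sum_norm_le) auto
  then show ?thesis unfolding jackson_kernel_def using n by (intro power_le_one) (auto simp: field_simps)
qed

text \<open>The geometric sum times \<open>cis u - 1\<close> is \<open>cis u ^ n - 1\<close>, of
  modulus at most 2, while \<open>cis u - 1\<close> has modulus 2 |sin(u/2)|.\<close>

lemma jackson_kernel_decay:
  assumes "0 < n"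
  shows "jackson_kernel M n u * (real n * \<bar>sin (u / 2)\<bar>) ^ (2 * M) \<le> 1"
proof -
  let ?S = "\<Sum>j<n. cis (real j * u)"
  have "?S = (\<Sum>j<n. cis u ^ j)" by (intro sum.cong refl) (simp only: Complex.DeMoivre)
  then have "?S * (cis u - 1) = cis u ^ n - 1"
    by (simp only: power_diff_1_eq mult.commute)
  then have "cmod ?S * cmod (cis u - 1) = cmod (cis u ^ n - 1)" by (metis norm_mult)
  also have "\<dots> \<le> 2" using norm_triangle_ineq4[of "cis u ^ n" 1] by (simp add: norm_power)
  also have "cmod (cis u - 1) = 2 * \<bar>sin (u / 2)\<bar>"
  proof -
    have "(cmod (cis u - 1))\<^sup>2 = (cos u - 1)\<^sup>2 + (sin u)\<^sup>2" by (simp add: cmod_power2)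
    also have "\<dots> = 2 - 2 * cos (2 * (u / 2))"
      using sin_cos_squared_add[of u] by (simp add: power2_eq_square algebra_simps)
    also have "\<dots> = (2 * \<bar>sin (u / 2)\<bar>)\<^sup>2"
      using sin_cos_squared_add[of "u/2"] unfolding cos_double by (simp add: power_mult_distrib cos_squared_eq algebra_simps)
    finally show ?thesis by (rule power2_eq_imp_eq) auto
  qed
  finally have "cmod ?S * \<bar>sin (u / 2)\<bar> \<le> 1" by simp
  then have "(cmod ?S * \<bar>sin (u / 2)\<bar>) ^ (2 * M) \<le> 1" by (intro power_le_one) auto
  then show ?thesis using assms
    by (simp add: jackson_kernel_def power_mult_distrib[symmetric])
qed

text \<open>The squared modulus is the product of the sum with its conjugate; this is why the
  modulus is taken to an even power.\<close>

lemma trig_poly_jackson_kernel: "trig_poly (2 * M * n) (\<lambda>v. of_real (jackson_kernel M n (\<theta> - v)))"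
proof -
  have "(\<lambda>v. complex_of_real (jackson_kernel M n (\<theta> - v))) =
    (\<lambda>v. ((\<Sum>j<n. (cis (real j * \<theta>) / real n) * cis (of_int (- int j) * v)) * (\<Sum>j<n. (cis (- real j * \<theta>) / real n) * cis (of_int (int j) * v))) ^ M)"
  proof
    fix v
    let ?z = "\<Sum>j<n. cis (real j * (\<theta> - v))"
    have 1: "?z / real n = (\<Sum>j<n. (cis (real j * \<theta>) / real n) * cis (of_int (- int j) * v))"
      unfolding sum_divide_distrib by (intro sum.cong) (auto simp: cis_mult algebra_simps)
    have 2: "cnj ?z / real n = (\<Sum>j<n. (cis (- real j * \<theta>) / real n) * cis (of_int (int j) * v))"
      unfolding sum_divide_distrib cnj_sum by (intro sum.cong) (auto simp: cis_cnj cis_mult algebra_simps)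
    have "complex_of_real (jackson_kernel M n (\<theta> - v)) = (complex_of_real ((cmod ?z)\<^sup>2) / (real n)\<^sup>2) ^ M"
      by (simp add: jackson_kernel_def power_mult power_divide)
    also have "complex_of_real ((cmod ?z)\<^sup>2) / (real n)\<^sup>2 = (?z / real n) * (cnj ?z / real n)"
      using complex_norm_square[of ?z] by (simp add: power2_eq_square)
    finally show "complex_of_real (jackson_kernel M n (\<theta> - v)) =
      ((\<Sum>j<n. (cis (real j * \<theta>) / real n) * cis (of_int (- int j) * v)) * (\<Sum>j<n. (cis (- real j * \<theta>) / real n) * cis (of_int (int j) * v))) ^ M"
      unfolding 1 2 .
  qed
  moreover have "trig_poly (M * (n + n)) \<dots>"
    by (intro trig_poly_power trig_poly_mult trig_poly_sum trig_poly_cis) auto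
  moreover have "M * (n + n) = 2 * M * n" by simp
  ultimately show ?thesis by (simp only:)
qed

lemma trig_poly_real_derivative:
  assumes "trig_poly d (\<lambda>v. complex_of_real (f v))"
  shows "\<exists>f'. (f has_real_derivative f') (at \<theta>)"
proof -
  obtain c where c: "\<And>v. complex_of_real (f v) = (\<Sum>m=-int d..int d. c m * cis (of_int m * v))"
    using assms unfolding trig_poly_def by auto
  have "f = (\<lambda>v. \<Sum>m=-int d..int d. Re (c m) * cos (of_int m * v) - Im (c m) * sin (of_int m * v))"
  proof
    fix v show "f v = (\<Sum>m=-int d..int d. Re (c m) * cos (of_int m * v) - Im (c m) * sin (of_int m * v))"
      using arg_cong[OF c, of Re v] by simp
  qed
  moreover have "\<exists>f'. (\<dots> has_real_derivative f') (at \<theta>)"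
    by (rule exI) (auto intro!: derivative_eq_intros)
  ultimately show ?thesis by simp
qed

text \<open>The kernel attains its maximum 1 at the origin, so its derivative vanishes there, and
  multiplication by it leaves the derivative at \<theta> unchanged. Localisation is thus free of
  charge.\<close>

lemma jackson_product_derivative:
  assumes "0 < n" and f: "(f has_real_derivative f') (at \<theta>)"
  shows "((\<lambda>v. f v * jackson_kernel M n (\<theta> - v)) has_real_derivative f') (at \<theta>)"
proof -
  obtain j where j: "((\<lambda>v. jackson_kernel M n (\<theta> - v)) has_real_derivative j) (at \<theta>)"
    using trig_poly_real_derivative[OF trig_poly_jackson_kernel] by blast
  have "j = 0"
    by (rule DERIV_local_max[OF j, of 1]) (use jackson_kernel_le_1[OF assms(1)] jackson_kernel_0[OF assms(1)] in auto)
  then show ?thesis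
    using DERIV_mult[OF f j] jackson_kernel_0[OF assms(1)] by simp
qed

text \<open>The cubic Taylor remainder is at most x^3/6 \<le> 2x/3 on [0,2], and this interval
  contains all half angles that occur, because pi < 4.\<close>

lemma sin_ge_third:
  assumes "0 \<le> x" "x \<le> (2::real)"
  shows "x / 3 \<le> sin x"
proof -
  have "\<bar>sin x - x\<bar> \<le> x ^ 3 / 6"
    using Maclaurin_sin_bound[of x 3] assms
    by (simp add: eval_nat_numeral sin_coeff_def fact_numeral field_simps)
  moreover have "x ^ 3 \<le> 4 * x"
    using mult_right_mono[of "x * x" 4 x] mult_mono[of x 2 x 2] assms by (simp add: eval_nat_numeral)
  ultimately show ?thesis by linarith
qed

lemma abs_sin_mult_le: "\<bar>sin (real n * x)\<bar> \<le> real n * \<bar>sin x\<bar>"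
proof (induction n)
  case (Suc n)
  have "\<bar>sin (real (Suc n) * x)\<bar> = \<bar>sin (real n * x) * cos x + cos (real n * x) * sin x\<bar>"
    by (simp add: distrib_right sin_add algebra_simps)
  also have "\<dots> \<le> \<bar>sin (real n * x)\<bar> * 1 + 1 * \<bar>sin x\<bar>"
    by (intro order_trans[OF abs_triangle_ineq] add_mono) (auto simp: abs_mult intro!: mult_left_le mult_left_le_one_le)
  finally show ?case using Suc by (simp add: distrib_right)
qed simp

text \<open>Near the peak the bound 1 is used, away from it the decay, so that the single factor (1
  + s)^(-m) serves for all s.\<close>

lemma power_decay_bound:
  fixes s J :: real
  assumes "0 \<le> s" "J \<le> 1" "J * s ^ m \<le> 1"
  shows "J \<le> 2 ^ m / (1 + s) ^ m"
proof (cases "s \<le> 1")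
  case True
  then have "1 \<le> (2 / (1 + s)) ^ m" using assms by (intro one_le_power) (auto simp: field_simps)
  then show ?thesis using assms(2) unfolding power_divide by linarith
next
  case False
  then have "J \<le> (1 / s) ^ m" using assms by (simp add: power_divide field_simps)
  also have "\<dots> \<le> (2 / (1 + s)) ^ m" using False by (intro power_mono) (auto simp: field_simps)
  finally show ?thesis by (simp add: power_divide)
qed

lemma nn_integral_symmetric_interval:
  fixes H :: "real \<Rightarrow> ennreal"
  assumes [measurable]: "H \<in> borel_measurable borel" and "\<And>y. 0 \<le> y \<Longrightarrow> y \<le> b \<Longrightarrow> H (-y) \<le> H y"
  shows "(\<integral>\<^sup>+y. H y * indicator {-b..b} y \<partial>lborel) \<le> 2 * (\<integral>\<^sup>+y. H y * indicator {0..b} y \<partial>lborel)"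
proof -
  have "(\<integral>\<^sup>+y. H y * indicator {-b..b} y \<partial>lborel) \<le> (\<integral>\<^sup>+y. H y * indicator {-b..0} y + H y * indicator {0..b} y \<partial>lborel)"
    by (intro nn_integral_mono) (auto split: split_indicator)
  also have "\<dots> = (\<integral>\<^sup>+y. H y * indicator {-b..0} y \<partial>lborel) + (\<integral>\<^sup>+y. H y * indicator {0..b} y \<partial>lborel)"
    by (rule nn_integral_add) measurable
  also have "(\<integral>\<^sup>+y. H y * indicator {-b..0} y \<partial>lborel) = (\<integral>\<^sup>+y. H (-y) * indicator {-b..0} (-y) \<partial>lborel)"
    by (subst nn_integral_real_affine[where c = "-1" and t = 0]) (auto simp: )
  also have "\<dots> \<le> (\<integral>\<^sup>+y. H y * indicator {0..b} y \<partial>lborel)"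
    using assms(2) by (intro nn_integral_mono) (auto split: split_indicator)
  finally show ?thesis by (simp add: mult_2 add_right_mono)
qed

text \<open>The reflected point -y is at least as far from \<theta> on the circle as y is; this lets
  the kernel over [-pi, pi] be folded onto [0, pi].\<close>

lemma sin_half_diff_le:
  assumes "0 \<le> \<theta>" "\<theta> \<le> pi" "0 \<le> y" "y \<le> pi"
  shows "\<bar>sin ((\<theta> - y) / 2)\<bar> \<le> \<bar>sin ((\<theta> + y) / 2)\<bar>"
proof -
  have "0 \<le> sin (\<theta>/2)" "0 \<le> cos (\<theta>/2)" "0 \<le> sin (y/2)" "0 \<le> cos (y/2)"
    using assms by (auto intro!: sin_ge_zero cos_ge_zero)
  then have "0 \<le> sin (\<theta>/2) * cos (y/2)" "0 \<le> cos (\<theta>/2) * sin (y/2)" by auto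
  then show ?thesis by (simp add: add_divide_distrib diff_divide_distrib sin_add sin_diff)
qed

lemma sin_half_diff_ge:
  assumes "0 \<le> \<theta>" "\<theta> \<le> pi" "0 \<le> y" "y \<le> pi"
  shows "\<bar>\<theta> - y\<bar> / 6 \<le> \<bar>sin ((\<theta> - y) / 2)\<bar>"
proof -
  have "\<bar>\<theta> - y\<bar> / 2 \<le> 2" using assms pi_less_4 by auto
  then have "\<bar>\<theta> - y\<bar> / 2 / 3 \<le> sin (\<bar>\<theta> - y\<bar> / 2)" by (intro sin_ge_third) auto
  also have "\<dots> \<le> \<bar>sin ((\<theta> - y) / 2)\<bar>"
  proof -
    have "sin \<bar>u\<bar> \<le> \<bar>sin u\<bar>" for u :: real by (auto simp: abs_if)
    from this[of "(\<theta> - y) / 2"] show ?thesis by simp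
  qed
  finally show ?thesis by simp
qed

text \<open>The substitution \<open>x = cos \<theta>\<close> turns \<open>vphi P'\<close> into the derivative of a trigonometric polynomial.\<close>

lemma derivative_kernel_bound:
  obtains C where "0 < C" "\<And>n P \<theta>. 0 < n \<Longrightarrow> P \<in> polys_below n \<Longrightarrow> 0 \<le> \<theta> \<Longrightarrow> \<theta> \<le> pi \<Longrightarrow>
    ennreal \<bar>sin \<theta> * poly (pderiv P) (cos \<theta>)\<bar> \<le>
    (\<integral>\<^sup>+y. ennreal (C * real n ^ 2 / (1 + real n * \<bar>\<theta> - y\<bar>) ^ (2 * M) * min 1 (real n * \<bar>sin y\<bar>) ^ (2 * K) * \<bar>poly P (cos y)\<bar>)
       * indicator {0..pi} y \<partial>lborel)"
proof -
  obtain C0 where C0: "0 < C0" and main: "\<And>d N f f' \<theta>. trig_poly d (\<lambda>v. complex_of_real (f v)) \<Longrightarrow> 2 * d < N \<Longrightarrow>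
    (f has_real_derivative f') (at \<theta>) \<Longrightarrow>
    ennreal \<bar>f'\<bar> \<le> (\<integral>\<^sup>+y. ennreal (C0 * (2 * real d + 1)\<^sup>2 * (2 - 2 * cos (real N * y)) ^ K * \<bar>f y\<bar>) * indicator {-pi..pi} y \<partial>lborel)"
    using trig_poly_derivative_bound[of K] by blast
  \<comment> \<open>The product of P(cos v), of degree below n, and the localising factor, of degree
    2Mn, has degree below c n.\<close>
  define c where "c = 1 + 2 * real M"
  have c: "1 \<le> c" by (simp add: c_def)
  \<comment> \<open>Collected from the derivative bound, the squared degree, the weight (2 - 2
    cos)^K, and the decay of the localising factor.\<close>
  define B where "B = C0 * (2 * c)\<^sup>2 * (4 ^ K * c ^ (2 * K)) * 2 ^ (2 * M)"
  have B: "0 < B" using C0 c by (simp add: B_def)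
  \<comment> \<open>The 2 comes from folding, and 6^(2M) from |sin((\<theta> - y)/2)| \<ge>
    |\<theta> - y| / 6.\<close>
  define C where "C = 2 * B * 6 ^ (2 * M)"
  show thesis
  proof (rule that)
    show "0 < C" using B by (simp add: C_def)
    fix n :: nat and P :: "real poly" and \<theta> :: real
    assume n: "0 < n" and P: "P \<in> polys_below n" and \<theta>: "0 \<le> \<theta>" "\<theta> \<le> pi"
    define d where "d = n - 1 + 2 * M * n"
    \<comment> \<open>The weight is used with the even frequency 2n'. Then 2 - 2 cos(2n'y) = 4
      sin(n'y)^2 vanishes at 0 and at pi, and |sin(n'y)| is at most n' |sin y|.\<close>
    define n' where "n' = n * (1 + 2 * M)"
    have n': "real n' = c * real n" by (simp add: n'_def c_def algebra_simps)
    have dN: "2 * d < 2 * n'" using n by (simp add: d_def n'_def algebra_simps)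
    have d_le: "2 * real d + 1 \<le> 2 * c * real n"
      using n by (simp add: d_def c_def of_nat_diff algebra_simps)
    define f where "f = (\<lambda>v. poly P (cos v) * jackson_kernel M n (\<theta> - v))"
    have "degree P \<le> n - 1" using P by (auto simp: polys_below_def)
    then have "trig_poly d (\<lambda>v. complex_of_real (f v))"
      unfolding f_def d_def of_real_mult
      by (intro trig_poly_mult trig_poly_jackson_kernel trig_poly_mono[OF trig_poly_poly_cos])
    moreover have "(f has_real_derivative (poly (pderiv P) (cos \<theta>) * (- sin \<theta>))) (at \<theta>)"
      unfolding f_def using n by (intro jackson_product_derivative) (auto intro!: derivative_eq_intros poly_DERIV)
    ultimately have le: "ennreal \<bar>poly (pderiv P) (cos \<theta>) * (- sin \<theta>)\<bar> \<le> (\<integral>\<^sup>+y. ennreal (C0 * (2 * real d + 1)\<^sup>2 * (2 - 2 * cos (real (2 * n') * y)) ^ K * \<bar>f y\<bar>) * indicator {-pi..pi} y \<partial>lborel)"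
      by (intro main dN)
    define k where "k = (\<lambda>u. 1 / (1 + real n * \<bar>sin (u / 2)\<bar>) ^ (2 * M))"
    define m where "m = (\<lambda>y. min 1 (real n * \<bar>sin y\<bar>))"
    define H where "H = (\<lambda>y. B * real n ^ 2 * m y ^ (2 * K) * k (\<theta> - y) * \<bar>poly P (cos y)\<bar>)"
    have m: "0 \<le> m y" for y by (simp add: m_def)
    have k: "0 \<le> k u" for u by (simp add: k_def)
    have [measurable]: "H \<in> borel_measurable borel"
    proof -
      have "continuous_on UNIV (poly P)" by (intro continuous_intros)
      then have [measurable]: "poly P \<in> borel_measurable borel" by (rule borel_measurable_continuous_onI)
      show ?thesis unfolding H_def k_def m_def by measurable
    qed
    have GH: "C0 * (2 * real d + 1)\<^sup>2 * (2 - 2 * cos (real (2 * n') * y)) ^ K * \<bar>f y\<bar> \<le> H y" for y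
    proof -
      have chi: "2 - 2 * cos (real (2 * n') * y) = 4 * \<bar>sin (real n' * y)\<bar>\<^sup>2"
        using cos_double_sin[of "real n' * y"] by (simp add: mult.assoc algebra_simps)
      have "\<bar>sin (real n' * y)\<bar> \<le> c * m y"
      proof -
        have "\<bar>sin (real n' * y)\<bar> \<le> c * 1" using c abs_sin_le_one[of "real n' * y"] by linarith
        moreover have "\<bar>sin (real n' * y)\<bar> \<le> c * (real n * \<bar>sin y\<bar>)"
          using abs_sin_mult_le[of n' y] n' by (simp add: mult.assoc)
        ultimately show ?thesis by (auto simp: m_def min_def)
      qed
      then have "(4 * \<bar>sin (real n' * y)\<bar>\<^sup>2) ^ K \<le> (4 * (c * m y)\<^sup>2) ^ K"
        by (intro power_mono mult_left_mono) auto
      also have "\<dots> = 4 ^ K * c ^ (2 * K) * m y ^ (2 * K)" by (simp add: power_mult_distrib power_mult)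
      finally have 1: "(2 - 2 * cos (real (2 * n') * y)) ^ K \<le> 4 ^ K * c ^ (2 * K) * m y ^ (2 * K)" unfolding chi .
      have 2: "(2 * real d + 1)\<^sup>2 \<le> (2 * c)\<^sup>2 * real n ^ 2"
        using power_mono[OF d_le, of 2] by (simp add: power_mult_distrib)
      have 3: "jackson_kernel M n (\<theta> - y) \<le> 2 ^ (2 * M) * k (\<theta> - y)"
        using power_decay_bound[OF _ jackson_kernel_le_1[OF n, of M "\<theta> - y"] jackson_kernel_decay[OF n, of M "\<theta> - y"]] by (simp add: k_def)
      have "C0 * (2 * real d + 1)\<^sup>2 * (2 - 2 * cos (real (2 * n') * y)) ^ K * (jackson_kernel M n (\<theta> - y) * \<bar>poly P (cos y)\<bar>)
        \<le> C0 * ((2 * c)\<^sup>2 * real n ^ 2) * (4 ^ K * c ^ (2 * K) * m y ^ (2 * K)) * (2 ^ (2 * M) * k (\<theta> - y) * \<bar>poly P (cos y)\<bar>)"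
        using C0 c m k jackson_kernel_nonneg by (intro mult_mono 1 2 3) (auto simp: chi)
      then show ?thesis
        by (simp add: f_def H_def B_def abs_mult jackson_kernel_nonneg mult_ac)
    qed
    have "ennreal \<bar>sin \<theta> * poly (pderiv P) (cos \<theta>)\<bar> \<le> (\<integral>\<^sup>+y. ennreal (H y) * indicator {-pi..pi} y \<partial>lborel)"
    proof -
      have "\<bar>sin \<theta> * poly (pderiv P) (cos \<theta>)\<bar> = \<bar>poly (pderiv P) (cos \<theta>) * (- sin \<theta>)\<bar>"
        by (simp add: abs_mult)
      also note le
      also have "(\<integral>\<^sup>+y. ennreal (C0 * (2 * real d + 1)\<^sup>2 * (2 - 2 * cos (real (2 * n') * y)) ^ K * \<bar>f y\<bar>) * indicator {-pi..pi} y \<partial>lborel)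
        \<le> (\<integral>\<^sup>+y. ennreal (H y) * indicator {-pi..pi} y \<partial>lborel)"
        by (intro nn_integral_mono mult_right_mono ennreal_leI GH) auto
      finally show ?thesis .
    qed
    also have "\<dots> \<le> 2 * (\<integral>\<^sup>+y. ennreal (H y) * indicator {0..pi} y \<partial>lborel)"
    proof (rule nn_integral_symmetric_interval)
      fix y :: real assume y: "0 \<le> y" "y \<le> pi"
      have "k (\<theta> + y) \<le> k (\<theta> - y)"
        unfolding k_def using sin_half_diff_le[OF \<theta> y] n
        by (intro divide_left_mono power_mono add_left_mono mult_left_mono) (auto intro!: mult_pos_pos zero_less_power add_pos_nonneg)
      then show "ennreal (H (- y)) \<le> ennreal (H y)"
        unfolding H_def m_def using B by (intro ennreal_leI) (auto intro!: mult_mono mult_nonneg_nonneg k)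
    qed measurable
    also have "\<dots> = (\<integral>\<^sup>+y. 2 * (ennreal (H y) * indicator {0..pi} y) \<partial>lborel)"
      by (rule nn_integral_cmult[symmetric]) measurable
    also have "\<dots> \<le> (\<integral>\<^sup>+y. ennreal (C * real n ^ 2 / (1 + real n * \<bar>\<theta> - y\<bar>) ^ (2 * M) * m y ^ (2 * K) * \<bar>poly P (cos y)\<bar>)
       * indicator {0..pi} y \<partial>lborel)"
    proof (rule nn_integral_mono)
      fix y
      show "2 * (ennreal (H y) * indicator {0..pi} y) \<le> ennreal (C * real n ^ 2 / (1 + real n * \<bar>\<theta> - y\<bar>) ^ (2 * M) * m y ^ (2 * K) * \<bar>poly P (cos y)\<bar>)
       * indicator {0..pi} y"
      proof (cases "y \<in> {0..pi}")
        case True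
        have s: "real n * \<bar>\<theta> - y\<bar> / 6 \<le> real n * \<bar>sin ((\<theta> - y) / 2)\<bar>"
          using mult_left_mono[OF sin_half_diff_ge[OF \<theta>, of y], of "real n"] True by simp
        have s': "(1 + real n * \<bar>\<theta> - y\<bar>) / 6 \<le> 1 + real n * \<bar>sin ((\<theta> - y) / 2)\<bar>"
        proof -
          have "(1 + u) / 6 \<le> 1 + w" if "u / 6 \<le> w" for u w :: real using that by (simp add: field_simps)
          from this[OF s] show ?thesis .
        qed
        have "k (\<theta> - y) \<le> 1 / ((1 + real n * \<bar>\<theta> - y\<bar>) / 6) ^ (2 * M)"
          unfolding k_def using s'
          by (intro divide_left_mono power_mono) (auto intro!: mult_pos_pos zero_less_power add_pos_nonneg divide_pos_pos)
        also have "\<dots> = 6 ^ (2 * M) / (1 + real n * \<bar>\<theta> - y\<bar>) ^ (2 * M)" by (simp add: power_divide)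
        finally have k6: "k (\<theta> - y) \<le> 6 ^ (2 * M) / (1 + real n * \<bar>\<theta> - y\<bar>) ^ (2 * M)" .
        have "2 * H y \<le> 2 * (B * real n ^ 2 * m y ^ (2 * K) * (6 ^ (2 * M) / (1 + real n * \<bar>\<theta> - y\<bar>) ^ (2 * M)) * \<bar>poly P (cos y)\<bar>)"
          unfolding H_def using B m by (intro mult_left_mono mult_right_mono k6) auto
        also have "\<dots> = C * real n ^ 2 / (1 + real n * \<bar>\<theta> - y\<bar>) ^ (2 * M) * m y ^ (2 * K) * \<bar>poly P (cos y)\<bar>"
          by (simp add: C_def)
        finally have "ennreal (2 * H y) \<le> ennreal (C * real n ^ 2 / (1 + real n * \<bar>\<theta> - y\<bar>) ^ (2 * M) * m y ^ (2 * K) * \<bar>poly P (cos y)\<bar>)"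
          by (rule ennreal_leI)
        then show ?thesis using True by (simp add: ennreal_mult')
      qed simp
    qed
    finally show "ennreal \<bar>sin \<theta> * poly (pderiv P) (cos \<theta>)\<bar> \<le>
      (\<integral>\<^sup>+y. ennreal (C * real n ^ 2 / (1 + real n * \<bar>\<theta> - y\<bar>) ^ (2 * M) * min 1 (real n * \<bar>sin y\<bar>) ^ (2 * K) * \<bar>poly P (cos y)\<bar>)
       * indicator {0..pi} y \<partial>lborel)"
      unfolding m_def .
  qed
qed

section \<open>The Bernstein inequality for Jacobi weights\<close>

text \<open>Here x measures the distance of the target from an endpoint and z that of the source.
  For a \<ge> 0 the danger is a z much smaller than 1/n; the factor min(1, n z) pays for it through
  x min(1, n z) \<le> z (1 + n \<delta>). For a < 0 the danger is a small x: then z/x \<le> (1 + n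
  \<delta>)(1 + 1/(n x)), and the last factor stays in the bound, to be integrated later.\<close>

lemma weight_shift:
  fixes x z \<delta> n a K :: real
  assumes "0 < x" "0 < z" "x \<le> z + \<delta>" "z \<le> x + \<delta>" "0 < n" "0 \<le> \<delta>" "\<bar>a\<bar> \<le> K"
  shows "x powr a * min 1 (n * z) powr K \<le> z powr a * (1 + n * \<delta>) powr K * (1 + 1 / (n * x)) powr max 0 (- a)"
proof (cases "0 \<le> a")
  case True
  let ?m = "min 1 (n * z)"
  have m: "0 < ?m" "?m \<le> 1" using assms by auto
  have "x * ?m \<le> (z + \<delta>) * ?m" using assms m by (intro mult_right_mono) auto
  also have "\<dots> = z * ?m + \<delta> * ?m" by (simp add: distrib_right)
  also have "\<dots> \<le> z * 1 + \<delta> * (n * z)" using assms by (intro add_mono mult_left_mono) auto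
  finally have le: "x * ?m \<le> z * (1 + n * \<delta>)" by (simp add: algebra_simps)
  have "x powr a * ?m powr K \<le> x powr a * ?m powr a"
    using m assms True powr_mono_both'[of a K ?m ?m] by (intro mult_left_mono) auto
  also have "\<dots> = (x * ?m) powr a" using m assms by (simp add: powr_mult)
  also have "\<dots> \<le> (z * (1 + n * \<delta>)) powr a" using le assms m True by (intro powr_mono2) auto
  also have "\<dots> = z powr a * (1 + n * \<delta>) powr a" using assms by (simp add: powr_mult)
  also have "\<dots> \<le> z powr a * (1 + n * \<delta>) powr K" using assms by (intro mult_left_mono powr_mono) auto
  finally have "x powr a * ?m powr K \<le> z powr a * (1 + n * \<delta>) powr K" .
  moreover have "0 < 1 + 1 / (n * x)" using assms by (intro add_pos_pos) auto
  then have "(1 + 1 / (n * x)) powr max 0 (- a) = 1" using True by (simp add: max_def)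
  ultimately show ?thesis by simp
next
  case False
  have "z / x \<le> (x + \<delta>) / x" using assms by (intro divide_right_mono) auto
  also have "\<dots> = 1 + (n * \<delta>) * (1 / (n * x))" using assms by (simp add: field_simps)
  also have "\<dots> \<le> (1 + n * \<delta>) * (1 + 1 / (n * x))" 
  proof -
    have aux: "1 + A * B \<le> (1 + A) * (1 + B)" if "0 \<le> A" "0 \<le> B" for A B :: real
      using that by (simp add: algebra_simps)
    show ?thesis by (rule aux) (use assms in auto)
  qed
  finally have le: "z / x \<le> (1 + n * \<delta>) * (1 + 1 / (n * x))" .
  have "x powr a * min 1 (n * z) powr K \<le> x powr a * 1"
    using assms by (intro mult_left_mono powr_le1) auto
  also have "\<dots> = z powr a * (z / x) powr (- a)"
    using assms by (simp add: powr_divide powr_minus field_simps)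
  also have "\<dots> \<le> z powr a * ((1 + n * \<delta>) * (1 + 1 / (n * x))) powr (- a)"
    using le assms False by (intro mult_left_mono powr_mono2) auto
  also have "\<dots> = z powr a * ((1 + n * \<delta>) powr (- a) * (1 + 1 / (n * x)) powr (- a))"
    using assms by (subst powr_mult) auto
  also have "\<dots> \<le> z powr a * ((1 + n * \<delta>) powr K * (1 + 1 / (n * x)) powr (- a))"
    using assms by (intro mult_left_mono mult_right_mono powr_mono) auto
  finally show ?thesis using False by (simp add: max_def mult.assoc)
qed

text \<open>Up to a constant the Jacobi weight with exponents a/2 and b/2 at x = cos \<theta>,
  because 1 - x = 2 sin(\<theta>/2)^2 and 1 + x = 2 cos(\<theta>/2)^2. Each factor belongs to one
  endpoint.\<close>

definition angular_weight :: "real \<Rightarrow> real \<Rightarrow> real \<Rightarrow> real" where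
  "angular_weight a b \<theta> = sin (\<theta> / 2) powr a * cos (\<theta> / 2) powr b"

lemma sin_half_bounds:
  assumes "0 < \<theta>" "\<theta> < pi"
  shows "\<theta> / 6 \<le> sin (\<theta> / 2)" "(pi - \<theta>) / 6 \<le> cos (\<theta> / 2)" "0 < sin (\<theta> / 2)" "0 < cos (\<theta> / 2)"
proof -
  have "\<theta> / 2 / 3 \<le> sin (\<theta> / 2)" using assms pi_less_4 by (intro sin_ge_third) auto
  then show 1: "\<theta> / 6 \<le> sin (\<theta> / 2)" by simp
  have "(pi - \<theta>) / 2 / 3 \<le> sin ((pi - \<theta>) / 2)" using assms pi_less_4 by (intro sin_ge_third) auto
  also have "sin ((pi - \<theta>) / 2) = cos (\<theta> / 2)" by (simp add: cos_sin_eq diff_divide_distrib)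
  finally show 2: "(pi - \<theta>) / 6 \<le> cos (\<theta> / 2)" by simp
  have "0 < \<theta> / 6" "0 < (pi - \<theta>) / 6" using assms by auto
  then show "0 < sin (\<theta> / 2)" "0 < cos (\<theta> / 2)" using 1 2 by (meson less_le_trans)+
qed

lemma sin_cos_half_Lipschitz:
  fixes \<theta> y :: real
  shows "\<bar>sin (\<theta> / 2) - sin (y / 2)\<bar> \<le> \<bar>\<theta> - y\<bar>" "\<bar>cos (\<theta> / 2) - cos (y / 2)\<bar> \<le> \<bar>\<theta> - y\<bar>"
proof -
  have s: "\<bar>sin u\<bar> \<le> \<bar>u\<bar>" for u :: real using abs_sin_x_le_abs_x[of u] by simp
  have *: "\<bar>2 * sin u * w\<bar> \<le> 2 * \<bar>u\<bar>" if "\<bar>w\<bar> \<le> 1" for u w :: real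
    using mult_mono[OF s[of u] that] by (simp add: abs_mult)
  have "sin (\<theta> / 2) - sin (y / 2) = 2 * sin ((\<theta> - y) / 4) * cos ((\<theta> + y) / 4)"
    using sin_diff_sin[of "\<theta>/2" "y/2"] by (simp add: field_simps)
  then show "\<bar>sin (\<theta> / 2) - sin (y / 2)\<bar> \<le> \<bar>\<theta> - y\<bar>"
    using *[of "cos ((\<theta> + y) / 4)" "(\<theta> - y) / 4"] by simp
  have "cos (\<theta> / 2) - cos (y / 2) = 2 * sin ((\<theta> - y) / 4) * (- sin ((\<theta> + y) / 4))"
  proof -
    have "sin ((y - \<theta>) / 4) = - sin ((\<theta> - y) / 4)" by (metis minus_diff_eq minus_divide_left sin_minus)
    then show ?thesis using cos_diff_cos[of "\<theta>/2" "y/2"] by (simp add: field_simps)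
  qed
  then show "\<bar>cos (\<theta> / 2) - cos (y / 2)\<bar> \<le> \<bar>\<theta> - y\<bar>"
    using *[of "- sin ((\<theta> + y) / 4)" "(\<theta> - y) / 4"] by simp
qed

text \<open>\<open>weight_shift\<close> is applied at each endpoint with exponent K. The factor of
  exponent 2K can be shared between them because |sin y| is at most 2 sin(y/2) and at most 2
  cos(y/2); this yields 4^K.\<close>

lemma angular_weight_shift:
  fixes K n :: nat
  assumes \<theta>: "0 < \<theta>" "\<theta> < pi" and y: "0 < y" "y < pi" and n: "0 < n" and K: "\<bar>a\<bar> \<le> real K" "\<bar>b\<bar> \<le> real K"
  shows "angular_weight a b \<theta> * min 1 (real n * \<bar>sin y\<bar>) ^ (2 * K) \<le>
     4 ^ K * angular_weight a b y * (1 + real n * \<bar>\<theta> - y\<bar>) ^ (2 * K) *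
       ((1 + 1 / (real n * sin (\<theta> / 2))) powr max 0 (- a) * (1 + 1 / (real n * cos (\<theta> / 2))) powr max 0 (- b))"
proof -
  note h = sin_half_bounds(3,4)[OF \<theta>] sin_half_bounds(3,4)[OF y]
  let ?m = "min 1 (real n * \<bar>sin y\<bar>)" and ?ms = "min 1 (real n * sin (y/2))" and ?mc = "min 1 (real n * cos (y/2))"
  let ?d = "\<bar>\<theta> - y\<bar>"
  have pos: "0 < ?ms" "0 < ?mc" "0 < 1 + real n * ?d" using h n by (auto intro: add_pos_nonneg)
  have sy: "\<bar>sin y\<bar> = 2 * sin (y/2) * cos (y/2)" using sin_double[of "y/2"] h by (simp add: abs_mult)
  have "\<bar>sin y\<bar> \<le> 2 * sin (y/2)" using h unfolding sy by (intro mult_left_le) auto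
  then have "real n * \<bar>sin y\<bar> \<le> 2 * (real n * sin (y/2))" using n by simp
  then have ms: "?m \<le> 2 * ?ms" by (auto simp: min_def)
  have "\<bar>sin y\<bar> \<le> 2 * cos (y/2)" using h mult_left_le_one_le[of "2 * cos (y/2)" "sin (y/2)"] unfolding sy by (simp add: mult_ac)
  then have "real n * \<bar>sin y\<bar> \<le> 2 * (real n * cos (y/2))" using n by simp
  then have mc: "?m \<le> 2 * ?mc" by (auto simp: min_def)
  have "?m ^ (2 * K) = ?m ^ K * ?m ^ K" by (simp add: mult_2 power_add)
  also have "\<dots> \<le> (2 * ?ms) ^ K * (2 * ?mc) ^ K" using ms mc pos(1,2) by (intro mult_mono power_mono zero_le_power mult_nonneg_nonneg) (simp_all only: less_imp_le zero_le_numeral, simp_all)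
  also have "\<dots> = 4 ^ K * (?ms powr K * ?mc powr K)"
  proof -
    have "(4::real) ^ K = 2 ^ K * 2 ^ K" by (simp add: power_mult_distrib[symmetric])
    then show ?thesis using pos by (simp only: power_mult_distrib powr_realpow mult_ac)
  qed
  finally have m: "?m ^ (2 * K) \<le> 4 ^ K * (?ms powr K * ?mc powr K)" .
  have S: "sin (\<theta>/2) powr a * ?ms powr K \<le> sin (y/2) powr a * (1 + real n * ?d) powr K * (1 + 1 / (real n * sin (\<theta>/2))) powr max 0 (- a)"
    using h n K sin_cos_half_Lipschitz(1)[of \<theta> y] by (intro weight_shift) auto
  have C: "cos (\<theta>/2) powr b * ?mc powr K \<le> cos (y/2) powr b * (1 + real n * ?d) powr K * (1 + 1 / (real n * cos (\<theta>/2))) powr max 0 (- b)"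
    using h n K sin_cos_half_Lipschitz(2)[of \<theta> y] by (intro weight_shift) auto
  have "angular_weight a b \<theta> * ?m ^ (2 * K) \<le> angular_weight a b \<theta> * (4 ^ K * (?ms powr K * ?mc powr K))"
    using m by (intro mult_left_mono) (auto simp: angular_weight_def)
  also have "\<dots> = 4 ^ K * ((sin (\<theta>/2) powr a * ?ms powr K) * (cos (\<theta>/2) powr b * ?mc powr K))"
    by (simp add: angular_weight_def mult_ac)
  also have "\<dots> \<le> 4 ^ K * ((sin (y/2) powr a * (1 + real n * ?d) powr K * (1 + 1 / (real n * sin (\<theta>/2))) powr max 0 (- a)) *
      (cos (y/2) powr b * (1 + real n * ?d) powr K * (1 + 1 / (real n * cos (\<theta>/2))) powr max 0 (- b)))"
    by (intro mult_left_mono mult_mono S C) auto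
  also have "\<dots> = 4 ^ K * angular_weight a b y * (1 + real n * \<bar>\<theta> - y\<bar>) ^ (2 * K) *
       ((1 + 1 / (real n * sin (\<theta> / 2))) powr max 0 (- a) * (1 + 1 / (real n * cos (\<theta> / 2))) powr max 0 (- b))"
  proof -
    have "(1 + real n * ?d) ^ (2 * K) = (1 + real n * ?d) powr K * (1 + real n * ?d) powr K"
      using pos by (simp add: powr_realpow mult_2 power_add)
    then show ?thesis by (simp only: angular_weight_def mult_ac)
  qed
  finally show ?thesis .
qed

text \<open>Since (1 + |v|)^2 \<ge> 1 + v^2, the kernel is dominated by the derivative of an
  \<open>arctan\<close>, whose total increase is at most pi.\<close>

lemma nn_integral_kernel_le_pi:
  assumes "0 < n" "a \<le> b"
  shows "(\<integral>\<^sup>+\<theta>. ennreal (n / (1 + n * \<bar>\<theta> - y\<bar>) ^ 2) * indicator {a..b} \<theta> \<partial>lborel) \<le> ennreal pi"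
proof -
  have "(\<integral>\<^sup>+\<theta>. ennreal (n / (1 + n * \<bar>\<theta> - y\<bar>) ^ 2) * indicator {a..b} \<theta> \<partial>lborel) \<le>
    (\<integral>\<^sup>+\<theta>. ennreal (n / (1 + (n * (\<theta> - y)) ^ 2)) * indicator {a..b} \<theta> \<partial>lborel)"
  proof (intro nn_integral_mono mult_right_mono ennreal_leI divide_left_mono)
    fix \<theta>
    have "(1 + n * \<bar>\<theta> - y\<bar>)\<^sup>2 = 1 + (n * (\<theta> - y))\<^sup>2 + 2 * n * \<bar>\<theta> - y\<bar>"
      by (simp add: power2_eq_square algebra_simps flip: abs_mult)
    then show "1 + (n * (\<theta> - y))\<^sup>2 \<le> (1 + n * \<bar>\<theta> - y\<bar>)\<^sup>2" using assms by simp
    show "0 < (1 + n * \<bar>\<theta> - y\<bar>)\<^sup>2 * (1 + (n * (\<theta> - y))\<^sup>2)"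
      using assms by (intro mult_pos_pos zero_less_power add_pos_nonneg) auto
  qed (use assms in auto)
  also have "\<dots> = ennreal (arctan (n * (b - y)) - arctan (n * (a - y)))"
  proof (rule nn_integral_has_integral_lebesgue')
    show "((\<lambda>\<theta>. n / (1 + (n * (\<theta> - y))\<^sup>2)) has_integral arctan (n * (b - y)) - arctan (n * (a - y))) {a..b}"
      using assms by (intro fundamental_theorem_of_calculus)
        (auto intro!: derivative_eq_intros simp: has_real_derivative_iff_has_vector_derivative[symmetric] divide_inverse)
  qed (use assms in auto)
  also have "\<dots> \<le> ennreal pi"
    using arctan_bounded[of "n * (b - y)"] arctan_bounded[of "n * (a - y)"] by (intro ennreal_leI) auto
  finally show ?thesis .
qed

lemma nn_integral_powr_near_0:
  fixes n e b :: real
  assumes "0 < n" "0 \<le> e" "e < 1"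
  shows "(\<integral>\<^sup>+\<theta>. ennreal (n * (n * \<theta>) powr (- e)) * indicator {0..1/n} \<theta> \<partial>lborel) = ennreal (1 / (1 - e))"
proof -
  have "((\<lambda>\<theta>. (n * n powr (- e)) * \<theta> powr (- e)) has_integral (n * n powr (- e)) * ((1/n) powr (- e + 1) / (- e + 1))) {0..1/n}"
    using assms by (intro has_integral_mult_right has_integral_powr_from_0) auto
  also have "(n * n powr (- e)) * ((1/n) powr (- e + 1) / (- e + 1)) = 1 / (1 - e)"
    using assms by (simp add: powr_divide powr_add powr_minus field_simps powr_diff)
  finally have "((\<lambda>\<theta>. n * (n * \<theta>) powr (- e)) has_integral 1 / (1 - e)) {0..1/n}"
    by (rule has_integral_eq[rotated]) (use assms in \<open>auto simp: powr_mult\<close>)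
  then show ?thesis using assms by (intro nn_integral_has_integral_lebesgue') auto
qed

text \<open>With t = 1/(n \<theta>), the inequality (1 + t)^e \<le> 1 + t^e separates the
  singularity. For n \<theta> > 1 the singular part is at most 1 and at most doubles the kernel; for
  n \<theta> \<le> 1 the kernel is at most n, and the power is integrable because e < 1.\<close>

lemma nn_integral_kernel_powr:
  fixes n e y c :: real
  assumes n: "0 < n" and e: "0 \<le> e" "e < 1"
  shows "(\<integral>\<^sup>+\<theta>. ennreal (n / (1 + n * \<bar>\<theta> - y\<bar>) ^ 2 * (1 + 1 / (n * \<theta>)) powr e) * indicator {0..pi} \<theta> \<partial>lborel)
    \<le> ennreal (2 * pi + 1 / (1 - e))"
proof -
  let ?k = "\<lambda>\<theta>. n / (1 + n * \<bar>\<theta> - y\<bar>) ^ 2"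
  have k: "0 \<le> ?k \<theta>" "?k \<theta> \<le> n" for \<theta>
  proof -
    have "1 \<le> 1 + n * \<bar>\<theta> - y\<bar>" using n by simp
    then have "1 \<le> (1 + n * \<bar>\<theta> - y\<bar>)\<^sup>2" by (rule one_le_power)
    moreover have "0 < 1 + n * \<bar>\<theta> - y\<bar>" using n by (intro add_pos_nonneg) auto
    ultimately show "0 \<le> ?k \<theta>" "?k \<theta> \<le> n"
      using divide_left_mono[of 1 "(1 + n * \<bar>\<theta> - y\<bar>)\<^sup>2" n] n by auto
  qed
  have pt: "ennreal (?k \<theta> * (1 + 1 / (n * \<theta>)) powr e) * indicator {0..pi} \<theta> \<le>
     2 * (ennreal (?k \<theta>) * indicator {0..pi} \<theta>) + ennreal (n * (n * \<theta>) powr (- e)) * indicator {0..1/n} \<theta>"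
    (is "?L \<le> ?R") for \<theta>
  proof (cases "0 < \<theta> \<and> \<theta> \<le> pi")
    case True
    have "(1 + 1 / (n * \<theta>)) powr e \<le> 1 + (1 / (n * \<theta>)) powr e"
    proof -
      have sub: "(1 + t) powr e \<le> 1 + t powr e" if "0 < t" for t :: real
      proof -
        have "(1 + t) powr e = (1 + t) * (1 + t) powr (e - 1)" using that by (simp add: powr_diff)
        also have "\<dots> = 1 * (1 + t) powr (e - 1) + t * (1 + t) powr (e - 1)" by (simp add: distrib_right)
        also have "\<dots> \<le> 1 * 1 + t * t powr (e - 1)"
        proof (intro add_mono mult_left_mono)
          show "(1 + t) powr (e - 1) \<le> 1" using powr_mono2'[of "e - 1" 1 "1 + t"] that e by simp
          show "(1 + t) powr (e - 1) \<le> t powr (e - 1)" using that e by (intro powr_mono2') auto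
        qed (use that in auto)
        finally show ?thesis using that by (simp add: powr_diff)
      qed
      show ?thesis using True n by (intro sub) auto
    qed
    then have *: "?k \<theta> * (1 + 1 / (n * \<theta>)) powr e \<le> ?k \<theta> + ?k \<theta> * (n * \<theta>) powr (- e)"
      using mult_left_mono[OF _ k(1), of "(1 + 1 / (n * \<theta>)) powr e" "1 + (n * \<theta>) powr (- e)" \<theta>] True n
      by (simp add: powr_divide powr_minus_divide distrib_left)
    show ?thesis
    proof (cases "n * \<theta> \<le> 1")
      case le: True
      have "?k \<theta> * (1 + 1 / (n * \<theta>)) powr e \<le> 2 * ?k \<theta> + n * (n * \<theta>) powr (- e)"
        using * mult_right_mono[OF k(2), of "(n * \<theta>) powr (- e)" \<theta>] k(1)[of \<theta>] by simp
      moreover have "\<theta> \<in> {0..1/n}" using le n True by (simp add: field_simps)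
      ultimately show ?thesis using True k n
        by (simp add: ennreal_leI ennreal_plus[symmetric] ennreal_mult[symmetric] del: ennreal_plus flip: ennreal_numeral)
    next
      case gt: False
      have "(n * \<theta>) powr (- e) \<le> 1" using gt e by (simp add: powr_minus inverse_le_1_iff ge_one_powr_ge_zero)
      then have "?k \<theta> * (1 + 1 / (n * \<theta>)) powr e \<le> 2 * ?k \<theta>"
        using * mult_left_mono[OF _ k(1), of "(n * \<theta>) powr (- e)" 1 \<theta>] by simp
      then have "ennreal (?k \<theta> * (1 + 1 / (n * \<theta>)) powr e) \<le> 2 * ennreal (?k \<theta>)"
        using k by (simp add: ennreal_leI ennreal_mult[symmetric] flip: ennreal_numeral)
      then show ?thesis using True by (simp add: add_increasing2)
    qed
  next
    case False
    show ?thesis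
    proof (cases "\<theta> = 0")
      \<comment> \<open>Division by zero yields 0, so the factor (1 + 1/(n \<theta>))^e is 1 at
        \<theta> = 0 and the bound holds there as well.\<close>
      case True
      have "ennreal (?k 0) \<le> 2 * ennreal (?k 0)" by (simp add: mult_2)
      then show ?thesis using True e by (auto intro: add_increasing2)
    qed (use False in \<open>auto simp: indicator_def\<close>)
  qed
  have [measurable]: "?k \<in> borel_measurable borel" by measurable
  have "(\<integral>\<^sup>+\<theta>. ?L \<theta> \<partial>lborel) \<le> (\<integral>\<^sup>+\<theta>. ?R \<theta> \<partial>lborel)" by (intro nn_integral_mono pt)
  also have "\<dots> = 2 * (\<integral>\<^sup>+\<theta>. ennreal (?k \<theta>) * indicator {0..pi} \<theta> \<partial>lborel) + (\<integral>\<^sup>+\<theta>. ennreal (n * (n * \<theta>) powr (- e)) * indicator {0..1/n} \<theta> \<partial>lborel)"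
    by (subst nn_integral_add) (auto simp: nn_integral_cmult)
  also have "\<dots> \<le> 2 * ennreal pi + ennreal (1 / (1 - e))"
    using nn_integral_kernel_le_pi[OF n, of 0 pi y] nn_integral_powr_near_0[OF n e]
    by (intro add_mono mult_left_mono) auto
  also have "\<dots> = ennreal (2 * pi + 1 / (1 - e))" using e by (simp add: ennreal_mult)
  finally show ?thesis .
qed

lemma nn_integral_reflect_interval:
  fixes f :: "real \<Rightarrow> ennreal"
  assumes "f \<in> borel_measurable borel"
  shows "(\<integral>\<^sup>+\<theta>. f (c - \<theta>) * indicator {0..c} \<theta> \<partial>lborel) = (\<integral>\<^sup>+\<theta>. f \<theta> * indicator {0..c} \<theta> \<partial>lborel)"
proof -
  have "(\<integral>\<^sup>+\<theta>. f \<theta> * indicator {0..c} \<theta> \<partial>lborel) = (\<integral>\<^sup>+\<theta>. f (c - \<theta>) * indicator {0..c} (c - \<theta>) \<partial>lborel)"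
    using assms by (subst nn_integral_real_affine[where c = "-1" and t = c]) auto
  also have "\<dots> = (\<integral>\<^sup>+\<theta>. f (c - \<theta>) * indicator {0..c} \<theta> \<partial>lborel)"
    by (intro nn_integral_cong) (auto simp: indicator_def)
  finally show ?thesis by simp
qed

lemma angular_weight_nonneg: "0 \<le> angular_weight a b \<theta>"
  by (simp add: angular_weight_def)

text \<open>The second half of a Schur test: integrated in \<theta> against the weight, the kernel
  returns at most a multiple of the weight at y. Of the exponent 2(K+1) in the denominator, 2K is
  spent on \<open>angular_weight_shift\<close> and 2 is left for integrability.\<close>

lemma kernel_weight_bound:
  fixes K :: nat
  assumes ab: "-1 < a" "-1 < b" and K: "\<bar>a\<bar> \<le> real K" "\<bar>b\<bar> \<le> real K"
  obtains C where "0 < C" "\<And>n y. 0 < n \<Longrightarrow> 0 < y \<Longrightarrow> y < pi \<Longrightarrow>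
    (\<integral>\<^sup>+\<theta>. ennreal (real n / (1 + real n * \<bar>\<theta> - y\<bar>) ^ (2 * (K + 1)) * min 1 (real n * \<bar>sin y\<bar>) ^ (2 * K) * angular_weight a b \<theta>)
       * indicator {0..pi} \<theta> \<partial>lborel) \<le> ennreal (C * angular_weight a b y)"
proof -
  define e where "e = max 0 (- a)"
  define g where "g = max 0 (- b)"
  have eg: "0 \<le> e" "e < 1" "0 \<le> g" "g < 1" using ab by (auto simp: e_def g_def)
  \<comment> \<open>The 144 exceeds 72 = 6 times 6 times 2, from the two half-angle comparisons and
    the separation of the endpoints; the bracket adds the two bounds from
    \<open>nn_integral_kernel_powr\<close>.\<close>
  define C where "C = 4 ^ K * 12 * 12 * (4 * pi + 1 / (1 - e) + 1 / (1 - g))"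
  show thesis
  proof (rule that)
    show "0 < C" using eg pi_gt_zero by (auto simp: C_def intro!: mult_pos_pos add_pos_pos divide_pos_pos)
    fix n :: nat and y :: real
    assume n: "0 < n" and y: "0 < y" "y < pi"
    let ?D = "\<lambda>\<theta>. 1 + real n * \<bar>\<theta> - y\<bar>"
    let ?c = "4 ^ K * angular_weight a b y * 12 * 12"
    have D: "0 < ?D \<theta>" for \<theta> by (intro add_pos_nonneg) auto
    let ?A = "\<lambda>\<theta>. real n / ?D \<theta> ^ 2 * (1 + 1 / (real n * \<theta>)) powr e"
    let ?B = "\<lambda>\<theta>. real n / ?D \<theta> ^ 2 * (1 + 1 / (real n * (pi - \<theta>))) powr g"
    have pt: "real n / ?D \<theta> ^ (2 * (K + 1)) * min 1 (real n * \<bar>sin y\<bar>) ^ (2 * K) * angular_weight a b \<theta> \<le> ?c * (?A \<theta> + ?B \<theta>)"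
      if \<theta>: "0 < \<theta>" "\<theta> < pi" for \<theta>
    proof -
      let ?u = "1 + 1 / (real n * \<theta>)" and ?w = "1 + 1 / (real n * (pi - \<theta>))"
      have uw: "1 \<le> ?u" "1 \<le> ?w" using \<theta> n by auto
      have "1 + 1 / (real n * sin (\<theta> / 2)) \<le> 1 + 1 / (real n * (\<theta> / 6))"
        using sin_half_bounds[OF \<theta>] n \<theta> by (intro add_left_mono divide_left_mono mult_left_mono) auto
      also have "\<dots> \<le> 6 * ?u" by simp
      finally have "(1 + 1 / (real n * sin (\<theta> / 2))) powr e \<le> (6 * ?u) powr e"
        using sin_half_bounds[OF \<theta>] n eg by (intro powr_mono2) auto
      also have "\<dots> = 6 powr e * ?u powr e" by (rule powr_mult)
      also have "\<dots> \<le> 6 powr 1 * ?u powr e" using eg by (intro mult_right_mono powr_mono) auto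
      finally have 1: "(1 + 1 / (real n * sin (\<theta> / 2))) powr e \<le> 6 * ?u powr e" by simp
      have "1 + 1 / (real n * cos (\<theta> / 2)) \<le> 1 + 1 / (real n * ((pi - \<theta>) / 6))"
        using sin_half_bounds[OF \<theta>] n \<theta> by (intro add_left_mono divide_left_mono mult_left_mono) auto
      also have "\<dots> \<le> 6 * ?w" by (simp add: field_simps)
      finally have "(1 + 1 / (real n * cos (\<theta> / 2))) powr g \<le> (6 * ?w) powr g"
        using sin_half_bounds[OF \<theta>] n eg by (intro powr_mono2) auto
      also have "\<dots> = 6 powr g * ?w powr g" by (rule powr_mult)
      also have "\<dots> \<le> 6 powr 1 * ?w powr g" using eg by (intro mult_right_mono powr_mono) auto
      finally have 2: "(1 + 1 / (real n * cos (\<theta> / 2))) powr g \<le> 6 * ?w powr g" by simp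
      \<comment> \<open>The two singularities lie at opposite endpoints. On each half of [0, pi] one
        of the factors is at most 2, so the product is controlled by the sum.\<close>
      have 3: "?u powr e * ?w powr g \<le> 2 * (?u powr e + ?w powr g)"
      proof (cases "\<theta> \<le> pi / 2")
        case True
        then have "1 * 1 \<le> real n * (pi - \<theta>)" using n pi_gt3 by (intro mult_mono) auto
        then have "?w \<le> 2" by (simp add: divide_le_eq)
        then have "?w powr g \<le> 2 powr 1" using uw eg by (intro powr_mono_both) auto
        then have "?u powr e * ?w powr g \<le> ?u powr e * 2" by (intro mult_left_mono) auto
        then show ?thesis by (simp add: add_increasing2)
      next
        case False
        then have "1 * 1 \<le> real n * \<theta>" using n pi_gt3 by (intro mult_mono) auto
        then have "?u \<le> 2" by (simp add: divide_le_eq)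
        then have "?u powr e \<le> 2 powr 1" using uw eg by (intro powr_mono_both) auto
        then have "?u powr e * ?w powr g \<le> 2 * ?w powr g" by (intro mult_right_mono) auto
        then show ?thesis by (simp add: add_increasing)
      qed
      have "real n / ?D \<theta> ^ (2 * (K + 1)) * min 1 (real n * \<bar>sin y\<bar>) ^ (2 * K) * angular_weight a b \<theta>
        = real n / ?D \<theta> ^ (2 * (K + 1)) * (angular_weight a b \<theta> * min 1 (real n * \<bar>sin y\<bar>) ^ (2 * K))" by simp
      also have "\<dots> \<le> real n / ?D \<theta> ^ (2 * (K + 1)) * (4 ^ K * angular_weight a b y * ?D \<theta> ^ (2 * K) *
         ((1 + 1 / (real n * sin (\<theta> / 2))) powr e * (1 + 1 / (real n * cos (\<theta> / 2))) powr g))"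
        using angular_weight_shift[OF \<theta> y n K] D[of \<theta>] unfolding e_def g_def by (intro mult_left_mono) auto
      also have "\<dots> \<le> real n / ?D \<theta> ^ (2 * (K + 1)) * (4 ^ K * angular_weight a b y * ?D \<theta> ^ (2 * K) *
         ((6 * ?u powr e) * (6 * ?w powr g)))"
        using D[of \<theta>] by (intro mult_left_mono mult_mono 1 2) (auto simp: angular_weight_nonneg)
      also have "\<dots> = 4 ^ K * angular_weight a b y * 36 * (real n / ?D \<theta> ^ 2) * (?u powr e * ?w powr g)"
      proof -
        have q: "real n / ?D \<theta> ^ (2 * (K + 1)) * ?D \<theta> ^ (2 * K) = real n / ?D \<theta> ^ 2"
          using D[of \<theta>] by (simp add: power_add power2_eq_square)
        have "R * (c * E * ((6 * u) * (6 * w))) = c * 36 * (R * E) * (u * w)" for R c E u w :: real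
          by simp
        from this[of "real n / ?D \<theta> ^ (2 * (K + 1))" _ "?D \<theta> ^ (2 * K)"] show ?thesis unfolding q .
      qed
      also have "\<dots> \<le> 4 ^ K * angular_weight a b y * 36 * (real n / ?D \<theta> ^ 2) * (2 * (?u powr e + ?w powr g))"
        using D[of \<theta>] by (intro mult_left_mono 3) (auto simp: angular_weight_nonneg)
      also have "\<dots> = (4 ^ K * angular_weight a b y * 72) * (?A \<theta> + ?B \<theta>)"
      proof -
        have "c * 36 * R * (2 * (u + w)) = c * 72 * (R * u + R * w)" for c R u w :: real by (simp add: algebra_simps)
        then show ?thesis .
      qed
      also have "\<dots> \<le> ?c * (?A \<theta> + ?B \<theta>)"
        using D[of \<theta>] by (intro mult_right_mono) (auto simp: angular_weight_nonneg)
      finally show ?thesis .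
    qed
    have c: "0 \<le> ?c" by (simp add: angular_weight_nonneg)
    have AB: "0 \<le> ?A \<theta>" "0 \<le> ?B \<theta>" for \<theta> by auto
    have "AE \<theta> in lborel. \<theta> \<noteq> (0::real)" "AE \<theta> in lborel. \<theta> \<noteq> pi" by (rule AE_lborel_singleton)+
    then have "(\<integral>\<^sup>+\<theta>. ennreal (real n / ?D \<theta> ^ (2 * (K + 1)) * min 1 (real n * \<bar>sin y\<bar>) ^ (2 * K) * angular_weight a b \<theta>)
       * indicator {0..pi} \<theta> \<partial>lborel) \<le> (\<integral>\<^sup>+\<theta>. ennreal ?c * (ennreal (?A \<theta>) * indicator {0..pi} \<theta> + ennreal (?B \<theta>) * indicator {0..pi} \<theta>) \<partial>lborel)"
    proof (intro nn_integral_mono_AE, eventually_elim)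
      fix \<theta> :: real assume "\<theta> \<noteq> 0" "\<theta> \<noteq> pi"
      show "ennreal (real n / ?D \<theta> ^ (2 * (K + 1)) * min 1 (real n * \<bar>sin y\<bar>) ^ (2 * K) * angular_weight a b \<theta>)
       * indicator {0..pi} \<theta> \<le> ennreal ?c * (ennreal (?A \<theta>) * indicator {0..pi} \<theta> + ennreal (?B \<theta>) * indicator {0..pi} \<theta>)"
      proof (cases "\<theta> \<in> {0..pi}")
        case True
        then have "0 < \<theta>" "\<theta> < pi" using \<open>\<theta> \<noteq> 0\<close> \<open>\<theta> \<noteq> pi\<close> by auto
        from ennreal_leI[OF pt[OF this]] show ?thesis
          using c AB[of \<theta>] True by (simp only: ennreal_mult add_nonneg_nonneg ennreal_plus indicator_simps if_True mult_1_right)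
      qed simp
    qed
    also have "\<dots> = ennreal ?c * ((\<integral>\<^sup>+\<theta>. ennreal (?A \<theta>) * indicator {0..pi} \<theta> \<partial>lborel) + (\<integral>\<^sup>+\<theta>. ennreal (?B \<theta>) * indicator {0..pi} \<theta> \<partial>lborel))"
      by (simp add: nn_integral_cmult nn_integral_add)
    \<comment> \<open>Reflection at pi/2 moves the singularity at pi to 0.\<close>
    also have "(\<integral>\<^sup>+\<theta>. ennreal (?B \<theta>) * indicator {0..pi} \<theta> \<partial>lborel) =
       (\<integral>\<^sup>+\<theta>. ennreal (real n / (1 + real n * \<bar>\<theta> - (pi - y)\<bar>) ^ 2 * (1 + 1 / (real n * \<theta>)) powr g) * indicator {0..pi} \<theta> \<partial>lborel)"
      by (subst nn_integral_reflect_interval[symmetric]) (auto simp: abs_minus_commute algebra_simps)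
    also have "ennreal ?c * ((\<integral>\<^sup>+\<theta>. ennreal (?A \<theta>) * indicator {0..pi} \<theta> \<partial>lborel) +
        (\<integral>\<^sup>+\<theta>. ennreal (real n / (1 + real n * \<bar>\<theta> - (pi - y)\<bar>) ^ 2 * (1 + 1 / (real n * \<theta>)) powr g) * indicator {0..pi} \<theta> \<partial>lborel))
      \<le> ennreal ?c * (ennreal (2 * pi + 1 / (1 - e)) + ennreal (2 * pi + 1 / (1 - g)))"
      using n eg by (intro mult_left_mono add_mono nn_integral_kernel_powr) auto
    also have "\<dots> = ennreal (C * angular_weight a b y)"
    proof -
      have aux: "ennreal u * (ennreal v + ennreal w) = ennreal (u * (v + w))" if "0 \<le> u" "0 \<le> v" "0 \<le> w" for u v w
        using that by (simp add: ennreal_mult ennreal_plus)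
      have "?c * ((2 * pi + 1 / (1 - e)) + (2 * pi + 1 / (1 - g))) = C * angular_weight a b y"
        by (simp add: C_def algebra_simps)
      moreover have "0 \<le> 2 * pi + 1 / (1 - e)" "0 \<le> 2 * pi + 1 / (1 - g)" using eg by auto
      ultimately show ?thesis using aux[OF c] by metis
    qed
    finally show "(\<integral>\<^sup>+\<theta>. ennreal (real n / ?D \<theta> ^ (2 * (K + 1)) * min 1 (real n * \<bar>sin y\<bar>) ^ (2 * K) * angular_weight a b \<theta>)
       * indicator {0..pi} \<theta> \<partial>lborel) \<le> ennreal (C * angular_weight a b y)" .
  qed
qed

text \<open>The substitution rule is applied to a nondecreasing map, hence the passage through
  \<open>- cos\<close>.\<close>

lemma nn_integral_cos_substitution:
  fixes F :: "real \<Rightarrow> ennreal"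
  assumes [measurable]: "F \<in> borel_measurable borel"
  shows "(\<integral>\<^sup>+x. F x * indicator {-1..1} x \<partial>lborel) = (\<integral>\<^sup>+\<theta>. F (cos \<theta>) * ennreal (sin \<theta>) * indicator {0..pi} \<theta> \<partial>lborel)"
proof -
  have "(\<integral>\<^sup>+x. F x * indicator {-1..1} x \<partial>lborel) = (\<integral>\<^sup>+x. F (-x) * indicator {-1..1} (-x) \<partial>lborel)"
    by (subst nn_integral_real_affine[where c = "-1" and t = 0]) auto
  also have "\<dots> = (\<integral>\<^sup>+x. F (-x) * indicator {(- cos 0)..(- cos pi)} x \<partial>lborel)"
    by (intro nn_integral_cong) (auto simp: indicator_def)
  also have "\<dots> = (\<integral>\<^sup>+\<theta>. F (- (- cos \<theta>)) * ennreal (sin \<theta>) * indicator {0..pi} \<theta> \<partial>lborel)"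
    by (intro nn_integral_substitution_aux[where g = "\<lambda>\<theta>. - cos \<theta>"])
      (auto intro!: derivative_eq_intros continuous_intros sin_ge_zero)
  finally show ?thesis by simp
qed

lemma borel_measurable_poly [measurable]: "(poly P :: real \<Rightarrow> real) \<in> borel_measurable borel"
  by (intro borel_measurable_continuous_onI continuous_intros)

lemma borel_measurable_jacobi_w [measurable]: "jacobi_w \<alpha> \<beta> \<in> borel_measurable borel"
  unfolding jacobi_w_def by measurable

lemma borel_measurable_vphi [measurable]: "vphi \<in> borel_measurable borel"
  unfolding vphi_def by measurable

lemma jacobi_w_cos:
  assumes "0 < \<theta>" "\<theta> < pi"
  shows "jacobi_w \<alpha> \<beta> (cos \<theta>) = 2 powr (\<alpha> + \<beta>) * angular_weight (2 * \<alpha>) (2 * \<beta>) \<theta>"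
proof -
  note h = sin_half_bounds(3,4)[OF assms]
  have 1: "1 - cos \<theta> = 2 * sin (\<theta>/2) powr 2"
    using cos_double_sin[of "\<theta>/2"] h by (simp add: powr_numeral)
  have 2: "1 + cos \<theta> = 2 * cos (\<theta>/2) powr 2"
    using cos_double_cos[of "\<theta>/2"] h by (simp add: powr_numeral)
  show ?thesis unfolding jacobi_w_def angular_weight_def 1 2
    by (simp add: powr_mult powr_powr powr_add)
qed

lemma borel_measurable_angular_weight [measurable]: "angular_weight a b \<in> borel_measurable borel"
  unfolding angular_weight_def by measurable

text \<open>The q-th power and the half-angle formulas turn \<alpha> into 2q\<alpha>, and the
  Jacobian sin \<theta> = 2 sin(\<theta>/2) cos(\<theta>/2) adds 1 to both exponents. Thus the
  condition \<alpha> > -1/q becomes an exponent above -1. The endpoints are left out as a null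
  set.\<close>

lemma nn_integral_jacobi_cos:
  assumes "1 \<le> q" and [measurable]: "g \<in> borel_measurable borel"
  shows "(\<integral>\<^sup>+x. ennreal (\<bar>jacobi_w \<alpha> \<beta> x * g x\<bar> powr q) \<partial>lebesgue_on {-1..1}) =
    ennreal (2 powr (q * (\<alpha> + \<beta>) + 1)) *
      (\<integral>\<^sup>+\<theta>. ennreal (\<bar>g (cos \<theta>)\<bar> powr q * angular_weight (2 * q * \<alpha> + 1) (2 * q * \<beta> + 1) \<theta>) * indicator {0..pi} \<theta> \<partial>lborel)"
proof -
  have "(\<integral>\<^sup>+x. ennreal (\<bar>jacobi_w \<alpha> \<beta> x * g x\<bar> powr q) \<partial>lebesgue_on {-1..1}) =
    (\<integral>\<^sup>+\<theta>. ennreal (\<bar>jacobi_w \<alpha> \<beta> (cos \<theta>) * g (cos \<theta>)\<bar> powr q) * ennreal (sin \<theta>) * indicator {0..pi} \<theta> \<partial>lborel)"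
    unfolding nn_integral_interval_lborel by (rule nn_integral_cos_substitution) measurable
  also have "\<dots> = (\<integral>\<^sup>+\<theta>. ennreal (2 powr (q * (\<alpha> + \<beta>) + 1)) * (ennreal (\<bar>g (cos \<theta>)\<bar> powr q * angular_weight (2 * q * \<alpha> + 1) (2 * q * \<beta> + 1) \<theta>) * indicator {0..pi} \<theta>) \<partial>lborel)"
  proof -
    have "AE \<theta> in lborel. \<theta> \<noteq> (0::real)" "AE \<theta> in lborel. \<theta> \<noteq> pi" by (rule AE_lborel_singleton)+
    then show ?thesis
    proof (intro nn_integral_cong_AE, eventually_elim)
      fix \<theta> :: real assume ne: "\<theta> \<noteq> 0" "\<theta> \<noteq> pi"
      show "ennreal (\<bar>jacobi_w \<alpha> \<beta> (cos \<theta>) * g (cos \<theta>)\<bar> powr q) * ennreal (sin \<theta>) * indicator {0..pi} \<theta> =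
        ennreal (2 powr (q * (\<alpha> + \<beta>) + 1)) * (ennreal (\<bar>g (cos \<theta>)\<bar> powr q * angular_weight (2 * q * \<alpha> + 1) (2 * q * \<beta> + 1) \<theta>) * indicator {0..pi} \<theta>)"
      proof (cases "\<theta> \<in> {0..pi}")
        case True
        then have \<theta>: "0 < \<theta>" "\<theta> < pi" using ne by auto
        note h = sin_half_bounds(3,4)[OF \<theta>]
        have s: "sin \<theta> = 2 * sin (\<theta>/2) * cos (\<theta>/2)" using sin_double[of "\<theta>/2"] by simp
        have "\<bar>jacobi_w \<alpha> \<beta> (cos \<theta>) * g (cos \<theta>)\<bar> powr q * sin \<theta> =
          2 powr (q * (\<alpha> + \<beta>) + 1) * (\<bar>g (cos \<theta>)\<bar> powr q * angular_weight (2 * q * \<alpha> + 1) (2 * q * \<beta> + 1) \<theta>)"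
          unfolding jacobi_w_cos[OF \<theta>] s using h
          by (simp add: abs_mult angular_weight_def powr_mult powr_powr powr_add distrib_left mult_ac)
        then show ?thesis using True \<theta> sin_gt_zero[OF \<theta>]
          by (simp add: ennreal_mult[symmetric] angular_weight_nonneg)
      qed simp
    qed
  qed
  also have "\<dots> = ennreal (2 powr (q * (\<alpha> + \<beta>) + 1)) *
      (\<integral>\<^sup>+\<theta>. ennreal (\<bar>g (cos \<theta>)\<bar> powr q * angular_weight (2 * q * \<alpha> + 1) (2 * q * \<beta> + 1) \<theta>) * indicator {0..pi} \<theta> \<partial>lborel)"
    by (rule nn_integral_cmult) measurable
  finally show ?thesis .
qed

lemma kernel_integral_le_pi:
  fixes M :: nat
  assumes "1 \<le> M"
  shows "(\<integral>\<^sup>+y. ennreal (real n / (1 + real n * \<bar>\<theta> - y\<bar>) ^ (2 * M) * min 1 (real n * \<bar>sin y\<bar>) ^ (2 * K) * indicator {0..pi} y) \<partial>lborel) \<le> ennreal pi"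
proof (cases "n = 0")
  case False
  have "(\<integral>\<^sup>+y. ennreal (real n / (1 + real n * \<bar>\<theta> - y\<bar>) ^ (2 * M) * min 1 (real n * \<bar>sin y\<bar>) ^ (2 * K) * indicator {0..pi} y) \<partial>lborel)
    \<le> (\<integral>\<^sup>+y. ennreal (real n / (1 + real n * \<bar>y - \<theta>\<bar>) ^ 2) * indicator {0..pi} y \<partial>lborel)"
  proof (rule nn_integral_mono)
    fix y
    have "real n / (1 + real n * \<bar>\<theta> - y\<bar>) ^ (2 * M) * min 1 (real n * \<bar>sin y\<bar>) ^ (2 * K) \<le> real n / (1 + real n * \<bar>y - \<theta>\<bar>) ^ 2 * 1"
    proof (intro mult_mono divide_left_mono)
      show "(1 + real n * \<bar>y - \<theta>\<bar>)\<^sup>2 \<le> (1 + real n * \<bar>\<theta> - y\<bar>) ^ (2 * M)"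
        using assms unfolding abs_minus_commute[of y] by (intro power_increasing) auto
      show "min 1 (real n * \<bar>sin y\<bar>) ^ (2 * K) \<le> 1" by (intro power_le_one) auto
      show "0 < (1 + real n * \<bar>\<theta> - y\<bar>) ^ (2 * M) * (1 + real n * \<bar>y - \<theta>\<bar>)\<^sup>2"
        by (intro mult_pos_pos zero_less_power add_pos_nonneg) auto
    qed auto
    then show "ennreal (real n / (1 + real n * \<bar>\<theta> - y\<bar>) ^ (2 * M) * min 1 (real n * \<bar>sin y\<bar>) ^ (2 * K) * indicator {0..pi} y)
      \<le> ennreal (real n / (1 + real n * \<bar>y - \<theta>\<bar>) ^ 2) * indicator {0..pi} y"
      by (auto simp: indicator_def intro!: ennreal_leI)
  qed
  also have "\<dots> \<le> ennreal pi" using False by (intro nn_integral_kernel_le_pi) auto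
  finally show ?thesis .
qed simp

text \<open>Jensen's inequality bounds the q-th power of the derivative by an integral of |P|^q
  against the kernel; after the integrations are interchanged, \<open>kernel_weight_bound\<close>
  returns the weight at y.\<close>

lemma Bernstein_finite:
  assumes q: "1 \<le> q" and \<alpha>: "-1/q < \<alpha>" "-1/q < \<beta>"
  obtains C where "0 < C" "\<And>n P. 0 < n \<Longrightarrow> P \<in> polys_below n \<Longrightarrow>
    Lp_norm (ennreal q) (\<lambda>x. jacobi_w \<alpha> \<beta> x * (vphi x * poly (pderiv P) x)) \<le> ennreal (C * real n) * Lp_norm (ennreal q) (\<lambda>x. jacobi_w \<alpha> \<beta> x * poly P x)"
proof -
  define a where "a = 2 * q * \<alpha> + 1"
  define b where "b = 2 * q * \<beta> + 1"
  define K where "K = nat \<lceil>max \<bar>a\<bar> \<bar>b\<bar>\<rceil>"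
  have K: "\<bar>a\<bar> \<le> real K" "\<bar>b\<bar> \<le> real K" unfolding K_def by linarith+
  have ab: "-1 < a" "-1 < b" using \<alpha> q unfolding a_def b_def by (auto simp: field_simps)
  obtain C1 where C1: "0 < C1" and kw: "\<And>n y. 0 < n \<Longrightarrow> 0 < y \<Longrightarrow> y < pi \<Longrightarrow>
    (\<integral>\<^sup>+\<theta>. ennreal (real n / (1 + real n * \<bar>\<theta> - y\<bar>) ^ (2 * (K + 1)) * min 1 (real n * \<bar>sin y\<bar>) ^ (2 * K) * angular_weight a b \<theta>)
       * indicator {0..pi} \<theta> \<partial>lborel) \<le> ennreal (C1 * angular_weight a b y)"
    using kernel_weight_bound[OF ab K] by blast
  obtain C2 where C2: "0 < C2" and dk: "\<And>n P \<theta>. 0 < n \<Longrightarrow> P \<in> polys_below n \<Longrightarrow> 0 \<le> \<theta> \<Longrightarrow> \<theta> \<le> pi \<Longrightarrow>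
    ennreal \<bar>sin \<theta> * poly (pderiv P) (cos \<theta>)\<bar> \<le>
    (\<integral>\<^sup>+y. ennreal (C2 * real n ^ 2 / (1 + real n * \<bar>\<theta> - y\<bar>) ^ (2 * (K + 1)) * min 1 (real n * \<bar>sin y\<bar>) ^ (2 * K) * \<bar>poly P (cos y)\<bar>)
       * indicator {0..pi} y \<partial>lborel)"
    using derivative_kernel_bound[of "K + 1" K] by blast
  \<comment> \<open>Chosen so that C^q = pi^(q-1) C2^q C1: Jensen's factor for mass pi, the kernel
    constant and the weight constant.\<close>
  define C where "C = (pi powr (q - 1) * C1) powr (1/q) * C2"
  have Cq: "C powr q = pi powr (q - 1) * C2 powr q * C1"
    using q C1 C2 pi_gt_zero by (simp add: C_def powr_mult powr_powr)
  show thesis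
  proof (rule that)
    show C: "0 < C" using C1 C2 by (auto simp: C_def intro!: mult_pos_pos)
    fix n :: nat and P :: "real poly" assume n: "0 < n" and P: "P \<in> polys_below n"
    \<comment> \<open>One of the two factors n from \<open>derivative_kernel_bound\<close>
      normalises the kernel; the other stays with |P| and becomes the Bernstein factor.\<close>
    define k where "k = (\<lambda>\<theta> y. real n / (1 + real n * \<bar>\<theta> - y\<bar>) ^ (2 * (K + 1)) * min 1 (real n * \<bar>sin y\<bar>) ^ (2 * K) * indicator {0..pi} y)"
    have k0: "0 \<le> k \<theta> y" for \<theta> y by (auto simp: k_def intro!: mult_nonneg_nonneg)
    have [measurable]: "(\<lambda>(\<theta>, y). k \<theta> y) \<in> borel_measurable (borel \<Otimes>\<^sub>M borel)" "k \<theta> \<in> borel_measurable borel" for \<theta>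
      unfolding k_def by measurable
    define V where "V = angular_weight a b"
    have V[measurable]: "V \<in> borel_measurable borel" and V0: "0 \<le> V \<theta>" for \<theta>
      unfolding V_def by (auto simp: angular_weight_nonneg)
    let ?p = "\<lambda>y. \<bar>poly P (cos y)\<bar>"
    let ?L = "\<lambda>\<theta>. \<bar>sin \<theta> * poly (pderiv P) (cos \<theta>)\<bar>"
    have J: "ennreal (?L \<theta> powr q) \<le> ennreal (pi powr (q - 1) * (C2 * real n) powr q) * (\<integral>\<^sup>+y. ennreal (k \<theta> y * ?p y powr q) \<partial>lborel)"
      if \<theta>: "0 \<le> \<theta>" "\<theta> \<le> pi" for \<theta>
    proof -
      have "ennreal (?L \<theta> powr q) \<le> ennreal (pi powr (q - 1)) * (\<integral>\<^sup>+y. ennreal (k \<theta> y * (C2 * real n * ?p y) powr q) \<partial>lborel)"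
      proof (rule Jensen_kernel[OF q])
        have "ennreal (?L \<theta>) \<le> (\<integral>\<^sup>+y. ennreal (C2 * real n ^ 2 / (1 + real n * \<bar>\<theta> - y\<bar>) ^ (2 * (K + 1)) * min 1 (real n * \<bar>sin y\<bar>) ^ (2 * K) * \<bar>poly P (cos y)\<bar>)
          * indicator {0..pi} y \<partial>lborel)" by (rule dk[OF n P \<theta>])
        also have "\<dots> = (\<integral>\<^sup>+y. ennreal (k \<theta> y * (C2 * real n * ?p y)) \<partial>lborel)"
          by (intro nn_integral_cong) (auto simp: k_def indicator_def power2_eq_square mult_ac)
        finally show "ennreal (?L \<theta>) \<le> (\<integral>\<^sup>+y. ennreal (k \<theta> y * (C2 * real n * ?p y)) \<partial>lborel)" .
        show "(\<integral>\<^sup>+y. ennreal (k \<theta> y) \<partial>lborel) \<le> ennreal pi"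
          unfolding k_def by (rule kernel_integral_le_pi) simp
      qed (use k0 C2 in auto)
      also have "(\<lambda>y. ennreal (k \<theta> y * (C2 * real n * ?p y) powr q)) = (\<lambda>y. ennreal ((C2 * real n) powr q) * ennreal (k \<theta> y * ?p y powr q))"
        using k0 by (auto simp: ennreal_mult[symmetric] powr_mult mult_ac)
      also have "ennreal (pi powr (q - 1)) * (\<integral>\<^sup>+y. ennreal ((C2 * real n) powr q) * ennreal (k \<theta> y * ?p y powr q) \<partial>lborel) =
        ennreal (pi powr (q - 1) * (C2 * real n) powr q) * (\<integral>\<^sup>+y. ennreal (k \<theta> y * ?p y powr q) \<partial>lborel)"
        by (subst nn_integral_cmult) (auto simp: ennreal_mult mult.assoc)
      finally show ?thesis .
    qed
    define c where "c = pi powr (q - 1) * (C2 * real n) powr q"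
    have "(\<integral>\<^sup>+\<theta>. ennreal (?L \<theta> powr q * V \<theta>) * indicator {0..pi} \<theta> \<partial>lborel) \<le>
      (\<integral>\<^sup>+\<theta>. \<integral>\<^sup>+y. ennreal c * (ennreal (k \<theta> y * ?p y powr q) * (ennreal (V \<theta>) * indicator {0..pi} \<theta>)) \<partial>lborel \<partial>lborel)"
    proof (rule nn_integral_mono)
      fix \<theta> :: real
      show "ennreal (?L \<theta> powr q * V \<theta>) * indicator {0..pi} \<theta> \<le> (\<integral>\<^sup>+y. ennreal c * (ennreal (k \<theta> y * ?p y powr q) * (ennreal (V \<theta>) * indicator {0..pi} \<theta>)) \<partial>lborel)"
      proof (cases "\<theta> \<in> {0..pi}")
        case True
        have "ennreal (?L \<theta> powr q * V \<theta>) = ennreal (?L \<theta> powr q) * ennreal (V \<theta>)" using V0 by (simp add: ennreal_mult)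
        also have "\<dots> \<le> ennreal c * (\<integral>\<^sup>+y. ennreal (k \<theta> y * ?p y powr q) \<partial>lborel) * ennreal (V \<theta>)"
          unfolding c_def using True by (intro mult_right_mono J) auto
        also have "\<dots> = (\<integral>\<^sup>+y. ennreal c * (ennreal (k \<theta> y * ?p y powr q) * ennreal (V \<theta>)) \<partial>lborel)"
          by (subst nn_integral_cmult, measurable, subst nn_integral_multc) (auto simp: mult.assoc)
        finally show ?thesis using True by simp
      qed simp
    qed
    also have "\<dots> = (\<integral>\<^sup>+y. \<integral>\<^sup>+\<theta>. ennreal c * (ennreal (k \<theta> y * ?p y powr q) * (ennreal (V \<theta>) * indicator {0..pi} \<theta>)) \<partial>lborel \<partial>lborel)"
      by (rule lborel_pair.Fubini') measurable
    also have "\<dots> \<le> (\<integral>\<^sup>+y. ennreal (c * C1) * (ennreal (?p y powr q * V y) * indicator {0..pi} y) \<partial>lborel)"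
    proof -
      have "AE y in lborel. y \<noteq> (0::real)" "AE y in lborel. y \<noteq> pi" by (rule AE_lborel_singleton)+
      then show ?thesis
      proof (intro nn_integral_mono_AE, eventually_elim)
        fix y :: real assume ne: "y \<noteq> 0" "y \<noteq> pi"
        show "(\<integral>\<^sup>+\<theta>. ennreal c * (ennreal (k \<theta> y * ?p y powr q) * (ennreal (V \<theta>) * indicator {0..pi} \<theta>)) \<partial>lborel) \<le>
          ennreal (c * C1) * (ennreal (?p y powr q * V y) * indicator {0..pi} y)"
        proof (cases "y \<in> {0..pi}")
          case True
          then have y: "0 < y" "y < pi" using ne by auto
          have c0: "0 \<le> c" by (simp add: c_def)
          let ?k = "\<lambda>\<theta>. real n / (1 + real n * \<bar>\<theta> - y\<bar>) ^ (2 * (K + 1)) * min 1 (real n * \<bar>sin y\<bar>) ^ (2 * K)"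
          have "(\<integral>\<^sup>+\<theta>. ennreal c * (ennreal (k \<theta> y * ?p y powr q) * (ennreal (V \<theta>) * indicator {0..pi} \<theta>)) \<partial>lborel)
            = (\<integral>\<^sup>+\<theta>. ennreal (c * ?p y powr q) * (ennreal (?k \<theta> * V \<theta>) * indicator {0..pi} \<theta>) \<partial>lborel)"
          proof (rule nn_integral_cong)
            fix \<theta>
            have aux: "ennreal c * (ennreal (u * w) * (ennreal v * i)) = ennreal (c * w) * (ennreal (u * v) * i)"
              if "0 \<le> u" "0 \<le> w" "0 \<le> v" for u w v i
              using c0 that by (simp add: ennreal_mult mult_ac)
            have "k \<theta> y = ?k \<theta>" using True by (simp add: k_def)
            then show "ennreal c * (ennreal (k \<theta> y * ?p y powr q) * (ennreal (V \<theta>) * indicator {0..pi} \<theta>)) = 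
              ennreal (c * ?p y powr q) * (ennreal (?k \<theta> * V \<theta>) * indicator {0..pi} \<theta>)"
              using aux[of "?k \<theta>"] k0[of \<theta> y] V0[of \<theta>] by (simp only: powr_ge_zero)
          qed
          also have "\<dots> = ennreal (c * ?p y powr q) * (\<integral>\<^sup>+\<theta>. ennreal (?k \<theta> * V \<theta>) * indicator {0..pi} \<theta> \<partial>lborel)"
            by (rule nn_integral_cmult) measurable
          also have "\<dots> \<le> ennreal (c * ?p y powr q) * ennreal (C1 * V y)"
            unfolding V_def by (intro mult_left_mono kw[OF n y]) auto
          also have "\<dots> = ennreal (c * C1) * (ennreal (?p y powr q * V y) * indicator {0..pi} y)"
            using True c0 C1 V0 by (simp add: ennreal_mult[symmetric] mult_ac)
          finally show ?thesis .
        qed (simp add: k_def)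
      qed
    qed
    also have "\<dots> = ennreal (c * C1) * (\<integral>\<^sup>+y. ennreal (?p y powr q * V y) * indicator {0..pi} y \<partial>lborel)"
      by (rule nn_integral_cmult) measurable
    finally have main: "(\<integral>\<^sup>+\<theta>. ennreal (?L \<theta> powr q * V \<theta>) * indicator {0..pi} \<theta> \<partial>lborel) \<le>
      ennreal (c * C1) * (\<integral>\<^sup>+y. ennreal (?p y powr q * V y) * indicator {0..pi} y \<partial>lborel)" .
    have cC: "c * C1 = (C * real n) powr q"
      using C1 C2 n C by (simp add: c_def powr_mult Cq)
    show "Lp_norm (ennreal q) (\<lambda>x. jacobi_w \<alpha> \<beta> x * (vphi x * poly (pderiv P) x)) \<le> ennreal (C * real n) * Lp_norm (ennreal q) (\<lambda>x. jacobi_w \<alpha> \<beta> x * poly P x)"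
    proof (rule Lp_norm_le_mult)
      show "0 < C * real n" using C n by simp
      fix B :: real assume B: "0 \<le> B" "Lp_norm (ennreal q) (\<lambda>x. jacobi_w \<alpha> \<beta> x * poly P x) \<le> ennreal B"
      let ?t = "2 powr (q * (\<alpha> + \<beta>) + 1) :: real"
      have sv: "\<bar>vphi (cos \<theta>) * poly (pderiv P) (cos \<theta>)\<bar> = ?L \<theta>" for \<theta>
      proof -
        have "vphi (cos \<theta>) = \<bar>sin \<theta>\<bar>" unfolding vphi_def sin_squared_eq[symmetric] by simp
        then show ?thesis by (simp add: abs_mult)
      qed
      have "(\<integral>\<^sup>+x. ennreal (\<bar>jacobi_w \<alpha> \<beta> x * (vphi x * poly (pderiv P) x)\<bar> powr q) \<partial>lebesgue_on {-1..1}) =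
        ennreal ?t * (\<integral>\<^sup>+\<theta>. ennreal (?L \<theta> powr q * V \<theta>) * indicator {0..pi} \<theta> \<partial>lborel)"
        by (subst nn_integral_jacobi_cos[OF q]) (auto simp: sv V_def a_def b_def)
      also have "\<dots> \<le> ennreal ?t * (ennreal (c * C1) * (\<integral>\<^sup>+y. ennreal (?p y powr q * V y) * indicator {0..pi} y \<partial>lborel))"
        by (intro mult_left_mono main) auto
      also have "\<dots> = ennreal (c * C1) * (ennreal ?t * (\<integral>\<^sup>+y. ennreal (?p y powr q * V y) * indicator {0..pi} y \<partial>lborel))"
        by (simp add: mult_ac)
      also have "ennreal ?t * (\<integral>\<^sup>+y. ennreal (?p y powr q * V y) * indicator {0..pi} y \<partial>lborel) =
        (\<integral>\<^sup>+x. ennreal (\<bar>jacobi_w \<alpha> \<beta> x * poly P x\<bar> powr q) \<partial>lebesgue_on {-1..1})"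
        by (subst nn_integral_jacobi_cos[OF q]) (auto simp: V_def a_def b_def)
      also have "ennreal (c * C1) * \<dots> \<le> ennreal (c * C1) * ennreal (B powr q)"
        using B q by (intro mult_left_mono) (auto simp: Lp_norm_le_iff_finite)
      also have "\<dots> = ennreal ((C * real n * B) powr q)"
        using C B n by (simp add: cC ennreal_mult[symmetric] powr_mult)
      finally show "Lp_norm (ennreal q) (\<lambda>x. jacobi_w \<alpha> \<beta> x * (vphi x * poly (pderiv P) x)) \<le> ennreal (C * real n * B)"
        using q B C by (subst Lp_norm_le_iff_finite) auto
    qed
  qed
qed

text \<open>The set where f exceeds B is open, and a nonempty open set is not negligible.\<close>

lemma continuous_AE_imp_le:
  fixes f :: "real \<Rightarrow> real"
  assumes "continuous_on {-1<..<1} f" "AE x in lebesgue_on {-1..1}. f x \<le> B" "-1 < x" "x < 1"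
  shows "f x \<le> B"
proof (rule ccontr)
  assume "\<not> f x \<le> B"
  define U where "U = {x \<in> {-1<..<1}. B < f x}"
  have "openin (top_of_set {-1<..<1}) ({-1<..<1} \<inter> f -` {B<..})"
    using assms(1) by (intro continuous_openin_preimage_gen) auto
  moreover have "U = {-1<..<1} \<inter> f -` {B<..}" by (auto simp: U_def)
  ultimately have "open U" using openin_open_eq[of "{-1<..<1::real}"] by auto
  have "AE x in lebesgue. x \<in> {-1..1} \<longrightarrow> f x \<le> B"
    using assms(2) by (subst (asm) AE_restrict_space_iff) auto
  then obtain N where N: "N \<in> null_sets lebesgue" "{x. \<not> (x \<in> {-1..1} \<longrightarrow> f x \<le> B)} \<subseteq> N"
    by (auto simp: eventually_ae_filter)
  have "U \<subseteq> N" using N(2) by (force simp: U_def)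
  then have "negligible U" using N(1) negligible_iff_null_sets negligible_subset by blast
  moreover have "x \<in> U" using assms(3,4) \<open>\<not> f x \<le> B\<close> by (auto simp: U_def)
  ultimately show False using open_not_negligible[OF \<open>open U\<close>] by blast
qed

lemma continuous_on_jacobi_w: "continuous_on {-1<..<1} (jacobi_w \<alpha> \<beta>)"
  unfolding jacobi_w_def by (intro continuous_intros) auto

lemma jacobi_w_nonneg: "0 \<le> jacobi_w \<alpha> \<beta> x"
  by (simp add: jacobi_w_def)

text \<open>Both exponents are nonnegative, so \<open>angular_weight_shift\<close> leaves no
  singular factor and the weight can be moved under the integral for each \<theta> separately. What
  remains is the mass of the kernel, at most pi; no averaging over \<theta> takes place.\<close>

lemma Bernstein_infinite:
  assumes \<alpha>: "0 \<le> \<alpha>" "0 \<le> \<beta>"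
  obtains C where "0 < C" "\<And>n P. 0 < n \<Longrightarrow> P \<in> polys_below n \<Longrightarrow>
    Lp_norm top (\<lambda>x. jacobi_w \<alpha> \<beta> x * (vphi x * poly (pderiv P) x)) \<le> ennreal (C * real n) * Lp_norm top (\<lambda>x. jacobi_w \<alpha> \<beta> x * poly P x)"
proof -
  define a where "a = 2 * \<alpha>"
  define b where "b = 2 * \<beta>"
  define K where "K = nat \<lceil>max \<bar>a\<bar> \<bar>b\<bar>\<rceil>"
  have K: "\<bar>a\<bar> \<le> real K" "\<bar>b\<bar> \<le> real K" unfolding K_def by linarith+
  obtain C2 where C2: "0 < C2" and dk: "\<And>n P \<theta>. 0 < n \<Longrightarrow> P \<in> polys_below n \<Longrightarrow> 0 \<le> \<theta> \<Longrightarrow> \<theta> \<le> pi \<Longrightarrow>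
    ennreal \<bar>sin \<theta> * poly (pderiv P) (cos \<theta>)\<bar> \<le>
    (\<integral>\<^sup>+y. ennreal (C2 * real n ^ 2 / (1 + real n * \<bar>\<theta> - y\<bar>) ^ (2 * (K + 1)) * min 1 (real n * \<bar>sin y\<bar>) ^ (2 * K) * \<bar>poly P (cos y)\<bar>)
       * indicator {0..pi} y \<partial>lborel)"
    using derivative_kernel_bound[of "K + 1" K] by blast
  define C where "C = C2 * 4 ^ K * pi"
  show thesis
  proof (rule that)
    show C: "0 < C" using C2 by (simp add: C_def)
    fix n :: nat and P :: "real poly" assume n: "0 < n" and P: "P \<in> polys_below n"
    show "Lp_norm top (\<lambda>x. jacobi_w \<alpha> \<beta> x * (vphi x * poly (pderiv P) x)) \<le> ennreal (C * real n) * Lp_norm top (\<lambda>x. jacobi_w \<alpha> \<beta> x * poly P x)"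
    proof (rule Lp_norm_le_mult)
      show "0 < C * real n" using C n by simp
      fix B :: real assume B: "0 \<le> B" "Lp_norm top (\<lambda>x. jacobi_w \<alpha> \<beta> x * poly P x) \<le> ennreal B"
      have m: "(\<lambda>x. jacobi_w \<alpha> \<beta> x * poly P x) \<in> borel_measurable (lebesgue_on {-1..1})"
        "(\<lambda>x. jacobi_w \<alpha> \<beta> x * (vphi x * poly (pderiv P) x)) \<in> borel_measurable (lebesgue_on {-1..1})"
        by (intro borel_measurable_lebesgue_onI; measurable)+
      have "AE x in lebesgue_on {-1..1}. \<bar>jacobi_w \<alpha> \<beta> x * poly P x\<bar> \<le> B"
        using B Lp_norm_le_iff_infinite[OF m(1)] by auto
      \<comment> \<open>By continuity the essential bound holds at every interior point.\<close>
      then have PB: "\<bar>jacobi_w \<alpha> \<beta> x * poly P x\<bar> \<le> B" if "-1 < x" "x < 1" for x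
        using that by (intro continuous_AE_imp_le[of "\<lambda>x. \<bar>jacobi_w \<alpha> \<beta> x * poly P x\<bar>"] continuous_intros continuous_on_jacobi_w) auto
      have bound: "\<bar>jacobi_w \<alpha> \<beta> (cos \<theta>) * (sin \<theta> * poly (pderiv P) (cos \<theta>))\<bar> \<le> C * real n * B" if \<theta>: "0 < \<theta>" "\<theta> < pi" for \<theta>
      proof -
        let ?t = "2 powr (\<alpha> + \<beta>) :: real"
        let ?w = "?t * angular_weight a b \<theta>"
        have w: "jacobi_w \<alpha> \<beta> (cos \<theta>) = ?w" unfolding a_def b_def by (rule jacobi_w_cos[OF \<theta>])
        have w0: "0 \<le> ?w" by (simp add: angular_weight_nonneg)
        have "ennreal \<bar>jacobi_w \<alpha> \<beta> (cos \<theta>) * (sin \<theta> * poly (pderiv P) (cos \<theta>))\<bar> = ennreal ?w * ennreal \<bar>sin \<theta> * poly (pderiv P) (cos \<theta>)\<bar>"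
          using w0 unfolding w by (subst ennreal_mult[symmetric]) (auto simp: abs_mult angular_weight_nonneg)
        also have "\<dots> \<le> ennreal ?w * (\<integral>\<^sup>+y. ennreal (C2 * real n ^ 2 / (1 + real n * \<bar>\<theta> - y\<bar>) ^ (2 * (K + 1)) * min 1 (real n * \<bar>sin y\<bar>) ^ (2 * K) * \<bar>poly P (cos y)\<bar>)
           * indicator {0..pi} y \<partial>lborel)"
          using \<theta> by (intro mult_left_mono dk n P) auto
        also have "\<dots> = (\<integral>\<^sup>+y. ennreal ?w * (ennreal (C2 * real n ^ 2 / (1 + real n * \<bar>\<theta> - y\<bar>) ^ (2 * (K + 1)) * min 1 (real n * \<bar>sin y\<bar>) ^ (2 * K) * \<bar>poly P (cos y)\<bar>)
           * indicator {0..pi} y) \<partial>lborel)"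
          by (rule nn_integral_cmult[symmetric]) measurable
        also have "\<dots> \<le> (\<integral>\<^sup>+y. ennreal (C2 * real n * 4 ^ K * B) * (ennreal (real n / (1 + real n * \<bar>y - \<theta>\<bar>) ^ 2) * indicator {0..pi} y) \<partial>lborel)"
        proof -
          have "AE y in lborel. y \<noteq> (0::real)" "AE y in lborel. y \<noteq> pi" by (rule AE_lborel_singleton)+
          then show ?thesis
          proof (intro nn_integral_mono_AE, eventually_elim)
            fix y :: real assume ne: "y \<noteq> 0" "y \<noteq> pi"
            let ?D = "1 + real n * \<bar>\<theta> - y\<bar>"
            have D: "0 < ?D" by (intro add_pos_nonneg) auto
            show "ennreal ?w * (ennreal (C2 * real n ^ 2 / ?D ^ (2 * (K + 1)) * min 1 (real n * \<bar>sin y\<bar>) ^ (2 * K) * \<bar>poly P (cos y)\<bar>) * indicator {0..pi} y)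
              \<le> ennreal (C2 * real n * 4 ^ K * B) * (ennreal (real n / (1 + real n * \<bar>y - \<theta>\<bar>) ^ 2) * indicator {0..pi} y)"
            proof (cases "y \<in> {0..pi}")
              case True
              then have y: "0 < y" "y < pi" using ne by auto
              have cy: "-1 < cos y" "cos y < 1"
                using cos_monotone_0_pi[of 0 y] cos_monotone_0_pi[of y pi] y by auto
              have Vy: "?t * angular_weight a b y * \<bar>poly P (cos y)\<bar> \<le> B"
                using PB[OF cy] unfolding jacobi_w_cos[OF y, of \<alpha> \<beta>, folded a_def b_def]
                by (simp add: abs_mult angular_weight_nonneg)
              have "angular_weight a b \<theta> * min 1 (real n * \<bar>sin y\<bar>) ^ (2 * K) \<le> 4 ^ K * angular_weight a b y * ?D ^ (2 * K) *
                 ((1 + 1 / (real n * sin (\<theta> / 2))) powr max 0 (- a) * (1 + 1 / (real n * cos (\<theta> / 2))) powr max 0 (- b))"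
                by (rule angular_weight_shift[OF \<theta> y n K])
              also have "\<dots> = 4 ^ K * angular_weight a b y * ?D ^ (2 * K)"
              proof -
                \<comment> \<open>A power with exponent 0 is 1 only for a nonzero base, so the bases
                  have to be checked as well.\<close>
                have "max 0 (- a) = 0" "max 0 (- b) = 0" using \<alpha> by (auto simp: a_def b_def)
                moreover have "1 + 1 / (real n * sin (\<theta> / 2)) \<noteq> 0" "1 + 1 / (real n * cos (\<theta> / 2)) \<noteq> 0"
                  using sin_half_bounds(3,4)[OF \<theta>] n by (smt (verit) divide_pos_pos mult_pos_pos of_nat_0_less_iff)+
                ultimately show ?thesis by simp
              qed
              finally have shift: "angular_weight a b \<theta> * min 1 (real n * \<bar>sin y\<bar>) ^ (2 * K) \<le> 4 ^ K * angular_weight a b y * ?D ^ (2 * K)" .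
              have "?w * (C2 * real n ^ 2 / ?D ^ (2 * (K + 1)) * min 1 (real n * \<bar>sin y\<bar>) ^ (2 * K) * \<bar>poly P (cos y)\<bar>)
                = C2 * real n ^ 2 / ?D ^ (2 * (K + 1)) * ?t * \<bar>poly P (cos y)\<bar> * (angular_weight a b \<theta> * min 1 (real n * \<bar>sin y\<bar>) ^ (2 * K))"
                by (simp only: mult_ac times_divide_eq_left times_divide_eq_right)
              also have "\<dots> \<le> C2 * real n ^ 2 / ?D ^ (2 * (K + 1)) * ?t * \<bar>poly P (cos y)\<bar> * (4 ^ K * angular_weight a b y * ?D ^ (2 * K))"
                using C2 D by (intro mult_left_mono shift mult_nonneg_nonneg divide_nonneg_nonneg) auto
              also have "\<dots> = C2 * 4 ^ K * (real n ^ 2 / ?D ^ (2 * (K + 1)) * ?D ^ (2 * K)) * (?t * angular_weight a b y * \<bar>poly P (cos y)\<bar>)"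
                by (simp only: mult_ac times_divide_eq_left times_divide_eq_right)
              also have "real n ^ 2 / ?D ^ (2 * (K + 1)) * ?D ^ (2 * K) = real n ^ 2 / ?D ^ 2"
                using D by (simp add: power_add power2_eq_square)
              also have "C2 * 4 ^ K * (real n ^ 2 / ?D ^ 2) * (?t * angular_weight a b y * \<bar>poly P (cos y)\<bar>) \<le> C2 * 4 ^ K * (real n ^ 2 / ?D ^ 2) * B"
                using C2 by (intro mult_left_mono Vy) auto
              also have "\<dots> = (C2 * real n * 4 ^ K * B) * (real n / (1 + real n * \<bar>y - \<theta>\<bar>) ^ 2)"
                unfolding abs_minus_commute[of y] by (simp add: power2_eq_square)
              finally have le: "?w * (C2 * real n ^ 2 / ?D ^ (2 * (K + 1)) * min 1 (real n * \<bar>sin y\<bar>) ^ (2 * K) * \<bar>poly P (cos y)\<bar>)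
                \<le> (C2 * real n * 4 ^ K * B) * (real n / (1 + real n * \<bar>y - \<theta>\<bar>) ^ 2)" .
              have aux: "ennreal u * (ennreal v * i) \<le> ennreal u' * (ennreal v' * i)" if "u * v \<le> u' * v'" "0 \<le> u" "0 \<le> u'" for u v u' v' i
                using mult_right_mono[OF ennreal_leI[OF that(1)], of i] that by (simp add: ennreal_mult' mult.assoc)
              show ?thesis using C2 B by (intro aux[OF le] w0) auto
            qed simp
          qed
        qed
        also have "\<dots> = ennreal (C2 * real n * 4 ^ K * B) * (\<integral>\<^sup>+y. ennreal (real n / (1 + real n * \<bar>y - \<theta>\<bar>) ^ 2) * indicator {0..pi} y \<partial>lborel)"
          by (rule nn_integral_cmult) measurable
        also have "\<dots> \<le> ennreal (C2 * real n * 4 ^ K * B) * ennreal pi"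
          using n by (intro mult_left_mono nn_integral_kernel_le_pi) auto
        also have "\<dots> = ennreal (C * real n * B)"
          using C2 B by (simp add: C_def ennreal_mult[symmetric] mult_ac)
        finally show ?thesis using C B by (subst (asm) ennreal_le_iff) auto
      qed
      have "AE x in lebesgue_on {-1..1}. \<bar>jacobi_w \<alpha> \<beta> x * (vphi x * poly (pderiv P) x)\<bar> \<le> C * real n * B"
        using AE_open_interval
      proof eventually_elim
        fix x :: real assume x: "-1 < x \<and> x < 1"
        have s: "sin (arccos x) = vphi x" using x by (simp add: sin_arccos vphi_def)
        have "0 < arccos x" "arccos x < pi" using x arccos_lt_bounded by auto
        from bound[OF this] show "\<bar>jacobi_w \<alpha> \<beta> x * (vphi x * poly (pderiv P) x)\<bar> \<le> C * real n * B"
          using x by (simp add: s cos_arccos)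
      qed
      then show "Lp_norm top (\<lambda>x. jacobi_w \<alpha> \<beta> x * (vphi x * poly (pderiv P) x)) \<le> ennreal (C * real n * B)"
        using B C Lp_norm_le_iff_infinite[OF m(2)] by auto
    qed
  qed
qed

lemma Bernstein:
  assumes "1 \<le> p" "\<alpha> \<in> J_exp p" "\<beta> \<in> J_exp p"
  obtains C where "0 < C" "\<And>n P. 0 < n \<Longrightarrow> P \<in> polys_below n \<Longrightarrow>
    Lp_norm p (\<lambda>x. jacobi_w \<alpha> \<beta> x * (vphi x * poly (pderiv P) x)) \<le> ennreal (C * real n) * Lp_norm p (\<lambda>x. jacobi_w \<alpha> \<beta> x * poly P x)"
  using \<open>1 \<le> p\<close>
proof (cases rule: ennreal_exponent_cases)
  case infinite
  then have "0 \<le> \<alpha>" "0 \<le> \<beta>" using assms by (auto simp: J_exp_def)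
  from Bernstein_infinite[OF this] that infinite show thesis by metis
next
  case (finite q)
  then have "-1/q < \<alpha>" "-1/q < \<beta>" using assms by (auto simp: J_exp_def)
  from Bernstein_finite[OF finite(1) this] that finite show thesis by metis
qed

section \<open>Powers of \<open>vphi\<close> absorbed into the weight, and Bernstein inequalities of
  higher order\<close>

lemma jacobi_w_vphi_power:
  assumes "-1 \<le> x" "x \<le> 1"
  shows "jacobi_w \<alpha> \<beta> x * vphi x ^ r = jacobi_w (\<alpha> + real r / 2) (\<beta> + real r / 2) x"
proof (induction r)
  case (Suc r)
  have v: "vphi x = (1 - x) powr (1/2) * (1 + x) powr (1/2)"
  proof -
    have "1 - x\<^sup>2 = (1 - x) * (1 + x)" by (simp add: power2_eq_square algebra_simps)
    then show ?thesis using assms by (simp add: vphi_def real_sqrt_mult powr_half_sqrt)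
  qed
  have "jacobi_w \<alpha> \<beta> x * vphi x ^ Suc r = jacobi_w (\<alpha> + real r / 2) (\<beta> + real r / 2) x * vphi x"
    using Suc by (simp add: mult_ac)
  also have "\<dots> = jacobi_w (\<alpha> + real r / 2 + 1/2) (\<beta> + real r / 2 + 1/2) x"
    by (simp add: v jacobi_w_def powr_add)
  also have "\<alpha> + real r / 2 + 1/2 = \<alpha> + real (Suc r) / 2" by (simp add: add_divide_distrib)
  also have "\<beta> + real r / 2 + 1/2 = \<beta> + real (Suc r) / 2" by (simp add: add_divide_distrib)
  finally show ?case .
qed simp

lemma jacobi_w_vphi_measurable:
  "(\<lambda>x. jacobi_w \<alpha> \<beta> x * (vphi x ^ r * poly P x)) \<in> borel_measurable (lebesgue_on {-1..1})"
  by (intro borel_measurable_lebesgue_onI) measurable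

lemma Lp_norm_jacobi_w_vphi:
  assumes "1 \<le> p"
  shows "Lp_norm p (\<lambda>x. jacobi_w \<alpha> \<beta> x * (vphi x ^ r * poly P x)) = Lp_norm p (\<lambda>x. jacobi_w (\<alpha> + real r / 2) (\<beta> + real r / 2) x * poly P x)"
proof (rule Lp_norm_cong_AE[OF assms jacobi_w_vphi_measurable])
  show "AE x in lebesgue_on {-1..1}. \<bar>jacobi_w \<alpha> \<beta> x * (vphi x ^ r * poly P x)\<bar> = \<bar>jacobi_w (\<alpha> + real r / 2) (\<beta> + real r / 2) x * poly P x\<bar>"
    using AE_open_interval by eventually_elim (simp add: jacobi_w_vphi_power[symmetric] mult.assoc)
  show "(\<lambda>x. jacobi_w (\<alpha> + real r / 2) (\<beta> + real r / 2) x * poly P x) \<in> borel_measurable (lebesgue_on {-1..1})"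
    by (intro borel_measurable_lebesgue_onI) measurable
qed

lemma polys_below_pderiv: "P \<in> polys_below n \<Longrightarrow> pderiv P \<in> polys_below n"
  unfolding polys_below_def using degree_pderiv[of P] by auto

lemma J_exp_add: "\<alpha> \<in> J_exp p \<Longrightarrow> 0 \<le> t \<Longrightarrow> \<alpha> + t \<in> J_exp p"
  by (auto simp: J_exp_def split: if_splits)

text \<open>The factor \<open>vphi x ^ r\<close> raises both exponents by r/2, and the raised
  exponents stay in \<open>J_exp p\<close>. So the step from r to r+1 is the first-order inequality
  for another Jacobi weight, applied to the r-th derivative, whose degree is still below n.\<close>

lemma Bernstein_higher:
  assumes "1 \<le> p" "\<alpha> \<in> J_exp p" "\<beta> \<in> J_exp p"
  shows "\<exists>C>0. \<forall>n>0. \<forall>P\<in>polys_below n.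
    Lp_norm p (\<lambda>x. jacobi_w \<alpha> \<beta> x * (vphi x ^ r * poly ((pderiv ^^ r) P) x)) \<le> ennreal (C * real n ^ r) * Lp_norm p (\<lambda>x. jacobi_w \<alpha> \<beta> x * poly P x)"
proof (induction r)
  case 0
  show ?case by (intro exI[of _ 1]) auto
next
  case (Suc r)
  then obtain C where C: "0 < C" and IH: "\<And>n P. 0 < n \<Longrightarrow> P \<in> polys_below n \<Longrightarrow>
    Lp_norm p (\<lambda>x. jacobi_w \<alpha> \<beta> x * (vphi x ^ r * poly ((pderiv ^^ r) P) x)) \<le> ennreal (C * real n ^ r) * Lp_norm p (\<lambda>x. jacobi_w \<alpha> \<beta> x * poly P x)"
    by blast
  let ?a = "\<alpha> + real r / 2" and ?b = "\<beta> + real r / 2"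
  obtain C' where C': "0 < C'" and B: "\<And>n P. 0 < n \<Longrightarrow> P \<in> polys_below n \<Longrightarrow>
    Lp_norm p (\<lambda>x. jacobi_w ?a ?b x * (vphi x * poly (pderiv P) x)) \<le> ennreal (C' * real n) * Lp_norm p (\<lambda>x. jacobi_w ?a ?b x * poly P x)"
    using Bernstein[OF assms(1) J_exp_add[OF assms(2)] J_exp_add[OF assms(3)], of "real r / 2" "real r / 2"] by auto
  show ?case
  proof (intro exI[of _ "C' * C"] conjI allI impI ballI)
    fix n :: nat and P :: "real poly" assume n: "0 < n" and P: "P \<in> polys_below n"
    have Pr: "(pderiv ^^ r) P \<in> polys_below n" by (induction r) (auto simp: P polys_below_pderiv)
    have "Lp_norm p (\<lambda>x. jacobi_w \<alpha> \<beta> x * (vphi x ^ Suc r * poly ((pderiv ^^ Suc r) P) x)) =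
        Lp_norm p (\<lambda>x. jacobi_w (?a + real 1 / 2) (?b + real 1 / 2) x * poly ((pderiv ^^ Suc r) P) x)"
    proof -
      have "?a + real 1 / 2 = \<alpha> + real (Suc r) / 2" "?b + real 1 / 2 = \<beta> + real (Suc r) / 2"
        by (auto simp: add_divide_distrib)
      then show ?thesis by (simp only: Lp_norm_jacobi_w_vphi[OF assms(1)])
    qed
    also have "\<dots> = Lp_norm p (\<lambda>x. jacobi_w ?a ?b x * (vphi x ^ 1 * poly ((pderiv ^^ Suc r) P) x))"
      by (rule Lp_norm_jacobi_w_vphi[OF assms(1), symmetric])
    also have "\<dots> \<le> ennreal (C' * real n) * Lp_norm p (\<lambda>x. jacobi_w ?a ?b x * poly ((pderiv ^^ r) P) x)"
      using B[OF n Pr] by simp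
    also have "\<dots> = ennreal (C' * real n) * Lp_norm p (\<lambda>x. jacobi_w \<alpha> \<beta> x * (vphi x ^ r * poly ((pderiv ^^ r) P) x))"
      by (subst Lp_norm_jacobi_w_vphi[OF assms(1)]) simp
    also have "\<dots> \<le> ennreal (C' * real n) * (ennreal (C * real n ^ r) * Lp_norm p (\<lambda>x. jacobi_w \<alpha> \<beta> x * poly P x))"
      by (intro mult_left_mono IH n P) auto
    also have "\<dots> = ennreal (C' * C * real n ^ Suc r) * Lp_norm p (\<lambda>x. jacobi_w \<alpha> \<beta> x * poly P x)"
      using C C' by (simp add: ennreal_mult[symmetric] mult.assoc[symmetric]) (simp add: mult_ac)
    finally show "Lp_norm p (\<lambda>x. jacobi_w \<alpha> \<beta> x * (vphi x ^ Suc r * poly ((pderiv ^^ Suc r) P) x))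
      \<le> ennreal (C' * C * real n ^ Suc r) * Lp_norm p (\<lambda>x. jacobi_w \<alpha> \<beta> x * poly P x)" .
  qed (use C C' in auto)
qed

section \<open>Bounds for the weighted modulus\<close>

text \<open>With d = k h / 2 these are the interior points at which the difference of order k with
  step h \<open>vphi x\<close> is not cut off.\<close>

definition shift_domain :: "real \<Rightarrow> real set" where
  "shift_domain d = {x. -1 < x \<and> x < 1 \<and> d * vphi x \<le> 1 - \<bar>x\<bar>}"

lemma shift_domain_measurable [measurable]: "shift_domain d \<in> sets borel"
  unfolding shift_domain_def by measurable

lemma vphi_nonneg: "\<bar>x\<bar> \<le> 1 \<Longrightarrow> 0 \<le> vphi x"
  by (simp add: vphi_def abs_square_le_1)

lemma vphi_squared: "\<bar>x\<bar> \<le> 1 \<Longrightarrow> (vphi x)\<^sup>2 = 1 - x\<^sup>2"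
  by (simp add: vphi_def abs_square_le_1)

lemma vphi_squared_abs: "\<bar>x\<bar> \<le> 1 \<Longrightarrow> (vphi x)\<^sup>2 = (1 - \<bar>x\<bar>) * (1 + \<bar>x\<bar>)"
  by (subst vphi_squared) (auto simp: power2_eq_square algebra_simps)

lemma shift_domain_shift:
  assumes "x \<in> shift_domain d" "\<bar>c\<bar> \<le> d"
  shows "\<bar>x + c * vphi x\<bar> \<le> 1"
proof -
  have "0 \<le> vphi x" using assms by (intro vphi_nonneg) (auto simp: shift_domain_def)
  then have "\<bar>c * vphi x\<bar> \<le> d * vphi x" using assms by (simp add: abs_mult mult_right_mono)
  also have "\<dots> \<le> 1 - \<bar>x\<bar>" using assms by (simp add: shift_domain_def)
  finally show ?thesis by linarith
qed

text \<open>On the domain d (1 + |x|) \<le> \<open>vphi x\<close>, so the derivative 1 - c x /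
  \<open>vphi x\<close> of the shifted point is at least 1/2 whenever |c| \<le> d. The substitution
  therefore costs at most a factor 2, and the image stays in [-1,1].\<close>

lemma nn_integral_shift_le:
  fixes F :: "real \<Rightarrow> ennreal"
  assumes d: "0 < d" "\<bar>c\<bar> \<le> d" and [measurable]: "F \<in> borel_measurable borel"
  shows "(\<integral>\<^sup>+x. F (x + c * vphi x) * indicator (shift_domain d) x \<partial>lborel) \<le> 2 * (\<integral>\<^sup>+x. F x * indicator {-1..1} x \<partial>lborel)"
proof -
  \<comment> \<open>The solution of d^2 (1 + x) = 1 - x, that is, of d \<open>vphi x\<close> = 1 - x
    apart from x = 1; the domain is |x| \<le> x0.\<close>
  define x0 where "x0 = (1 - d\<^sup>2) / (1 + d\<^sup>2)"
  have d1: "0 < 1 + d\<^sup>2" by (intro add_pos_nonneg) auto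
  have x0: "x0 < 1" using d d1 by (simp add: x0_def field_simps)
  have x0iff: "\<bar>x\<bar> \<le> x0 \<longleftrightarrow> d\<^sup>2 * (1 + \<bar>x\<bar>) \<le> 1 - \<bar>x\<bar>" for x
    using d1 by (simp add: x0_def field_simps)
  have sub: "\<bar>x\<bar> \<le> x0" if x: "x \<in> shift_domain d" for x
  proof -
    have "0 \<le> vphi x" using x by (intro vphi_nonneg) (auto simp: shift_domain_def)
    then have "(d * vphi x)\<^sup>2 \<le> (1 - \<bar>x\<bar>)\<^sup>2" using d x by (intro power_mono) (auto simp: shift_domain_def)
    then have "(d\<^sup>2 * (1 + \<bar>x\<bar>)) * (1 - \<bar>x\<bar>) \<le> (1 - \<bar>x\<bar>) * (1 - \<bar>x\<bar>)"
    proof -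
      have "\<bar>x\<bar> \<le> 1" using x by (auto simp: shift_domain_def)
      then have "(d * vphi x)\<^sup>2 = (d\<^sup>2 * (1 + \<bar>x\<bar>)) * (1 - \<bar>x\<bar>)"
        using vphi_squared_abs[of x] by (simp add: power_mult_distrib mult_ac)
      from \<open>(d * vphi x)\<^sup>2 \<le> (1 - \<bar>x\<bar>)\<^sup>2\<close>[unfolded this power2_eq_square[of "1 - \<bar>x\<bar>"]] show ?thesis .
    qed
    then show ?thesis unfolding x0iff using x by (subst (asm) mult_le_cancel_right) (auto simp: shift_domain_def)
  qed
  show ?thesis
  proof (cases "0 < x0")
    \<comment> \<open>The domain then contains at most the point 0.\<close>
    case False
    have "AE x in lborel. x \<noteq> (0::real)" by (rule AE_lborel_singleton)
    then have "AE x in lborel. F (x + c * vphi x) * indicator (shift_domain d) x = 0"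
      by eventually_elim (use sub False in \<open>force simp: indicator_def\<close>)
    then have "(\<integral>\<^sup>+x. F (x + c * vphi x) * indicator (shift_domain d) x \<partial>lborel) = 0"
      by (subst nn_integral_0_iff_AE) auto
    then show ?thesis by simp
  next
    case True
    define g where "g = (\<lambda>x. x + c * vphi x)"
    define g' where "g' = (\<lambda>x. 1 - c * x / vphi x)"
    have pos: "0 < vphi x" if "\<bar>x\<bar> \<le> x0" for x
      using that x0 by (simp add: vphi_def abs_square_less_1)
    have big: "d * (1 + \<bar>x\<bar>) \<le> vphi x" if "\<bar>x\<bar> \<le> x0" for x
    proof (rule power2_le_imp_le)
      have "(d * (1 + \<bar>x\<bar>))\<^sup>2 = (d\<^sup>2 * (1 + \<bar>x\<bar>)) * (1 + \<bar>x\<bar>)" by (simp add: power2_eq_square mult_ac)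
      also have "\<dots> \<le> (1 - \<bar>x\<bar>) * (1 + \<bar>x\<bar>)" 
        by (rule mult_right_mono[OF that[unfolded x0iff]]) simp
      also have "\<dots> = (vphi x)\<^sup>2" by (rule vphi_squared_abs[symmetric]) (rule less_imp_le[OF le_less_trans[OF that x0]])
      finally show "(d * (1 + \<bar>x\<bar>))\<^sup>2 \<le> (vphi x)\<^sup>2" .
    qed (use pos[OF that] in auto)
    have x1: "\<bar>x\<bar> < 1" if "\<bar>x\<bar> \<le> x0" for x using that x0 by (rule le_less_trans)
    have g'_ge: "1/2 \<le> g' x" if "\<bar>x\<bar> \<le> x0" for x
    proof -
      have "\<bar>c * x\<bar> \<le> d * \<bar>x\<bar>" using d by (simp add: abs_mult mult_right_mono)
      moreover have "2 * (d * \<bar>x\<bar>) \<le> d * (1 + \<bar>x\<bar>)" using d that x0 by (simp add: distrib_left)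
      ultimately have "2 * (c * x) \<le> vphi x" using big[OF that] by linarith
      then show ?thesis using pos[OF that] by (simp add: g'_def field_simps)
    qed
    have g01: "\<bar>g x\<bar> \<le> 1" if "\<bar>x\<bar> \<le> x0" for x
    proof -
      have "(d * vphi x)\<^sup>2 = (d\<^sup>2 * (1 + \<bar>x\<bar>)) * (1 - \<bar>x\<bar>)"
        using that x0 vphi_squared_abs[of x] by (simp add: power_mult_distrib mult_ac)
      also have "\<dots> \<le> (1 - \<bar>x\<bar>) * (1 - \<bar>x\<bar>)" 
        by (rule mult_right_mono[OF that[unfolded x0iff]]) (use x1[OF that] in simp)
      finally have "(d * vphi x)\<^sup>2 \<le> (1 - \<bar>x\<bar>)\<^sup>2" by (simp only: power2_eq_square[of "1 - \<bar>x\<bar>"])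
      then have "d * vphi x \<le> 1 - \<bar>x\<bar>" by (rule power2_le_imp_le) (use x1[OF that] in simp)
      then have "x \<in> shift_domain d" using x1[OF that] by (simp add: shift_domain_def abs_less_iff)
      then show ?thesis unfolding g_def by (rule shift_domain_shift[OF _ d(2)])
    qed
    have [measurable]: "g \<in> borel_measurable borel" "g' \<in> borel_measurable borel" unfolding g_def g'_def by measurable
    have "(\<integral>\<^sup>+x. F (x + c * vphi x) * indicator (shift_domain d) x \<partial>lborel) \<le>
      (\<integral>\<^sup>+x. 2 * (F (g x) * ennreal (g' x) * indicator {-x0..x0} x) \<partial>lborel)"
    proof (rule nn_integral_mono)
      fix x
      show "F (x + c * vphi x) * indicator (shift_domain d) x \<le> 2 * (F (g x) * ennreal (g' x) * indicator {-x0..x0} x)"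
      proof (cases "x \<in> shift_domain d")
        case True
        then have x: "\<bar>x\<bar> \<le> x0" by (rule sub)
        have "1 \<le> 2 * ennreal (g' x)"
        proof -
          have "ennreal 1 \<le> ennreal (2 * g' x)" using g'_ge[OF x] by (intro ennreal_leI) auto
          then show ?thesis using g'_ge[OF x] by (simp add: ennreal_mult)
        qed
        then have "F (g x) * 1 \<le> F (g x) * (2 * ennreal (g' x))" by (rule mult_left_mono) simp
        moreover have "x \<in> {-x0..x0}" using x by (simp add: abs_le_iff)
        ultimately show ?thesis using True by (simp add: g_def mult_ac)
      qed simp
    qed
    also have "\<dots> = 2 * (\<integral>\<^sup>+x. F (g x) * ennreal (g' x) * indicator {-x0..x0} x \<partial>lborel)"
      by (rule nn_integral_cmult) measurable
    also have "(\<integral>\<^sup>+x. F (g x) * ennreal (g' x) * indicator {-x0..x0} x \<partial>lborel) = (\<integral>\<^sup>+x. F x * indicator {g (-x0)..g x0} x \<partial>lborel)"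
    proof (rule nn_integral_substitution_aux[symmetric])
      fix x assume "x \<in> {-x0..x0}"
      then have x: "\<bar>x\<bar> \<le> x0" by auto
      have "0 < 1 - x\<^sup>2" using x x0 by (simp add: abs_square_less_1)
      then show "(g has_real_derivative g' x) (at x)"
        unfolding g_def g'_def vphi_def by (auto intro!: derivative_eq_intros simp: field_simps)
      show "0 \<le> g' x" using g'_ge[OF x] by simp
    next
      have "vphi x \<noteq> 0" if "x \<in> {-x0..x0}" for x using pos[of x] that by (auto simp: abs_le_iff)
      moreover have "continuous_on {-x0..x0} vphi" unfolding vphi_def by (intro continuous_intros)
      ultimately show "continuous_on {-x0..x0} g'" unfolding g'_def by (intro continuous_intros) auto
    qed (use True in auto)
    also have "\<dots> \<le> (\<integral>\<^sup>+x. F x * indicator {-1..1} x \<partial>lborel)"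
      using g01[of x0] g01[of "-x0"] True by (intro nn_integral_mono) (auto simp: indicator_def)
    finally show ?thesis by (simp add: mult_left_mono)
  qed
qed

text \<open>\<open>nn_integral_shift_le\<close> for the indicator of a null set shows that its
  preimage under the shift is null. This allows functions that are only Lebesgue measurable to be
  composed with the shift.\<close>

lemma AE_shift:
  assumes "0 < d" "\<bar>c\<bar> \<le> d" "AE y in lebesgue_on {-1..1}. P y"
  shows "AE x in lebesgue_on {-1..1}. x \<in> shift_domain d \<longrightarrow> P (x + c * vphi x)"
proof -
  from assms(3) have "AE y in lborel. y \<in> {-1..1} \<longrightarrow> P y" by (simp add: AE_interval_lborel)
  then obtain N where N: "N \<in> null_sets lborel" "{y. \<not> (y \<in> {-1..1} \<longrightarrow> P y)} \<subseteq> N"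
    by (auto simp: eventually_ae_filter)
  then have [measurable]: "N \<in> sets borel" by auto
  have "(\<integral>\<^sup>+x. indicator N x * indicator {-1..1} x \<partial>lborel) \<le> (\<integral>\<^sup>+x. indicator N x \<partial>lborel)"
    by (intro nn_integral_mono) (auto simp: indicator_def)
  also have "\<dots> = 0" using N by auto
  finally have z: "(\<integral>\<^sup>+x. indicator N x * indicator {-1..1} x \<partial>lborel) = (0::ennreal)" by simp
  have "(\<integral>\<^sup>+x. indicator N (x + c * vphi x) * indicator (shift_domain d) x \<partial>lborel) \<le> 2 * (\<integral>\<^sup>+x. indicator N x * indicator {-1..1} x \<partial>lborel)"
    using assms by (intro nn_integral_shift_le) auto
  then have "(\<integral>\<^sup>+x. indicator N (x + c * vphi x) * indicator (shift_domain d) x \<partial>lborel) = (0::ennreal)"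
    by (simp add: z)
  then have "AE x in lborel. indicator N (x + c * vphi x) * indicator (shift_domain d) x = (0::ennreal)"
    by (subst (asm) nn_integral_0_iff_AE) auto
  then show ?thesis unfolding AE_interval_lborel
  proof eventually_elim
    case (elim x)
    show ?case
    proof (intro impI)
      assume x: "x \<in> shift_domain d"
      then have "x + c * vphi x \<notin> N" using elim by (auto simp: indicator_def split: if_splits)
      moreover have "x + c * vphi x \<in> {-1..1}" using shift_domain_shift[OF x assms(2)] by (simp add: abs_le_iff)
      ultimately show "P (x + c * vphi x)" using N(2) by blast
    qed
  qed
qed

lemma borel_representative:
  assumes "g \<in> borel_measurable (lebesgue_on {-1..1::real})"
  obtains g' :: "real \<Rightarrow> real" where "g' \<in> borel_measurable borel" "AE x in lebesgue_on {-1..1}. g x = g' x"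
proof -
  have "(\<lambda>x. if x \<in> {-1..1} then g x else 0) \<in> borel_measurable lebesgue"
    using assms by (subst borel_measurable_if) auto
  from completion_ex_borel_measurable_real[OF this] obtain g' where
    "g' \<in> borel_measurable lborel" "AE x in lborel. (if x \<in> {-1..1} then g x else 0) = g' x" by blast
  then show thesis
  proof (intro that[of g'])
    show "AE x in lebesgue_on {-1..1}. g x = g' x"
      unfolding AE_interval_lborel
      using \<open>AE x in lborel. (if x \<in> {-1..1} then g x else 0) = g' x\<close> by eventually_elim (auto split: if_splits)
  qed auto
qed

lemma shift_measurable:
  fixes g :: "real \<Rightarrow> real"
  assumes "0 < d" "\<bar>c\<bar> \<le> d" "g \<in> borel_measurable (lebesgue_on {-1..1})"
  shows "(\<lambda>x. indicator (shift_domain d) x * g (x + c * vphi x)) \<in> borel_measurable (lebesgue_on {-1..1})"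
proof -
  obtain g' where [measurable]: "g' \<in> borel_measurable borel" and eq: "AE x in lebesgue_on {-1..1}. g x = g' x"
    using borel_representative[OF assms(3)] by blast
  show ?thesis
  proof (rule borel_measurable_lebesgue_on_AE)
    show "(\<lambda>x. indicator (shift_domain d) x * g' (x + c * vphi x)) \<in> borel_measurable (lebesgue_on {-1..1})"
      by (intro borel_measurable_lebesgue_onI) measurable
    show "AE x in lebesgue_on {-1..1}. indicator (shift_domain d) x * g' (x + c * vphi x) = indicator (shift_domain d) x * g (x + c * vphi x)"
      using AE_shift[OF assms(1,2) eq] by eventually_elim (auto simp: indicator_def)
  qed
qed

text \<open>For finite q the factor 2 of the substitution stands before the q-th power of the norm,
  where it is at most 2^q.\<close>

lemma Lp_norm_shift:
  assumes "1 \<le> p" "0 < d" "\<bar>c\<bar> \<le> d" and g: "g \<in> borel_measurable (lebesgue_on {-1..1})"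
  shows "Lp_norm p (\<lambda>x. indicator (shift_domain d) x * g (x + c * vphi x)) \<le> 2 * Lp_norm p g"
proof -
  let ?f = "\<lambda>x. indicator (shift_domain d) x * g (x + c * vphi x)"
  have "Lp_norm p ?f \<le> ennreal 2 * Lp_norm p g"
  proof (rule Lp_norm_le_mult)
    fix B :: real assume B: "0 \<le> B" "Lp_norm p g \<le> ennreal B"
    from \<open>1 \<le> p\<close> show "Lp_norm p ?f \<le> ennreal (2 * B)"
    proof (cases rule: ennreal_exponent_cases)
      case infinite
      have "AE x in lebesgue_on {-1..1}. \<bar>g x\<bar> \<le> B" using B infinite Lp_norm_le_iff_infinite[OF g] by auto
      from AE_shift[OF assms(2,3) this] have "AE x in lebesgue_on {-1..1}. \<bar>?f x\<bar> \<le> 2 * B"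
        by eventually_elim (use B in \<open>auto simp: indicator_def\<close>)
      then show ?thesis using B infinite Lp_norm_le_iff_infinite[OF shift_measurable[OF assms(2-4)]] by auto
    next
      case (finite q)
      obtain g' where [measurable]: "g' \<in> borel_measurable borel" and eq: "AE x in lebesgue_on {-1..1}. g x = g' x"
        using borel_representative[OF g] by blast
      have "(\<integral>\<^sup>+x. ennreal (\<bar>?f x\<bar> powr q) \<partial>lebesgue_on {-1..1}) =
        (\<integral>\<^sup>+x. ennreal (\<bar>g' (x + c * vphi x)\<bar> powr q) * indicator (shift_domain d) x \<partial>lebesgue_on {-1..1})"
        using AE_shift[OF assms(2,3) eq] finite
        by (intro nn_integral_cong_AE) (auto simp: indicator_def elim!: eventually_mono)
      also have "\<dots> \<le> (\<integral>\<^sup>+x. ennreal (\<bar>g' (x + c * vphi x)\<bar> powr q) * indicator (shift_domain d) x \<partial>lborel)"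
        unfolding nn_integral_interval_lborel by (intro nn_integral_mono) (auto simp: indicator_def)
      also have "\<dots> \<le> 2 * (\<integral>\<^sup>+x. ennreal (\<bar>g' x\<bar> powr q) * indicator {-1..1} x \<partial>lborel)"
        by (intro nn_integral_shift_le[where F = "\<lambda>x. ennreal (\<bar>g' x\<bar> powr q)"] assms) measurable
      also have "(\<integral>\<^sup>+x. ennreal (\<bar>g' x\<bar> powr q) * indicator {-1..1} x \<partial>lborel) = (\<integral>\<^sup>+x. ennreal (\<bar>g x\<bar> powr q) \<partial>lebesgue_on {-1..1})"
        unfolding nn_integral_interval_lborel[symmetric] using eq by (intro nn_integral_cong_AE) (auto elim!: eventually_mono)
      also have "2 * \<dots> \<le> 2 * ennreal (B powr q)"
        using B finite by (intro mult_left_mono) (auto simp: Lp_norm_le_iff_finite)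
      also have "\<dots> = ennreal (2 * B powr q)" by (simp add: ennreal_mult)
      also have "\<dots> \<le> ennreal ((2 * B) powr q)"
      proof (rule ennreal_leI)
        have "2 powr 1 * B powr q \<le> 2 powr q * B powr q" using finite by (intro mult_right_mono powr_mono) auto
        then show "2 * B powr q \<le> (2 * B) powr q" by (simp add: powr_mult)
      qed
      finally show ?thesis using B finite by (subst finite(2), subst Lp_norm_le_iff_finite) auto
    qed
  qed simp
  then show ?thesis by simp
qed

text \<open>For y = x + c \<open>vphi x\<close> with |c| \<le> D/2, the base 1 - x - D
  \<open>vphi x\<close> / 2 is at most 1 - y, and likewise at the other endpoint. Powers with
  nonnegative exponents preserve this, which is where the conditions on r/2 + \<alpha> and r/2 +
  \<beta> are used.\<close>

lemma shifted_w_le_jacobi_w: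
  assumes "0 \<le> \<xi>" "0 \<le> \<zeta>" "x \<in> shift_domain (D / 2)" "\<bar>c\<bar> \<le> D / 2"
  shows "shifted_w D \<xi> \<zeta> x \<le> jacobi_w \<xi> \<zeta> (x + c * vphi x)"
proof -
  have v: "0 \<le> vphi x" using assms by (intro vphi_nonneg) (auto simp: shift_domain_def)
  have "\<bar>c * vphi x\<bar> \<le> D / 2 * vphi x" using assms v by (simp only: abs_mult abs_of_nonneg mult_right_mono)
  moreover have "D / 2 * vphi x \<le> 1 - \<bar>x\<bar>" using assms by (simp add: shift_domain_def)
  ultimately show ?thesis unfolding shifted_w_def jacobi_w_def using assms
    by (intro mult_mono powr_mono2) auto
qed

lemma shifted_w_nonneg: "0 \<le> shifted_w D \<xi> \<zeta> x"
  by (simp add: shifted_w_def)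

text \<open>The nodes take the form x + c_i \<open>vphi x\<close> with numbers c_i independent of x,
  to which the shift estimates apply.\<close>

lemma sym_diff_in_domain:
  assumes "-1 < x" "x < 1" "0 \<le> h"
  shows "sym_diff k (h * vphi x) g x = indicator (shift_domain (real k * h / 2)) x *
    (\<Sum>i\<le>k. real (k choose i) * (-1) ^ (k - i) * g (x + ((real i - real k / 2) * h) * vphi x))"
proof -
  have v: "0 \<le> vphi x" using assms by (intro vphi_nonneg) auto
  let ?u = "real k * (h * vphi x) / 2"
  have u: "0 \<le> ?u" using v assms by simp
  have "{x - ?u .. x + ?u} \<subseteq> {-1..1} \<longleftrightarrow> ?u \<le> 1 - \<bar>x\<bar>"
    using u by (subst atLeastatMost_subset_iff) linarith
  moreover have "?u \<le> 1 - \<bar>x\<bar> \<longleftrightarrow> x \<in> shift_domain (real k * h / 2)"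
    using assms by (simp add: shift_domain_def mult.assoc)
  ultimately have iff: "{x - ?u .. x + ?u} \<subseteq> {-1..1} \<longleftrightarrow> x \<in> shift_domain (real k * h / 2)" by simp
  have node: "x - ?u + real i * (h * vphi x) = x + ((real i - real k / 2) * h) * vphi x" for i
    by (simp add: algebra_simps)
  show ?thesis unfolding sym_diff_def iff node by (simp add: indicator_def)
qed

lemma centred_node_le:
  assumes "i \<le> k" "0 \<le> h"
  shows "\<bar>(real i - real k / 2) * h\<bar> \<le> real k * h / 2"
proof -
  have "\<bar>real i - real k / 2\<bar> \<le> real k / 2" 
  proof -
    have "real i \<le> real k" using assms by simp
    then show ?thesis unfolding abs_le_iff by (auto simp: field_simps)
  qed
  then have "\<bar>real i - real k / 2\<bar> * h \<le> real k / 2 * h" using assms by (intro mult_right_mono)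
  then show ?thesis using assms by (simp add: abs_mult)
qed

text \<open>The alternating binomial coefficients sum to 0. The step 0 is treated apart because the
  shift estimates assume a positive d.\<close>

lemma sym_diff_zero_step: "1 \<le> k \<Longrightarrow> sym_diff k 0 g x = 0"
proof -
  assume "1 \<le> k"
  then have "(\<Sum>i\<le>k. real (k choose i) * (-1) ^ (k - i)) = 0"
    using binomial_ring[of "1::real" "-1" k] by (simp add: power_0_left)
  then show ?thesis by (simp add: sym_diff_def sum_distrib_right[symmetric])
qed

lemma weighted_sym_diff_measurable:
  assumes "1 \<le> k" "0 \<le> h" and g: "g \<in> borel_measurable (lebesgue_on {-1..1})"
  shows "(\<lambda>x. shifted_w D \<xi> \<zeta> x * sym_diff k (h * vphi x) g x) \<in> borel_measurable (lebesgue_on {-1..1})"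
proof (cases "h = 0")
  case True
  then show ?thesis using sym_diff_zero_step[OF assms(1)] by simp
next
  case False
  let ?d = "real k * h / 2"
  have d: "0 < ?d" using assms False by simp
  show ?thesis
  proof (rule borel_measurable_lebesgue_on_AE)
    have [measurable]: "shifted_w D \<xi> \<zeta> \<in> borel_measurable (lebesgue_on {-1..1})"
      unfolding shifted_w_def by (intro borel_measurable_lebesgue_onI) measurable
    have "(\<lambda>x. indicator (shift_domain ?d) x * g (x + ((real i - real k / 2) * h) * vphi x)) \<in> borel_measurable (lebesgue_on {-1..1})"
      if "i \<le> k" for i using shift_measurable[OF d centred_node_le[OF that assms(2)] g] .
    then have "(\<lambda>x. \<Sum>i\<le>k. real (k choose i) * (-1) ^ (k - i) * (indicator (shift_domain ?d) x * g (x + ((real i - real k / 2) * h) * vphi x))) \<in> borel_measurable (lebesgue_on {-1..1})"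
      by (intro borel_measurable_sum borel_measurable_times[OF borel_measurable_const]) auto
    then show "(\<lambda>x. shifted_w D \<xi> \<zeta> x * (\<Sum>i\<le>k. real (k choose i) * (-1) ^ (k - i) * (indicator (shift_domain ?d) x * g (x + ((real i - real k / 2) * h) * vphi x)))) \<in> borel_measurable (lebesgue_on {-1..1})"
      by measurable
    show "AE x in lebesgue_on {-1..1}. shifted_w D \<xi> \<zeta> x * (\<Sum>i\<le>k. real (k choose i) * (-1) ^ (k - i) * (indicator (shift_domain ?d) x * g (x + ((real i - real k / 2) * h) * vphi x)))
      = shifted_w D \<xi> \<zeta> x * sym_diff k (h * vphi x) g x"
      using AE_open_interval
    proof eventually_elim
      fix x :: real assume x: "-1 < x \<and> x < 1"
      then show "shifted_w D \<xi> \<zeta> x * (\<Sum>i\<le>k. real (k choose i) * (-1) ^ (k - i) * (indicator (shift_domain ?d) x * g (x + ((real i - real k / 2) * h) * vphi x)))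
        = shifted_w D \<xi> \<zeta> x * sym_diff k (h * vphi x) g x"
        using sym_diff_in_domain[of x h k g] assms(2) by (simp add: sum_distrib_left mult_ac)
    qed
  qed
qed

text \<open>Once the weight has been moved to the nodes, each node contributes at most twice the
  norm by \<open>Lp_norm_shift\<close>, and the binomial coefficients sum to 2^k.\<close>

lemma Lp_norm_sym_diff_le:
  assumes "1 \<le> p" "1 \<le> k" "0 \<le> h" "0 \<le> \<xi>" "0 \<le> \<zeta>" and g: "g \<in> borel_measurable (lebesgue_on {-1..1})"
  shows "Lp_norm p (\<lambda>x. shifted_w (real k * h) \<xi> \<zeta> x * sym_diff k (h * vphi x) g x) \<le> ennreal (2 ^ (k + 1)) * Lp_norm p (\<lambda>x. jacobi_w \<xi> \<zeta> x * g x)"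
proof (cases "h = 0")
  case True
  then show ?thesis using sym_diff_zero_step[OF assms(2)] Lp_norm_zero[OF assms(1)] by simp
next
  case False
  let ?d = "real k * h / 2"
  let ?c = "\<lambda>i. (real i - real k / 2) * h"
  let ?G = "\<lambda>x. jacobi_w \<xi> \<zeta> x * g x"
  have d: "0 < ?d" using assms False by simp
  have G: "?G \<in> borel_measurable (lebesgue_on {-1..1})"
    by (intro borel_measurable_times g borel_measurable_lebesgue_onI) measurable
  let ?f = "\<lambda>i x. real (k choose i) * \<bar>indicator (shift_domain ?d) x * ?G (x + ?c i * vphi x)\<bar>"
  have f0: "(\<lambda>x. indicator (shift_domain ?d) x * ?G (x + ?c i * vphi x)) \<in> borel_measurable (lebesgue_on {-1..1})" if "i \<le> k" for i
    by (rule shift_measurable[OF d centred_node_le[OF that assms(3)] G])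
  have fm: "?f i \<in> borel_measurable (lebesgue_on {-1..1})" if "i \<le> k" for i
    by (rule borel_measurable_times[OF borel_measurable_const borel_measurable_abs[OF f0[OF that]]])
  have "Lp_norm p (\<lambda>x. shifted_w (real k * h) \<xi> \<zeta> x * sym_diff k (h * vphi x) g x) \<le> Lp_norm p (\<lambda>x. \<Sum>i\<le>k. ?f i x)"
  proof (rule Lp_norm_mono[OF assms(1) weighted_sym_diff_measurable[OF assms(2,3) g]])
    show "AE x in lebesgue_on {-1..1}. \<bar>shifted_w (real k * h) \<xi> \<zeta> x * sym_diff k (h * vphi x) g x\<bar> \<le> \<bar>\<Sum>i\<le>k. ?f i x\<bar>"
      using AE_open_interval
    proof eventually_elim
      fix x :: real assume x: "-1 < x \<and> x < 1"
      show "\<bar>shifted_w (real k * h) \<xi> \<zeta> x * sym_diff k (h * vphi x) g x\<bar> \<le> \<bar>\<Sum>i\<le>k. ?f i x\<bar>"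
      proof (cases "x \<in> shift_domain ?d")
        case True
        have "\<bar>shifted_w (real k * h) \<xi> \<zeta> x * sym_diff k (h * vphi x) g x\<bar> =
          \<bar>\<Sum>i\<le>k. shifted_w (real k * h) \<xi> \<zeta> x * (real (k choose i) * (-1) ^ (k - i) * g (x + ?c i * vphi x))\<bar>"
          using sym_diff_in_domain[of x h k g] x assms(3) True by (simp add: sum_distrib_left)
        also have "\<dots> \<le> (\<Sum>i\<le>k. \<bar>shifted_w (real k * h) \<xi> \<zeta> x * (real (k choose i) * (-1) ^ (k - i) * g (x + ?c i * vphi x))\<bar>)"
          by (rule sum_abs)
        also have "\<dots> \<le> (\<Sum>i\<le>k. ?f i x)"
        proof (rule sum_mono)
          fix i assume "i \<in> {..k}"
          then have i: "i \<le> k" by simp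
          have "shifted_w (real k * h) \<xi> \<zeta> x \<le> jacobi_w \<xi> \<zeta> (x + ?c i * vphi x)"
            using assms centred_node_le[OF i assms(3)] True by (intro shifted_w_le_jacobi_w) auto
          then have "shifted_w (real k * h) \<xi> \<zeta> x * (real (k choose i) * \<bar>g (x + ?c i * vphi x)\<bar>) \<le> jacobi_w \<xi> \<zeta> (x + ?c i * vphi x) * (real (k choose i) * \<bar>g (x + ?c i * vphi x)\<bar>)"
            by (intro mult_right_mono) auto
          then show "\<bar>shifted_w (real k * h) \<xi> \<zeta> x * (real (k choose i) * (-1) ^ (k - i) * g (x + ?c i * vphi x))\<bar> \<le> ?f i x"
            using True by (simp add: abs_mult power_abs shifted_w_nonneg jacobi_w_nonneg mult_ac)
        qed
        finally show ?thesis by simp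
      next
        case False
        then show ?thesis using sym_diff_in_domain[of x h k g] x assms(3) by simp
      qed
    qed
  qed
  also have "\<dots> \<le> (\<Sum>i\<le>k. Lp_norm p (?f i))"
    by (rule Lp_norm_sum[OF assms(1)]) (use fm in auto)
  also have "\<dots> \<le> (\<Sum>i\<le>k. ennreal (real (k choose i)) * (2 * Lp_norm p ?G))"
  proof (rule sum_mono)
    fix i assume "i \<in> {..k}"
    then have i: "i \<le> k" by simp
    have "Lp_norm p (?f i) \<le> ennreal (real (k choose i)) * Lp_norm p (\<lambda>x. indicator (shift_domain ?d) x * ?G (x + ?c i * vphi x))"
      by (rule Lp_norm_scale[OF assms(1) fm[OF i] _ _ f0[OF i]]) (use i in auto)
    also have "\<dots> \<le> ennreal (real (k choose i)) * (2 * Lp_norm p ?G)"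
      by (intro mult_left_mono Lp_norm_shift[OF assms(1) d centred_node_le[OF i assms(3)] G]) auto
    finally show "Lp_norm p (?f i) \<le> ennreal (real (k choose i)) * (2 * Lp_norm p ?G)" .
  qed
  also have "\<dots> = ennreal (real (\<Sum>i\<le>k. k choose i)) * (2 * Lp_norm p ?G)"
    by (simp add: sum_distrib_right[symmetric] sum_ennreal)
  also have "\<dots> = ennreal (2 ^ (k + 1)) * Lp_norm p ?G"
    unfolding choose_row_sum by (simp add: ennreal_mult mult_ac)
  finally show ?thesis .
qed

section \<open>Differences of polynomials and the gain of a power of the step\<close>

lemma polys_below_forward_difference:
  assumes "S \<in> polys_below (Suc k)"
  shows "pcompose S [:1, 1:] - S \<in> polys_below k"
proof (cases "degree S = 0")
  case True
  then obtain a where "S = [:a:]" by (metis degree_eq_zeroE)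
  then show ?thesis by (simp add: polys_below_def)
next
  case False
  let ?T = "pcompose S [:1, 1:] - S"
  have deg: "degree (pcompose S [:1, 1:]) = degree S" by (simp add: degree_pcompose)
  have "lead_coeff (pcompose S [:1, 1:]) = lead_coeff S" by (subst lead_coeff_comp) auto
  then have "coeff ?T (degree S) = 0" using deg by simp
  moreover have "degree ?T \<le> degree S" using deg degree_diff_le[of "pcompose S [:1, 1:]" "degree S" S] by simp
  ultimately have "?T = 0 \<or> degree ?T < degree S" using eq_zero_or_degree_less by blast
  then show ?thesis using assms by (auto simp: polys_below_def)
qed

text \<open>By Pascal's rule the difference of order k+1 of S is the difference of order k of S(x+1)
  - S(x), in which the leading coefficients cancel.\<close>

lemma alternating_sum_poly:
  fixes S :: "real poly"
  assumes "S \<in> polys_below k"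
  shows "(\<Sum>i\<le>k. real (k choose i) * (-1) ^ (k - i) * poly S (real i)) = 0"
  using assms
proof (induction k arbitrary: S)
  case 0
  then show ?case by (simp add: polys_below_def)
next
  case (Suc k)
  let ?s = "\<lambda>i. poly S (real i)"
  have "(\<Sum>i\<le>Suc k. real (Suc k choose i) * (-1) ^ (Suc k - i) * ?s i) =
    (-1) ^ Suc k * ?s 0 + (\<Sum>i\<le>k. real (Suc k choose Suc i) * (-1) ^ (k - i) * ?s (Suc i))"
    by (subst sum.atMost_Suc_shift) simp
  also have "(\<Sum>i\<le>k. real (Suc k choose Suc i) * (-1) ^ (k - i) * ?s (Suc i)) =
    (\<Sum>i\<le>k. real (k choose i) * (-1) ^ (k - i) * ?s (Suc i)) + (\<Sum>i\<le>k. real (k choose Suc i) * (-1) ^ (k - i) * ?s (Suc i))"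
    by (simp add: sum.distrib[symmetric] distrib_right)
  also have "(\<Sum>i\<le>k. real (k choose Suc i) * (-1) ^ (k - i) * ?s (Suc i)) =
     (\<Sum>i\<le>Suc k. real (k choose i) * (-1) ^ (Suc k - i) * ?s i) - (-1) ^ Suc k * ?s 0"
    by (subst sum.atMost_Suc_shift) simp
  also have "(\<Sum>i\<le>Suc k. real (k choose i) * (-1) ^ (Suc k - i) * ?s i) = - (\<Sum>i\<le>k. real (k choose i) * (-1) ^ (k - i) * ?s i)"
    by (simp add: Suc_diff_le sum_negf[symmetric])
  also have "(-1) ^ Suc k * ?s 0 + ((\<Sum>i\<le>k. real (k choose i) * (-1) ^ (k - i) * ?s (Suc i)) + (- (\<Sum>i\<le>k. real (k choose i) * (-1) ^ (k - i) * ?s i) - (-1) ^ Suc k * ?s 0))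
    = (\<Sum>i\<le>k. real (k choose i) * (-1) ^ (k - i) * poly (pcompose S [:1, 1:] - S) (real i))"
    by (simp add: sum_subtractf[symmetric] poly_pcompose algebra_simps)
  also have "\<dots> = 0" by (rule Suc.IH[OF polys_below_forward_difference[OF Suc.prems]])
  finally show ?case .
qed

lemma alternating_sum_power:
  assumes "j < k"
  shows "(\<Sum>i\<le>k. real (k choose i) * (-1) ^ (k - i) * (a + b * real i) ^ j) = 0"
proof -
  have "[:a, b:] ^ j \<in> polys_below k"
    using degree_power_le[of "[:a, b:]" j] assms by (auto simp: polys_below_def split: if_splits intro: le_less_trans)
  from alternating_sum_poly[OF this] show ?thesis by (simp add: poly_power mult.commute)
qed

text \<open>The factorial of the integral remainder is dropped, but the power of 1 - \<tau> is kept: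
  it compensates for \<open>vphi\<close> being possibly smaller at the intermediate point than at
  x.\<close>

lemma poly_Taylor_integral:
  fixes Q :: "real poly"
  assumes "1 \<le> k"
  defines "R \<equiv> \<lambda>x u. poly Q (x + u) - (\<Sum>j<k. u ^ j / fact j * poly ((pderiv ^^ j) Q) x)"
  shows "ennreal \<bar>R x u\<bar> \<le> (\<integral>\<^sup>+\<tau>. ennreal (\<bar>u\<bar> ^ k * (1 - \<tau>) ^ (k - 1) * \<bar>poly ((pderiv ^^ k) Q) (x + \<tau> * u)\<bar>) * indicator {0..1} \<tau> \<partial>lborel)"
proof -
  define Df where "Df = (\<lambda>j \<tau>. u ^ j * poly ((pderiv ^^ j) Q) (x + \<tau> * u))"
  let ?i = "\<lambda>\<tau>. ((1 - \<tau>) ^ (k - 1) / fact (k - 1)) *\<^sub>R Df k \<tau>"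
  have I: "(?i has_integral poly Q (x + 1 * u) - (\<Sum>j<k. ((1 - 0) ^ j / fact j) *\<^sub>R Df j 0)) {0..1}"
  proof (rule Taylor_has_integral[where f = "\<lambda>\<tau>. poly Q (x + \<tau> * u)"])
    fix m \<tau> assume "m < k" "0 \<le> \<tau>" "\<tau> \<le> (1::real)"
    have "(Df m has_real_derivative Df (Suc m) \<tau>) (at \<tau> within {0..1})"
      unfolding Df_def
      by (rule DERIV_subset[OF _ subset_UNIV]) (auto intro!: derivative_eq_intros DERIV_chain2[OF poly_DERIV])
    then show "(Df m has_vector_derivative Df (Suc m) \<tau>) (at \<tau> within {0..1})"
      by (simp add: has_real_derivative_iff_has_vector_derivative)
  qed (use assms in \<open>auto simp: Df_def\<close>)
  have R: "poly Q (x + 1 * u) - (\<Sum>j<k. ((1 - 0) ^ j / fact j) *\<^sub>R Df j 0) = R x u"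
    by (simp add: R_def Df_def)
  let ?g = "\<lambda>\<tau>. \<bar>u\<bar> ^ k * (1 - \<tau>) ^ (k - 1) * \<bar>poly ((pderiv ^^ k) Q) (x + \<tau> * u)\<bar>"
  have gi: "?g integrable_on {0..1}"
    by (intro integrable_continuous_real continuous_intros)
  have "norm (integral {0..1} ?i) \<le> integral {0..1} ?g"
  proof (rule integral_norm_bound_integral)
    fix \<tau> :: real assume t: "\<tau> \<in> {0..1}"
    have "norm (?i \<tau>) = ?g \<tau> / fact (k - 1)" using t by (simp add: Df_def abs_mult power_abs)
    also have "\<dots> \<le> ?g \<tau> / 1" using t by (intro divide_left_mono) (auto simp: fact_ge_1)
    finally show "norm (?i \<tau>) \<le> ?g \<tau>" by simp
  qed (use I gi in auto)
  moreover have "integral {0..1} ?i = R x u" using integral_unique[OF I] unfolding R .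
  ultimately have "\<bar>R x u\<bar> \<le> integral {0..1} ?g" by (simp only: real_norm_def)
  also have "ennreal (integral {0..1} ?g) = (\<integral>\<^sup>+\<tau>. ennreal (?g \<tau>) * indicator {0..1} \<tau> \<partial>lborel)"
    by (rule nn_integral_has_integral_lebesgue'[symmetric]) (use gi in auto)
  finally show ?thesis by (simp add: ennreal_leI)
qed

lemma nn_integral_inverse_sqrt:
  "(\<integral>\<^sup>+\<tau>. ennreal ((1 - \<tau>) powr (-1/2) * indicator {0..1} \<tau>) \<partial>lborel) = ennreal 2"
proof -
  have "(\<integral>\<^sup>+\<tau>. ennreal ((1 - \<tau>) powr (-1/2) * indicator {0..1} \<tau>) \<partial>lborel) =
     (\<integral>\<^sup>+\<tau>. ennreal ((1 - \<tau>) powr (-1/2)) * indicator {0..1} \<tau> \<partial>lborel)"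
    by (intro nn_integral_cong) (auto simp: indicator_def)
  also have "\<dots> = (\<integral>\<^sup>+\<tau>. ennreal (\<tau> powr (-1/2)) * indicator {0..1} \<tau> \<partial>lborel)"
    by (subst nn_integral_reflect_interval[where f = "\<lambda>\<tau>. ennreal (\<tau> powr (-1/2))"]) auto
  also have "\<dots> = ennreal (1 powr (-1/2 + 1) / (-1/2 + 1))"
    by (intro nn_integral_has_integral_lebesgue' has_integral_powr_from_0) auto
  finally show ?thesis by simp
qed

text \<open>R is dominated by an average of shifted copies of \<Phi> against a kernel of mass 2. For
  finite q, Jensen's inequality and the shift estimate for each \<tau> give the factor 2^(q-1) 2 2 =
  2^(q+1), which is at most 4^q.\<close>

lemma Lp_norm_shift_average:
  fixes R \<Phi> :: "real \<Rightarrow> real"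
  assumes "1 \<le> p" "0 < d" "\<bar>c\<bar> \<le> d" and [measurable]: "R \<in> borel_measurable borel" "\<Phi> \<in> borel_measurable borel"
    and \<Phi>0: "\<And>x. 0 \<le> \<Phi> x" and cont: "continuous_on {-1<..<1} \<Phi>"
    and out: "\<And>x. -1 < x \<Longrightarrow> x < 1 \<Longrightarrow> x \<notin> shift_domain d \<Longrightarrow> R x = 0"
    and avg: "\<And>x. x \<in> shift_domain d \<Longrightarrow> ennreal \<bar>R x\<bar> \<le>
      (\<integral>\<^sup>+\<tau>. ennreal ((1 - \<tau>) powr (-1/2) * indicator {0..1} \<tau> * \<Phi> (x + (\<tau> * c) * vphi x)) \<partial>lborel)"
  shows "Lp_norm p R \<le> 4 * Lp_norm p \<Phi>"
proof -
  have mR: "R \<in> borel_measurable (lebesgue_on {-1..1})" and m\<Phi>: "\<Phi> \<in> borel_measurable (lebesgue_on {-1..1})"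
    by (intro borel_measurable_lebesgue_onI; measurable)+
  let ?k = "\<lambda>\<tau>. (1 - \<tau>) powr (-1/2) * indicator {0..1} \<tau> :: real"
  have "Lp_norm p R \<le> ennreal 4 * Lp_norm p \<Phi>"
  proof (rule Lp_norm_le_mult)
    fix B :: real assume B: "0 \<le> B" "Lp_norm p \<Phi> \<le> ennreal B"
    from \<open>1 \<le> p\<close> show "Lp_norm p R \<le> ennreal (4 * B)"
    proof (cases rule: ennreal_exponent_cases)
      case infinite
      have "AE x in lebesgue_on {-1..1}. \<Phi> x \<le> B" using B infinite Lp_norm_le_iff_infinite[OF m\<Phi>] \<Phi>0 by auto
      then have \<Phi>B: "\<Phi> x \<le> B" if "-1 < x" "x < 1" for x using continuous_AE_imp_le[OF cont] that by blast
      have R4: "\<bar>R x\<bar> \<le> 4 * B" if x: "-1 < x" "x < 1" for x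
      proof (cases "x \<in> shift_domain d")
        case True
        have "ennreal \<bar>R x\<bar> \<le> (\<integral>\<^sup>+\<tau>. ennreal (?k \<tau> * \<Phi> (x + (\<tau> * c) * vphi x)) \<partial>lborel)" by (rule avg[OF True])
        also have "\<dots> \<le> (\<integral>\<^sup>+\<tau>. ennreal (?k \<tau>) * ennreal B \<partial>lborel)"
        proof (rule nn_integral_mono)
          fix \<tau> :: real
          show "ennreal (?k \<tau> * \<Phi> (x + (\<tau> * c) * vphi x)) \<le> ennreal (?k \<tau>) * ennreal B"
          proof (cases "0 \<le> \<tau> \<and> \<tau> < 1")
            case t: True
            have y: "\<bar>x + c * vphi x\<bar> \<le> 1" by (rule shift_domain_shift[OF True assms(3)])
            \<comment> \<open>For \<tau> < 1 the point is a convex combination of the interior point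
              x and a point of [-1,1], hence interior, and there \<Phi> \<le> B holds without
              exception.\<close>
            have "\<bar>(1 - \<tau>) * x + \<tau> * (x + c * vphi x)\<bar> \<le> \<bar>(1 - \<tau>) * x\<bar> + \<bar>\<tau> * (x + c * vphi x)\<bar>" by (rule abs_triangle_ineq)
            also have "\<bar>\<tau> * (x + c * vphi x)\<bar> \<le> \<tau> * 1" using t y by (simp add: abs_mult mult_left_le)
            also have "\<bar>(1 - \<tau>) * x\<bar> < (1 - \<tau>) * 1" using t x by (simp add: abs_mult abs_less_iff)
            finally have "\<bar>(1 - \<tau>) * x + \<tau> * (x + c * vphi x)\<bar> < 1" by simp
            then have "\<Phi> (x + (\<tau> * c) * vphi x) \<le> B" by (intro \<Phi>B) (auto simp: algebra_simps abs_less_iff)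
            then have "?k \<tau> * \<Phi> (x + (\<tau> * c) * vphi x) \<le> ?k \<tau> * B" by (intro mult_left_mono) auto
            then show ?thesis using B by (simp add: ennreal_mult[symmetric] ennreal_leI)
          qed (auto simp: indicator_def)
        qed
        also have "\<dots> = ennreal 2 * ennreal B" by (subst nn_integral_multc) (auto simp: nn_integral_inverse_sqrt[simplified])
        also have "\<dots> = ennreal (2 * B)" using B by (simp add: ennreal_mult)
        finally have "\<bar>R x\<bar> \<le> 2 * B" using B by (subst (asm) ennreal_le_iff) auto
        then show ?thesis using B by simp
      qed (use out[OF x] B in auto)
      then have "AE x in lebesgue_on {-1..1}. \<bar>R x\<bar> \<le> 4 * B"
        by (rule eventually_mono[OF AE_open_interval]) (use R4 in auto)
      then show ?thesis using B infinite Lp_norm_le_iff_infinite[OF mR] by auto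
    next
      case (finite q)
      let ?F = "\<lambda>x \<tau>. ennreal (?k \<tau> * \<Phi> (x + (\<tau> * c) * vphi x) powr q) * indicator (shift_domain d) x"
      have "(\<integral>\<^sup>+x. ennreal (\<bar>R x\<bar> powr q) \<partial>lebesgue_on {-1..1}) \<le>
        (\<integral>\<^sup>+x. (\<integral>\<^sup>+\<tau>. ennreal (2 powr (q - 1)) * ?F x \<tau> \<partial>lborel) \<partial>lebesgue_on {-1..1})"
      proof (rule nn_integral_mono_AE, use AE_open_interval in eventually_elim)
        fix x :: real assume x: "-1 < x \<and> x < 1"
        show "ennreal (\<bar>R x\<bar> powr q) \<le> (\<integral>\<^sup>+\<tau>. ennreal (2 powr (q - 1)) * ?F x \<tau> \<partial>lborel)"
        proof (cases "x \<in> shift_domain d")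
          case True
          have "ennreal (\<bar>R x\<bar> powr q) \<le> ennreal (2 powr (q - 1)) * (\<integral>\<^sup>+\<tau>. ennreal (?k \<tau> * \<Phi> (x + (\<tau> * c) * vphi x) powr q) \<partial>lborel)"
            using avg[OF True] nn_integral_inverse_sqrt \<Phi>0 finite(1) by (intro Jensen_kernel) auto
          also have "\<dots> = (\<integral>\<^sup>+\<tau>. ennreal (2 powr (q - 1)) * ?F x \<tau> \<partial>lborel)"
            using True by (subst nn_integral_cmult) auto
          finally show ?thesis .
        qed (use out[of x] x in auto)
      qed
      also have "\<dots> \<le> (\<integral>\<^sup>+x. (\<integral>\<^sup>+\<tau>. ennreal (2 powr (q - 1)) * ?F x \<tau> \<partial>lborel) \<partial>lborel)"
        unfolding nn_integral_interval_lborel by (intro nn_integral_mono) (auto simp: indicator_def)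
      also have "\<dots> = (\<integral>\<^sup>+\<tau>. (\<integral>\<^sup>+x. ennreal (2 powr (q - 1)) * ?F x \<tau> \<partial>lborel) \<partial>lborel)"
        by (rule lborel_pair.Fubini'[symmetric]) measurable
      also have "\<dots> \<le> (\<integral>\<^sup>+\<tau>. ennreal (?k \<tau>) * ennreal (2 powr (q - 1) * (2 * B powr q)) \<partial>lborel)"
      proof (rule nn_integral_mono)
        fix \<tau> :: real
        show "(\<integral>\<^sup>+x. ennreal (2 powr (q - 1)) * ?F x \<tau> \<partial>lborel) \<le> ennreal (?k \<tau>) * ennreal (2 powr (q - 1) * (2 * B powr q))"
        proof (cases "\<tau> \<in> {0..1}")
          case True
          have c: "\<bar>\<tau> * c\<bar> \<le> d" using True assms(3) mult_mono[of "\<bar>\<tau>\<bar>" 1 "\<bar>c\<bar>" d] by (simp add: abs_mult)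
          have "(\<integral>\<^sup>+x. ennreal (2 powr (q - 1)) * ?F x \<tau> \<partial>lborel) =
            (\<integral>\<^sup>+x. ennreal (2 powr (q - 1) * ?k \<tau>) * (ennreal (\<Phi> (x + (\<tau> * c) * vphi x) powr q) * indicator (shift_domain d) x) \<partial>lborel)"
            by (intro nn_integral_cong) (simp add: ennreal_mult mult_ac)
          also have "\<dots> = ennreal (2 powr (q - 1) * ?k \<tau>) * (\<integral>\<^sup>+x. ennreal (\<Phi> (x + (\<tau> * c) * vphi x) powr q) * indicator (shift_domain d) x \<partial>lborel)"
            by (rule nn_integral_cmult) measurable
          also have "\<dots> \<le> ennreal (2 powr (q - 1) * ?k \<tau>) * (2 * (\<integral>\<^sup>+x. ennreal (\<Phi> x powr q) * indicator {-1..1} x \<partial>lborel))"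
            by (intro mult_left_mono nn_integral_shift_le[OF assms(2) c, where F = "\<lambda>x. ennreal (\<Phi> x powr q)"]) auto
          also have "(\<integral>\<^sup>+x. ennreal (\<Phi> x powr q) * indicator {-1..1} x \<partial>lborel) = (\<integral>\<^sup>+x. ennreal (\<bar>\<Phi> x\<bar> powr q) \<partial>lebesgue_on {-1..1})"
            unfolding nn_integral_interval_lborel using \<Phi>0 by simp
          also have "ennreal (2 powr (q - 1) * ?k \<tau>) * (2 * \<dots>) \<le> ennreal (2 powr (q - 1) * ?k \<tau>) * (2 * ennreal (B powr q))"
            using B finite by (intro mult_left_mono) (auto simp: Lp_norm_le_iff_finite)
          also have "\<dots> = ennreal (?k \<tau>) * ennreal (2 powr (q - 1) * (2 * B powr q))"
            by (simp add: ennreal_mult mult_ac)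
          finally show ?thesis .
        qed simp
      qed
      also have "\<dots> = ennreal 2 * ennreal (2 powr (q - 1) * (2 * B powr q))"
        by (subst nn_integral_multc) (auto simp: nn_integral_inverse_sqrt[simplified])
      also have "\<dots> = ennreal (2 * (2 powr (q - 1) * (2 * B powr q)))" by (rule ennreal_mult[symmetric]) auto
      also have "2 * (2 powr (q - 1) * (2 * B powr q)) = 2 powr (q + 1) * B powr q" by (simp add: powr_diff powr_add)
      also have "\<dots> \<le> 2 powr (2 * q) * B powr q" using finite by (intro mult_right_mono powr_mono) auto
      also have "\<dots> = (4 * B) powr q"
      proof -
        have "(4::real) powr q = 2 powr (2 * q)" using powr_powr[of "2::real" 2 q] by simp
        then show ?thesis by (simp add: powr_mult)
      qed
      finally show ?thesis using B finite by (subst finite(2), subst Lp_norm_le_iff_finite) (auto simp: ennreal_leI)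
    qed
  qed simp
  then show ?thesis by simp
qed

text \<open>1 - x^2 is concave and nonnegative on [-1,1]; the contribution of the far end x + u is
  discarded.\<close>

lemma vphi_convex_lower:
  assumes "\<bar>x\<bar> \<le> 1" "\<bar>x + u\<bar> \<le> 1" "0 \<le> \<tau>" "\<tau> \<le> 1"
  shows "sqrt (1 - \<tau>) * vphi x \<le> vphi (x + \<tau> * u)"
proof -
  have "(x + u)\<^sup>2 \<le> 1" "x\<^sup>2 \<le> 1" using assms by (simp_all add: abs_square_le_1)
  have "(x + \<tau> * u)\<^sup>2 = (1 - \<tau>) * x\<^sup>2 + \<tau> * (x + u)\<^sup>2 - \<tau> * (1 - \<tau>) * u\<^sup>2"
    by (simp add: power2_eq_square algebra_simps)
  also have "\<dots> \<le> (1 - \<tau>) * x\<^sup>2 + \<tau> * 1 - 0"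
    using assms \<open>(x + u)\<^sup>2 \<le> 1\<close> by (intro diff_mono add_mono mult_left_mono) auto
  finally have "(1 - \<tau>) * (1 - x\<^sup>2) \<le> 1 - (x + \<tau> * u)\<^sup>2" by (simp add: algebra_simps)
  then show ?thesis unfolding vphi_def real_sqrt_mult[symmetric] by (rule real_sqrt_le_mono)
qed

text \<open>Taylor expansion at the centre x: the difference of order k annihilates the Taylor
  polynomial of degree below k, so only the remainders at the nodes are left. Each is an average of
  the k-th derivative along the segment from x to the node, and \<open>Lp_norm_shift_average\<close>
  applies.\<close>

lemma Lp_norm_sym_diff_poly_le:
  assumes "1 \<le> p" "1 \<le> k" "0 \<le> h" "0 \<le> \<xi>" "0 \<le> \<zeta>"
  shows "Lp_norm p (\<lambda>x. shifted_w (real k * h) \<xi> \<zeta> x * sym_diff k (h * vphi x) (poly Q) x) \<le>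
    ennreal (4 * (2 * real k) ^ k * h ^ k) * Lp_norm p (\<lambda>x. jacobi_w \<xi> \<zeta> x * (vphi x ^ k * poly ((pderiv ^^ k) Q) x))"
proof (cases "h = 0")
  case True
  then show ?thesis using sym_diff_zero_step[OF assms(2)] Lp_norm_zero[OF assms(1)] by simp
next
  case False
  then have h: "0 < h" using assms by simp
  let ?d = "real k * h / 2"
  have d: "0 < ?d" using assms h by simp
  define c where "c = (\<lambda>i. (real i - real k / 2) * h)"
  have c: "\<bar>c i\<bar> \<le> ?d" if "i \<le> k" for i unfolding c_def by (rule centred_node_le[OF that assms(3)])
  let ?Q = "poly ((pderiv ^^ k) Q)"
  let ?W = "shifted_w (real k * h) \<xi> \<zeta>"
  let ?N = "\<lambda>x. jacobi_w \<xi> \<zeta> x * (vphi x ^ k * ?Q x)"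
  \<comment> \<open>As |c_i| \<le> k h / 2, the factor (k h)^k serves for every node.\<close>
  define \<Phi> where "\<Phi> = (\<lambda>x. (real k * h) ^ k * \<bar>?N x\<bar>)"
  define T where "T = (\<lambda>x u. poly Q (x + u) - (\<Sum>j<k. u ^ j / fact j * poly ((pderiv ^^ j) Q) x))"
  define R where "R = (\<lambda>i x. indicator (shift_domain ?d) x * ?W x * T x (c i * vphi x))"
  have W[measurable]: "?W \<in> borel_measurable borel" unfolding shifted_w_def by measurable
  have [measurable]: "R i \<in> borel_measurable borel" for i unfolding R_def T_def by measurable
  have [measurable]: "\<Phi> \<in> borel_measurable borel" unfolding \<Phi>_def by measurable
  have LpR: "Lp_norm p (R i) \<le> 4 * Lp_norm p \<Phi>" if i: "i \<le> k" for i
  proof (rule Lp_norm_shift_average[OF assms(1) d c[OF i]])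
    show "continuous_on {-1<..<1} \<Phi>"
      unfolding \<Phi>_def vphi_def by (intro continuous_intros continuous_on_jacobi_w)
    fix x assume x: "x \<in> shift_domain ?d"
    then have x1: "\<bar>x\<bar> < 1" by (auto simp: shift_domain_def)
    let ?u = "c i * vphi x"
    have "ennreal \<bar>R i x\<bar> = ennreal (?W x) * ennreal \<bar>T x ?u\<bar>"
      using x by (simp add: R_def abs_mult shifted_w_nonneg ennreal_mult)
    also have "\<dots> \<le> ennreal (?W x) * (\<integral>\<^sup>+\<tau>. ennreal (\<bar>?u\<bar> ^ k * (1 - \<tau>) ^ (k - 1) * \<bar>?Q (x + \<tau> * ?u)\<bar>) * indicator {0..1} \<tau> \<partial>lborel)"
      unfolding T_def by (intro mult_left_mono poly_Taylor_integral assms(2)) auto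
    also have "\<dots> = (\<integral>\<^sup>+\<tau>. ennreal (?W x) * (ennreal (\<bar>?u\<bar> ^ k * (1 - \<tau>) ^ (k - 1) * \<bar>?Q (x + \<tau> * ?u)\<bar>) * indicator {0..1} \<tau>) \<partial>lborel)"
      by (rule nn_integral_cmult[symmetric]) measurable
    also have "\<dots> \<le> (\<integral>\<^sup>+\<tau>. ennreal ((1 - \<tau>) powr (-1/2) * indicator {0..1} \<tau> * \<Phi> (x + (\<tau> * c i) * vphi x)) \<partial>lborel)"
    proof -
      \<comment> \<open>At \<tau> = 1 the right-hand integrand is 0, because \<open>powr\<close>
        with base 0 is 0; this single point is left out.\<close>
      have "AE \<tau> in lborel. \<tau> \<noteq> (1::real)" by (rule AE_lborel_singleton)
      then show ?thesis
      proof (intro nn_integral_mono_AE, eventually_elim)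
        fix \<tau> :: real assume t1: "\<tau> \<noteq> 1"
        show "ennreal (?W x) * (ennreal (\<bar>?u\<bar> ^ k * (1 - \<tau>) ^ (k - 1) * \<bar>?Q (x + \<tau> * ?u)\<bar>) * indicator {0..1} \<tau>) \<le>
          ennreal ((1 - \<tau>) powr (-1/2) * indicator {0..1} \<tau> * \<Phi> (x + (\<tau> * c i) * vphi x))"
        proof (cases "\<tau> \<in> {0..1}")
          case True
          then have t: "0 \<le> \<tau>" "\<tau> < 1" using t1 by auto
          define s where "s = sqrt (1 - \<tau>)"
          have s: "0 < s" "s \<le> 1" "1 - \<tau> = s ^ 2" using t by (auto simp: s_def)
          let ?y = "x + (\<tau> * c i) * vphi x"
          have v: "0 \<le> vphi x" "0 \<le> vphi ?y"
          proof -
            show "0 \<le> vphi x" using x1 by (intro vphi_nonneg) auto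
            have "s * vphi x \<le> vphi (x + \<tau> * ?u)" unfolding s_def
              using x1 t shift_domain_shift[OF x c[OF i]] by (intro vphi_convex_lower) auto
            moreover have "0 \<le> s * vphi x" using s \<open>0 \<le> vphi x\<close> by simp
            ultimately show "0 \<le> vphi ?y" by (simp add: mult.assoc)
          qed
          have sv: "s * vphi x \<le> vphi ?y"
            using vphi_convex_lower[of x ?u \<tau>] x1 t shift_domain_shift[OF x c[OF i]] by (simp add: s_def mult.assoc)
          have tc: "\<bar>\<tau> * c i\<bar> \<le> ?d" using t c[OF i] mult_mono[of "\<bar>\<tau>\<bar>" 1 "\<bar>c i\<bar>" ?d] by (simp add: abs_mult)
          have W: "?W x \<le> jacobi_w \<xi> \<zeta> ?y" using shifted_w_le_jacobi_w[OF assms(4,5), of x "real k * h" "\<tau> * c i"] x tc by simp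
          have ci: "\<bar>c i\<bar> ^ k \<le> (real k * h) ^ k" using c[OF i] assms h by (intro power_mono) auto
          \<comment> \<open>With s = sqrt(1 - \<tau>) one has s \<open>vphi x\<close> \<le>
            \<open>vphi ?y\<close>. Since s^(2k-1) \<le> s^k, only one factor 1/s is lost, and this
            is the integrable kernel (1 - \<tau>)^(-1/2).\<close>
          have sk: "(1 - \<tau>) ^ (k - 1) * vphi x ^ k \<le> (1 / s) * vphi ?y ^ k"
          proof -
            have "s ^ (2 * k - 1) \<le> s ^ k" using s assms(2) by (intro power_decreasing) auto
            then have "s ^ (2 * k - 1) * vphi x ^ k \<le> s ^ k * vphi x ^ k" using v by (intro mult_right_mono) auto
            also have "\<dots> = (s * vphi x) ^ k" by (simp add: power_mult_distrib)
            also have "\<dots> \<le> vphi ?y ^ k" using sv s v by (intro power_mono) auto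
            finally have "s ^ (2 * k - 1) * vphi x ^ k \<le> vphi ?y ^ k" .
            moreover have "s ^ (2 * k - 1) = s * (1 - \<tau>) ^ (k - 1)"
            proof -
              have "2 * k - 1 = Suc (2 * (k - 1))" using assms(2) by simp
              then show ?thesis unfolding s(3) by (simp add: power_mult[symmetric])
            qed
            ultimately show ?thesis using s(1) unfolding s(3) by (simp add: field_simps)
          qed
          have rs: "(1 - \<tau>) powr (-1/2) = 1 / s"
            using t by (simp add: s_def powr_minus_divide powr_half_sqrt[symmetric])
          have "?W x * (\<bar>?u\<bar> ^ k * (1 - \<tau>) ^ (k - 1) * \<bar>?Q (x + \<tau> * ?u)\<bar>) =
            ?W x * (\<bar>c i\<bar> ^ k * ((1 - \<tau>) ^ (k - 1) * vphi x ^ k)) * \<bar>?Q ?y\<bar>"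
            using v by (simp add: abs_mult power_mult_distrib mult_ac)
          also have "\<dots> \<le> jacobi_w \<xi> \<zeta> ?y * ((real k * h) ^ k * ((1 / s) * vphi ?y ^ k)) * \<bar>?Q ?y\<bar>"
            by (rule mult_right_mono[OF mult_mono[OF W mult_mono[OF ci sk]]])
              (use v t h in \<open>auto simp: jacobi_w_nonneg intro!: mult_nonneg_nonneg\<close>)
          also have "\<dots> = (1 - \<tau>) powr (-1/2) * indicator {0..1} \<tau> * \<Phi> ?y"
            using True v unfolding \<Phi>_def rs by (simp add: abs_mult jacobi_w_nonneg mult_ac)
          finally have "ennreal (?W x * (\<bar>?u\<bar> ^ k * (1 - \<tau>) ^ (k - 1) * \<bar>?Q (x + \<tau> * ?u)\<bar>)) \<le> ennreal ((1 - \<tau>) powr (-1/2) * indicator {0..1} \<tau> * \<Phi> ?y)"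
            by (rule ennreal_leI)
          then show ?thesis using True by (simp add: ennreal_mult' shifted_w_nonneg)
        qed simp
      qed
    qed
    finally show "ennreal \<bar>R i x\<bar> \<le> (\<integral>\<^sup>+\<tau>. ennreal ((1 - \<tau>) powr (-1/2) * indicator {0..1} \<tau> * \<Phi> (x + (\<tau> * c i) * vphi x)) \<partial>lborel)" .
  next
    show "0 \<le> \<Phi> x" for x using h by (simp add: \<Phi>_def)
    show "R i x = 0" if "x \<notin> shift_domain ?d" for x using that by (simp add: R_def)
  qed measurable
  let ?b = "\<lambda>i. real (k choose i) * (-1) ^ (k - i)"
  have decomp: "?W x * sym_diff k (h * vphi x) (poly Q) x = (\<Sum>i\<le>k. ?b i * R i x)" if x: "-1 < x" "x < 1" for x
  proof (cases "x \<in> shift_domain ?d")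
    case True
    \<comment> \<open>The offset of a node is affine in i, so each term of the Taylor polynomial is
      a polynomial in i of degree below k.\<close>
    have z: "(\<Sum>i\<le>k. ?b i * (\<Sum>j<k. (c i * vphi x) ^ j / fact j * poly ((pderiv ^^ j) Q) x)) = 0"
    proof -
      have "(\<Sum>i\<le>k. ?b i * (\<Sum>j<k. (c i * vphi x) ^ j / fact j * poly ((pderiv ^^ j) Q) x)) =
        (\<Sum>j<k. \<Sum>i\<le>k. ?b i * ((c i * vphi x) ^ j / fact j * poly ((pderiv ^^ j) Q) x))"
        unfolding sum_distrib_left by (rule sum.swap)
      also have "\<dots> = (\<Sum>j<k. (\<Sum>i\<le>k. ?b i * (- (real k / 2 * h * vphi x) + (h * vphi x) * real i) ^ j) * (poly ((pderiv ^^ j) Q) x / fact j))"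
      proof (rule sum.cong[OF refl])
        fix j
        have e: "c i * vphi x = - (real k / 2 * h * vphi x) + (h * vphi x) * real i" for i
          by (simp add: c_def algebra_simps)
        show "(\<Sum>i\<le>k. ?b i * ((c i * vphi x) ^ j / fact j * poly ((pderiv ^^ j) Q) x)) =
          (\<Sum>i\<le>k. ?b i * (- (real k / 2 * h * vphi x) + (h * vphi x) * real i) ^ j) * (poly ((pderiv ^^ j) Q) x / fact j)"
          unfolding e sum_distrib_right by (intro sum.cong) simp_all
      qed
      also have "\<dots> = 0"
      proof (intro sum.neutral ballI)
        fix j assume "j \<in> {..<k}"
        then have "(\<Sum>i\<le>k. ?b i * (- (real k / 2 * h * vphi x) + (h * vphi x) * real i) ^ j) = 0"
          by (intro alternating_sum_power) simp
        then show "(\<Sum>i\<le>k. ?b i * (- (real k / 2 * h * vphi x) + (h * vphi x) * real i) ^ j) * (poly ((pderiv ^^ j) Q) x / fact j) = 0"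
          by (simp only: mult_zero_left)
      qed
      finally show ?thesis .
    qed
    have "(\<Sum>i\<le>k. ?b i * R i x) = ?W x * (\<Sum>i\<le>k. ?b i * T x (c i * vphi x))"
      using True by (simp add: R_def sum_distrib_left mult_ac)
    also have "(\<Sum>i\<le>k. ?b i * T x (c i * vphi x)) = (\<Sum>i\<le>k. ?b i * poly Q (x + c i * vphi x))"
      unfolding T_def right_diff_distrib sum_subtractf z by simp
    finally show ?thesis using True sym_diff_in_domain[OF x assms(3), of k "poly Q"] by (simp add: c_def)
  next
    case False
    then show ?thesis using sym_diff_in_domain[OF x assms(3), of k "poly Q"] by (simp add: R_def)
  qed
  have bR: "(\<lambda>x. ?b i * R i x) \<in> borel_measurable (lebesgue_on {-1..1})" "R i \<in> borel_measurable (lebesgue_on {-1..1})" for i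
    by (intro borel_measurable_lebesgue_onI; measurable)+
  have mN: "?N \<in> borel_measurable (lebesgue_on {-1..1})" "\<Phi> \<in> borel_measurable (lebesgue_on {-1..1})"
    by (intro borel_measurable_lebesgue_onI; measurable)+
  have "Lp_norm p (\<lambda>x. ?W x * sym_diff k (h * vphi x) (poly Q) x) \<le> Lp_norm p (\<lambda>x. \<Sum>i\<le>k. ?b i * R i x)"
  proof (rule Lp_norm_mono[OF assms(1) weighted_sym_diff_measurable[OF assms(2,3)]])
    show "poly Q \<in> borel_measurable (lebesgue_on {-1..1})" by (intro borel_measurable_lebesgue_onI) measurable
    show "AE x in lebesgue_on {-1..1}. \<bar>?W x * sym_diff k (h * vphi x) (poly Q) x\<bar> \<le> \<bar>\<Sum>i\<le>k. ?b i * R i x\<bar>"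
      using AE_open_interval by eventually_elim (simp add: decomp)
  qed
  also have "\<dots> \<le> (\<Sum>i\<le>k. Lp_norm p (\<lambda>x. ?b i * R i x))"
    by (rule Lp_norm_sum[OF assms(1)]) (use bR in auto)
  also have "\<dots> \<le> (\<Sum>i\<le>k. ennreal (real (k choose i)) * (4 * (ennreal ((real k * h) ^ k) * Lp_norm p ?N)))"
  proof (rule sum_mono)
    fix i assume "i \<in> {..k}"
    then have i: "i \<le> k" by simp
    have "Lp_norm p (\<lambda>x. ?b i * R i x) \<le> ennreal (real (k choose i)) * Lp_norm p (R i)"
      by (rule Lp_norm_scale[OF assms(1) bR(1) _ _ bR(2)]) (use i in \<open>auto simp: abs_mult power_abs\<close>)
    also have "\<dots> \<le> ennreal (real (k choose i)) * (4 * Lp_norm p \<Phi>)" by (intro mult_left_mono LpR i) auto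
    also have "Lp_norm p \<Phi> \<le> ennreal ((real k * h) ^ k) * Lp_norm p ?N"
      by (rule Lp_norm_scale[OF assms(1) mN(2) _ _ mN(1)]) (use h assms in \<open>auto simp: \<Phi>_def abs_mult\<close>)
    finally show "Lp_norm p (\<lambda>x. ?b i * R i x) \<le> ennreal (real (k choose i)) * (4 * (ennreal ((real k * h) ^ k) * Lp_norm p ?N))"
      by (simp add: mult_left_mono)
  qed
  also have "\<dots> = ennreal (real (\<Sum>i\<le>k. k choose i)) * (4 * (ennreal ((real k * h) ^ k) * Lp_norm p ?N))"
    by (simp add: sum_distrib_right[symmetric] sum_ennreal)
  also have "\<dots> = ennreal (2 ^ k * (4 * (real k * h) ^ k)) * Lp_norm p ?N"
    unfolding choose_row_sum using h by (simp add: ennreal_mult mult.assoc)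
  also have "2 ^ k * (4 * (real k * h) ^ k) = 4 * (2 * real k) ^ k * h ^ k"
    by (simp add: power_mult_distrib)
  finally show ?thesis .
qed

section \<open>Termwise differentiation of series of polynomials\<close>

lemma ennreal_abs_suminf_le:
  fixes d :: "nat \<Rightarrow> real"
  assumes "summable d"
  shows "ennreal \<bar>suminf d\<bar> \<le> (\<Sum>j. ennreal \<bar>d j\<bar>)"
proof (rule LIMSEQ_le_const2)
  show "(\<lambda>n. ennreal \<bar>\<Sum>j<n. d j\<bar>) \<longlonglongrightarrow> ennreal \<bar>suminf d\<bar>"
    using assms by (intro tendsto_ennrealI tendsto_rabs summable_LIMSEQ)
  show "\<exists>N. \<forall>n\<ge>N. ennreal \<bar>\<Sum>j<n. d j\<bar> \<le> (\<Sum>j. ennreal \<bar>d j\<bar>)"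
  proof (intro exI allI impI)
    fix n
    have "ennreal \<bar>\<Sum>j<n. d j\<bar> \<le> ennreal (\<Sum>j<n. \<bar>d j\<bar>)" by (intro ennreal_leI sum_abs)
    also have "\<dots> = (\<Sum>j<n. ennreal \<bar>d j\<bar>)" by (simp add: sum_ennreal)
    also have "\<dots> \<le> (\<Sum>j. ennreal \<bar>d j\<bar>)" by (intro sum_le_suminf) auto
    finally show "ennreal \<bar>\<Sum>j<n. d j\<bar> \<le> (\<Sum>j. ennreal \<bar>d j\<bar>)" .
  qed
qed

lemma poly_increment_le:
  fixes P :: "real poly"
  assumes "x \<le> y"
  shows "ennreal \<bar>poly P y - poly P x\<bar> \<le> (\<integral>\<^sup>+z. ennreal \<bar>poly (pderiv P) z\<bar> * indicator {x..y} z \<partial>lborel)"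
proof -
  have I: "(poly (pderiv P) has_integral poly P y - poly P x) {x..y}"
    using assms by (intro fundamental_theorem_of_calculus)
      (auto simp: has_real_derivative_iff_has_vector_derivative[symmetric] intro!: DERIV_subset[OF poly_DERIV])
  have i: "(\<lambda>z. \<bar>poly (pderiv P) z\<bar>) integrable_on {x..y}"
    by (intro integrable_continuous_real continuous_intros)
  have "norm (integral {x..y} (poly (pderiv P))) \<le> integral {x..y} (\<lambda>z. \<bar>poly (pderiv P) z\<bar>)"
    by (rule integral_norm_bound_integral) (use I i in auto)
  then have "\<bar>poly P y - poly P x\<bar> \<le> integral {x..y} (\<lambda>z. \<bar>poly (pderiv P) z\<bar>)"
    using integral_unique[OF I] by simp
  also have "ennreal \<dots> = (\<integral>\<^sup>+z. ennreal \<bar>poly (pderiv P) z\<bar> * indicator {x..y} z \<partial>lborel)"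
    by (rule nn_integral_has_integral_lebesgue'[symmetric]) (use i in auto)
  finally show ?thesis by (simp add: ennreal_leI)
qed

text \<open>Its integral over an interval bounds the increment of the remainder of the series from
  index m on. It is extended-valued, since only its integral will be known to be finite.\<close>

definition tail_variation :: "(nat \<Rightarrow> real poly) \<Rightarrow> nat \<Rightarrow> real \<Rightarrow> ennreal" where
  "tail_variation P m x = (\<Sum>j. ennreal \<bar>poly (pderiv (P (j + m))) x\<bar>)"

lemma borel_measurable_tail_variation [measurable]: "tail_variation P m \<in> borel_measurable borel"
  unfolding tail_variation_def by measurable

text \<open>Each term is bounded by the integral of its derivative, and the sum is then taken under
  the integral, so no differentiability of the limit is used.\<close>

lemma tail_increment_le:
  assumes "x \<le> y" "summable (\<lambda>j. poly (P j) x)" "summable (\<lambda>j. poly (P j) y)"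
  shows "ennreal \<bar>(\<Sum>j. poly (P (j + m)) y) - (\<Sum>j. poly (P (j + m)) x)\<bar> \<le> (\<integral>\<^sup>+z. tail_variation P m z * indicator {x..y} z \<partial>lborel)"
proof -
  have s: "summable (\<lambda>j. poly (P (j + m)) x)" "summable (\<lambda>j. poly (P (j + m)) y)"
    using assms by (auto intro: summable_ignore_initial_segment)
  have "(\<Sum>j. poly (P (j + m)) y) - (\<Sum>j. poly (P (j + m)) x) = (\<Sum>j. poly (P (j + m)) y - poly (P (j + m)) x)"
    using s by (intro suminf_diff)
  then have "ennreal \<bar>(\<Sum>j. poly (P (j + m)) y) - (\<Sum>j. poly (P (j + m)) x)\<bar> \<le> (\<Sum>j. ennreal \<bar>poly (P (j + m)) y - poly (P (j + m)) x\<bar>)"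
    using ennreal_abs_suminf_le[OF summable_diff[OF s(2,1)]] by simp
  also have "\<dots> \<le> (\<Sum>j. \<integral>\<^sup>+z. ennreal \<bar>poly (pderiv (P (j + m))) z\<bar> * indicator {x..y} z \<partial>lborel)"
    by (intro suminf_le poly_increment_le assms) auto
  also have "\<dots> = (\<integral>\<^sup>+z. (\<Sum>j. ennreal \<bar>poly (pderiv (P (j + m))) z\<bar> * indicator {x..y} z) \<partial>lborel)"
    by (rule nn_integral_suminf[symmetric]) measurable
  also have "\<dots> = (\<integral>\<^sup>+z. tail_variation P m z * indicator {x..y} z \<partial>lborel)"
    by (simp add: tail_variation_def)
  finally show ?thesis .
qed

lemma tail_integral_tendsto_0:
  assumes "(\<Sum>j. \<integral>\<^sup>+z. ennreal \<bar>poly (pderiv (P j)) z\<bar> * indicator A z \<partial>lborel) < \<infinity>" and A: "A \<in> sets borel"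
  shows "(\<lambda>m. \<integral>\<^sup>+z. tail_variation P m z * indicator A z \<partial>lborel) \<longlonglongrightarrow> 0"
proof -
  define I where "I = (\<lambda>j. \<integral>\<^sup>+z. ennreal \<bar>poly (pderiv (P j)) z\<bar> * indicator A z \<partial>lborel)"
  have [measurable]: "A \<in> sets borel" by fact
  have I: "suminf I < \<infinity>" using assms by (simp add: I_def)
  have fin: "I j < \<infinity>" for j using ennreal_suminf_lessD[OF I] by simp
  define a where "a = (\<lambda>j. enn2real (I j))"
  have Ia: "I = (\<lambda>j. ennreal (a j))" using fin by (auto simp: a_def less_top)
  have a0: "0 \<le> a j" for j by (simp add: a_def)
  have sa: "summable a" using I a0 unfolding Ia by (intro summable_suminf_not_top) auto
  have "(\<integral>\<^sup>+z. tail_variation P m z * indicator A z \<partial>lborel) = ennreal (\<Sum>j. a (j + m))" for m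
  proof -
    have "(\<integral>\<^sup>+z. tail_variation P m z * indicator A z \<partial>lborel) = (\<Sum>j. I (j + m))"
      unfolding tail_variation_def I_def ennreal_suminf_multc[symmetric] by (rule nn_integral_suminf) measurable
    also have "\<dots> = ennreal (\<Sum>j. a (j + m))"
      unfolding Ia using a0 sa by (intro suminf_ennreal2 summable_ignore_initial_segment) auto
    finally show ?thesis .
  qed
  moreover have "(\<lambda>m. ennreal (\<Sum>j. a (j + m))) \<longlonglongrightarrow> ennreal 0"
    by (intro tendsto_ennrealI suminf_exist_split2 sa)
  ultimately show ?thesis by simp
qed

text \<open>Every point of \<open>E\<close> is the centre of an interval on which v has mean above
  l/2. A disjoint subfamily has fivefold enlargements that cover \<open>E\<close>; radius r enlarges
  to length 10 r, and l r is below the integral of v over the interval. A Borel superset is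
  delivered because \<open>E\<close> itself is not assumed to be measurable.\<close>

lemma Vitali_maximal_inequality:
  fixes v :: "real \<Rightarrow> ennreal"
  assumes [measurable]: "v \<in> borel_measurable borel" and l: "0 < l"
    and E: "\<And>x. x \<in> E \<Longrightarrow> a < x \<and> x < b"
    and dense: "\<And>x e. x \<in> E \<Longrightarrow> 0 < e \<Longrightarrow> \<exists>r. 0 < r \<and> r < e \<and> ennreal (l * r) < (\<integral>\<^sup>+z. v z * indicator {x - r..x + r} z \<partial>lborel)"
  shows "\<exists>T\<in>sets borel. E \<subseteq> T \<and> emeasure lborel T \<le> ennreal (10 / l) * (\<integral>\<^sup>+z. v z * indicator {a..b} z \<partial>lborel)"
proof -
  define K where "K = {(x, r). 0 < r \<and> a \<le> x - r \<and> x + r \<le> b \<and> ennreal (l * r) < (\<integral>\<^sup>+z. v z * indicator {x - r..x + r} z \<partial>lborel)}"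
  have cov: "E \<subseteq> (\<Union>i\<in>K. cball (fst i) (snd i))"
  proof
    fix x assume x: "x \<in> E"
    then have "0 < min (x - a) (b - x)" using E by force
    from dense[OF x this] obtain r where "0 < r" "r < min (x - a) (b - x)" "ennreal (l * r) < (\<integral>\<^sup>+z. v z * indicator {x - r..x + r} z \<partial>lborel)" by blast
    then have "(x, r) \<in> K" by (auto simp: K_def)
    moreover have "x \<in> cball (fst (x, r)) (snd (x, r))" using \<open>0 < r\<close> by simp
    ultimately show "x \<in> (\<Union>i\<in>K. cball (fst i) (snd i))" by (rule UN_I)
  qed
  have rb: "\<And>i. i \<in> K \<Longrightarrow> 0 < snd i \<and> snd i \<le> b - a" by (auto simp: K_def)
  obtain C where C: "countable C" "C \<subseteq> K" "pairwise (\<lambda>i j. disjnt (cball (fst i) (snd i)) (cball (fst j) (snd j))) C"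
    "E \<subseteq> (\<Union>i\<in>C. cball (fst i) (5 * snd i))"
    by (rule Vitali_covering_lemma_cballs[OF cov rb], assumption) (rule that; assumption)
  let ?J = "to_nat_on C ` C"
  define A where "A = (\<lambda>c n. if n \<in> ?J then cball (fst (from_nat_into C n)) (c * snd (from_nat_into C n)) else {})"
  have inv: "from_nat_into C n \<in> C" if "n \<in> ?J" for n using that C(1) by auto
  have [measurable]: "A c n \<in> sets borel" for c n by (simp add: A_def)
  have UA: "(\<Union>i\<in>C. cball (fst i) (c * snd i)) = (\<Union>n. A c n)" for c
  proof -
    have "(\<Union>n. A c n) = (\<Union>n\<in>?J. cball (fst (from_nat_into C n)) (c * snd (from_nat_into C n)))"
      by (auto simp: A_def split: if_splits)
    also have "\<dots> = (\<Union>i\<in>C. cball (fst i) (c * snd i))" using C(1) by simp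
    finally show ?thesis ..
  qed
  have disj: "disjoint_family (A 1)"
  proof (unfold disjoint_family_on_def, intro ballI impI)
    fix m n :: nat assume mn: "m \<noteq> n"
    show "A 1 m \<inter> A 1 n = {}"
    proof (cases "m \<in> ?J \<and> n \<in> ?J")
      case True
      then obtain i j where ij: "i \<in> C" "j \<in> C" "m = to_nat_on C i" "n = to_nat_on C j" by auto
      then have "i \<noteq> j" using mn by auto
      then have "disjnt (cball (fst i) (snd i)) (cball (fst j) (snd j))" using C(3) ij by (auto simp: pairwise_def)
      then show ?thesis using ij C(1) by (simp add: A_def disjnt_def)
    qed (auto simp: A_def)
  qed
  have each: "emeasure lborel (A 5 n) \<le> ennreal (10 / l) * (\<integral>\<^sup>+z. v z * indicator (A 1 n) z \<partial>lborel)" for n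
  proof (cases "n \<in> ?J")
    case True
    obtain x r where xr: "from_nat_into C n = (x, r)" by (cases "from_nat_into C n")
    then have "(x, r) \<in> K" using inv[OF True] C(2) by auto
    then have r: "0 < r" "ennreal (l * r) < (\<integral>\<^sup>+z. v z * indicator {x - r..x + r} z \<partial>lborel)" by (auto simp: K_def)
    have "emeasure lborel (A 5 n) = ennreal (10 * r)"
      using True xr r by (simp add: A_def cball_eq_atLeastAtMost)
    also have "10 * r = 10 / l * (l * r)" using l by simp
    also have "ennreal \<dots> = ennreal (10 / l) * ennreal (l * r)" using l r by (intro ennreal_mult) auto
    also have "\<dots> \<le> ennreal (10 / l) * (\<integral>\<^sup>+z. v z * indicator (A 1 n) z \<partial>lborel)"
      using True xr r by (intro mult_left_mono) (auto simp: A_def cball_eq_atLeastAtMost)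
    finally show ?thesis .
  qed (simp add: A_def)
  have "emeasure lborel (\<Union>n. A 5 n) \<le> (\<Sum>n. emeasure lborel (A 5 n))"
    by (rule emeasure_subadditive_countably) auto
  also have "\<dots> \<le> (\<Sum>n. ennreal (10 / l) * (\<integral>\<^sup>+z. v z * indicator (A 1 n) z \<partial>lborel))"
    by (intro suminf_le each) auto
  also have "\<dots> = ennreal (10 / l) * (\<Sum>n. \<integral>\<^sup>+z. v z * indicator (A 1 n) z \<partial>lborel)" by simp
  also have "(\<Sum>n. \<integral>\<^sup>+z. v z * indicator (A 1 n) z \<partial>lborel) = (\<integral>\<^sup>+z. (\<Sum>n. v z * indicator (A 1 n) z) \<partial>lborel)"
    by (rule nn_integral_suminf[symmetric]) measurable
  also have "\<dots> = (\<integral>\<^sup>+z. v z * indicator (\<Union>n. A 1 n) z \<partial>lborel)"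
    by (simp add: suminf_indicator[OF disj])
  also have "\<dots> \<le> (\<integral>\<^sup>+z. v z * indicator {a..b} z \<partial>lborel)"
  proof (intro nn_integral_mono mult_left_mono)
    have "(\<Union>n. A 1 n) \<subseteq> {a..b}" unfolding UA[symmetric] using C(2)
      by (force simp: K_def cball_eq_atLeastAtMost)
    then show "indicator (\<Union>n. A 1 n) z \<le> (indicator {a..b} z :: ennreal)" for z by (intro indicator_leI) blast
  qed auto
  finally have "emeasure lborel (\<Union>n. A 5 n) \<le> ennreal (10 / l) * (\<integral>\<^sup>+z. v z * indicator {a..b} z \<partial>lborel)"
    by (simp add: mult_left_mono)
  moreover have "E \<subseteq> (\<Union>n. A 5 n)" using C(4) unfolding UA .
  moreover have "(\<Union>n. A 5 n) \<in> sets borel" by measurable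
  ultimately show ?thesis by blast
qed

text \<open>Termwise differentiation almost everywhere. The exceptional set of a level \<open>l\<close> is covered, for
  every \<open>m\<close>, by the set where the averages of the tail variation from \<open>m\<close> on exceed \<open>l\<close>, and its
  measure tends to \<open>0\<close> with \<open>m\<close>.\<close>

lemma series_derivative_AE:
  fixes P :: "nat \<Rightarrow> real poly"
  assumes ab: "a < b" and sum: "\<And>x. a \<le> x \<Longrightarrow> x \<le> b \<Longrightarrow> summable (\<lambda>j. poly (P j) x)"
    and fin: "(\<Sum>j. \<integral>\<^sup>+z. ennreal \<bar>poly (pderiv (P j)) z\<bar> * indicator {a..b} z \<partial>lborel) < \<infinity>"
  shows "AE x in lborel. a < x \<and> x < b \<longrightarrow> summable (\<lambda>j. poly (pderiv (P j)) x) \<and>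
    ((\<lambda>x. \<Sum>j. poly (P j) x) has_real_derivative (\<Sum>j. poly (pderiv (P j)) x)) (at x)"
proof -
  let ?V = "tail_variation P"
  let ?I = "\<lambda>m. \<integral>\<^sup>+z. ?V m z * indicator {a..b} z \<partial>lborel"
  have I0: "?I \<longlonglongrightarrow> 0" by (rule tail_integral_tendsto_0[OF fin]) auto
  define E where "E = (\<lambda>l m. {x. a < x \<and> x < b \<and> (\<forall>e>0. \<exists>r. 0 < r \<and> r < e \<and> ennreal (l * r) < (\<integral>\<^sup>+z. ?V m z * indicator {x - r..x + r} z \<partial>lborel))})"
  have bad: "\<exists>N\<in>null_sets lborel. (\<Inter>m. E l m) \<subseteq> N" if l: "0 < l" for l
  proof -
    have "\<exists>T\<in>sets borel. E l m \<subseteq> T \<and> emeasure lborel T \<le> ennreal (10 / l) * ?I m" for m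
    proof (rule Vitali_maximal_inequality[OF borel_measurable_tail_variation l])
      show "a < x \<and> x < b" if "x \<in> E l m" for x using that unfolding E_def by blast
      show "\<exists>r. 0 < r \<and> r < e \<and> ennreal (l * r) < (\<integral>\<^sup>+z. ?V m z * indicator {x - r..x + r} z \<partial>lborel)"
        if "x \<in> E l m" "0 < e" for x e using that unfolding E_def by blast
    qed
    then have "\<forall>m. \<exists>T. T \<in> sets borel \<and> E l m \<subseteq> T \<and> emeasure lborel T \<le> ennreal (10 / l) * ?I m" by blast
    from choice[OF this] obtain T where T: "\<And>m. T m \<in> sets borel" "\<And>m. E l m \<subseteq> T m" "\<And>m. emeasure lborel (T m) \<le> ennreal (10 / l) * ?I m" by blast
    have "emeasure lborel (\<Inter>m. T m) \<le> 0"
    proof (rule LIMSEQ_le_const)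
      show "(\<lambda>m. ennreal (10 / l) * ?I m) \<longlonglongrightarrow> 0"
        using ennreal_tendsto_cmult[OF _ I0, of "ennreal (10 / l)"] by simp
      have "emeasure lborel (\<Inter>m. T m) \<le> ennreal (10 / l) * ?I m" for m
        by (rule order_trans[OF emeasure_mono T(3)]) (use T(1) in auto)
      then show "\<exists>N. \<forall>n\<ge>N. emeasure lborel (\<Inter>m. T m) \<le> ennreal (10 / l) * ?I n" by auto
    qed
    then have "(\<Inter>m. T m) \<in> null_sets lborel" using T(1) by (intro null_setsI) auto
    then show ?thesis using T(2) by (intro bexI[of _ "\<Inter>m. T m"]) auto
  qed
  \<comment> \<open>The countably many levels 1/(n+1) suffice, since one of them lies below any
    given positive number.\<close>
  have A1: "AE x in lborel. \<forall>n. x \<notin> (\<Inter>m. E (1 / real (Suc n)) m)"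
    unfolding AE_all_countable
  proof
    fix n
    obtain N where "N \<in> null_sets lborel" "(\<Inter>m. E (1 / real (Suc n)) m) \<subseteq> N" using bad[of "1 / real (Suc n)"] by auto
    then show "AE x in lborel. x \<notin> (\<Inter>m. E (1 / real (Suc n)) m)"
      by (intro AE_I'[of N]) auto
  qed
  have "(\<integral>\<^sup>+z. ?V 0 z * indicator {a..b} z \<partial>lborel) \<noteq> \<infinity>"
  proof -
    have "(\<integral>\<^sup>+z. ?V 0 z * indicator {a..b} z \<partial>lborel) = (\<Sum>j. \<integral>\<^sup>+z. ennreal \<bar>poly (pderiv (P j)) z\<bar> * indicator {a..b} z \<partial>lborel)"
      unfolding tail_variation_def ennreal_suminf_multc[symmetric] by (subst nn_integral_suminf) auto
    then show ?thesis using fin by auto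
  qed
  then have A2: "AE x in lborel. ?V 0 x * indicator {a..b} x \<noteq> \<infinity>"
    by (intro nn_integral_PInf_AE) measurable
  from A1 A2 show ?thesis
  proof eventually_elim
    fix x assume x1: "\<forall>n. x \<notin> (\<Inter>m. E (1 / real (Suc n)) m)" and x2: "?V 0 x * indicator {a..b} x \<noteq> \<infinity>"
    show "a < x \<and> x < b \<longrightarrow> summable (\<lambda>j. poly (pderiv (P j)) x) \<and>
      ((\<lambda>x. \<Sum>j. poly (P j) x) has_real_derivative (\<Sum>j. poly (pderiv (P j)) x)) (at x)"
    proof (intro impI conjI)
      assume x: "a < x \<and> x < b"
      let ?p = "\<lambda>j. poly (pderiv (P j)) x"
      have "(\<Sum>j. ennreal \<bar>?p j\<bar>) \<noteq> \<infinity>" using x2 x by (simp add: tail_variation_def indicator_def)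
      then have abs: "summable (\<lambda>j. \<bar>?p j\<bar>)" by (intro summable_suminf_not_top) auto
      then show sp: "summable ?p" by (rule summable_rabs_cancel)
      let ?S = "\<lambda>x. \<Sum>j. poly (P j) x" and ?G = "suminf ?p"
      show "(?S has_real_derivative ?G) (at x)"
        unfolding has_field_derivative_def has_derivative_at_alt
      proof (intro conjI allI impI bounded_linear_mult_right)
        fix e :: real assume e: "0 < e"
        \<comment> \<open>Three errors of size e/4 are to be met: in the increment of the remainder,
          in the difference quotient of the finite sum, and in the remainder of the derivative
          series.\<close>
        obtain n where n: "1 / real (Suc n) < e / 4" using e by (meson nat_approx_posE zero_less_divide_iff zero_less_numeral)
        obtain m0 where m0: "x \<notin> E (1 / real (Suc n)) m0" using x1 by auto
        have "(\<lambda>m. \<Sum>j. \<bar>?p (j + m)\<bar>) \<longlonglongrightarrow> 0" by (rule suminf_exist_split2[OF abs])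
        then have "\<forall>\<^sub>F m in sequentially. (\<Sum>j. \<bar>?p (j + m)\<bar>) < e / 4" using e by (intro order_tendstoD) auto
        then obtain m1 where m1: "\<And>m. m \<ge> m1 \<Longrightarrow> (\<Sum>j. \<bar>?p (j + m)\<bar>) < e / 4" by (auto simp: eventually_sequentially)
        define m where "m = max m0 m1"
        \<comment> \<open>x avoids the exceptional set for one index m0; since the tail variation
          decreases in the index, m can be raised until the derivative series has a small tail
          too.\<close>
        have Vm: "?V m z \<le> ?V m0 z" for z
        proof -
          have "?V m0 z = (\<Sum>j. ennreal \<bar>poly (pderiv (P (j + m0))) z\<bar>)" by (simp add: tail_variation_def)
          also have "\<dots> = (\<Sum>j. ennreal \<bar>poly (pderiv (P (j + (m - m0) + m0))) z\<bar>) + (\<Sum>j<m - m0. ennreal \<bar>poly (pderiv (P (j + m0))) z\<bar>)"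
            by (rule suminf_offset) auto
          also have "\<dots> \<ge> (\<Sum>j. ennreal \<bar>poly (pderiv (P (j + (m - m0) + m0))) z\<bar>)" by simp
          also have "(\<lambda>j. P (j + (m - m0) + m0)) = (\<lambda>j. P (j + m))" by (simp add: m_def fun_eq_iff add.assoc)
          finally show ?thesis by (simp add: tail_variation_def m_def)
        qed
        obtain d0 where d0: "0 < d0" "\<And>r. 0 < r \<Longrightarrow> r < d0 \<Longrightarrow> (\<integral>\<^sup>+z. ?V m0 z * indicator {x - r..x + r} z \<partial>lborel) \<le> ennreal (1 / real (Suc n) * r)"
        proof -
          obtain d0 where "0 < d0" and "\<forall>r. \<not> (0 < r \<and> r < d0 \<and> ennreal (1 / real (Suc n) * r) < (\<integral>\<^sup>+z. ?V m0 z * indicator {x - r..x + r} z \<partial>lborel))"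
            using m0 x unfolding E_def by blast
          then show thesis using that[of d0] by (meson not_less)
        qed
        have D: "((\<lambda>x. \<Sum>j<m. poly (P j) x) has_real_derivative (\<Sum>j<m. ?p j)) (at x)"
          by (intro DERIV_sum poly_DERIV)
        have e4: "0 < e / 4" using e by simp
        obtain d1 where d1: "0 < d1" "\<And>y. norm (y - x) < d1 \<Longrightarrow> norm ((\<Sum>j<m. poly (P j) y) - (\<Sum>j<m. poly (P j) x) - (\<Sum>j<m. ?p j) * (y - x)) \<le> e / 4 * norm (y - x)"
          using D[unfolded has_field_derivative_def has_derivative_at_alt, THEN conjunct2, rule_format, OF e4] by blast
        define dd where "dd = min (min d0 d1) (min (x - a) (b - x))"
        show "\<exists>d>0. \<forall>y. norm (y - x) < d \<longrightarrow> norm (?S y - ?S x - ?G * (y - x)) \<le> e * norm (y - x)"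
        proof (intro exI[of _ dd] conjI allI impI)
          show "0 < dd" using d0 d1 x by (simp add: dd_def)
          fix y assume y: "norm (y - x) < dd"
          have yab: "a \<le> y" "y \<le> b" using y x by (auto simp: dd_def abs_if split: if_splits)
          let ?t = "\<lambda>z. \<Sum>j. poly (P (j + m)) z"
          have Sy: "?S z = ?t z + (\<Sum>j<m. poly (P j) z)" if "a \<le> z" "z \<le> b" for z
            using sum[OF that] by (rule suminf_split_initial_segment)
          have G: "?G = (\<Sum>j. ?p (j + m)) + (\<Sum>j<m. ?p j)" using sp by (rule suminf_split_initial_segment)
          have tail: "\<bar>?t y - ?t x\<bar> \<le> e / 4 * \<bar>y - x\<bar>"
          proof (cases "y = x")
            case False
            define r where "r = \<bar>y - x\<bar>"
            have r: "0 < r" "r < d0" using False y by (auto simp: r_def dd_def)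
            have "ennreal \<bar>?t y - ?t x\<bar> \<le> (\<integral>\<^sup>+z. ?V m z * indicator {min x y..max x y} z \<partial>lborel)"
              using tail_increment_le[of x y P m] tail_increment_le[of y x P m] sum[of x] sum[of y] x yab
              by (cases "x \<le> y") (auto simp: abs_minus_commute min_def max_def)
            also have "\<dots> \<le> (\<integral>\<^sup>+z. ?V m0 z * indicator {x - r..x + r} z \<partial>lborel)"
              by (intro nn_integral_mono mult_mono Vm) (auto simp: indicator_def r_def)
            also have "\<dots> \<le> ennreal (1 / real (Suc n) * r)" by (rule d0(2)[OF r])
            also have "\<dots> \<le> ennreal (e / 4 * r)" using n r by (intro ennreal_leI mult_right_mono) auto
            finally show ?thesis using e r by (subst (asm) ennreal_le_iff) (auto simp: r_def)
          qed simp
          have tp: "\<bar>\<Sum>j. ?p (j + m)\<bar> \<le> e / 4"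
          proof -
            have "\<bar>\<Sum>j. ?p (j + m)\<bar> \<le> (\<Sum>j. \<bar>?p (j + m)\<bar>)"
              by (rule summable_rabs) (rule summable_ignore_initial_segment[OF abs])
            also have "\<dots> < e / 4" by (rule m1) (simp add: m_def)
            finally show ?thesis by simp
          qed
          have "?S y - ?S x - ?G * (y - x) = (?t y - ?t x) + ((\<Sum>j<m. poly (P j) y) - (\<Sum>j<m. poly (P j) x) - (\<Sum>j<m. ?p j) * (y - x)) - (\<Sum>j. ?p (j + m)) * (y - x)"
            using Sy[of x] Sy[of y] x yab by (simp add: G algebra_simps)
          also have "\<bar>\<dots>\<bar> \<le> e / 4 * \<bar>y - x\<bar> + e / 4 * \<bar>y - x\<bar> + e / 4 * \<bar>y - x\<bar>"
          proof -
            have "\<bar>(\<Sum>j. ?p (j + m)) * (y - x)\<bar> \<le> e / 4 * \<bar>y - x\<bar>" unfolding abs_mult by (rule mult_right_mono[OF tp]) simp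
            moreover have "\<bar>(\<Sum>j<m. poly (P j) y) - (\<Sum>j<m. poly (P j) x) - (\<Sum>j<m. ?p j) * (y - x)\<bar> \<le> e / 4 * \<bar>y - x\<bar>"
              using d1(2)[of y] y by (simp add: dd_def)
            ultimately show ?thesis using tail by linarith
          qed
          also have "\<dots> \<le> e * \<bar>y - x\<bar>" using e by simp
          finally show "norm (?S y - ?S x - ?G * (y - x)) \<le> e * norm (y - x)" by simp
        qed
      qed
    qed
  qed
qed

section \<open>Local estimates for polynomials and absolute continuity of the limit\<close>

lemma ennreal_add_left_le_less:
  fixes a b c d :: ennreal
  assumes "a \<le> ennreal x" "b < d"
  shows "a + b < ennreal x + d"
proof -
  have "a + b \<le> ennreal x + b" using assms by (intro add_right_mono)
  also have "\<dots> < ennreal x + d" using assms by (simp add: ennreal_add_left_cancel_less)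
  finally show ?thesis .
qed

text \<open>On a compact subinterval the weight is continuous and positive, hence bounded below by
  its minimum; the passage from the norm to L_1 contributes the 3.\<close>

lemma poly_local_L1_le:
  assumes "1 \<le> p" "-1 < a" "a < b" "b < 1"
  obtains C where "0 < C" "\<And>D. (\<integral>\<^sup>+z. ennreal \<bar>poly D z\<bar> * indicator {a..b} z \<partial>lborel) \<le>
    ennreal C * Lp_norm p (\<lambda>x. jacobi_w \<alpha> \<beta> x * (vphi x ^ i * poly D x))"
proof -
  define \<omega> where "\<omega> = (\<lambda>x. jacobi_w \<alpha> \<beta> x * vphi x ^ i)"
  have "continuous_on {a..b} \<omega>"
    unfolding \<omega>_def vphi_def using assms
    by (intro continuous_intros continuous_on_subset[OF continuous_on_jacobi_w]) auto
  then obtain x0 where x0: "x0 \<in> {a..b}" "\<And>x. x \<in> {a..b} \<Longrightarrow> \<omega> x0 \<le> \<omega> x"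
    using continuous_attains_inf[of "{a..b}" \<omega>] assms by force
  have pos: "0 < \<omega> x0" 
  proof -
    have "\<bar>x0\<bar> < 1" using x0(1) assms by (auto simp: abs_less_iff)
    then have "0 < vphi x0" by (simp add: vphi_def abs_square_less_1)
    moreover have "0 < jacobi_w \<alpha> \<beta> x0" using \<open>\<bar>x0\<bar> < 1\<close> by (auto simp: jacobi_w_def abs_less_iff)
    ultimately show ?thesis by (simp add: \<omega>_def)
  qed
  show thesis
  proof (rule that[of "3 / \<omega> x0"])
    show "0 < 3 / \<omega> x0" using pos by simp
    fix D :: "real poly"
    let ?f = "\<lambda>x. jacobi_w \<alpha> \<beta> x * (vphi x ^ i * poly D x)"
    have "(\<integral>\<^sup>+z. ennreal \<bar>poly D z\<bar> * indicator {a..b} z \<partial>lborel) \<le> (\<integral>\<^sup>+z. ennreal (1 / \<omega> x0) * (ennreal \<bar>?f z\<bar> * indicator {-1..1} z) \<partial>lborel)"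
    proof (rule nn_integral_mono)
      fix z
      show "ennreal \<bar>poly D z\<bar> * indicator {a..b} z \<le> ennreal (1 / \<omega> x0) * (ennreal \<bar>?f z\<bar> * indicator {-1..1} z)"
      proof (cases "z \<in> {a..b}")
        case True
        have "\<omega> x0 * \<bar>poly D z\<bar> \<le> \<omega> z * \<bar>poly D z\<bar>" using x0(2)[OF True] by (intro mult_right_mono) auto
        also have "\<dots> \<le> \<bar>\<omega> z * poly D z\<bar>" by (simp add: abs_mult mult_right_mono)
        also have "\<omega> z * poly D z = ?f z" by (simp add: \<omega>_def mult.assoc)
        finally have "\<bar>poly D z\<bar> \<le> 1 / \<omega> x0 * \<bar>?f z\<bar>" using pos by (simp add: field_simps)
        then have "ennreal \<bar>poly D z\<bar> \<le> ennreal (1 / \<omega> x0) * ennreal \<bar>?f z\<bar>"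
          using pos by (simp add: ennreal_mult[symmetric] ennreal_leI)
        then show ?thesis using True assms by simp
      qed simp
    qed
    also have "\<dots> = ennreal (1 / \<omega> x0) * (\<integral>\<^sup>+z. ennreal \<bar>?f z\<bar> \<partial>lebesgue_on {-1..1})"
      unfolding nn_integral_interval_lborel by (rule nn_integral_cmult) measurable
    also have "\<dots> \<le> ennreal (1 / \<omega> x0) * (3 * Lp_norm p ?f)"
      by (intro mult_left_mono nn_integral_abs_le_Lp_norm assms(1) jacobi_w_vphi_measurable) auto
    also have "\<dots> = ennreal (3 / \<omega> x0) * Lp_norm p ?f"
    proof -
      have "ennreal (3 / \<omega> x0) = ennreal (1 / \<omega> x0 * 3)" by simp
      also have "\<dots> = ennreal (1 / \<omega> x0) * 3" using pos by (subst ennreal_mult) auto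
      finally show ?thesis by (simp only: mult.assoc)
    qed
    finally show "(\<integral>\<^sup>+z. ennreal \<bar>poly D z\<bar> * indicator {a..b} z \<partial>lborel) \<le> ennreal (3 / \<omega> x0) * Lp_norm p ?f" .
  qed
qed

text \<open>Where |D| is smallest it is at most its mean, and from there to x it changes by at most
  the integral of |D'|. This turns L_1 bounds for two consecutive derivatives into a uniform
  bound.\<close>

lemma poly_sup_le_L1:
  fixes D :: "real poly"
  assumes "a < b" "x \<in> {a..b}"
  shows "ennreal \<bar>poly D x\<bar> \<le> ennreal (1 / (b - a)) * (\<integral>\<^sup>+z. ennreal \<bar>poly D z\<bar> * indicator {a..b} z \<partial>lborel)
    + (\<integral>\<^sup>+z. ennreal \<bar>poly (pderiv D) z\<bar> * indicator {a..b} z \<partial>lborel)"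
proof -
  have "continuous_on {a..b} (\<lambda>x. \<bar>poly D x\<bar>)" by (intro continuous_intros)
  then obtain y where y: "y \<in> {a..b}" "\<And>z. z \<in> {a..b} \<Longrightarrow> \<bar>poly D y\<bar> \<le> \<bar>poly D z\<bar>"
    using continuous_attains_inf[of "{a..b}" "\<lambda>x. \<bar>poly D x\<bar>"] assms by force
  have "ennreal \<bar>poly D y\<bar> = ennreal (1 / (b - a)) * (ennreal \<bar>poly D y\<bar> * ennreal (b - a))"
  proof -
    have "\<bar>poly D y\<bar> = 1 / (b - a) * (\<bar>poly D y\<bar> * (b - a))" using assms by simp
    then show ?thesis using assms by (metis abs_ge_zero diff_ge_0_iff_ge ennreal_mult less_imp_le mult_nonneg_nonneg zero_le_divide_1_iff)
  qed
  also have "ennreal \<bar>poly D y\<bar> * ennreal (b - a) = (\<integral>\<^sup>+z. ennreal \<bar>poly D y\<bar> * indicator {a..b} z \<partial>lborel)"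
    using assms by (simp add: nn_integral_cmult_indicator)
  also have "\<dots> \<le> (\<integral>\<^sup>+z. ennreal \<bar>poly D z\<bar> * indicator {a..b} z \<partial>lborel)"
    by (intro nn_integral_mono) (auto simp: indicator_def intro!: ennreal_leI y(2))
  finally have Dy: "ennreal \<bar>poly D y\<bar> \<le> ennreal (1 / (b - a)) * (\<integral>\<^sup>+z. ennreal \<bar>poly D z\<bar> * indicator {a..b} z \<partial>lborel)"
    by (simp add: mult_left_mono)
  have "ennreal \<bar>poly D x - poly D y\<bar> \<le> (\<integral>\<^sup>+z. ennreal \<bar>poly (pderiv D) z\<bar> * indicator {min x y..max x y} z \<partial>lborel)"
    using poly_increment_le[of x y D] poly_increment_le[of y x D]
    by (cases "x \<le> y") (auto simp: abs_minus_commute min_def max_def)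
  also have "\<dots> \<le> (\<integral>\<^sup>+z. ennreal \<bar>poly (pderiv D) z\<bar> * indicator {a..b} z \<partial>lborel)"
    using assms y(1) by (intro nn_integral_mono mult_left_mono indicator_leI) auto
  finally have Dxy: "ennreal \<bar>poly D x - poly D y\<bar> \<le> (\<integral>\<^sup>+z. ennreal \<bar>poly (pderiv D) z\<bar> * indicator {a..b} z \<partial>lborel)" .
  have "ennreal \<bar>poly D x\<bar> \<le> ennreal (\<bar>poly D y\<bar> + \<bar>poly D x - poly D y\<bar>)" by (intro ennreal_leI) linarith
  also have "\<dots> = ennreal \<bar>poly D y\<bar> + ennreal \<bar>poly D x - poly D y\<bar>" by simp
  finally show ?thesis using add_mono[OF Dy Dxy] by (rule order_trans)
qed

text \<open>Intervals of a division overlap only in endpoints, so their interiors are disjoint and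
  carry the integrals.\<close>

lemma sum_interior_integrals_le:
  fixes v :: "real \<Rightarrow> ennreal"
  assumes [measurable]: "v \<in> borel_measurable borel" and D: "D division_of T" and T: "T \<subseteq> {a..b}"
  shows "(\<Sum>K\<in>D. \<integral>\<^sup>+z. v z * indicator {Inf K..Sup K} z \<partial>lborel) \<le> (\<integral>\<^sup>+z. v z * indicator {a..b} z \<partial>lborel)"
proof -
  have fin: "finite D" using D by (rule division_ofD)
  have K: "\<exists>u w. u \<le> w \<and> K = {u..w} \<and> a \<le> u \<and> w \<le> b" if K: "K \<in> D" for K
  proof -
    obtain u w where uw: "K = cbox u w" using division_ofD(4)[OF D K] by blast
    have "K \<noteq> {}" "K \<subseteq> {a..b}" using division_ofD(2,3)[OF D K] T by auto
    then show ?thesis using uw by (intro exI[of _ u] exI[of _ w]) (auto simp: box_real)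
  qed
  have "(\<Sum>K\<in>D. \<integral>\<^sup>+z. v z * indicator {Inf K..Sup K} z \<partial>lborel) = (\<Sum>K\<in>D. \<integral>\<^sup>+z. v z * indicator (interior K) z \<partial>lborel)"
  proof (rule sum.cong[OF refl])
    fix K assume "K \<in> D"
    then obtain u w where uw: "u \<le> w" "K = {u..w}" using K by blast
    have "AE z in lborel. z \<noteq> u" "AE z in lborel. z \<noteq> w" by (rule AE_lborel_singleton)+
    then have "AE z in lborel. v z * indicator {Inf K..Sup K} z = v z * indicator (interior K) z"
      by eventually_elim (use uw in \<open>auto simp: indicator_def interior_atLeastAtMost_real\<close>)
    then show "(\<integral>\<^sup>+z. v z * indicator {Inf K..Sup K} z \<partial>lborel) = (\<integral>\<^sup>+z. v z * indicator (interior K) z \<partial>lborel)"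
      by (rule nn_integral_cong_AE)
  qed
  also have "\<dots> = (\<integral>\<^sup>+z. (\<Sum>K\<in>D. v z * indicator (interior K) z) \<partial>lborel)"
    by (rule nn_integral_sum[symmetric]) measurable
  also have "\<dots> \<le> (\<integral>\<^sup>+z. v z * indicator {a..b} z \<partial>lborel)"
  proof (rule nn_integral_mono)
    fix z
    have dj: "disjoint_family_on interior D"
      using division_ofD(5)[OF D] by (auto simp: disjoint_family_on_def)
    have "(\<Sum>K\<in>D. v z * indicator (interior K) z) = v z * indicator (\<Union>K\<in>D. interior K) z"
      unfolding sum_distrib_left[symmetric] by (simp add: indicator_UN_disjoint[OF fin dj])
    also have "\<dots> \<le> v z * indicator {a..b} z"
    proof (intro mult_left_mono indicator_leI)
      assume "z \<in> (\<Union>K\<in>D. interior K)"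
      then obtain K where "K \<in> D" "z \<in> K" using interior_subset by blast
      then show "z \<in> {a..b}" using K by fastforce
    qed simp
    finally show "(\<Sum>K\<in>D. v z * indicator (interior K) z) \<le> v z * indicator {a..b} z" .
  qed
  finally show ?thesis .
qed

text \<open>A finite part of the series is Lipschitz on the compact interval, and the increments of
  the remainder sum to less than e/2. The endpoint \<open>b'\<close> admits a = b while the integral
  bound refers to a proper interval.\<close>

lemma abs_cont_on_poly_series:
  assumes "a < b'" "b \<le> b'" and F: "\<And>x. a \<le> x \<Longrightarrow> x \<le> b \<Longrightarrow> F x = poly R x + (\<Sum>j. poly (P j) x)"
    and sum: "\<And>x. a \<le> x \<Longrightarrow> x \<le> b \<Longrightarrow> summable (\<lambda>j. poly (P j) x)"
    and fin: "(\<Sum>j. \<integral>\<^sup>+z. ennreal \<bar>poly (pderiv (P j)) z\<bar> * indicator {a..b'} z \<partial>lborel) < \<infinity>"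
  shows "abs_cont_on a b F"
  unfolding abs_cont_on_def
proof (intro allI impI)
  fix e :: real assume e: "0 < e"
  let ?I = "\<lambda>m. \<integral>\<^sup>+z. tail_variation P m z * indicator {a..b'} z \<partial>lborel"
  have "?I \<longlonglongrightarrow> 0" by (rule tail_integral_tendsto_0[OF fin]) auto
  then have "\<forall>\<^sub>F m in sequentially. ?I m < ennreal (e / 2)" using e by (intro order_tendstoD) auto
  then obtain m where m: "?I m < ennreal (e / 2)" by (auto simp: eventually_sequentially)
  define Q where "Q = R + (\<Sum>j<m. P j)"
  have "bounded ((\<lambda>x. poly (pderiv Q) x) ` {a..b'})"
    by (intro compact_imp_bounded compact_continuous_image continuous_intros) auto
  then obtain L where L: "0 < L" "\<And>x. x \<in> {a..b'} \<Longrightarrow> \<bar>poly (pderiv Q) x\<bar> \<le> L"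
    by (auto simp: bounded_pos)
  have inc: "ennreal \<bar>F v - F u\<bar> \<le> ennreal (L * (v - u)) + (\<integral>\<^sup>+z. tail_variation P m z * indicator {u..v} z \<partial>lborel)"
    if uv: "a \<le> u" "u \<le> v" "v \<le> b" for u v
  proof -
    let ?t = "\<lambda>z. \<Sum>j. poly (P (j + m)) z"
    have Fz: "F z = poly Q z + ?t z" if "a \<le> z" "z \<le> b" for z
      unfolding F[OF that] suminf_split_initial_segment[OF sum[OF that], of m] by (simp add: Q_def poly_sum)
    have 1: "\<bar>poly Q v - poly Q u\<bar> \<le> L * (v - u)"
    proof (cases "u = v")
      case False
      then obtain z where z: "u < z" "z < v" "poly Q v - poly Q u = (v - u) * poly (pderiv Q) z"
        using poly_MVT[of u v Q] uv by auto
      then show ?thesis using L(2)[of z] uv assms(2) by (simp add: abs_mult mult.commute mult_left_mono)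
    qed simp
    have 2: "ennreal \<bar>?t v - ?t u\<bar> \<le> (\<integral>\<^sup>+z. tail_variation P m z * indicator {u..v} z \<partial>lborel)"
      using uv by (intro tail_increment_le sum) auto
    have "ennreal \<bar>F v - F u\<bar> \<le> ennreal (\<bar>poly Q v - poly Q u\<bar> + \<bar>?t v - ?t u\<bar>)"
      using Fz[of u] Fz[of v] uv by (intro ennreal_leI) simp
    also have "\<dots> = ennreal \<bar>poly Q v - poly Q u\<bar> + ennreal \<bar>?t v - ?t u\<bar>"
      by (intro ennreal_plus) auto
    also have "\<dots> \<le> ennreal (L * (v - u)) + (\<integral>\<^sup>+z. tail_variation P m z * indicator {u..v} z \<partial>lborel)"
      by (rule add_mono[OF ennreal_leI[OF 1] 2])
    finally show ?thesis .
  qed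
  show "\<exists>\<delta>>0. \<forall>D S. D division_of S \<and> S \<subseteq> {a..b} \<and> (\<Sum>K\<in>D. Sup K - Inf K) < \<delta> \<longrightarrow> (\<Sum>K\<in>D. \<bar>F (Sup K) - F (Inf K)\<bar>) < e"
  \<comment> \<open>With L a Lipschitz bound for the finite part, this total length limits its
    contribution to e/2.\<close>
  proof (intro exI[of _ "e / (2 * L)"] conjI allI impI)
    show "0 < e / (2 * L)" using e L by simp
    fix D S assume DS: "D division_of S \<and> S \<subseteq> {a..b} \<and> (\<Sum>K\<in>D. Sup K - Inf K) < e / (2 * L)"
    have K: "a \<le> Inf K \<and> Inf K \<le> Sup K \<and> Sup K \<le> b" if K: "K \<in> D" for K
    proof -
      obtain u w where uw: "K = cbox u w" using division_ofD(4)[of D S K] DS K by blast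
      have "K \<noteq> {}" "K \<subseteq> {a..b}" using division_ofD(2,3)[of D S K] DS K by auto
      then show ?thesis using uw by (auto simp: box_real)
    qed
    have "ennreal (\<Sum>K\<in>D. \<bar>F (Sup K) - F (Inf K)\<bar>) = (\<Sum>K\<in>D. ennreal \<bar>F (Sup K) - F (Inf K)\<bar>)"
      by (simp add: sum_ennreal)
    also have "\<dots> \<le> (\<Sum>K\<in>D. ennreal (L * (Sup K - Inf K)) + (\<integral>\<^sup>+z. tail_variation P m z * indicator {Inf K..Sup K} z \<partial>lborel))"
      using K by (intro sum_mono inc) auto
    also have "\<dots> = ennreal (\<Sum>K\<in>D. L * (Sup K - Inf K)) + (\<Sum>K\<in>D. \<integral>\<^sup>+z. tail_variation P m z * indicator {Inf K..Sup K} z \<partial>lborel)"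
      unfolding sum.distrib using K L by (subst sum_ennreal) auto
    also have "\<dots> \<le> ennreal (\<Sum>K\<in>D. L * (Sup K - Inf K)) + ?I m"
    proof (intro add_left_mono)
      have "(\<Sum>K\<in>D. \<integral>\<^sup>+z. tail_variation P m z * indicator {Inf K..Sup K} z \<partial>lborel) \<le> (\<integral>\<^sup>+z. tail_variation P m z * indicator {a..b} z \<partial>lborel)"
        by (rule sum_interior_integrals_le[of _ D S]) (use DS in auto)
      also have "\<dots> \<le> ?I m" using assms(2) by (intro nn_integral_mono mult_left_mono indicator_leI) auto
      finally show "(\<Sum>K\<in>D. \<integral>\<^sup>+z. tail_variation P m z * indicator {Inf K..Sup K} z \<partial>lborel) \<le> ?I m" .
    qed
    also have "\<dots> < ennreal (e / 2) + ennreal (e / 2)"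
    proof (rule ennreal_add_left_le_less)
      have "(\<Sum>K\<in>D. L * (Sup K - Inf K)) = L * (\<Sum>K\<in>D. Sup K - Inf K)" by (simp add: sum_distrib_left)
      also have "\<dots> \<le> L * (e / (2 * L))" using DS L by (intro mult_left_mono) auto
      also have "\<dots> = e / 2" using L by simp
      finally show "ennreal (\<Sum>K\<in>D. L * (Sup K - Inf K)) \<le> ennreal (e / 2)" by (rule ennreal_leI)
    qed (use m in auto)
    also have "\<dots> = ennreal e" using e by (subst ennreal_plus[symmetric]) auto
    finally show "(\<Sum>K\<in>D. \<bar>F (Sup K) - F (Inf K)\<bar>) < e"
      using e by (subst (asm) ennreal_less_iff) (auto intro: sum_nonneg)
  qed
qed

lemma pderiv_iterate_diff: "(pderiv ^^ i) (P - Q) = (pderiv ^^ i) P - (pderiv ^^ i) (Q :: real poly)"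
  by (induction i) (simp_all add: pderiv_diff)

text \<open>For orders below r the terms have summable uniform bounds on compact intervals, because
  L_1 bounds are available for the next derivative too. These orders may be differentiated termwise
  at every point as long as the derivative also has order below r; the step to order r, with L_1
  bounds only, is possible almost everywhere.\<close>

lemma poly_sequence_limit:
  fixes S :: "nat \<Rightarrow> real poly"
  assumes p: "1 \<le> p" and r: "1 \<le> r"
    and fin: "\<And>i. i \<le> r \<Longrightarrow> (\<Sum>j. Lp_norm p (\<lambda>x. jacobi_w \<alpha> \<beta> x * (vphi x ^ i * poly ((pderiv ^^ i) (S (Suc j) - S j)) x))) < \<infinity>"
  obtains g where "\<And>j x. j < r - 1 \<Longrightarrow> -1 < x \<Longrightarrow> x < 1 \<Longrightarrow> (deriv ^^ j) g differentiable (at x)"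
    "AC_loc ((deriv ^^ (r - 1)) g)"
    "\<And>x. -1 < x \<Longrightarrow> x < 1 \<Longrightarrow> (\<lambda>j. poly (S j) x) \<longlonglongrightarrow> g x"
    "AE x in lebesgue_on {-1..1}. (\<lambda>j. poly ((pderiv ^^ r) (S j)) x) \<longlonglongrightarrow> (deriv ^^ r) g x"
proof -
  define D where "D = (\<lambda>i j. (pderiv ^^ i) (S (Suc j) - S j))"
  have pD: "pderiv (D i j) = D (Suc i) j" for i j by (simp add: D_def)
  have telescope: "(pderiv ^^ i) (S m) = (pderiv ^^ i) (S 0) + (\<Sum>j<m. D i j)" for i m
    by (induction m) (simp_all add: D_def pderiv_iterate_diff)
  have partial: "poly ((pderiv ^^ i) (S m)) x = poly ((pderiv ^^ i) (S 0)) x + (\<Sum>j<m. poly (D i j) x)" for i m x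
    unfolding poly_sum[symmetric] poly_add[symmetric] telescope[of i m, symmetric] ..
  have L1: "(\<Sum>j. \<integral>\<^sup>+z. ennreal \<bar>poly (D i j) z\<bar> * indicator {a..b} z \<partial>lborel) < \<infinity>" if i: "i \<le> r" and ab: "-1 < a" "a < b" "b < 1" for i a b
  proof -
    obtain C where C: "0 < C" "\<And>D. (\<integral>\<^sup>+z. ennreal \<bar>poly D z\<bar> * indicator {a..b} z \<partial>lborel) \<le>
      ennreal C * Lp_norm p (\<lambda>x. jacobi_w \<alpha> \<beta> x * (vphi x ^ i * poly D x))"
      using poly_local_L1_le[OF p ab] by blast
    have "(\<Sum>j. \<integral>\<^sup>+z. ennreal \<bar>poly (D i j) z\<bar> * indicator {a..b} z \<partial>lborel) \<le> (\<Sum>j. ennreal C * Lp_norm p (\<lambda>x. jacobi_w \<alpha> \<beta> x * (vphi x ^ i * poly (D i j) x)))"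
      by (intro suminf_le C(2)) auto
    also have "\<dots> < \<infinity>" using fin[OF i] by (simp add: D_def ennreal_mult_less_top)
    finally show ?thesis .
  qed
  have M: "\<exists>M. summable M \<and> (\<forall>j. \<forall>x\<in>{a..b}. \<bar>poly (D i j) x\<bar> \<le> M j)" if i: "i < r" and ab: "-1 < a" "a < b" "b < 1" for i a b
  proof -
    let ?I = "\<lambda>i j. \<integral>\<^sup>+z. ennreal \<bar>poly (D i j) z\<bar> * indicator {a..b} z \<partial>lborel"
    let ?M = "\<lambda>j. ennreal (1 / (b - a)) * ?I i j + ?I (Suc i) j"
    have "(\<Sum>j. ?M j) = ennreal (1 / (b - a)) * (\<Sum>j. ?I i j) + (\<Sum>j. ?I (Suc i) j)"
      by (subst suminf_add[symmetric]) auto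
    also have "\<dots> < \<infinity>" using L1[of i a b] L1[of "Suc i" a b] i ab by (simp add: ennreal_mult_less_top)
    finally have Mf: "(\<Sum>j. ?M j) < \<infinity>" .
    then have fj: "?M j < \<infinity>" for j using ennreal_suminf_lessD[of ?M \<infinity> j] by blast
    define N where "N = (\<lambda>j. enn2real (?M j))"
    have NM: "ennreal (N j) = ?M j" for j using fj[of j] unfolding N_def by (intro ennreal_enn2real) simp
    have "summable N" using Mf unfolding NM[symmetric] by (intro summable_suminf_not_top) (auto simp: N_def)
    moreover have "\<bar>poly (D i j) x\<bar> \<le> N j" if "x \<in> {a..b}" for j x
    proof -
      have "ennreal \<bar>poly (D i j) x\<bar> \<le> ennreal (N j)"
        using poly_sup_le_L1[OF ab(2) that, of "D i j"] unfolding NM pD .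
      then show ?thesis by (subst (asm) ennreal_le_iff) (simp_all add: N_def)
    qed
    ultimately show ?thesis by blast
  qed
  \<comment> \<open>Gives a symmetric compact interval in (-1,1) with x in its interior.\<close>
  define c where "c = (\<lambda>x::real. (1 + \<bar>x\<bar>) / 2)"
  have c: "- 1 < - c x" "- c x < c x" "c x < 1" "x \<in> {- c x<..<c x}" if "-1 < x" "x < 1" for x
    using that by (auto simp: c_def field_simps abs_if)
  have sum: "summable (\<lambda>j. poly (D i j) x)" if i: "i < r" and x: "-1 < x" "x < 1" for i x
  proof -
    obtain M where sM: "summable M" and M: "\<forall>j. \<forall>y\<in>{- c x..c x}. \<bar>poly (D i j) y\<bar> \<le> M j"
      using M[OF i c(1-3)[OF x]] by blast
    have "x \<in> {- c x..c x}" using c(4)[OF x] by simp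
    then have "norm (poly (D i j) x) \<le> M j" for j using M by simp
    then show ?thesis by (rule summable_comparison_test'[OF sM])
  qed
  define G where "G = (\<lambda>i x. poly ((pderiv ^^ i) (S 0)) x + (\<Sum>j. poly (D i j) x))"
  have dG: "(G i has_real_derivative G (Suc i) x) (at x)" if i: "Suc i < r" and x: "-1 < x" "x < 1" for i x
  proof -
    obtain M where "summable M" "\<forall>j. \<forall>y\<in>{- c x..c x}. \<bar>poly (D (Suc i) j) y\<bar> \<le> M j"
      using M[OF i c(1-3)[OF x]] by blast
    then have "uniformly_convergent_on {- c x..c x} (\<lambda>n y. \<Sum>j<n. poly (D (Suc i) j) y)"
      by (intro Weierstrass_m_test') auto
    then have "((\<lambda>x. \<Sum>j. poly (D i j) x) has_real_derivative (\<Sum>j. poly (D (Suc i) j) x)) (at x)"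
    proof (intro has_field_derivative_series'(2)[where S = "{- c x..c x}" and ?x0.0 = x])
      show "(poly (D i n) has_real_derivative poly (D (Suc i) n) y) (at y within {- c x..c x})" for n y
        using poly_DERIV[of "D i n" y] pD[of i n] by (auto intro: DERIV_subset)
      show "summable (\<lambda>n. poly (D i n) x)" using i x by (intro sum) auto
      show "x \<in> interior {- c x..c x}" using c(4)[OF x] by (simp add: interior_atLeastAtMost_real)
    qed (use c(4)[OF x] in auto)
    moreover have "(poly ((pderiv ^^ i) (S 0)) has_real_derivative poly ((pderiv ^^ Suc i) (S 0)) x) (at x)"
      using poly_DERIV[of "(pderiv ^^ i) (S 0)" x] by simp
    ultimately show ?thesis unfolding G_def by (rule DERIV_add[rotated])
  qed
  define g where "g = G 0"
  have near: "\<forall>\<^sub>F y in nhds x. -1 < y \<and> y < 1" if "-1 < x" "x < 1" for x :: real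
    using eventually_nhds_in_open[of "{-1<..<1}" x] that by auto
  have gG: "(deriv ^^ i) g x = G i x" if "i \<le> r - 1" "-1 < x" "x < 1" for i x
    using that
  proof (induction i arbitrary: x)
    case (Suc i)
    have "(deriv ^^ Suc i) g x = deriv ((deriv ^^ i) g) x" by simp
    also have "\<dots> = deriv (G i) x"
      using near[OF Suc.prems(2,3)] Suc by (intro deriv_cong_ev) (auto elim!: eventually_mono)
    also have "\<dots> = G (Suc i) x" using Suc.prems by (intro DERIV_imp_deriv dG) auto
    finally show ?case .
  qed (simp add: g_def)
  have eqG: "\<forall>\<^sub>F y in nhds x. (deriv ^^ i) g y = G i y" if "i \<le> r - 1" "-1 < x" "x < 1" for i x
    using near[OF that(2,3)] by eventually_elim (use gG that(1) in auto)
  show thesis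
  proof (rule that[of g])
    fix j x assume j: "j < r - 1" and x: "-1 < x" "x < (1::real)"
    have "((deriv ^^ j) g has_real_derivative G (Suc j) x) (at x)"
      by (subst DERIV_cong_ev[OF refl eqG refl]) (use dG j x in auto)
    then show "(deriv ^^ j) g differentiable (at x)" using real_differentiable_def by blast
  next
    show "AC_loc ((deriv ^^ (r - 1)) g)"
      unfolding AC_loc_def
    proof (intro allI impI)
      fix a b :: real assume ab: "-1 < a \<and> a \<le> b \<and> b < 1"
      \<comment> \<open>Strictly between b and 1, so that [a, ?b] is a proper interval even for a =
        b.\<close>
      let ?b = "(b + 1) / 2"
      show "abs_cont_on a b ((deriv ^^ (r - 1)) g)"
      proof (rule abs_cont_on_poly_series[of a ?b b _ "(pderiv ^^ (r - 1)) (S 0)" "D (r - 1)"])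
        show "(\<Sum>j. \<integral>\<^sup>+z. ennreal \<bar>poly (pderiv (D (r - 1) j)) z\<bar> * indicator {a..?b} z \<partial>lborel) < \<infinity>"
          unfolding pD using ab r by (intro L1) auto
        show "(deriv ^^ (r - 1)) g x = poly ((pderiv ^^ (r - 1)) (S 0)) x + (\<Sum>j. poly (D (r - 1) j) x)" if "a \<le> x" "x \<le> b" for x
          using gG[of "r - 1" x] that ab by (simp add: G_def)
      qed (use ab r in \<open>auto intro: sum\<close>)
    qed
  next
    fix x :: real assume x: "-1 < x" "x < 1"
    have "(\<lambda>m. poly (S 0) x + (\<Sum>j<m. poly (D 0 j) x)) \<longlonglongrightarrow> poly (S 0) x + (\<Sum>j. poly (D 0 j) x)"
      using r x by (intro tendsto_add tendsto_const summable_LIMSEQ sum) auto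
    then show "(\<lambda>m. poly (S m) x) \<longlonglongrightarrow> g x"
      unfolding partial[of 0, simplified, symmetric] by (simp add: g_def G_def)
  next
    \<comment> \<open>The intervals exhaust (-1,1); with n + 2 in the denominator, the one for n = 0
      is already nondegenerate.\<close>
    define e where "e = (\<lambda>n::nat. 1 - 1 / (real n + 2))"
    have e: "-1 < - e n" "- e n < e n" "e n < 1" for n by (auto simp: e_def field_simps)
    have "AE x in lborel. \<forall>n. - e n < x \<and> x < e n \<longrightarrow> summable (\<lambda>j. poly (pderiv (D (r - 1) j)) x) \<and>
      ((\<lambda>x. \<Sum>j. poly (D (r - 1) j) x) has_real_derivative (\<Sum>j. poly (pderiv (D (r - 1) j)) x)) (at x)"
      unfolding AE_all_countable
    proof
      fix n
      show "AE x in lborel. - e n < x \<and> x < e n \<longrightarrow> summable (\<lambda>j. poly (pderiv (D (r - 1) j)) x) \<and>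
        ((\<lambda>x. \<Sum>j. poly (D (r - 1) j) x) has_real_derivative (\<Sum>j. poly (pderiv (D (r - 1) j)) x)) (at x)"
      proof (rule series_derivative_AE[OF e(2)])
        show "summable (\<lambda>j. poly (D (r - 1) j) x)" if "- e n \<le> x" "x \<le> e n" for x
          using e[of n] that r by (intro sum) auto
        show "(\<Sum>j. \<integral>\<^sup>+z. ennreal \<bar>poly (pderiv (D (r - 1) j)) z\<bar> * indicator {- e n..e n} z \<partial>lborel) < \<infinity>"
          unfolding pD using e r by (intro L1) auto
      qed
    qed
    then have "AE x in lebesgue_on {-1..1}. \<forall>n. - e n < x \<and> x < e n \<longrightarrow> summable (\<lambda>j. poly (pderiv (D (r - 1) j)) x) \<and>
      ((\<lambda>x. \<Sum>j. poly (D (r - 1) j) x) has_real_derivative (\<Sum>j. poly (pderiv (D (r - 1) j)) x)) (at x)"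
      unfolding AE_interval_lborel by (auto elim!: eventually_mono)
    with AE_open_interval show "AE x in lebesgue_on {-1..1}. (\<lambda>j. poly ((pderiv ^^ r) (S j)) x) \<longlonglongrightarrow> (deriv ^^ r) g x"
    proof eventually_elim
      case (elim x)
      have Sr: "Suc (r - 1) = r" using r by simp
      have "0 < 1 - \<bar>x\<bar>" using elim(1) by (simp add: abs_less_iff)
      then obtain n where "1 / real (Suc n) < 1 - \<bar>x\<bar>" using nat_approx_posE by blast
      moreover have "1 / (real n + 2) \<le> 1 / real (Suc n)" by (simp add: field_simps)
      ultimately have "- e n < x \<and> x < e n" by (auto simp: e_def abs_if split: if_splits)
      then have s: "summable (\<lambda>j. poly (D r j) x)"
        and d: "((\<lambda>x. \<Sum>j. poly (D (r - 1) j) x) has_real_derivative (\<Sum>j. poly (D r j) x)) (at x)"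
        using elim(2) unfolding pD Sr by blast+
      have dS: "(poly ((pderiv ^^ (r - 1)) (S 0)) has_real_derivative poly ((pderiv ^^ r) (S 0)) x) (at x)"
        using poly_DERIV[of "(pderiv ^^ (r - 1)) (S 0)" x] Sr by (metis funpow.simps(2) o_apply)
      have "(G (r - 1) has_real_derivative (poly ((pderiv ^^ r) (S 0)) x + (\<Sum>j. poly (D r j) x))) (at x)"
        unfolding G_def by (rule DERIV_add[OF dS d])
      then have "deriv (G (r - 1)) x = poly ((pderiv ^^ r) (S 0)) x + (\<Sum>j. poly (D r j) x)" by (rule DERIV_imp_deriv)
      moreover have "(deriv ^^ r) g x = deriv (G (r - 1)) x"
      proof -
        have "(deriv ^^ r) g x = deriv ((deriv ^^ (r - 1)) g) x" using Sr by (metis funpow.simps(2) o_apply)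
        also have "\<dots> = deriv (G (r - 1)) x" using elim(1) by (intro deriv_cong_ev eqG) auto
        finally show ?thesis .
      qed
      moreover have "(\<lambda>m. poly ((pderiv ^^ r) (S 0)) x + (\<Sum>j<m. poly (D r j) x)) \<longlonglongrightarrow> poly ((pderiv ^^ r) (S 0)) x + (\<Sum>j. poly (D r j) x)"
        using s by (intro tendsto_add tendsto_const summable_LIMSEQ)
      ultimately show ?case unfolding partial[symmetric] by simp
    qed
  qed
qed

section \<open>Uniqueness of the continuous representative\<close>

lemma AC_loc_imp_continuous_on:
  assumes "AC_loc f"
  shows "continuous_on {-1<..<1} f"
proof (intro continuous_at_imp_continuous_on ballI)
  fix x :: real assume x: "x \<in> {-1<..<1}"
  define a where "a = (x - 1) / 2"
  define b where "b = (x + 1) / 2"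
  have ab: "-1 < a" "a < x" "x < b" "b < 1" using x by (auto simp: a_def b_def field_simps)
  then have ac: "abs_cont_on a b f" using assms by (simp add: AC_loc_def)
  show "isCont f x"
    unfolding continuous_at_real_range
  proof (intro allI impI)
    fix e :: real assume "0 < e"
    then obtain d where d: "0 < d" "\<And>D S. D division_of S \<Longrightarrow> S \<subseteq> {a..b} \<Longrightarrow> (\<Sum>K\<in>D. Sup K - Inf K) < d \<Longrightarrow> (\<Sum>K\<in>D. \<bar>f (Sup K) - f (Inf K)\<bar>) < e"
      using ac unfolding abs_cont_on_def by meson
    have "\<bar>f y - f x\<bar> < e" if y: "\<bar>y - x\<bar> < min d (min (x - a) (b - x))" for y
    proof -
      let ?u = "min x y" and ?v = "max x y"
      have "{cbox ?u ?v} division_of (cbox ?u ?v)" by (intro division_of_self) (auto simp: box_real)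
      moreover have "cbox ?u ?v \<subseteq> {a..b}" using y ab by (auto simp: box_real abs_if split: if_splits)
      moreover have "?v - ?u < d" using y by (auto simp: abs_if split: if_splits)
      ultimately have "(\<Sum>K\<in>{cbox ?u ?v}. \<bar>f (Sup K) - f (Inf K)\<bar>) < e" using d(2)[of "{cbox ?u ?v}" "cbox ?u ?v"] by (simp add: box_real)
      then show ?thesis by (auto simp: box_real min_def max_def abs_minus_commute split: if_splits)
    qed
    moreover have "0 < min d (min (x - a) (b - x))" using d ab by auto
    ultimately show "\<exists>d>0. \<forall>y. norm (y - x) < d \<longrightarrow> \<bar>f y - f x\<bar> < e" unfolding real_norm_def by blast
  qed
qed

lemma B_rep_continuous:
  assumes "g \<in> B_rep p r \<alpha> \<beta>" "1 \<le> r"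
  shows "continuous_on {-1<..<1} g"
proof (cases "r = 1")
  case True
  then show ?thesis using assms by (auto simp: B_rep_def intro: AC_loc_imp_continuous_on)
next
  case False
  then have "0 < r - 1" using assms by simp
  moreover have "\<forall>j<r - 1. \<forall>x\<in>{-1<..<1}. (deriv ^^ j) g differentiable (at x)"
    using assms by (auto simp: B_rep_def)
  ultimately have "\<forall>x\<in>{-1<..<1}. (deriv ^^ 0) g differentiable (at x)" by blast
  then show ?thesis by (auto intro!: continuous_at_imp_continuous_on differentiable_imp_continuous_within)
qed

text \<open>The theorem speaks of every representative of f, whereas the limit construction yields
  one. For r \<ge> 1 representatives are continuous, so by this lemma they agree on (-1,1) and have
  the same derivatives there.\<close>

lemma continuous_ae_eq_imp_eq:
  assumes "continuous_on {-1<..<1} f" "continuous_on {-1<..<1} g" "ae_eq f g" "-1 < x" "x < 1"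
  shows "f x = g x"
proof -
  have "f x - g x \<le> 0" "g x - f x \<le> 0"
    using assms by (auto intro!: continuous_AE_imp_le[where x = x and f = "\<lambda>x. f x - g x"] continuous_AE_imp_le[where x = x and f = "\<lambda>x. g x - f x"] continuous_intros simp: ae_eq_def simp del: diff_le_0_iff_le elim!: eventually_mono)
  then show ?thesis by simp
qed

lemma higher_deriv_cong:
  assumes "\<And>x. -1 < x \<Longrightarrow> x < 1 \<Longrightarrow> f x = g x" "-1 < x" "x < (1::real)"
  shows "(deriv ^^ i) f x = (deriv ^^ i) g x"
  using assms(2,3)
proof (induction i arbitrary: x)
  case (Suc i)
  have "\<forall>\<^sub>F y in nhds x. -1 < y \<and> y < 1" using eventually_nhds_in_open[of "{-1<..<1}" x] Suc.prems by auto
  then have "\<forall>\<^sub>F y in nhds x. (deriv ^^ i) f y = (deriv ^^ i) g y" by eventually_elim (use Suc.IH in auto)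
  then have "deriv ((deriv ^^ i) f) x = deriv ((deriv ^^ i) g) x" by (intro deriv_cong_ev) auto
  then show ?case by simp
qed (use assms in auto)

section \<open>Telescoping of near-best polynomials\<close>

text \<open>For u in (2^-n, 2^(1-n)] monotonicity gives \<phi>(u) / u^(s+1) \<ge> \<phi>(2^-n) /
  2^((1-n)(s+1)). The interval has length 2^-n, which accounts for the factor 2^(s+1), and distinct
  intervals are disjoint.\<close>

lemma dyadic_sum_le_integral:
  fixes \<phi> :: "real \<Rightarrow> real"
  assumes mono: "mono_on {0..} \<phi>" and nn: "\<And>t. 0 \<le> t \<Longrightarrow> 0 \<le> \<phi> t" and fin: "finite I"
    and sub: "\<And>n. n \<in> I \<Longrightarrow> {1/2^n <.. 2/2^n} \<subseteq> A"
  shows "(\<Sum>n\<in>I. ennreal (2 ^ (n * s) * \<phi> (1 / 2 ^ n))) \<le> ennreal (2 ^ (s + 1)) * (\<integral>\<^sup>+u\<in>A. ennreal (\<phi> u / u ^ (s + 1)) \<partial>lborel)"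
proof -
  let ?B = "\<lambda>n::nat. {1/2^n <.. 2/2^n} :: real set"
  let ?c = "\<lambda>n::nat. \<phi> (1 / 2 ^ n) / (2 / 2 ^ n) ^ (s + 1)"
  have c0: "0 \<le> ?c n" for n by (simp add: nn)
  have disj: "disjoint_family_on ?B I"
  proof (unfold disjoint_family_on_def, intro ballI impI)
    have aux: "?B m \<inter> ?B n = {}" if "m < n" for m n :: nat
    proof -
      have "(2::real) ^ Suc m \<le> 2 ^ n" using that by (intro power_increasing) auto
      then have "2 / 2 ^ n \<le> 1 / (2::real) ^ m" by (simp add: field_simps)
      then show ?thesis by auto
    qed
    fix m n :: nat assume "m \<noteq> n"
    then consider "m < n" | "n < m" by linarith
    then show "?B m \<inter> ?B n = {}"
    proof cases
      case 2
      then show ?thesis by (subst Int_commute) (rule aux)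
    qed (rule aux)
  qed
  have summand: "ennreal (2 ^ (n * s) * \<phi> (1 / 2 ^ n)) = ennreal (2 ^ (s + 1)) * (\<integral>\<^sup>+u. ennreal (?c n) * indicator (?B n) u \<partial>lborel)" for n
  proof -
    have "(\<integral>\<^sup>+u. ennreal (?c n) * indicator (?B n) u \<partial>lborel) = ennreal (?c n) * ennreal (1 / 2 ^ n)"
      by (subst nn_integral_cmult_indicator) (auto simp: field_simps)
    also have "\<dots> = ennreal (?c n * (1 / 2 ^ n))" using c0 by (intro ennreal_mult[symmetric]) auto
    finally have "ennreal (2 ^ (s + 1)) * (\<integral>\<^sup>+u. ennreal (?c n) * indicator (?B n) u \<partial>lborel) = ennreal (2 ^ (s + 1) * (?c n * (1 / 2 ^ n)))"
      using c0[of n] by (simp only: ennreal_mult[symmetric] zero_le_power zero_le_numeral mult_nonneg_nonneg divide_nonneg_nonneg zero_le_one)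
    also have "2 ^ (s + 1) * (?c n * (1 / 2 ^ n)) = 2 ^ (n * s) * \<phi> (1 / 2 ^ n)"
      by (simp add: power_divide power_mult field_simps power_add)
    finally show ?thesis ..
  qed
  have "(\<Sum>n\<in>I. ennreal (2 ^ (n * s) * \<phi> (1 / 2 ^ n))) = ennreal (2 ^ (s + 1)) * (\<Sum>n\<in>I. \<integral>\<^sup>+u. ennreal (?c n) * indicator (?B n) u \<partial>lborel)"
    unfolding summand by (simp add: sum_distrib_left)
  also have "(\<Sum>n\<in>I. \<integral>\<^sup>+u. ennreal (?c n) * indicator (?B n) u \<partial>lborel) = (\<integral>\<^sup>+u. (\<Sum>n\<in>I. ennreal (?c n) * indicator (?B n) u) \<partial>lborel)"
    by (rule nn_integral_sum[symmetric]) measurable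
  also have "\<dots> \<le> (\<integral>\<^sup>+u\<in>A. ennreal (\<phi> u / u ^ (s + 1)) \<partial>lborel)"
  proof (rule nn_integral_mono)
    fix u :: real
    show "(\<Sum>n\<in>I. ennreal (?c n) * indicator (?B n) u) \<le> ennreal (\<phi> u / u ^ (s + 1)) * indicator A u"
    proof (cases "\<exists>n\<in>I. u \<in> ?B n")
      case True
      then obtain n where n: "n \<in> I" "u \<in> ?B n" by blast
      have "(\<Sum>k\<in>I. ennreal (?c k) * indicator (?B k) u) = (\<Sum>k\<in>{n}. ennreal (?c k) * indicator (?B k) u)"
      proof (rule sum.mono_neutral_right[OF fin])
        show "\<forall>k\<in>I - {n}. ennreal (?c k) * indicator (?B k) u = 0"
        proof
          fix k assume "k \<in> I - {n}"
          then have "?B k \<inter> ?B n = {}" using disj n(1) unfolding disjoint_family_on_def by blast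
          then have "u \<notin> ?B k" using n(2) by blast
          then have "indicator (?B k) u = (0::ennreal)" by (rule indicator_simps(2))
          then show "ennreal (?c k) * indicator (?B k) u = 0" by (simp only: mult_zero_right)
        qed
      qed (use n in auto)
      also have "\<dots> = ennreal (?c n)" using n by simp
      also have "\<dots> \<le> ennreal (\<phi> u / u ^ (s + 1))"
      proof (rule ennreal_leI)
        have u: "1 / 2 ^ n < u" "u \<le> 2 / 2 ^ n" using n by auto
        have u0: "0 < u" using u(1) by (rule less_trans[rotated]) simp
        have "\<phi> (1 / 2 ^ n) \<le> \<phi> u" using u u0 by (intro mono_onD[OF mono]) auto
        moreover have "u ^ (s + 1) \<le> (2 / 2 ^ n) ^ (s + 1)" using u u0 by (intro power_mono) auto
        ultimately show "?c n \<le> \<phi> u / u ^ (s + 1)" using u0 nn by (intro frac_le) auto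
      qed
      finally show ?thesis using sub[OF n(1)] n(2) by auto
    next
      case False
      then have "(\<Sum>n\<in>I. ennreal (?c n) * indicator (?B n) u) = 0" by (intro sum.neutral) (auto simp: indicator_def)
      then show ?thesis by simp
    qed
  qed
  finally show ?thesis by (simp add: mult_left_mono)
qed

text \<open>The comparison on the single interval [t, 2t], which lies in [t, 1] because t \<le>
  1/2.\<close>

lemma phi_le_integral:
  fixes \<phi> :: "real \<Rightarrow> real"
  assumes mono: "mono_on {0..} \<phi>" and nn: "\<And>t. 0 \<le> t \<Longrightarrow> 0 \<le> \<phi> t" and t: "0 < t" "t \<le> 1/2"
  shows "ennreal (\<phi> t) \<le> ennreal (2 ^ (s + 1) * t ^ s) * (\<integral>\<^sup>+u\<in>{t..1}. ennreal (\<phi> u / u ^ (s + 1)) \<partial>lborel)"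
proof -
  let ?c = "\<phi> t / (2 * t) ^ (s + 1)"
  have c0: "0 \<le> ?c" using t nn by simp
  have "ennreal (\<phi> t) = ennreal (2 ^ (s + 1) * t ^ s * (?c * t))"
    using t by (simp add: power_mult_distrib)
  also have "\<dots> = ennreal (2 ^ (s + 1) * t ^ s) * (ennreal ?c * ennreal t)"
  proof -
    have "ennreal (x * (y * z)) = ennreal x * (ennreal y * ennreal z)" if "0 \<le> x" "0 \<le> y" "0 \<le> z" for x y z
      using that by (simp add: ennreal_mult)
    from this[of "2 ^ (s + 1) * t ^ s" ?c t] show ?thesis using t c0 by (simp only: zero_le_mult_iff zero_le_power_eq zero_le_power less_imp_le simp_thms zero_le_numeral)
  qed
  also have "ennreal ?c * ennreal t = (\<integral>\<^sup>+u. ennreal ?c * indicator {t..2*t} u \<partial>lborel)"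
    using t by (subst nn_integral_cmult_indicator) auto
  also have "\<dots> \<le> (\<integral>\<^sup>+u\<in>{t..1}. ennreal (\<phi> u / u ^ (s + 1)) \<partial>lborel)"
  proof (rule nn_integral_mono)
    fix u :: real
    show "ennreal ?c * indicator {t..2*t} u \<le> ennreal (\<phi> u / u ^ (s + 1)) * indicator {t..1} u"
    proof (cases "u \<in> {t..2*t}")
      case True
      have "\<phi> t \<le> \<phi> u" using True t by (intro mono_onD[OF mono]) auto
      moreover have "u ^ (s + 1) \<le> (2 * t) ^ (s + 1)" using True t by (intro power_mono) auto
      ultimately have "?c \<le> \<phi> u / u ^ (s + 1)" using True t nn by (intro frac_le) auto
      then show ?thesis using True t by (auto intro: ennreal_leI)
    qed simp
  qed
  finally show ?thesis by (simp add: mult_left_mono)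
qed

section \<open>Derivative norms of differences of near-best polynomials\<close>

definition deriv_norm :: "ennreal \<Rightarrow> real \<Rightarrow> real \<Rightarrow> nat \<Rightarrow> real poly \<Rightarrow> ennreal" where
  "deriv_norm p \<alpha> \<beta> i Q = Lp_norm p (\<lambda>x. jacobi_w \<alpha> \<beta> x * (vphi x ^ i * poly ((pderiv ^^ i) Q) x))"

definition approx_error :: "ennreal \<Rightarrow> real \<Rightarrow> real \<Rightarrow> (real \<Rightarrow> real) \<Rightarrow> real poly \<Rightarrow> ennreal" where
  "approx_error p \<alpha> \<beta> f Q = Lp_norm p (\<lambda>x. jacobi_w \<alpha> \<beta> x * (f x - poly Q x))"

lemma borel_measurable_weighted_error:
  assumes "f \<in> borel_measurable (lebesgue_on {-1..1})"
  shows "(\<lambda>x. jacobi_w \<alpha> \<beta> x * (f x - poly Q x)) \<in> borel_measurable (lebesgue_on {-1..1})"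
  by (intro borel_measurable_times borel_measurable_diff assms borel_measurable_lebesgue_onI) measurable

lemma deriv_norm_0_diff_le:
  assumes p: "1 \<le> p" and f: "f \<in> borel_measurable (lebesgue_on {-1..1})"
  shows "Lp_norm p (\<lambda>x. jacobi_w \<alpha> \<beta> x * poly (Q - R) x) \<le> approx_error p \<alpha> \<beta> f Q + approx_error p \<alpha> \<beta> f R"
proof -
  note m = borel_measurable_weighted_error[OF f, of \<alpha> \<beta>]
  have "Lp_norm p (\<lambda>x. jacobi_w \<alpha> \<beta> x * poly (Q - R) x) =
    Lp_norm p (\<lambda>x. - (jacobi_w \<alpha> \<beta> x * (f x - poly Q x)) + jacobi_w \<alpha> \<beta> x * (f x - poly R x))"
    by (rule arg_cong[where f = "Lp_norm p"]) (simp add: fun_eq_iff algebra_simps)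
  also have "\<dots> \<le> Lp_norm p (\<lambda>x. - (jacobi_w \<alpha> \<beta> x * (f x - poly Q x))) + Lp_norm p (\<lambda>x. jacobi_w \<alpha> \<beta> x * (f x - poly R x))"
    using m by (intro Lp_norm_triangle p borel_measurable_uminus)
  also have "Lp_norm p (\<lambda>x. - (jacobi_w \<alpha> \<beta> x * (f x - poly Q x))) = Lp_norm p (\<lambda>x. jacobi_w \<alpha> \<beta> x * (f x - poly Q x))"
    using m by (intro Lp_norm_cong_AE p borel_measurable_uminus) auto
  finally show ?thesis by (simp add: approx_error_def)
qed

lemma polys_below_mono: "m \<le> n \<Longrightarrow> Q \<in> polys_below m \<Longrightarrow> Q \<in> polys_below n"
  by (auto simp: polys_below_def)

lemma polys_below_diff: "Q \<in> polys_below n \<Longrightarrow> R \<in> polys_below n \<Longrightarrow> Q - R \<in> polys_below n"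
  by (auto simp: polys_below_def intro: degree_diff_less)

text \<open>The derivatives of f are not involved: the Bernstein inequality is applied to the
  difference of the polynomials, and f is inserted only at order 0.\<close>

lemma deriv_norm_diff_le:
  assumes p: "1 \<le> p" and f: "f \<in> borel_measurable (lebesgue_on {-1..1})"
    and C: "\<And>n P. 0 < n \<Longrightarrow> P \<in> polys_below n \<Longrightarrow> deriv_norm p \<alpha> \<beta> i P \<le> ennreal (C * real n ^ i) * Lp_norm p (\<lambda>x. jacobi_w \<alpha> \<beta> x * poly P x)"
    and "0 < n" "Q \<in> polys_below n" "R \<in> polys_below n"
  shows "deriv_norm p \<alpha> \<beta> i (Q - R) \<le> ennreal (C * real n ^ i) * (approx_error p \<alpha> \<beta> f Q + approx_error p \<alpha> \<beta> f R)"
  by (rule order_trans[OF C[OF assms(4) polys_below_diff[OF assms(5,6)]]])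
    (intro mult_left_mono deriv_norm_0_diff_le p f, simp)

lemma telescope_diff:
  fixes P :: "nat \<Rightarrow> real poly"
  assumes "J \<le> M"
  shows "P M - P J = (\<Sum>n=J..<M. P (Suc n) - P n)"
  using assms by (simp add: sum_Suc_diff')

text \<open>In the step from n to n+1 the degrees are below 2^(n+1). The Bernstein factor weighs the
  error of P_n by 2^i 2^(n i) and that of P_(n+1) by 2^((n+1) i); an error occurs in at most two
  steps, whence 2^i + 1.\<close>

lemma deriv_norm_telescope_le:
  assumes p: "1 \<le> p" and f: "f \<in> borel_measurable (lebesgue_on {-1..1})" and C0: "0 < C"
    and C: "\<And>n P. 0 < n \<Longrightarrow> P \<in> polys_below n \<Longrightarrow> deriv_norm p \<alpha> \<beta> i P \<le> ennreal (C * real n ^ i) * Lp_norm p (\<lambda>x. jacobi_w \<alpha> \<beta> x * poly P x)"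
    and P: "\<And>n. P n \<in> polys_below (2 ^ n)"
  shows "(\<Sum>n=J..<M. deriv_norm p \<alpha> \<beta> i (P (Suc n) - P n)) \<le> ennreal (C * (2 ^ i + 1)) * (\<Sum>n=J..M. ennreal (2 ^ (n * i)) * approx_error p \<alpha> \<beta> f (P n))"
proof -
  let ?e = "\<lambda>n. approx_error p \<alpha> \<beta> f (P n)"
  let ?a = "\<lambda>n. ennreal (2 ^ (n * i)) * ?e n"
  have step: "deriv_norm p \<alpha> \<beta> i (P (Suc n) - P n) \<le> ennreal (C * 2 ^ i) * ?a n + ennreal C * ?a (Suc n)" for n
  proof -
    have "deriv_norm p \<alpha> \<beta> i (P (Suc n) - P n) \<le> ennreal (C * real (2 ^ Suc n) ^ i) * (?e (Suc n) + ?e n)"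
    proof (rule deriv_norm_diff_le[OF p f C])
      show "P n \<in> polys_below (2 ^ Suc n)" by (rule polys_below_mono[OF _ P]) simp
      show "P (Suc n) \<in> polys_below (2 ^ Suc n)" by (rule P)
      show "0 < (2::nat) ^ Suc n" by (rule zero_less_power) simp
    qed
    also have "\<dots> = ennreal (C * real (2 ^ Suc n) ^ i) * ?e n + ennreal (C * real (2 ^ Suc n) ^ i) * ?e (Suc n)"
      by (simp add: distrib_left add.commute)
    also have "C * real (2 ^ Suc n) ^ i = C * 2 ^ i * 2 ^ (n * i)" by (simp add: power_mult_distrib power_mult mult.assoc)
    also have "ennreal \<dots> = ennreal (C * 2 ^ i) * ennreal (2 ^ (n * i))" using C0 by (intro ennreal_mult) auto
    also have "\<dots> * ?e (Suc n) = ennreal C * ?a (Suc n)"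
      using C0 by (simp add: ennreal_mult[symmetric] mult.assoc[symmetric] power_add)
    finally show ?thesis by (simp add: mult.assoc)
  qed
  have "(\<Sum>n=J..<M. deriv_norm p \<alpha> \<beta> i (P (Suc n) - P n)) \<le> (\<Sum>n=J..<M. ennreal (C * 2 ^ i) * ?a n + ennreal C * ?a (Suc n))"
    by (intro sum_mono step)
  also have "\<dots> = ennreal (C * 2 ^ i) * (\<Sum>n=J..<M. ?a n) + ennreal C * (\<Sum>n=J..<M. ?a (Suc n))"
    by (simp add: sum.distrib sum_distrib_left)
  also have "\<dots> \<le> ennreal (C * 2 ^ i) * (\<Sum>n=J..M. ?a n) + ennreal C * (\<Sum>n=J..M. ?a n)"
  proof (intro add_mono mult_left_mono)
    show "(\<Sum>n=J..<M. ?a n) \<le> (\<Sum>n=J..M. ?a n)" by (intro sum_mono2) auto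
    have "(\<Sum>n=J..<M. ?a (Suc n)) = (\<Sum>n=Suc J..<Suc M. ?a n)" by (rule sum.shift_bounds_Suc_ivl[symmetric])
    also have "\<dots> \<le> (\<Sum>n=J..M. ?a n)" by (intro sum_mono2) auto
    finally show "(\<Sum>n=J..<M. ?a (Suc n)) \<le> (\<Sum>n=J..M. ?a n)" .
  qed auto
  also have "\<dots> = ennreal (C * (2 ^ i + 1)) * (\<Sum>n=J..M. ?a n)"
  proof -
    have "ennreal (C * (2 ^ i + 1)) = ennreal (C * 2 ^ i) + ennreal C"
      using C0 by (subst ennreal_plus[symmetric]) (auto simp: distrib_left)
    then show ?thesis by (simp add: distrib_right)
  qed
  finally show ?thesis .
qed

lemma deriv_norm_diff_le_sum:
  assumes p: "1 \<le> p" and "J \<le> M"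
  shows "deriv_norm p \<alpha> \<beta> i (P M - P J) \<le> (\<Sum>n=J..<M. deriv_norm p \<alpha> \<beta> i (P (Suc n) - P n))"
proof -
  have "deriv_norm p \<alpha> \<beta> i (P M - P J) = Lp_norm p (\<lambda>x. \<Sum>n=J..<M. jacobi_w \<alpha> \<beta> x * (vphi x ^ i * poly ((pderiv ^^ i) (P (Suc n) - P n)) x))"
    unfolding deriv_norm_def telescope_diff[OF assms(2)] higher_pderiv_sum poly_sum sum_distrib_left ..
  also have "\<dots> \<le> (\<Sum>n=J..<M. deriv_norm p \<alpha> \<beta> i (P (Suc n) - P n))"
    unfolding deriv_norm_def by (rule Lp_norm_sum[OF p]) (auto intro: jacobi_w_vphi_measurable)
  finally show ?thesis .
qed

text \<open>The zero polynomial shows that the infimum is finite, which makes adding \<delta> a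
  strict increase.\<close>

lemma near_best_polynomial:
  assumes "f \<in> Lp_weighted p \<alpha> \<beta>" "0 < \<delta>"
  obtains Q where "Q \<in> polys_below n" "approx_error p \<alpha> \<beta> f Q \<le> best_approx n f p \<alpha> \<beta> + ennreal \<delta>"
proof -
  have "best_approx n f p \<alpha> \<beta> \<le> Lp_norm p (\<lambda>x. jacobi_w \<alpha> \<beta> x * (f x - poly 0 x))"
    unfolding best_approx_def by (rule INF_lower) (simp add: polys_below_def)
  also have "\<dots> < \<infinity>" using assms(1) by (simp add: Lp_weighted_def)
  finally have "best_approx n f p \<alpha> \<beta> < best_approx n f p \<alpha> \<beta> + ennreal \<delta>"
    using assms(2) using ennreal_add_left_cancel_less[of "best_approx n f p \<alpha> \<beta>" 0 "ennreal \<delta>"] by auto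
  then obtain Q where "Q \<in> polys_below n" "Lp_norm p (\<lambda>x. jacobi_w \<alpha> \<beta> x * (f x - poly Q x)) < best_approx n f p \<alpha> \<beta> + ennreal \<delta>"
    unfolding best_approx_def INF_less_iff by blast
  then show thesis using that[of Q] by (simp add: approx_error_def)
qed

lemma best_approx_antimono:
  "m \<le> n \<Longrightarrow> best_approx n f p \<alpha> \<beta> \<le> best_approx m f p \<alpha> \<beta>"
  unfolding best_approx_def by (intro INF_superset_mono) (auto intro: polys_below_mono)

lemma Lp_norm_le_0_imp_AE:
  assumes "1 \<le> p" "f \<in> borel_measurable (lebesgue_on {-1..1})" "Lp_norm p f \<le> 0"
  shows "AE x in lebesgue_on {-1..1}. f x = 0"
  using \<open>1 \<le> p\<close>
proof (cases rule: ennreal_exponent_cases)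
  case infinite
  then show ?thesis using assms(3) Lp_norm_le_iff_infinite[OF assms(2), of 0] by (auto elim!: eventually_mono)
next
  case (finite q)
  have "(\<integral>\<^sup>+x. ennreal (\<bar>f x\<bar> powr q) \<partial>lebesgue_on {-1..1}) \<le> ennreal (0 powr q)"
    using assms(3) finite by (subst Lp_norm_le_iff_finite[symmetric]) auto
  then have "(\<integral>\<^sup>+x. ennreal (\<bar>f x\<bar> powr q) \<partial>lebesgue_on {-1..1}) = 0" using finite by simp
  then have "AE x in lebesgue_on {-1..1}. ennreal (\<bar>f x\<bar> powr q) = 0"
    using assms(2) by (subst (asm) nn_integral_0_iff_AE) auto
  then show ?thesis by (auto elim!: eventually_mono)
qed

text \<open>Serves for the r-th \<open>deriv\<close> of the limit function, which is known only as
  an almost everywhere limit of polynomials.\<close>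

lemma poly_limit_measurable:
  fixes S :: "nat \<Rightarrow> real poly"
  assumes "AE x in lebesgue_on {-1..1}. (\<lambda>j. poly (S j) x) \<longlonglongrightarrow> h x"
  shows "h \<in> borel_measurable (lebesgue_on {-1..1})"
proof (rule borel_measurable_lebesgue_on_AE)
  show "(\<lambda>x. lim (\<lambda>j. poly (S j) x)) \<in> borel_measurable (lebesgue_on {-1..1})"
    by (intro borel_measurable_lebesgue_onI borel_measurable_lim_metric) measurable
  show "AE x in lebesgue_on {-1..1}. lim (\<lambda>j. poly (S j) x) = h x"
    using assms by eventually_elim (rule limI)
qed

text \<open>The slack \<epsilon> / 2^(n (m+1)) survives multiplication by 2^(n i) for every i \<le>
  m: at most \<epsilon> / 2^n is left, with sum at most 2 \<epsilon>.\<close>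

lemma weighted_error_sum_le:
  fixes e :: "nat \<Rightarrow> ennreal"
  assumes "finite I" "i \<le> m" "0 < \<epsilon>" and nn: "\<And>t. 0 \<le> t \<Longrightarrow> 0 \<le> \<phi> (t::real)"
    and e: "\<And>n. n \<in> I \<Longrightarrow> e n \<le> ennreal (\<phi> (1 / 2 ^ n)) + ennreal (\<epsilon> / 2 ^ (n * (m + 1)))"
  shows "(\<Sum>n\<in>I. ennreal (2 ^ (n * i)) * e n) \<le> (\<Sum>n\<in>I. ennreal (2 ^ (n * i) * \<phi> (1 / 2 ^ n))) + ennreal (2 * \<epsilon>)"
proof -
  have "(\<Sum>n\<in>I. ennreal (2 ^ (n * i)) * e n) \<le> (\<Sum>n\<in>I. ennreal (2 ^ (n * i) * \<phi> (1 / 2 ^ n)) + ennreal (\<epsilon> * (1 / 2) ^ n))"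
  proof (rule sum_mono)
    fix n assume n: "n \<in> I"
    have "ennreal (2 ^ (n * i)) * e n \<le> ennreal (2 ^ (n * i)) * (ennreal (\<phi> (1 / 2 ^ n)) + ennreal (\<epsilon> / 2 ^ (n * (m + 1))))"
      by (intro mult_left_mono e n) auto
    also have "\<dots> = ennreal (2 ^ (n * i) * \<phi> (1 / 2 ^ n)) + ennreal (2 ^ (n * i) * (\<epsilon> / 2 ^ (n * (m + 1))))"
      using nn assms(3) unfolding distrib_left by (subst (1 2) ennreal_mult) auto
    also have "\<dots> \<le> ennreal (2 ^ (n * i) * \<phi> (1 / 2 ^ n)) + ennreal (\<epsilon> * (1 / 2) ^ n)"
    proof (intro add_left_mono ennreal_leI)
      have "(2::real) ^ (n * i) \<le> 2 ^ (n * m)" using assms(2) by (intro power_increasing) auto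
      then have "2 ^ (n * i) * (\<epsilon> / 2 ^ (n * (m + 1))) \<le> 2 ^ (n * m) * (\<epsilon> / 2 ^ (n * (m + 1)))"
        using assms(3) by (intro mult_right_mono) auto
      also have "\<dots> = \<epsilon> * (1 / 2) ^ n" by (simp add: power_add power_divide)
      finally show "2 ^ (n * i) * (\<epsilon> / 2 ^ (n * (m + 1))) \<le> \<epsilon> * (1 / 2) ^ n" .
    qed
    finally show "ennreal (2 ^ (n * i)) * e n \<le> ennreal (2 ^ (n * i) * \<phi> (1 / 2 ^ n)) + ennreal (\<epsilon> * (1 / 2) ^ n)" .
  qed
  also have "\<dots> = (\<Sum>n\<in>I. ennreal (2 ^ (n * i) * \<phi> (1 / 2 ^ n))) + ennreal (\<Sum>n\<in>I. \<epsilon> * (1 / 2) ^ n)"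
    using assms(3) by (simp add: sum.distrib sum_ennreal)
  also have "\<dots> \<le> (\<Sum>n\<in>I. ennreal (2 ^ (n * i) * \<phi> (1 / 2 ^ n))) + ennreal (2 * \<epsilon>)"
  proof (intro add_left_mono ennreal_leI)
    have "(\<Sum>n\<in>I. (1 / 2) ^ n) \<le> (\<Sum>n. (1 / 2 :: real) ^ n)"
      by (rule sum_le_suminf) (auto simp: assms(1) intro: summable_geometric)
    also have "\<dots> = 2" by (subst suminf_geometric) auto
    finally show "(\<Sum>n\<in>I. \<epsilon> * (1 / 2) ^ n) \<le> 2 * \<epsilon>" using assms(3) by (simp add: sum_distrib_left[symmetric])
  qed
  finally show ?thesis .
qed

text \<open>A bound for the sums of order r also bounds those of all orders i \<le> r, since 2^(n i)
  \<le> 2^(n r); this is what \<open>poly_sequence_limit\<close> asks for. The last conclusion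
  passes from P_M - P_L to the limit by Fatou's lemma.\<close>

lemma inverse_limit:
  assumes p: "1 \<le> p" and J: "\<alpha> \<in> J_exp p" "\<beta> \<in> J_exp p" and r: "1 \<le> r"
    and f: "f \<in> Lp_weighted p \<alpha> \<beta>" and P: "\<And>n. P n \<in> polys_below (2 ^ n)"
    and K: "K < \<infinity>" "\<And>M. (\<Sum>n=i0..M. ennreal (2 ^ (n * r)) * approx_error p \<alpha> \<beta> f (P n)) \<le> K"
  obtains g where "g \<in> B_rep p r \<alpha> \<beta>" "ae_eq f g"
    "\<forall>L B. i0 \<le> L \<longrightarrow> (\<forall>M\<ge>L. deriv_norm p \<alpha> \<beta> r (P M - P L) \<le> B) \<longrightarrow>
      Lp_norm p (\<lambda>x. jacobi_w \<alpha> \<beta> x * (vphi x ^ r * ((deriv ^^ r) g x - poly ((pderiv ^^ r) (P L)) x))) \<le> B"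
proof -
  \<comment> \<open>The sequence starts at i0, because the errors are controlled from there
    on.\<close>
  define S where "S = (\<lambda>j. P (i0 + j))"
  have fm: "f \<in> borel_measurable (lebesgue_on {-1..1})" using f by (simp add: Lp_weighted_def)
  let ?e = "\<lambda>n. approx_error p \<alpha> \<beta> f (P n)"
  have part: "\<exists>C'<\<infinity>. \<forall>M. (\<Sum>j<M. deriv_norm p \<alpha> \<beta> i (S (Suc j) - S j)) \<le> C'" if i: "i \<le> r" for i
  proof -
    obtain C where C: "0 < C" "\<And>n P. 0 < n \<Longrightarrow> P \<in> polys_below n \<Longrightarrow> deriv_norm p \<alpha> \<beta> i P \<le> ennreal (C * real n ^ i) * Lp_norm p (\<lambda>x. jacobi_w \<alpha> \<beta> x * poly P x)"
      using Bernstein_higher[OF p J, of i] unfolding deriv_norm_def by blast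
    have "(\<Sum>j<M. deriv_norm p \<alpha> \<beta> i (S (Suc j) - S j)) \<le> ennreal (C * (2 ^ i + 1)) * K" for M
    proof -
      have "(\<Sum>j<M. deriv_norm p \<alpha> \<beta> i (S (Suc j) - S j)) = (\<Sum>n=i0..<i0 + M. deriv_norm p \<alpha> \<beta> i (P (Suc n) - P n))"
        unfolding S_def by (rule sum.reindex_bij_witness[of _ "\<lambda>n. n - i0" "\<lambda>j. i0 + j"]) auto
      also have "\<dots> \<le> ennreal (C * (2 ^ i + 1)) * (\<Sum>n=i0..i0 + M. ennreal (2 ^ (n * i)) * ?e n)"
        by (rule deriv_norm_telescope_le[OF p fm C P])
      also have "\<dots> \<le> ennreal (C * (2 ^ i + 1)) * (\<Sum>n=i0..i0 + M. ennreal (2 ^ (n * r)) * ?e n)"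
        using i by (intro mult_left_mono sum_mono mult_right_mono ennreal_leI power_increasing) auto
      also have "\<dots> \<le> ennreal (C * (2 ^ i + 1)) * K" by (intro mult_left_mono K) auto
      finally show ?thesis .
    qed
    moreover have "ennreal (C * (2 ^ i + 1)) * K < \<infinity>" using K(1) by (simp add: ennreal_mult_less_top)
    ultimately show ?thesis by blast
  qed
  have fin: "(\<Sum>j. Lp_norm p (\<lambda>x. jacobi_w \<alpha> \<beta> x * (vphi x ^ i * poly ((pderiv ^^ i) (S (Suc j) - S j)) x))) < \<infinity>" if i: "i \<le> r" for i
  proof -
    obtain C' where C': "C' < \<infinity>" "\<And>M. (\<Sum>j<M. deriv_norm p \<alpha> \<beta> i (S (Suc j) - S j)) \<le> C'" using part[OF i] by blast
    have "(\<Sum>j. deriv_norm p \<alpha> \<beta> i (S (Suc j) - S j)) \<le> C'" by (rule suminf_le_const[OF summableI C'(2)])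
    then show ?thesis using C'(1) unfolding deriv_norm_def by (rule le_less_trans)
  qed
  obtain g where g: "\<And>j x. j < r - 1 \<Longrightarrow> -1 < x \<Longrightarrow> x < 1 \<Longrightarrow> (deriv ^^ j) g differentiable (at x)"
    "AC_loc ((deriv ^^ (r - 1)) g)"
    "\<And>x. -1 < x \<Longrightarrow> x < 1 \<Longrightarrow> (\<lambda>j. poly (S j) x) \<longlonglongrightarrow> g x"
    "AE x in lebesgue_on {-1..1}. (\<lambda>j. poly ((pderiv ^^ r) (S j)) x) \<longlonglongrightarrow> (deriv ^^ r) g x"
    using poly_sequence_limit[OF p r fin] by blast
  let ?G = "(deriv ^^ r) g"
  have Gm: "?G \<in> borel_measurable (lebesgue_on {-1..1})"
    by (rule poly_limit_measurable[OF g(4)])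
  have gl: "AE x in lebesgue_on {-1..1}. (\<lambda>j. poly (S j) x) \<longlonglongrightarrow> g x"
    using AE_open_interval by eventually_elim (use g(3) in auto)
  have gm: "g \<in> borel_measurable (lebesgue_on {-1..1})" by (rule poly_limit_measurable[OF gl])
  have [measurable]: "vphi \<in> borel_measurable (lebesgue_on {-1..1})" "jacobi_w \<alpha> \<beta> \<in> borel_measurable (lebesgue_on {-1..1})"
    by (intro borel_measurable_lebesgue_onI; measurable)+
  have pm: "poly Q \<in> borel_measurable (lebesgue_on {-1..1})" for Q :: "real poly"
    by (intro borel_measurable_lebesgue_onI) measurable
  have dm: "(\<lambda>x. jacobi_w \<alpha> \<beta> x * (vphi x ^ r * (?G x - poly ((pderiv ^^ r) Q) x))) \<in> borel_measurable (lebesgue_on {-1..1})" for Q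
    using Gm pm[of "(pderiv ^^ r) Q"] by measurable
  have Fat: "Lp_norm p (\<lambda>x. jacobi_w \<alpha> \<beta> x * (vphi x ^ r * (?G x - poly ((pderiv ^^ r) Q) x))) \<le> B"
    if ev: "\<forall>\<^sub>F j in sequentially. deriv_norm p \<alpha> \<beta> r (S j - Q) \<le> B" for Q B
  proof (rule Lp_norm_Fatou[OF p _ _ dm])
    show "(\<lambda>x. jacobi_w \<alpha> \<beta> x * (vphi x ^ r * poly ((pderiv ^^ r) (S j - Q)) x)) \<in> borel_measurable (lebesgue_on {-1..1})" for j
      by (rule jacobi_w_vphi_measurable)
    show "AE x in lebesgue_on {-1..1}. (\<lambda>j. jacobi_w \<alpha> \<beta> x * (vphi x ^ r * poly ((pderiv ^^ r) (S j - Q)) x)) \<longlonglongrightarrow> jacobi_w \<alpha> \<beta> x * (vphi x ^ r * (?G x - poly ((pderiv ^^ r) Q) x))"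
      using g(4) by eventually_elim (simp add: pderiv_iterate_diff, intro tendsto_mult tendsto_const tendsto_diff)
    show "\<forall>\<^sub>F j in sequentially. Lp_norm p (\<lambda>x. jacobi_w \<alpha> \<beta> x * (vphi x ^ r * poly ((pderiv ^^ r) (S j - Q)) x)) \<le> B"
      using ev by (simp add: deriv_norm_def)
  qed
  show thesis
  proof (rule that[of g])
    have "(\<lambda>x. vphi x ^ r * ?G x) \<in> Lp_weighted p \<alpha> \<beta>"
    proof -
      obtain C' where C': "C' < \<infinity>" "\<And>M. (\<Sum>j<M. deriv_norm p \<alpha> \<beta> r (S (Suc j) - S j)) \<le> C'" using part[of r] by blast
      have X: "Lp_norm p (\<lambda>x. jacobi_w \<alpha> \<beta> x * (vphi x ^ r * (?G x - poly ((pderiv ^^ r) (S 0)) x))) \<le> C'"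
      proof (rule Fat, intro always_eventually allI)
        fix j
        have "deriv_norm p \<alpha> \<beta> r (S j - S 0) \<le> (\<Sum>n=0..<j. deriv_norm p \<alpha> \<beta> r (S (Suc n) - S n))"
          by (rule deriv_norm_diff_le_sum[OF p]) simp
        also have "\<dots> \<le> C'" using C'(2)[of j] by (simp add: lessThan_atLeast0)
        finally show "deriv_norm p \<alpha> \<beta> r (S j - S 0) \<le> C'" .
      qed
      \<comment> \<open>The first polynomial and 0 are both at finite distance from f, so the
        Bernstein inequality for their difference gives a finite norm.\<close>
      have Y: "deriv_norm p \<alpha> \<beta> r (S 0) < \<infinity>"
      proof -
        obtain C where C: "0 < C" "\<And>n P. 0 < n \<Longrightarrow> P \<in> polys_below n \<Longrightarrow> deriv_norm p \<alpha> \<beta> r P \<le> ennreal (C * real n ^ r) * Lp_norm p (\<lambda>x. jacobi_w \<alpha> \<beta> x * poly P x)"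
          using Bernstein_higher[OF p J, of r] unfolding deriv_norm_def by blast
        have z: "approx_error p \<alpha> \<beta> f 0 < \<infinity>" using f by (simp add: approx_error_def Lp_weighted_def)
        have "ennreal (2 ^ (i0 * r)) * ?e i0 \<le> K" using K(2)[of i0] by simp
        then have "ennreal (2 ^ (i0 * r)) * ?e i0 < \<infinity>" using K(1) by (rule le_less_trans)
        then have e0: "approx_error p \<alpha> \<beta> f (S 0) < \<infinity>"
          by (auto simp: S_def ennreal_mult_less_top)
        have "deriv_norm p \<alpha> \<beta> r (S 0 - 0) \<le> ennreal (C * real (2 ^ i0) ^ r) * (approx_error p \<alpha> \<beta> f (S 0) + approx_error p \<alpha> \<beta> f 0)"
          using P[of i0] by (intro deriv_norm_diff_le[OF p fm C(2)]) (auto simp: S_def polys_below_def)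
        also have "\<dots> < \<infinity>" using e0 z by (simp add: ennreal_mult_less_top)
        finally show ?thesis by simp
      qed
      have "Lp_norm p (\<lambda>x. jacobi_w \<alpha> \<beta> x * (vphi x ^ r * ?G x)) \<le>
        Lp_norm p (\<lambda>x. jacobi_w \<alpha> \<beta> x * (vphi x ^ r * (?G x - poly ((pderiv ^^ r) (S 0)) x))) + deriv_norm p \<alpha> \<beta> r (S 0)"
      proof -
        have "(\<lambda>x. jacobi_w \<alpha> \<beta> x * (vphi x ^ r * ?G x)) = (\<lambda>x. jacobi_w \<alpha> \<beta> x * (vphi x ^ r * (?G x - poly ((pderiv ^^ r) (S 0)) x)) + jacobi_w \<alpha> \<beta> x * (vphi x ^ r * poly ((pderiv ^^ r) (S 0)) x))"
          by (simp add: fun_eq_iff algebra_simps)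
        then show ?thesis unfolding deriv_norm_def using Lp_norm_triangle[OF p dm jacobi_w_vphi_measurable] by simp
      qed
      also have "\<dots> \<le> C' + deriv_norm p \<alpha> \<beta> r (S 0)" using X by (rule add_right_mono)
      also have "\<dots> < \<infinity>" using C'(1) Y by simp
      finally have "Lp_norm p (\<lambda>x. jacobi_w \<alpha> \<beta> x * (vphi x ^ r * ?G x)) < \<infinity>" .
      then show ?thesis using Gm unfolding Lp_weighted_def by simp
    qed
    then show "g \<in> B_rep p r \<alpha> \<beta>" using g(1,2) r by (auto simp: B_rep_def)
  next
    have wm: "(\<lambda>x. jacobi_w \<alpha> \<beta> x * (f x - g x)) \<in> borel_measurable (lebesgue_on {-1..1})"
      using fm gm by measurable
    \<comment> \<open>Each single summand is at most K, so the error of P_n is at most K / 2^(n r),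
      which tends to 0 because r \<ge> 1.\<close>
    have "Lp_norm p (\<lambda>x. jacobi_w \<alpha> \<beta> x * (f x - g x)) \<le> 0"
    proof (rule ennreal_le_epsilon)
      fix d :: real assume d: "0 < d"
      obtain k where k: "K = ennreal k" "0 \<le> k" using K(1) by (cases K) auto
      obtain N where N: "k / d < 2 ^ N" using real_arch_pow[of 2 "k / d"] by auto
      have "Lp_norm p (\<lambda>x. jacobi_w \<alpha> \<beta> x * (f x - g x)) \<le> ennreal d"
      proof (rule Lp_norm_Fatou[OF p _ _ wm])
        show "(\<lambda>x. jacobi_w \<alpha> \<beta> x * (f x - poly (S j) x)) \<in> borel_measurable (lebesgue_on {-1..1})" for j
          by (rule borel_measurable_weighted_error[OF fm])
        show "AE x in lebesgue_on {-1..1}. (\<lambda>j. jacobi_w \<alpha> \<beta> x * (f x - poly (S j) x)) \<longlonglongrightarrow> jacobi_w \<alpha> \<beta> x * (f x - g x)"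
          using gl by eventually_elim (intro tendsto_mult tendsto_const tendsto_diff)
        show "\<forall>\<^sub>F j in sequentially. Lp_norm p (\<lambda>x. jacobi_w \<alpha> \<beta> x * (f x - poly (S j) x)) \<le> ennreal d"
          unfolding eventually_sequentially
        proof (intro exI[of _ N] allI impI)
          fix j assume j: "N \<le> j"
          have "ennreal (2 ^ ((i0 + j) * r)) * ?e (i0 + j) \<le> (\<Sum>n=i0..i0 + j. ennreal (2 ^ (n * r)) * ?e n)"
            by (rule member_le_sum) auto
          also have "\<dots> \<le> ennreal k" using K(2)[of "i0 + j"] k by simp
          finally have le: "ennreal (2 ^ ((i0 + j) * r)) * ?e (i0 + j) \<le> ennreal k" .
          have "N \<le> (i0 + j) * r" using j r using mult_le_mono[of N "i0 + j" 1 r] by simp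
          then have "(2::real) ^ N \<le> 2 ^ ((i0 + j) * r)" by (intro power_increasing) auto
          then have "k / d \<le> 2 ^ ((i0 + j) * r)" using N by linarith
          then have kd: "k \<le> 2 ^ ((i0 + j) * r) * d" using d by (simp add: pos_divide_le_eq)
          have "?e (i0 + j) = ennreal (1 / 2 ^ ((i0 + j) * r)) * (ennreal (2 ^ ((i0 + j) * r)) * ?e (i0 + j))"
            by (simp add: mult.assoc[symmetric] ennreal_mult[symmetric])
          also have "\<dots> \<le> ennreal (1 / 2 ^ ((i0 + j) * r)) * ennreal (2 ^ ((i0 + j) * r) * d)"
            using le kd by (intro mult_left_mono order_trans[OF le] ennreal_leI) auto
          also have "\<dots> = ennreal d" using d by (simp add: ennreal_mult[symmetric])
          finally show "Lp_norm p (\<lambda>x. jacobi_w \<alpha> \<beta> x * (f x - poly (S j) x)) \<le> ennreal d"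
            by (simp add: approx_error_def S_def)
        qed
      qed
      then show "Lp_norm p (\<lambda>x. jacobi_w \<alpha> \<beta> x * (f x - g x)) \<le> 0 + ennreal d" by simp
    qed
    then have "AE x in lebesgue_on {-1..1}. jacobi_w \<alpha> \<beta> x * (f x - g x) = 0"
      by (rule Lp_norm_le_0_imp_AE[OF p wm])
    with AE_open_interval have "AE x in lebesgue_on {-1..1}. f x = g x"
      by eventually_elim (auto simp: jacobi_w_def)
    then show "ae_eq f g" by (simp add: ae_eq_def)
  next
    show "\<forall>L B. i0 \<le> L \<longrightarrow> (\<forall>M\<ge>L. deriv_norm p \<alpha> \<beta> r (P M - P L) \<le> B) \<longrightarrow>
      Lp_norm p (\<lambda>x. jacobi_w \<alpha> \<beta> x * (vphi x ^ r * (?G x - poly ((pderiv ^^ r) (P L)) x))) \<le> B"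
    proof (intro allI impI)
      fix L B assume L: "i0 \<le> L" and B: "\<forall>M\<ge>L. deriv_norm p \<alpha> \<beta> r (P M - P L) \<le> B"
      show "Lp_norm p (\<lambda>x. jacobi_w \<alpha> \<beta> x * (vphi x ^ r * (?G x - poly ((pderiv ^^ r) (P L)) x))) \<le> B"
      proof (rule Fat)
        show "\<forall>\<^sub>F j in sequentially. deriv_norm p \<alpha> \<beta> r (S j - P L) \<le> B"
          unfolding eventually_sequentially S_def by (intro exI[of _ "L - i0"] allI impI B[rule_format]) auto
      qed
    qed
  qed
qed

section \<open>The inverse estimate\<close>

text \<open>The least n with 2^n \<ge> 2/t; minimality, tested at n - 1, gives the upper
  bound.\<close>

lemma dyadic_index_near:
  fixes t :: real
  assumes "0 < t" "t \<le> 1/2"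
  obtains n :: nat where "2 / 2 ^ n \<le> t" "2 ^ n < 4 / t"
proof -
  define n where "n = (LEAST n::nat. 2 / t \<le> 2 ^ n)"
  have "\<exists>n::nat. 2 / t \<le> 2 ^ n" using real_arch_pow[of 2 "2 / t"] by (auto intro: less_imp_le)
  then have n: "2 / t \<le> 2 ^ n" unfolding n_def by (rule LeastI_ex)
  have "n \<noteq> 0"
  proof
    assume "n = 0"
    then have "2 / t \<le> 1" using n by simp
    then show False using assms by (simp add: field_simps)
  qed
  then obtain n' where n': "n = Suc n'" by (cases n) auto
  have "\<not> 2 / t \<le> 2 ^ n'" using not_less_Least[of n' "\<lambda>n. 2 / t \<le> 2 ^ n"] n' by (simp add: n_def)
  then have "2 ^ n < 4 / t" using n' by simp
  moreover have "2 / 2 ^ n \<le> t" using n assms by (simp add: field_simps)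
  ultimately show thesis by (rule that[rotated])
qed

text \<open>The power \<open>vphi x ^ r\<close> merges with the Jacobi weight into the exponents of
  the modulus. The function is then split at the r-th derivative of Q: no smoothness is asked of the
  first part, and the power of t comes from the polynomial part alone.\<close>

lemma Lp_norm_shift_split:
  assumes p: "1 \<le> p" and k: "1 \<le> k" and ab: "0 \<le> real r / 2 + \<alpha>" "0 \<le> real r / 2 + \<beta>"
    and G: "G \<in> borel_measurable (lebesgue_on {-1..1})" and t: "0 \<le> t"
  shows "modulus k r G t p \<alpha> \<beta> \<le>
    ennreal (2 ^ (k + 1)) * Lp_norm p (\<lambda>x. jacobi_w \<alpha> \<beta> x * (vphi x ^ r * (G x - poly ((pderiv ^^ r) Q) x))) +
    ennreal (4 * (2 * real k) ^ k * t ^ k) * deriv_norm p \<alpha> \<beta> (k + r) Q"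
  unfolding modulus_def
proof (rule SUP_least)
  fix h assume "h \<in> {0..t}"
  then have h: "0 \<le> h" "h \<le> t" by auto
  let ?\<xi> = "real r / 2 + \<alpha>" and ?\<zeta> = "real r / 2 + \<beta>"
  let ?W = "shifted_w (real k * h) ?\<xi> ?\<zeta>"
  let ?q = "poly ((pderiv ^^ r) Q)"
  let ?H = "\<lambda>x. G x - ?q x"
  have wr: "jacobi_w ?\<xi> ?\<zeta> x = jacobi_w \<alpha> \<beta> x * vphi x ^ r" if "-1 < x" "x < 1" for x
    using jacobi_w_vphi_power[of x \<alpha> \<beta> r] that by (simp add: add.commute)
  have qm: "?q \<in> borel_measurable (lebesgue_on {-1..1})" by (intro borel_measurable_lebesgue_onI) measurable
  then have Hm: "?H \<in> borel_measurable (lebesgue_on {-1..1})" using G by measurable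
  have wm: "jacobi_w a b \<in> borel_measurable (lebesgue_on {-1..1})" "vphi \<in> borel_measurable (lebesgue_on {-1..1})" for a b
    by (intro borel_measurable_lebesgue_onI; measurable)+
  have "(\<lambda>x. ?W x * sym_diff k (h * vphi x) G x) = (\<lambda>x. ?W x * sym_diff k (h * vphi x) ?H x + ?W x * sym_diff k (h * vphi x) ?q x)"
    by (auto simp: fun_eq_iff sym_diff_def distrib_left[symmetric] sum.distrib[symmetric] intro!: sum.cong)
  then have "Lp_norm p (\<lambda>x. ?W x * sym_diff k (h * vphi x) G x) \<le>
    Lp_norm p (\<lambda>x. ?W x * sym_diff k (h * vphi x) ?H x) + Lp_norm p (\<lambda>x. ?W x * sym_diff k (h * vphi x) ?q x)"
    using Lp_norm_triangle[OF p weighted_sym_diff_measurable[OF k h(1) Hm] weighted_sym_diff_measurable[OF k h(1) qm]] by simp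
  also have "\<dots> \<le> ennreal (2 ^ (k + 1)) * Lp_norm p (\<lambda>x. jacobi_w ?\<xi> ?\<zeta> x * ?H x) +
    ennreal (4 * (2 * real k) ^ k * h ^ k) * Lp_norm p (\<lambda>x. jacobi_w ?\<xi> ?\<zeta> x * (vphi x ^ k * poly ((pderiv ^^ k) ((pderiv ^^ r) Q)) x))"
    by (intro add_mono Lp_norm_sym_diff_le Lp_norm_sym_diff_poly_le p k h ab Hm)
  also have "Lp_norm p (\<lambda>x. jacobi_w ?\<xi> ?\<zeta> x * ?H x) = Lp_norm p (\<lambda>x. jacobi_w \<alpha> \<beta> x * (vphi x ^ r * ?H x))"
  proof (rule Lp_norm_cong_AE[OF p])
    show "AE x in lebesgue_on {-1..1}. \<bar>jacobi_w ?\<xi> ?\<zeta> x * ?H x\<bar> = \<bar>jacobi_w \<alpha> \<beta> x * (vphi x ^ r * ?H x)\<bar>"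
      using AE_open_interval by eventually_elim (simp add: wr mult.assoc)
  qed (use wm Hm in measurable)
  also have "Lp_norm p (\<lambda>x. jacobi_w ?\<xi> ?\<zeta> x * (vphi x ^ k * poly ((pderiv ^^ k) ((pderiv ^^ r) Q)) x)) = deriv_norm p \<alpha> \<beta> (k + r) Q"
    unfolding deriv_norm_def
  proof (rule Lp_norm_cong_AE[OF p jacobi_w_vphi_measurable _ jacobi_w_vphi_measurable])
    show "AE x in lebesgue_on {-1..1}. \<bar>jacobi_w ?\<xi> ?\<zeta> x * (vphi x ^ k * poly ((pderiv ^^ k) ((pderiv ^^ r) Q)) x)\<bar> =
      \<bar>jacobi_w \<alpha> \<beta> x * (vphi x ^ (k + r) * poly ((pderiv ^^ (k + r)) Q) x)\<bar>"
      using AE_open_interval by eventually_elim (simp add: wr power_add funpow_add mult_ac)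
  qed
  also have "ennreal (4 * (2 * real k) ^ k * h ^ k) * deriv_norm p \<alpha> \<beta> (k + r) Q \<le> ennreal (4 * (2 * real k) ^ k * t ^ k) * deriv_norm p \<alpha> \<beta> (k + r) Q"
    using h by (intro mult_right_mono ennreal_leI mult_left_mono power_mono) auto
  finally show "Lp_norm p (\<lambda>x. ?W x * sym_diff k (h * vphi x) G x) \<le>
    ennreal (2 ^ (k + 1)) * Lp_norm p (\<lambda>x. jacobi_w \<alpha> \<beta> x * (vphi x ^ r * ?H x)) +
    ennreal (4 * (2 * real k) ^ k * t ^ k) * deriv_norm p \<alpha> \<beta> (k + r) Q"
    by (simp add: add_left_mono)
qed

lemma deriv_norm_add_le:
  assumes "1 \<le> p"
  shows "deriv_norm p \<alpha> \<beta> i Q \<le> deriv_norm p \<alpha> \<beta> i (Q - R) + deriv_norm p \<alpha> \<beta> i R"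
proof -
  have "(\<lambda>x. jacobi_w \<alpha> \<beta> x * (vphi x ^ i * poly ((pderiv ^^ i) Q) x)) =
    (\<lambda>x. jacobi_w \<alpha> \<beta> x * (vphi x ^ i * poly ((pderiv ^^ i) (Q - R)) x) + jacobi_w \<alpha> \<beta> x * (vphi x ^ i * poly ((pderiv ^^ i) R) x))"
    by (simp add: fun_eq_iff pderiv_iterate_diff algebra_simps)
  then show ?thesis unfolding deriv_norm_def
    using Lp_norm_triangle[OF assms jacobi_w_vphi_measurable jacobi_w_vphi_measurable] by simp
qed

lemma pderiv_iterate_polys_below:
  "P \<in> polys_below m \<Longrightarrow> (pderiv ^^ m) P = (0 :: real poly)"
proof (induction m arbitrary: P)
  case (Suc m)
  have "pderiv P \<in> polys_below m"
    using Suc.prems degree_pderiv[of P] by (cases "degree P = 0") (auto simp: polys_below_def pderiv_eq_0_iff)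
  then have "(pderiv ^^ m) (pderiv P) = 0" by (rule Suc.IH)
  then show ?case by (simp add: funpow_Suc_right del: funpow.simps)
qed (simp add: polys_below_def)

text \<open>For \<open>2\<^sup>-\<^sup>J < t\<close> only the two largest indices can fall outside the range of integration; there the
  monotonicity of \<open>\<phi>\<close> is used instead.\<close>

lemma dyadic_sum_le_upper_integral:
  fixes \<phi> :: "real \<Rightarrow> real"
  assumes mono: "mono_on {0..} \<phi>" and nn: "\<And>t. 0 \<le> t \<Longrightarrow> 0 \<le> \<phi> t" and t: "0 < t" "t \<le> 1/2"
    and J: "2 / 2 ^ J \<le> t" "2 ^ J < 4 / t" and i0: "1 \<le> i0"
  shows "(\<Sum>n=i0..J. ennreal (2 ^ (n * m) * \<phi> (1 / 2 ^ n))) \<le>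
    ennreal (2 ^ (m + 1) * (1 + 2 * 4 ^ m)) * (\<integral>\<^sup>+u\<in>{t..1}. ennreal (\<phi> u / u ^ (m + 1)) \<partial>lborel)"
proof -
  let ?T = "\<integral>\<^sup>+u\<in>{t..1}. ennreal (\<phi> u / u ^ (m + 1)) \<partial>lborel"
  let ?a = "\<lambda>n. ennreal (2 ^ (n * m) * \<phi> (1 / 2 ^ n))"
  \<comment> \<open>For n + 2 \<le> J one has 4 2^n \<le> 2^J < 4/t, so (2^-n, 2^(1-n)] lies above
    t; it lies below 1 because n \<ge> 1.\<close>
  let ?I1 = "{n\<in>{i0..J}. n + 2 \<le> J}" and ?I2 = "{n\<in>{i0..J}. J < n + 2}"
  have "(\<Sum>n=i0..J. ?a n) = (\<Sum>n\<in>?I1. ?a n) + (\<Sum>n\<in>?I2. ?a n)"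
    by (subst sum.union_disjoint[symmetric]) (auto intro!: sum.cong)
  also have "(\<Sum>n\<in>?I1. ?a n) \<le> ennreal (2 ^ (m + 1)) * ?T"
  proof (rule dyadic_sum_le_integral[OF mono nn])
    fix n assume n: "n \<in> ?I1"
    have "(2::real) ^ (n + 2) \<le> 2 ^ J" using n by (intro power_increasing) auto
    then have "2 ^ n * 4 < 4 / t" using J(2) by simp
    then have "t \<le> 1 / 2 ^ n" using t by (simp add: field_simps)
    moreover have "2 / 2 ^ n \<le> (1::real)"
    proof -
      have "(2::real) ^ 1 \<le> 2 ^ n" using n i0 by (intro power_increasing) auto
      then show ?thesis by (simp add: field_simps)
    qed
    ultimately show "{1/2^n <.. 2/2^n} \<subseteq> {t..1}"
      by (intro subsetI) (simp only: greaterThanAtMost_iff atLeastAtMost_iff, linarith)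
  qed auto
  also have "(\<Sum>n\<in>?I2. ?a n) \<le> (\<Sum>n\<in>{J - 1, J}. ennreal ((4 / t) ^ m * \<phi> t))"
  proof (rule order_trans[OF sum_mono sum_mono2])
    fix n assume n: "n \<in> ?I2"
    have "(2::real) ^ n \<le> 2 ^ J" using n by (intro power_increasing) auto
    then have le: "2 ^ n \<le> 4 / t" using J(2) by linarith
    have "(2::real) ^ J \<le> 2 ^ (n + 1)" using n by (intro power_increasing) auto
    then have "1 / 2 ^ n \<le> 2 / (2::real) ^ J" by (simp add: field_simps)
    then have "\<phi> (1 / 2 ^ n) \<le> \<phi> t" using J(1) t by (intro mono_onD[OF mono]) auto
    moreover have "2 ^ (n * m) \<le> (4 / t) ^ m" unfolding power_mult using le by (intro power_mono) auto
    ultimately show "?a n \<le> ennreal ((4 / t) ^ m * \<phi> t)"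
      using nn t by (intro ennreal_leI mult_mono) auto
  qed auto
  also have "\<dots> \<le> ennreal (2 * (4 / t) ^ m) * ennreal (\<phi> t)"
  proof -
    have "(\<Sum>n\<in>{J - 1, J}. ennreal ((4 / t) ^ m * \<phi> t)) = of_nat (card {J - 1, J}) * ennreal ((4 / t) ^ m * \<phi> t)" by simp
    also have "\<dots> \<le> of_nat 2 * ennreal ((4 / t) ^ m * \<phi> t)"
      by (intro mult_right_mono) (auto simp: card_insert_if)
    also have "\<dots> = ennreal (2 * (4 / t) ^ m) * ennreal (\<phi> t)" using t nn by (simp add: ennreal_mult mult.assoc)
    finally show ?thesis .
  qed
  also have "\<dots> \<le> ennreal (2 * (4 / t) ^ m) * (ennreal (2 ^ (m + 1) * t ^ m) * ?T)"
    by (intro mult_left_mono phi_le_integral mono nn t) auto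
  also have "\<dots> = ennreal (2 * 4 ^ m * 2 ^ (m + 1)) * ?T"
    using t by (simp add: mult.assoc[symmetric] ennreal_mult[symmetric] power_divide)
  also have "ennreal (2 ^ (m + 1)) * ?T + ennreal (2 * 4 ^ m * 2 ^ (m + 1)) * ?T = ennreal (2 ^ (m + 1) * (1 + 2 * 4 ^ m)) * ?T"
    by (subst distrib_right[symmetric], subst ennreal_plus[symmetric]) (auto simp: algebra_simps)
  finally show ?thesis by (simp add: add_mono)
qed

section \<open>Near-best sequences under the rate hypothesis\<close>

lemma near_best_sequence:
  assumes "f \<in> Lp_weighted p \<alpha> \<beta>" "0 < \<epsilon>"
  obtains P where "\<And>n. P n \<in> polys_below (2 ^ n)"
    "\<And>n. approx_error p \<alpha> \<beta> f (P n) \<le> best_approx (2 ^ n) f p \<alpha> \<beta> + ennreal (\<epsilon> / 2 ^ (n * (m + 1)))"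
proof -
  have "\<forall>n. \<exists>Q. Q \<in> polys_below (2 ^ n) \<and> approx_error p \<alpha> \<beta> f Q \<le> best_approx (2 ^ n) f p \<alpha> \<beta> + ennreal (\<epsilon> / 2 ^ (n * (m + 1)))"
  proof
    fix n :: nat
    have "0 < \<epsilon> / 2 ^ (n * (m + 1))" using assms(2) by simp
    from near_best_polynomial[OF assms(1) this] show "\<exists>Q. Q \<in> polys_below (2 ^ n) \<and> approx_error p \<alpha> \<beta> f Q \<le> best_approx (2 ^ n) f p \<alpha> \<beta> + ennreal (\<epsilon> / 2 ^ (n * (m + 1)))"
      by blast
  qed
  from choice[OF this] show thesis using that by blast
qed

text \<open>The rate is assumed at 1/(2^n + 1) \<le> 2^-n, and \<phi> is monotone. Writing the
  starting degree as 2^i0 makes it apply to all dyadic degrees of index at least i0.\<close>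

lemma approx_rate_dyadic:
  assumes "approx_rate_hyp r (2 ^ i0) p \<alpha> \<beta> \<phi> f" "i0 \<le> n"
  shows "best_approx (2 ^ n) f p \<alpha> \<beta> \<le> ennreal (\<phi> (1 / 2 ^ n))"
proof -
  have "(2::nat) ^ i0 \<le> 2 ^ n" using assms(2) by (intro power_increasing) auto
  then have "best_approx (2 ^ n) f p \<alpha> \<beta> \<le> ennreal (\<phi> (1 / (real (2 ^ n) + 1)))"
    using assms(1) unfolding approx_rate_hyp_def by blast
  also have "\<dots> \<le> ennreal (\<phi> (1 / 2 ^ n))"
  proof -
    have "mono_on {0..} \<phi>" using assms(1) by (simp add: approx_rate_hyp_def Phi_class_def)
    moreover have "1 / (real (2 ^ n) + 1) \<le> 1 / 2 ^ n"
      by (intro divide_left_mono) (auto intro!: mult_pos_pos add_pos_pos)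
    ultimately show ?thesis by (intro ennreal_leI mono_onD[of "{0..}" \<phi>]) auto
  qed
  finally show ?thesis .
qed

text \<open>From L on, all dyadic intervals lie in (0,t]. The factor r of the integrand is at least
  1 here and can be inserted.\<close>

lemma inverse_tail_sum:
  assumes p: "1 \<le> p" and hyp: "approx_rate_hyp r (2 ^ i0) p \<alpha> \<beta> \<phi> f" and r: "1 \<le> r" "r \<le> m" and \<epsilon>: "0 < \<epsilon>"
    and e: "\<And>n. approx_error p \<alpha> \<beta> f (P n) \<le> best_approx (2 ^ n) f p \<alpha> \<beta> + ennreal (\<epsilon> / 2 ^ (n * (m + 1)))"
    and L: "i0 \<le> L" "2 / 2 ^ L \<le> t"
  shows "(\<Sum>n=L..M. ennreal (2 ^ (n * r)) * approx_error p \<alpha> \<beta> f (P n)) \<le>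
    ennreal (2 ^ (r + 1)) * (\<integral>\<^sup>+u\<in>{0<..t}. ennreal (real r * \<phi> u / u ^ (r + 1)) \<partial>lborel) + ennreal (2 * \<epsilon>)"
proof -
  have \<phi>: "mono_on {0..} \<phi>" "\<And>t. 0 \<le> t \<Longrightarrow> 0 \<le> \<phi> t" using hyp by (auto simp: approx_rate_hyp_def Phi_class_def)
  have "(\<Sum>n=L..M. ennreal (2 ^ (n * r)) * approx_error p \<alpha> \<beta> f (P n)) \<le> (\<Sum>n=L..M. ennreal (2 ^ (n * r) * \<phi> (1 / 2 ^ n))) + ennreal (2 * \<epsilon>)"
  proof (rule weighted_error_sum_le[OF _ r(2) \<epsilon> \<phi>(2)])
    fix n assume "n \<in> {L..M}"
    then have "best_approx (2 ^ n) f p \<alpha> \<beta> \<le> ennreal (\<phi> (1 / 2 ^ n))" using L by (intro approx_rate_dyadic[OF hyp]) auto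
    then show "approx_error p \<alpha> \<beta> f (P n) \<le> ennreal (\<phi> (1 / 2 ^ n)) + ennreal (\<epsilon> / 2 ^ (n * (m + 1)))"
      by (intro order_trans[OF e] add_right_mono)
  qed auto
  also have "(\<Sum>n=L..M. ennreal (2 ^ (n * r) * \<phi> (1 / 2 ^ n))) \<le> ennreal (2 ^ (r + 1)) * (\<integral>\<^sup>+u\<in>{0<..t}. ennreal (\<phi> u / u ^ (r + 1)) \<partial>lborel)"
  proof (rule dyadic_sum_le_integral[OF \<phi>])
    fix n assume "n \<in> {L..M}"
    then have "(2::real) ^ L \<le> 2 ^ n" by (intro power_increasing) auto
    then have "2 / 2 ^ n \<le> 2 / (2::real) ^ L" by (simp add: field_simps)
    then have "2 / 2 ^ n \<le> t" using L(2) by linarith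
    moreover have "0 < 1 / (2::real) ^ n" by simp
    ultimately show "{1/2^n <.. 2/2^n} \<subseteq> {0<..t}" by (auto intro: less_trans)
  qed auto
  also have "(\<integral>\<^sup>+u\<in>{0<..t}. ennreal (\<phi> u / u ^ (r + 1)) \<partial>lborel) \<le> (\<integral>\<^sup>+u\<in>{0<..t}. ennreal (real r * \<phi> u / u ^ (r + 1)) \<partial>lborel)"
  proof (rule nn_integral_mono)
    fix u :: real
    show "ennreal (\<phi> u / u ^ (r + 1)) * indicator {0<..t} u \<le> ennreal (real r * \<phi> u / u ^ (r + 1)) * indicator {0<..t} u"
    proof (cases "u \<in> {0<..t}")
      case True
      have "1 * \<phi> u \<le> real r * \<phi> u" using True r \<phi>(2) by (intro mult_right_mono) auto
      then have "\<phi> u / u ^ (r + 1) \<le> real r * \<phi> u / u ^ (r + 1)" using True by (intro divide_right_mono) auto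
      then show ?thesis by (intro mult_right_mono ennreal_leI) auto
    qed simp
  qed
  finally show ?thesis by (simp add: mult_left_mono add_right_mono)
qed

lemma approx_rate_in_B_space:
  assumes p: "1 \<le> p" and J: "\<alpha> \<in> J_exp p" "\<beta> \<in> J_exp p" and hyp: "approx_rate_hyp r N p \<alpha> \<beta> \<phi> f"
  shows "f \<in> B_space p r \<alpha> \<beta>"
proof (cases "r = 0")
  case True
  then show ?thesis using hyp by (auto simp: B_space_def B_rep_def approx_rate_hyp_def ae_eq_def)
next
  case False
  then have r: "1 \<le> r" by simp
  \<comment> \<open>Ensures N \<le> 2^i0, and i0 \<ge> 1 puts the dyadic intervals into (0,1], where
    the integral is finite by hypothesis.\<close>
  define i0 where "i0 = Suc N"
  have "N \<le> 2 ^ i0" using less_exp[of N] unfolding i0_def power_Suc by linarith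
  then have hyp': "approx_rate_hyp r (2 ^ i0) p \<alpha> \<beta> \<phi> f" using hyp by (auto simp: approx_rate_hyp_def)
  have f: "f \<in> Lp_weighted p \<alpha> \<beta>" using hyp by (simp add: approx_rate_hyp_def)
  obtain P where P: "\<And>n. P n \<in> polys_below (2 ^ n)"
    "\<And>n. approx_error p \<alpha> \<beta> f (P n) \<le> best_approx (2 ^ n) f p \<alpha> \<beta> + ennreal (1 / 2 ^ (n * (r + 1)))"
    using near_best_sequence[OF f, of 1] by auto
  let ?K = "ennreal (2 ^ (r + 1)) * (\<integral>\<^sup>+u\<in>{0<..1}. ennreal (real r * \<phi> u / u ^ (r + 1)) \<partial>lborel) + ennreal (2 * 1)"
  have "?K < \<infinity>" using hyp by (auto simp: approx_rate_hyp_def ennreal_mult_less_top)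
  moreover have "2 / 2 ^ i0 \<le> (1::real)" by (simp add: i0_def)
  then have "(\<Sum>n=i0..M. ennreal (2 ^ (n * r)) * approx_error p \<alpha> \<beta> f (P n)) \<le> ?K" for M
    by (intro inverse_tail_sum[OF p hyp' r order_refl _ P(2)]) auto
  ultimately obtain g where "g \<in> B_rep p r \<alpha> \<beta>" "ae_eq f g"
    using inverse_limit[OF p J r f P(1), of ?K i0] by blast
  then show ?thesis by (auto simp: B_space_def)
qed

text \<open>For r \<ge> 1 the sum over the indices from L on controls the difference and yields the
  first integral. For r = 0 that integral vanishes through its factor r; there the error of P_L is
  at most \<phi>(t) up to slack, and \<phi>(t) is covered by the second integral.\<close>

lemma inverse_tail_estimate:
  assumes p: "1 \<le> p" and J: "\<alpha> \<in> J_exp p" "\<beta> \<in> J_exp p"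
  obtains c where "0 < c" "\<And>i0 \<phi> f g \<epsilon> P t L. approx_rate_hyp r (2 ^ i0) p \<alpha> \<beta> \<phi> f \<Longrightarrow> g \<in> B_rep p r \<alpha> \<beta> \<Longrightarrow> ae_eq f g \<Longrightarrow> 0 < \<epsilon> \<Longrightarrow>
    (\<And>n. P n \<in> polys_below (2 ^ n)) \<Longrightarrow>
    (\<And>n. approx_error p \<alpha> \<beta> f (P n) \<le> best_approx (2 ^ n) f p \<alpha> \<beta> + ennreal (\<epsilon> / 2 ^ (n * (k + r + 1)))) \<Longrightarrow>
    1 \<le> i0 \<Longrightarrow> i0 \<le> L \<Longrightarrow> 2 / 2 ^ L \<le> t \<Longrightarrow> 0 < t \<Longrightarrow> t \<le> 1/2 \<Longrightarrow>
    Lp_norm p (\<lambda>x. jacobi_w \<alpha> \<beta> x * (vphi x ^ r * ((deriv ^^ r) g x - poly ((pderiv ^^ r) (P L)) x))) \<le>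
    inverse_bound k r \<phi> c t + ennreal (c * \<epsilon>)"
proof (cases "r = 0")
  case True
  \<comment> \<open>The constant of \<open>phi_le_integral\<close> with s = k.\<close>
  let ?c = "2 ^ (k + 1) :: real"
  show thesis
  proof (rule that[of ?c])
    fix i0 \<phi> f g and \<epsilon> :: real and P :: "nat \<Rightarrow> real poly" and t :: real and L
    assume hyp: "approx_rate_hyp r (2 ^ i0) p \<alpha> \<beta> \<phi> f" and g: "g \<in> B_rep p r \<alpha> \<beta>" "ae_eq f g" and \<epsilon>: "0 < \<epsilon>"
      and P: "\<And>n. P n \<in> polys_below (2 ^ n)" "\<And>n. approx_error p \<alpha> \<beta> f (P n) \<le> best_approx (2 ^ n) f p \<alpha> \<beta> + ennreal (\<epsilon> / 2 ^ (n * (k + r + 1)))"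
      and L: "1 \<le> i0" "i0 \<le> L" "2 / 2 ^ L \<le> t" and t: "0 < t" "t \<le> 1/2"
    have \<phi>: "mono_on {0..} \<phi>" "\<And>t. 0 \<le> t \<Longrightarrow> 0 \<le> \<phi> t" using hyp by (auto simp: approx_rate_hyp_def Phi_class_def)
    have gm: "g \<in> borel_measurable (lebesgue_on {-1..1})" using g True by (simp add: B_rep_def Lp_weighted_def)
    have fm: "f \<in> borel_measurable (lebesgue_on {-1..1})" using hyp by (simp add: approx_rate_hyp_def Lp_weighted_def)
    let ?T = "\<integral>\<^sup>+u\<in>{t..1}. ennreal (\<phi> u / u ^ (k + r + 1)) \<partial>lborel"
    have "Lp_norm p (\<lambda>x. jacobi_w \<alpha> \<beta> x * (vphi x ^ r * ((deriv ^^ r) g x - poly ((pderiv ^^ r) (P L)) x))) =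
      Lp_norm p (\<lambda>x. jacobi_w \<alpha> \<beta> x * (g x - poly (P L) x))" using True by simp
    also have "\<dots> = approx_error p \<alpha> \<beta> f (P L)" unfolding approx_error_def
      using g(2) by (intro Lp_norm_cong_AE[OF p] borel_measurable_weighted_error gm fm) (auto simp: ae_eq_def elim!: eventually_mono)
    also have "\<dots> \<le> best_approx (2 ^ L) f p \<alpha> \<beta> + ennreal (\<epsilon> / 2 ^ (L * (k + r + 1)))" by (rule P(2))
    also have "\<dots> \<le> ennreal (\<phi> t) + ennreal (?c * \<epsilon>)"
    proof (rule add_mono)
      have "best_approx (2 ^ L) f p \<alpha> \<beta> \<le> ennreal (\<phi> (1 / 2 ^ L))" by (rule approx_rate_dyadic[OF hyp L(2)])
      also have "\<dots> \<le> ennreal (\<phi> t)"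
      proof (intro ennreal_leI mono_onD[OF \<phi>(1)])
        have "1 / 2 ^ L \<le> 2 / (2::real) ^ L" by (simp add: field_simps)
        then show "1 / 2 ^ L \<le> t" using L(3) by linarith
      qed (use t in auto)
      finally show "best_approx (2 ^ L) f p \<alpha> \<beta> \<le> ennreal (\<phi> t)" .
      have "\<epsilon> / 2 ^ (L * (k + r + 1)) \<le> \<epsilon> / 1" using \<epsilon> by (intro divide_left_mono) auto
      also have "\<dots> \<le> ?c * \<epsilon>" 
      proof -
        have "1 \<le> ?c" by (rule one_le_power) simp
        from mult_right_mono[OF this, of \<epsilon>] show ?thesis using \<epsilon> by simp
      qed
      finally show "ennreal (\<epsilon> / 2 ^ (L * (k + r + 1))) \<le> ennreal (?c * \<epsilon>)" by (rule ennreal_leI)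
    qed
    also have "ennreal (\<phi> t) \<le> ennreal (?c * t ^ k) * ?T"
      using phi_le_integral[OF \<phi> t, of k] True by simp
    also have "\<dots> \<le> inverse_bound k r \<phi> ?c t" unfolding inverse_bound_def by simp
    finally show "Lp_norm p (\<lambda>x. jacobi_w \<alpha> \<beta> x * (vphi x ^ r * ((deriv ^^ r) g x - poly ((pderiv ^^ r) (P L)) x))) \<le> inverse_bound k r \<phi> ?c t + ennreal (?c * \<epsilon>)"
      by (simp add: add_right_mono)
  qed simp
next
  case False
  then have r: "1 \<le> r" by simp
  obtain C where C: "0 < C" "\<And>n P. 0 < n \<Longrightarrow> P \<in> polys_below n \<Longrightarrow> deriv_norm p \<alpha> \<beta> r P \<le> ennreal (C * real n ^ r) * Lp_norm p (\<lambda>x. jacobi_w \<alpha> \<beta> x * poly P x)"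
    using Bernstein_higher[OF p J, of r] unfolding deriv_norm_def by blast
  \<comment> \<open>The telescoping constant times the factor 2^(r+1) from the comparison with the
    integral.\<close>
  let ?c = "C * (2 ^ r + 1) * 2 ^ (r + 1)"
  show thesis
  proof (rule that[of ?c])
    show "0 < ?c" using C by (intro mult_pos_pos add_pos_pos) auto
    fix i0 \<phi> f g and \<epsilon> :: real and P :: "nat \<Rightarrow> real poly" and t :: real and L
    assume hyp: "approx_rate_hyp r (2 ^ i0) p \<alpha> \<beta> \<phi> f" and g: "g \<in> B_rep p r \<alpha> \<beta>" "ae_eq f g" and \<epsilon>: "0 < \<epsilon>"
      and P: "\<And>n. P n \<in> polys_below (2 ^ n)" "\<And>n. approx_error p \<alpha> \<beta> f (P n) \<le> best_approx (2 ^ n) f p \<alpha> \<beta> + ennreal (\<epsilon> / 2 ^ (n * (k + r + 1)))"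
      and L: "1 \<le> i0" "i0 \<le> L" "2 / 2 ^ L \<le> t" and t: "0 < t" "t \<le> 1/2"
    have f: "f \<in> Lp_weighted p \<alpha> \<beta>" using hyp by (simp add: approx_rate_hyp_def)
    then have fm: "f \<in> borel_measurable (lebesgue_on {-1..1})" by (simp add: Lp_weighted_def)
    let ?T = "\<lambda>t. \<integral>\<^sup>+u\<in>{0<..t}. ennreal (real r * \<phi> u / u ^ (r + 1)) \<partial>lborel"
    let ?K = "ennreal (2 ^ (r + 1)) * ?T 1 + ennreal (2 * \<epsilon>)"
    have K: "?K < \<infinity>" using hyp by (auto simp: approx_rate_hyp_def ennreal_mult_less_top)
    have "(2::real) ^ 1 \<le> 2 ^ i0" using L(1) by (intro power_increasing) auto
    then have "2 / 2 ^ i0 \<le> (1::real)" by (simp add: field_simps)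
    then have Ksum: "(\<Sum>n=i0..M. ennreal (2 ^ (n * r)) * approx_error p \<alpha> \<beta> f (P n)) \<le> ?K" for M
      by (intro inverse_tail_sum[OF p hyp r _ \<epsilon> P(2)]) auto
    obtain g0 where g0: "g0 \<in> B_rep p r \<alpha> \<beta>" "ae_eq f g0"
      "\<forall>L B. i0 \<le> L \<longrightarrow> (\<forall>M\<ge>L. deriv_norm p \<alpha> \<beta> r (P M - P L) \<le> B) \<longrightarrow>
      Lp_norm p (\<lambda>x. jacobi_w \<alpha> \<beta> x * (vphi x ^ r * ((deriv ^^ r) g0 x - poly ((pderiv ^^ r) (P L)) x))) \<le> B"
      by (rule inverse_limit[OF p J r f P(1) K Ksum])
    \<comment> \<open>The given representative and the constructed one are continuous, hence equal
      on (-1,1) together with their derivatives.\<close>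
    have "ae_eq g g0" using g(2) g0(2) unfolding ae_eq_def by eventually_elim auto
    then have "g x = g0 x" if "-1 < x" "x < 1" for x
      using continuous_ae_eq_imp_eq[OF B_rep_continuous[OF g(1) r] B_rep_continuous[OF g0(1) r]] that by blast
    then have deq: "(deriv ^^ r) g x = (deriv ^^ r) g0 x" if "-1 < x" "x < 1" for x
      using higher_deriv_cong that by blast
    have dm: "(\<lambda>x. jacobi_w \<alpha> \<beta> x * (vphi x ^ r * ((deriv ^^ r) h x - poly ((pderiv ^^ r) (P L)) x))) \<in> borel_measurable (lebesgue_on {-1..1})"
      if "h \<in> B_rep p r \<alpha> \<beta>" for h
    proof -
      have [measurable]: "(\<lambda>x. vphi x ^ r * (deriv ^^ r) h x) \<in> borel_measurable (lebesgue_on {-1..1})"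
        using that r by (auto simp: B_rep_def Lp_weighted_def)
      have [measurable]: "jacobi_w \<alpha> \<beta> \<in> borel_measurable (lebesgue_on {-1..1})" "vphi \<in> borel_measurable (lebesgue_on {-1..1})"
        "poly ((pderiv ^^ r) (P L)) \<in> borel_measurable (lebesgue_on {-1..1})"
        by (intro borel_measurable_lebesgue_onI; measurable)+
      have "(\<lambda>x. jacobi_w \<alpha> \<beta> x * (vphi x ^ r * (deriv ^^ r) h x - vphi x ^ r * poly ((pderiv ^^ r) (P L)) x)) \<in> borel_measurable (lebesgue_on {-1..1})"
        by measurable
      then show ?thesis by (simp add: right_diff_distrib)
    qed
    have "Lp_norm p (\<lambda>x. jacobi_w \<alpha> \<beta> x * (vphi x ^ r * ((deriv ^^ r) g x - poly ((pderiv ^^ r) (P L)) x))) =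
      Lp_norm p (\<lambda>x. jacobi_w \<alpha> \<beta> x * (vphi x ^ r * ((deriv ^^ r) g0 x - poly ((pderiv ^^ r) (P L)) x)))"
    proof (rule Lp_norm_cong_AE[OF p dm[OF g(1)] _ dm[OF g0(1)]])
      show "AE x in lebesgue_on {-1..1}. \<bar>jacobi_w \<alpha> \<beta> x * (vphi x ^ r * ((deriv ^^ r) g x - poly ((pderiv ^^ r) (P L)) x))\<bar> =
        \<bar>jacobi_w \<alpha> \<beta> x * (vphi x ^ r * ((deriv ^^ r) g0 x - poly ((pderiv ^^ r) (P L)) x))\<bar>"
        using AE_open_interval by eventually_elim (simp add: deq)
    qed
    also have "\<dots> \<le> ennreal (C * (2 ^ r + 1)) * (ennreal (2 ^ (r + 1)) * ?T t + ennreal (2 * \<epsilon>))"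
    proof (rule g0(3)[rule_format, OF L(2)])
      fix M assume M: "L \<le> M"
      have "deriv_norm p \<alpha> \<beta> r (P M - P L) \<le> (\<Sum>n=L..<M. deriv_norm p \<alpha> \<beta> r (P (Suc n) - P n))"
        by (rule deriv_norm_diff_le_sum[OF p M])
      also have "\<dots> \<le> ennreal (C * (2 ^ r + 1)) * (\<Sum>n=L..M. ennreal (2 ^ (n * r)) * approx_error p \<alpha> \<beta> f (P n))"
        by (rule deriv_norm_telescope_le[OF p fm C P(1)])
      also have "\<dots> \<le> ennreal (C * (2 ^ r + 1)) * (ennreal (2 ^ (r + 1)) * ?T t + ennreal (2 * \<epsilon>))"
        by (intro mult_left_mono inverse_tail_sum[OF p hyp r _ \<epsilon> P(2) L(2,3)]) auto
      finally show "deriv_norm p \<alpha> \<beta> r (P M - P L) \<le> ennreal (C * (2 ^ r + 1)) * (ennreal (2 ^ (r + 1)) * ?T t + ennreal (2 * \<epsilon>))" .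
    qed
    also have "\<dots> = ennreal ?c * ?T t + ennreal (C * (2 ^ r + 1) * (2 * \<epsilon>))"
    proof -
      have "ennreal u * (ennreal v * X + ennreal w) = ennreal (u * v) * X + ennreal (u * w)" if "0 \<le> u" "0 \<le> v" "0 \<le> w" for u v w X
        using that by (simp add: distrib_left ennreal_mult mult.assoc)
      then show ?thesis using C(1) \<epsilon> by simp
    qed
    also have "\<dots> \<le> inverse_bound k r \<phi> ?c t + ennreal (?c * \<epsilon>)"
    proof (intro add_mono ennreal_leI)
      show "ennreal ?c * ?T t \<le> inverse_bound k r \<phi> ?c t" unfolding inverse_bound_def by simp
      have "(2::real) ^ 1 \<le> 2 ^ (r + 1)" by (intro power_increasing) auto
      then have "C * (2 ^ r + 1) * 2 \<le> ?c" using C(1) by (intro mult_left_mono) auto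
      then have "(C * (2 ^ r + 1) * 2) * \<epsilon> \<le> ?c * \<epsilon>" using \<epsilon> by (intro mult_right_mono) auto
      then show "C * (2 ^ r + 1) * (2 * \<epsilon>) \<le> ?c * \<epsilon>" by (simp only: mult.assoc)
    qed
    finally show "Lp_norm p (\<lambda>x. jacobi_w \<alpha> \<beta> x * (vphi x ^ r * ((deriv ^^ r) g x - poly ((pderiv ^^ r) (P L)) x))) \<le> inverse_bound k r \<phi> ?c t + ennreal (?c * \<epsilon>)" .
  qed
qed

text \<open>P_L is reached from P_i0 by telescoping, and P_i0 is compared with a near-best
  polynomial of degree below k + r, whose derivative of order k + r vanishes. This comparison
  produces the term with \<open>best_approx (k + r)\<close>, and its Bernstein factor 2^(i0 (k+r))
  is the source of the dependence on N. If L = i0, nothing has to be telescoped.\<close>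

lemma inverse_head_estimate:
  assumes p: "1 \<le> p" and J: "\<alpha> \<in> J_exp p" "\<beta> \<in> J_exp p" and k: "1 \<le> k"
  obtains c where "0 < c" "\<And>i0 \<phi> f \<epsilon> P t L. approx_rate_hyp r (2 ^ i0) p \<alpha> \<beta> \<phi> f \<Longrightarrow> 0 < \<epsilon> \<Longrightarrow>
    (\<And>n. P n \<in> polys_below (2 ^ n)) \<Longrightarrow>
    (\<And>n. approx_error p \<alpha> \<beta> f (P n) \<le> best_approx (2 ^ n) f p \<alpha> \<beta> + ennreal (\<epsilon> / 2 ^ (n * (k + r + 1)))) \<Longrightarrow>
    1 \<le> i0 \<Longrightarrow> k + r \<le> 2 ^ i0 \<Longrightarrow> L = i0 \<or> i0 \<le> L \<and> 2 / 2 ^ L \<le> t \<and> 2 ^ L < 4 / t \<Longrightarrow> 0 < t \<Longrightarrow> t \<le> 1/2 \<Longrightarrow>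
    deriv_norm p \<alpha> \<beta> (k + r) (P L) \<le> ennreal c * (\<integral>\<^sup>+u\<in>{t..1}. ennreal (\<phi> u / u ^ (k + r + 1)) \<partial>lborel) + ennreal (c * \<epsilon>) +
      ennreal (c * real (2 ^ i0) ^ (k + r)) * (best_approx (k + r) f p \<alpha> \<beta> + ennreal \<epsilon>)"
proof -
  let ?m = "k + r"
  obtain C where C: "0 < C" "\<And>n P. 0 < n \<Longrightarrow> P \<in> polys_below n \<Longrightarrow> deriv_norm p \<alpha> \<beta> ?m P \<le> ennreal (C * real n ^ ?m) * Lp_norm p (\<lambda>x. jacobi_w \<alpha> \<beta> x * poly P x)"
    using Bernstein_higher[OF p J, of ?m] unfolding deriv_norm_def by blast
  \<comment> \<open>The constant of \<open>dyadic_sum_le_upper_integral\<close> with m = k + r;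
    being at least 2, it also covers the factor 2 of the slack and of the comparison with Q.\<close>
  define K where "K = (2::real) ^ (?m + 1) * (1 + 2 * 4 ^ ?m)"
  have K: "2 \<le> K"
  proof -
    have "(2::real) ^ 1 * 1 \<le> 2 ^ (?m + 1) * (1 + 2 * 4 ^ ?m)"
      by (intro mult_mono power_increasing) auto
    then show ?thesis by (simp add: K_def)
  qed
  define c where "c = C * (2 ^ ?m + 1) * K"
  have cK: "C * 2 \<le> c"
  proof -
    have "C * 1 * 2 \<le> C * (2 ^ ?m + 1) * K" using C(1) K by (intro mult_mono) auto
    then show ?thesis by (simp add: c_def)
  qed
  have c0: "0 < c" using C(1) cK by linarith
  show thesis
  proof (rule that[OF c0])
    fix i0 \<phi> f and \<epsilon> :: real and P :: "nat \<Rightarrow> real poly" and t :: real and L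
    assume hyp: "approx_rate_hyp r (2 ^ i0) p \<alpha> \<beta> \<phi> f" and \<epsilon>: "0 < \<epsilon>"
      and P: "\<And>n. P n \<in> polys_below (2 ^ n)" "\<And>n. approx_error p \<alpha> \<beta> f (P n) \<le> best_approx (2 ^ n) f p \<alpha> \<beta> + ennreal (\<epsilon> / 2 ^ (n * (?m + 1)))"
      and i0: "1 \<le> i0" "?m \<le> 2 ^ i0" and L: "L = i0 \<or> i0 \<le> L \<and> 2 / 2 ^ L \<le> t \<and> 2 ^ L < 4 / t" and t: "0 < t" "t \<le> 1/2"
    have \<phi>: "mono_on {0..} \<phi>" "\<And>t. 0 \<le> t \<Longrightarrow> 0 \<le> \<phi> t" using hyp by (auto simp: approx_rate_hyp_def Phi_class_def)
    have f: "f \<in> Lp_weighted p \<alpha> \<beta>" using hyp by (simp add: approx_rate_hyp_def)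
    then have fm: "f \<in> borel_measurable (lebesgue_on {-1..1})" by (simp add: Lp_weighted_def)
    let ?T = "\<integral>\<^sup>+u\<in>{t..1}. ennreal (\<phi> u / u ^ (?m + 1)) \<partial>lborel"
    let ?E = "best_approx ?m f p \<alpha> \<beta>"
    obtain Q where Q: "Q \<in> polys_below ?m" "approx_error p \<alpha> \<beta> f Q \<le> ?E + ennreal \<epsilon>"
      using near_best_polynomial[OF f \<epsilon>] by blast
    have "deriv_norm p \<alpha> \<beta> ?m (P i0) \<le> deriv_norm p \<alpha> \<beta> ?m (P i0 - Q) + deriv_norm p \<alpha> \<beta> ?m Q"
      by (rule deriv_norm_add_le[OF p])
    also have "deriv_norm p \<alpha> \<beta> ?m Q = 0"
      using pderiv_iterate_polys_below[OF Q(1)] Lp_norm_zero[OF p] by (simp add: deriv_norm_def)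
    also have "deriv_norm p \<alpha> \<beta> ?m (P i0 - Q) + 0 \<le> ennreal (C * real (2 ^ i0) ^ ?m) * (approx_error p \<alpha> \<beta> f (P i0) + approx_error p \<alpha> \<beta> f Q)"
      using deriv_norm_diff_le[OF p fm C(2) _ P(1) polys_below_mono[OF i0(2) Q(1)]] by simp
    also have "\<dots> \<le> ennreal (C * real (2 ^ i0) ^ ?m) * ((?E + ennreal \<epsilon>) + (?E + ennreal \<epsilon>))"
    proof (intro mult_left_mono add_mono Q(2))
      \<comment> \<open>As k + r \<le> 2^i0, the infimum for P_i0 runs over a larger set of
        polynomials than that for Q.\<close>
      have "approx_error p \<alpha> \<beta> f (P i0) \<le> best_approx (2 ^ i0) f p \<alpha> \<beta> + ennreal (\<epsilon> / 2 ^ (i0 * (?m + 1)))" by (rule P(2))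
      also have "\<dots> \<le> ?E + ennreal \<epsilon>"
      proof (intro add_mono best_approx_antimono i0 ennreal_leI)
        have "\<epsilon> / 2 ^ (i0 * (?m + 1)) \<le> \<epsilon> / 1" using \<epsilon> by (intro divide_left_mono one_le_power) auto
        then show "\<epsilon> / 2 ^ (i0 * (?m + 1)) \<le> \<epsilon>" by simp
      qed
      finally show "approx_error p \<alpha> \<beta> f (P i0) \<le> ?E + ennreal \<epsilon>" .
    qed auto
    also have "\<dots> = ennreal (2 * (C * real (2 ^ i0) ^ ?m)) * (?E + ennreal \<epsilon>)"
    proof -
      have "ennreal x * (e + e) = ennreal (2 * x) * e" if "0 \<le> x" for x e
      proof -
        have "ennreal (2 * x) = ennreal x + ennreal x" using that by (subst ennreal_plus[symmetric]) auto
        then show ?thesis by (simp add: distrib_left distrib_right)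
      qed
      then show ?thesis using C(1) by simp
    qed
    also have "\<dots> \<le> ennreal (c * real (2 ^ i0) ^ ?m) * (?E + ennreal \<epsilon>)"
    proof (intro mult_right_mono ennreal_leI)
      have "(C * 2) * real (2 ^ i0) ^ ?m \<le> c * real (2 ^ i0) ^ ?m" using cK by (intro mult_right_mono) auto
      then show "2 * (C * real (2 ^ i0) ^ ?m) \<le> c * real (2 ^ i0) ^ ?m" by (simp add: mult_ac)
    qed simp
    finally have head: "deriv_norm p \<alpha> \<beta> ?m (P i0) \<le> ennreal (c * real (2 ^ i0) ^ ?m) * (?E + ennreal \<epsilon>)" .
    have tail: "deriv_norm p \<alpha> \<beta> ?m (P L - P i0) \<le> ennreal c * ?T + ennreal (c * \<epsilon>)"
    proof (cases "L = i0")
      case True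
      then show ?thesis using deriv_norm_diff_le_sum[OF p, of i0 L \<alpha> \<beta> ?m P] by simp
    next
      case False
      then have L': "i0 \<le> L" "2 / 2 ^ L \<le> t" "2 ^ L < 4 / t" using L by auto
      have "deriv_norm p \<alpha> \<beta> ?m (P L - P i0) \<le> (\<Sum>n=i0..<L. deriv_norm p \<alpha> \<beta> ?m (P (Suc n) - P n))"
        by (rule deriv_norm_diff_le_sum[OF p L'(1)])
      also have "\<dots> \<le> ennreal (C * (2 ^ ?m + 1)) * (\<Sum>n=i0..L. ennreal (2 ^ (n * ?m)) * approx_error p \<alpha> \<beta> f (P n))"
        by (rule deriv_norm_telescope_le[OF p fm C P(1)])
      also have "(\<Sum>n=i0..L. ennreal (2 ^ (n * ?m)) * approx_error p \<alpha> \<beta> f (P n)) \<le> (\<Sum>n=i0..L. ennreal (2 ^ (n * ?m) * \<phi> (1 / 2 ^ n))) + ennreal (2 * \<epsilon>)"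
      proof (rule weighted_error_sum_le[OF _ order_refl \<epsilon> \<phi>(2)])
        fix n assume "n \<in> {i0..L}"
        then have "best_approx (2 ^ n) f p \<alpha> \<beta> \<le> ennreal (\<phi> (1 / 2 ^ n))" by (intro approx_rate_dyadic[OF hyp]) auto
        then show "approx_error p \<alpha> \<beta> f (P n) \<le> ennreal (\<phi> (1 / 2 ^ n)) + ennreal (\<epsilon> / 2 ^ (n * (?m + 1)))"
          by (intro order_trans[OF P(2)] add_right_mono)
      qed auto
      also have "(\<Sum>n=i0..L. ennreal (2 ^ (n * ?m) * \<phi> (1 / 2 ^ n))) \<le> ennreal K * ?T"
        unfolding K_def by (rule dyadic_sum_le_upper_integral[OF \<phi> t L'(2,3) i0(1)])
      also have "ennreal (C * (2 ^ ?m + 1)) * (ennreal K * ?T + ennreal (2 * \<epsilon>)) \<le> ennreal (C * (2 ^ ?m + 1)) * (ennreal K * ?T + ennreal (K * \<epsilon>))"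
        using K \<epsilon> by (intro mult_left_mono add_left_mono ennreal_leI mult_right_mono) auto
      also have "\<dots> = ennreal c * ?T + ennreal (c * \<epsilon>)"
      proof -
        have "ennreal u * (ennreal v * X + ennreal (v * w)) = ennreal (u * v) * X + ennreal (u * v * w)" if "0 \<le> u" "0 \<le> v" "0 \<le> w" for u v w X
          using that by (simp add: distrib_left ennreal_mult mult.assoc)
        then show ?thesis using C(1) K \<epsilon> unfolding c_def by simp
      qed
      finally show ?thesis by (simp add: mult_left_mono add_right_mono)
    qed
    show "deriv_norm p \<alpha> \<beta> ?m (P L) \<le> ennreal c * ?T + ennreal (c * \<epsilon>) + ennreal (c * real (2 ^ i0) ^ ?m) * (?E + ennreal \<epsilon>)"
      by (rule order_trans[OF deriv_norm_add_le[OF p, of _ _ _ _ "P i0"] add_mono[OF tail head]])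
  qed
qed

text \<open>Here s stands for t^k, w for 2^(i0 (k+r)), T1 and T2 for the two integrals. The
  multiples of \<epsilon> are collected, and s \<le> 1 makes their total factor independent of
  s.\<close>

lemma combine_bounds:
  fixes X Y T1 T2 E :: ennreal and a b c d s \<epsilon> w :: real
  assumes nn: "0 \<le> a" "0 \<le> b" "0 \<le> c" "0 \<le> d" "0 \<le> s" "s \<le> 1" "0 \<le> \<epsilon>" "0 \<le> w"
    and X: "X \<le> ennreal c * T1 + ennreal (c * s) * T2 + ennreal (c * \<epsilon>)"
    and Y: "Y \<le> ennreal d * T2 + ennreal (d * \<epsilon>) + ennreal (d * w) * (E + ennreal \<epsilon>)"
  shows "ennreal a * X + ennreal (b * s) * Y \<le>
    ennreal (a * c + b * d) * T1 + ennreal ((a * c + b * d) * s) * T2 + ennreal (b * d * w * s) * E + ennreal ((a * c + b * d + b * d * w) * \<epsilon>)"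
proof -
  have "ennreal a * X + ennreal (b * s) * Y \<le> ennreal a * (ennreal c * T1 + ennreal (c * s) * T2 + ennreal (c * \<epsilon>)) +
    ennreal (b * s) * (ennreal d * T2 + ennreal (d * \<epsilon>) + ennreal (d * w) * (E + ennreal \<epsilon>))"
    by (intro add_mono mult_left_mono X Y) auto
  also have "\<dots> = ennreal (a * c) * T1 + (ennreal (a * c * s) * T2 + ennreal (b * d * s) * T2) + ennreal (b * d * w * s) * E +
    (ennreal (a * c * \<epsilon>) + ennreal (b * d * \<epsilon> * s) + ennreal (b * d * w * \<epsilon> * s))"
    using nn by (simp add: distrib_left ennreal_mult mult_ac add_ac)
  also have "ennreal (a * c * s) * T2 + ennreal (b * d * s) * T2 = ennreal ((a * c + b * d) * s) * T2"
    using nn by (simp add: distrib_right ennreal_plus)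
  also have "ennreal (a * c * \<epsilon>) + ennreal (b * d * \<epsilon> * s) + ennreal (b * d * w * \<epsilon> * s) = ennreal (a * c * \<epsilon> + b * d * \<epsilon> * s + b * d * w * \<epsilon> * s)"
    using nn by (simp add: ennreal_plus)
  also have "ennreal (a * c) * T1 + ennreal ((a * c + b * d) * s) * T2 + ennreal (b * d * w * s) * E + ennreal (a * c * \<epsilon> + b * d * \<epsilon> * s + b * d * w * \<epsilon> * s)
    \<le> ennreal (a * c + b * d) * T1 + ennreal ((a * c + b * d) * s) * T2 + ennreal (b * d * w * s) * E + ennreal ((a * c + b * d + b * d * w) * \<epsilon>)"
  proof -
    have 1: "ennreal (a * c) * T1 \<le> ennreal (a * c + b * d) * T1"
      using nn by (intro mult_right_mono ennreal_leI) auto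
    have "b * d * \<epsilon> * s \<le> b * d * \<epsilon>" "b * d * w * \<epsilon> * s \<le> b * d * w * \<epsilon>" using nn by (auto intro!: mult_left_le)
    then have 2: "ennreal (a * c * \<epsilon> + b * d * \<epsilon> * s + b * d * w * \<epsilon> * s) \<le> ennreal ((a * c + b * d + b * d * w) * \<epsilon>)"
      by (intro ennreal_leI) (simp add: distrib_right)
    show ?thesis by (rule add_mono[OF add_mono[OF add_mono[OF 1 order_refl] order_refl] 2])
  qed
  finally show ?thesis .
qed

text \<open>Both parts of \<open>Lp_norm_shift_split\<close> are estimated with the same L. The
  polynomials depend on the slack \<epsilon>, the constants do not, so the slack can be made to
  contribute any prescribed e > 0.\<close>

lemma inverse_estimate:
  assumes p: "1 \<le> p" and J: "\<alpha> \<in> J_exp p" "\<beta> \<in> J_exp p" and k: "1 \<le> k"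
    and ab: "0 \<le> real r / 2 + \<alpha>" "0 \<le> real r / 2 + \<beta>"
  obtains C where "0 < C" "\<And>i0 \<phi> f g t. approx_rate_hyp r (2 ^ i0) p \<alpha> \<beta> \<phi> f \<Longrightarrow> 1 \<le> i0 \<Longrightarrow> k + r \<le> 2 ^ i0 \<Longrightarrow>
    g \<in> B_rep p r \<alpha> \<beta> \<Longrightarrow> ae_eq f g \<Longrightarrow> 0 < t \<Longrightarrow> t \<le> 1/2 \<Longrightarrow>
    modulus k r ((deriv ^^ r) g) t p \<alpha> \<beta> \<le> inverse_bound k r \<phi> C t + ennreal (C * real (2 ^ i0) ^ (k + r) * t ^ k) * best_approx (k + r) f p \<alpha> \<beta>"
proof -
  obtain c where c: "0 < c" and X: "\<And>i0 \<phi> f g \<epsilon> P t L. approx_rate_hyp r (2 ^ i0) p \<alpha> \<beta> \<phi> f \<Longrightarrow> g \<in> B_rep p r \<alpha> \<beta> \<Longrightarrow> ae_eq f g \<Longrightarrow> 0 < \<epsilon> \<Longrightarrow>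
    (\<And>n. P n \<in> polys_below (2 ^ n)) \<Longrightarrow>
    (\<And>n. approx_error p \<alpha> \<beta> f (P n) \<le> best_approx (2 ^ n) f p \<alpha> \<beta> + ennreal (\<epsilon> / 2 ^ (n * (k + r + 1)))) \<Longrightarrow>
    1 \<le> i0 \<Longrightarrow> i0 \<le> L \<Longrightarrow> 2 / 2 ^ L \<le> t \<Longrightarrow> 0 < t \<Longrightarrow> t \<le> 1/2 \<Longrightarrow>
    Lp_norm p (\<lambda>x. jacobi_w \<alpha> \<beta> x * (vphi x ^ r * ((deriv ^^ r) g x - poly ((pderiv ^^ r) (P L)) x))) \<le>
    inverse_bound k r \<phi> c t + ennreal (c * \<epsilon>)"
    using inverse_tail_estimate[OF p J] by blast
  obtain d where d: "0 < d" and Y: "\<And>i0 \<phi> f \<epsilon> P t L. approx_rate_hyp r (2 ^ i0) p \<alpha> \<beta> \<phi> f \<Longrightarrow> 0 < \<epsilon> \<Longrightarrow>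
    (\<And>n. P n \<in> polys_below (2 ^ n)) \<Longrightarrow>
    (\<And>n. approx_error p \<alpha> \<beta> f (P n) \<le> best_approx (2 ^ n) f p \<alpha> \<beta> + ennreal (\<epsilon> / 2 ^ (n * (k + r + 1)))) \<Longrightarrow>
    1 \<le> i0 \<Longrightarrow> k + r \<le> 2 ^ i0 \<Longrightarrow> L = i0 \<or> i0 \<le> L \<and> 2 / 2 ^ L \<le> t \<and> 2 ^ L < 4 / t \<Longrightarrow> 0 < t \<Longrightarrow> t \<le> 1/2 \<Longrightarrow>
    deriv_norm p \<alpha> \<beta> (k + r) (P L) \<le> ennreal d * (\<integral>\<^sup>+u\<in>{t..1}. ennreal (\<phi> u / u ^ (k + r + 1)) \<partial>lborel) + ennreal (d * \<epsilon>) +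
      ennreal (d * real (2 ^ i0) ^ (k + r)) * (best_approx (k + r) f p \<alpha> \<beta> + ennreal \<epsilon>)"
    using inverse_head_estimate[OF p J k, of r] by blast
  define a where "a = (2::real) ^ (k + 1)"
  define b where "b = 4 * (2 * real k) ^ k"
  have ab0: "0 < a" "0 < b" using k by (auto simp: a_def b_def)
  show thesis
  proof (rule that[of "a * c + b * d"])
    show "0 < a * c + b * d" using ab0 c d by (intro add_pos_pos mult_pos_pos)
    fix i0 \<phi> f g and t :: real
    assume hyp: "approx_rate_hyp r (2 ^ i0) p \<alpha> \<beta> \<phi> f" and i0: "1 \<le> i0" "k + r \<le> 2 ^ i0"
      and g: "g \<in> B_rep p r \<alpha> \<beta>" "ae_eq f g" and t: "0 < t" "t \<le> 1/2"
    have f: "f \<in> Lp_weighted p \<alpha> \<beta>" using hyp by (simp add: approx_rate_hyp_def)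
    let ?w = "real (2 ^ i0) ^ (k + r)"
    let ?E = "best_approx (k + r) f p \<alpha> \<beta>"
    let ?G = "(deriv ^^ r) g"
    \<comment> \<open>Membership in \<open>B_rep\<close> gives measurability of
      \<open>vphi x ^ r\<close> times the derivative; division by this power, positive in the
      interior, removes it.\<close>
    have Gm: "?G \<in> borel_measurable (lebesgue_on {-1..1})"
    proof (cases "r = 0")
      case True
      then show ?thesis using g by (simp add: B_rep_def Lp_weighted_def)
    next
      case False
      have [measurable]: "vphi \<in> borel_measurable (lebesgue_on {-1..1})" by (intro borel_measurable_lebesgue_onI) measurable
      have [measurable]: "(\<lambda>x. vphi x ^ r * ?G x) \<in> borel_measurable (lebesgue_on {-1..1})"
        using g False by (auto simp: B_rep_def Lp_weighted_def)
      show ?thesis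
      proof (rule borel_measurable_lebesgue_on_AE)
        show "(\<lambda>x. (vphi x ^ r * ?G x) / vphi x ^ r) \<in> borel_measurable (lebesgue_on {-1..1})" by measurable
        show "AE x in lebesgue_on {-1..1}. (vphi x ^ r * ?G x) / vphi x ^ r = ?G x"
          using AE_open_interval
        proof eventually_elim
          fix x :: real assume "-1 < x \<and> x < 1"
          then have "0 < vphi x" by (simp add: vphi_def abs_square_less_1 abs_less_iff)
          then show "(vphi x ^ r * ?G x) / vphi x ^ r = ?G x" by simp
        qed
      qed
    qed
    obtain J0 where J0: "2 / 2 ^ J0 \<le> t" "2 ^ J0 < 4 / t" using dyadic_index_near[OF t] by blast
    \<comment> \<open>The rate is assumed from 2^i0 on only. If i0 exceeds J0, then 2^L < 4/t may
      fail; this is the alternative L = i0 of \<open>inverse_head_estimate\<close>.\<close>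
    define L where "L = max i0 J0"
    have L: "i0 \<le> L" "2 / 2 ^ L \<le> t" "L = i0 \<or> i0 \<le> L \<and> 2 / 2 ^ L \<le> t \<and> 2 ^ L < 4 / t"
    proof -
      have "(2::real) ^ J0 \<le> 2 ^ L" by (intro power_increasing) (auto simp: L_def)
      then have "2 / 2 ^ L \<le> 2 / (2::real) ^ J0" by (simp add: field_simps)
      then show "2 / 2 ^ L \<le> t" using J0(1) by linarith
      show "i0 \<le> L" by (simp add: L_def)
      show "L = i0 \<or> i0 \<le> L \<and> 2 / 2 ^ L \<le> t \<and> 2 ^ L < 4 / t" using J0 by (auto simp: L_def max_def)
    qed
    \<comment> \<open>The total factor of \<epsilon> in \<open>combine_bounds\<close>; the choice
      \<epsilon> = e / ?D leaves exactly e.\<close>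
    let ?D = "a * c + b * d + b * d * ?w"
    have D: "0 < ?D" using ab0 c d by (intro add_pos_nonneg add_pos_pos mult_pos_pos) auto
    show "modulus k r ?G t p \<alpha> \<beta> \<le> inverse_bound k r \<phi> (a * c + b * d) t + ennreal ((a * c + b * d) * ?w * t ^ k) * ?E"
    proof (rule ennreal_le_epsilon)
      fix e :: real assume e: "0 < e"
      define \<epsilon> where "\<epsilon> = e / ?D"
      have \<epsilon>: "0 < \<epsilon>" using e D by (simp add: \<epsilon>_def)
      obtain P where P: "\<And>n. P n \<in> polys_below (2 ^ n)"
        "\<And>n. approx_error p \<alpha> \<beta> f (P n) \<le> best_approx (2 ^ n) f p \<alpha> \<beta> + ennreal (\<epsilon> / 2 ^ (n * (k + r + 1)))"
        using near_best_sequence[OF f \<epsilon>, of "k + r"] by blast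
      have "modulus k r ?G t p \<alpha> \<beta> \<le> ennreal a * Lp_norm p (\<lambda>x. jacobi_w \<alpha> \<beta> x * (vphi x ^ r * (?G x - poly ((pderiv ^^ r) (P L)) x))) +
        ennreal (b * t ^ k) * deriv_norm p \<alpha> \<beta> (k + r) (P L)"
        unfolding a_def b_def using t by (intro Lp_norm_shift_split p k ab Gm) auto
      also have "\<dots> \<le> ennreal (a * c + b * d) * (\<integral>\<^sup>+u\<in>{0<..t}. ennreal (real r * \<phi> u / u ^ (r + 1)) \<partial>lborel) +
        ennreal ((a * c + b * d) * t ^ k) * (\<integral>\<^sup>+u\<in>{t..1}. ennreal (\<phi> u / u ^ (k + r + 1)) \<partial>lborel) + ennreal (b * d * ?w * t ^ k) * ?E + ennreal (?D * \<epsilon>)"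
      proof (rule combine_bounds)
        show "t ^ k \<le> 1" using t by (intro power_le_one) auto
        show "Lp_norm p (\<lambda>x. jacobi_w \<alpha> \<beta> x * (vphi x ^ r * (?G x - poly ((pderiv ^^ r) (P L)) x))) \<le>
          ennreal c * (\<integral>\<^sup>+u\<in>{0<..t}. ennreal (real r * \<phi> u / u ^ (r + 1)) \<partial>lborel) + ennreal (c * t ^ k) * (\<integral>\<^sup>+u\<in>{t..1}. ennreal (\<phi> u / u ^ (k + r + 1)) \<partial>lborel) + ennreal (c * \<epsilon>)"
          using X[OF hyp g \<epsilon> P i0(1) L(1,2) t] unfolding inverse_bound_def .
        show "deriv_norm p \<alpha> \<beta> (k + r) (P L) \<le> ennreal d * (\<integral>\<^sup>+u\<in>{t..1}. ennreal (\<phi> u / u ^ (k + r + 1)) \<partial>lborel) + ennreal (d * \<epsilon>) +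
          ennreal (d * ?w) * (?E + ennreal \<epsilon>)"
          by (rule Y[OF hyp \<epsilon> P i0 L(3) t])
      qed (use ab0 c d \<epsilon> t in auto)
      also have "?D * \<epsilon> = e" using D by (simp add: \<epsilon>_def)
      also have "ennreal (b * d * ?w * t ^ k) * ?E \<le> ennreal ((a * c + b * d) * ?w * t ^ k) * ?E"
        using ab0 c d t by (intro mult_right_mono ennreal_leI) auto
      finally show "modulus k r ?G t p \<alpha> \<beta> \<le> inverse_bound k r \<phi> (a * c + b * d) t + ennreal ((a * c + b * d) * ?w * t ^ k) * ?E + ennreal e"
        unfolding inverse_bound_def by (simp add: add_left_mono add_right_mono)
    qed
  qed
qed

text \<open>The bounds are claimed for every representative g of f, so nothing depends on a choice;
  the first part ensures that a representative exists.\<close>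

theorem corollary1p8:
  fixes r :: nat and p :: ennreal and \<alpha> \<beta> :: real
  assumes "1 \<le> p"
    and "\<alpha> \<in> J_exp p" and "\<beta> \<in> J_exp p"
    and "real r / 2 + \<alpha> \<ge> 0" and "real r / 2 + \<beta> \<ge> 0"
  shows "(\<forall>N\<ge>1. \<forall>\<phi> f. approx_rate_hyp r N p \<alpha> \<beta> \<phi> f \<longrightarrow> f \<in> B_space p r \<alpha> \<beta>) \<and>
    (\<forall>k\<ge>1. \<exists>c>0. \<forall>N\<ge>1. \<exists>cN>0. \<forall>\<phi> f. approx_rate_hyp r N p \<alpha> \<beta> \<phi> f \<longrightarrow>
       (\<forall>g\<in>B_rep p r \<alpha> \<beta>. ae_eq f g \<longrightarrow> (\<forall>t\<in>{0<..1/2}.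
          modulus k r ((deriv ^^ r) g) t p \<alpha> \<beta>
            \<le> inverse_bound k r \<phi> c t + ennreal (cN * t ^ k) * best_approx (k + r) f p \<alpha> \<beta> \<and>
          (N \<le> k + r \<longrightarrow>
             modulus k r ((deriv ^^ r) g) t p \<alpha> \<beta> \<le> inverse_bound k r \<phi> c t))))"
proof (intro conjI allI impI)
  fix N \<phi> f assume "approx_rate_hyp r N p \<alpha> \<beta> \<phi> f"
  then show "f \<in> B_space p r \<alpha> \<beta>" by (rule approx_rate_in_B_space[OF assms(1-3)])
next
  fix k :: nat assume k: "1 \<le> k"
  obtain C where C: "0 < C" and main: "\<And>i0 \<phi> f g t. approx_rate_hyp r (2 ^ i0) p \<alpha> \<beta> \<phi> f \<Longrightarrow> 1 \<le> i0 \<Longrightarrow> k + r \<le> 2 ^ i0 \<Longrightarrow>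
    g \<in> B_rep p r \<alpha> \<beta> \<Longrightarrow> ae_eq f g \<Longrightarrow> 0 < t \<Longrightarrow> t \<le> 1/2 \<Longrightarrow>
    modulus k r ((deriv ^^ r) g) t p \<alpha> \<beta> \<le> inverse_bound k r \<phi> C t + ennreal (C * real (2 ^ i0) ^ (k + r) * t ^ k) * best_approx (k + r) f p \<alpha> \<beta>"
    using inverse_estimate[OF assms(1-3) k assms(4,5)] by blast
  let ?m = "k + r"
  \<comment> \<open>The index \<open>Suc (max N ?m)\<close> is at least 1, and 2 to this power is at
    least N and at least k + r; w N is the Bernstein factor that results.\<close>
  define w where "w = (\<lambda>N. real (2 ^ Suc (max N ?m)) ^ ?m)"
  have w: "0 < w N" for N by (simp add: w_def)
  \<comment> \<open>The second summand takes up the term with \<open>best_approx (k + r)\<close>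
    when N \<le> k + r; it involves \<open>w ?m\<close> and not w N, so c is independent of
    N.\<close>
  define c where "c = C + C * w ?m * 2 ^ (?m + 1)"
  have cC: "C \<le> c" "0 < c" using C w[of ?m] by (auto simp: c_def intro!: add_pos_pos)
  have mono: "inverse_bound k r \<phi> C t \<le> inverse_bound k r \<phi> c t" if "0 < t" for \<phi> t
    unfolding inverse_bound_def using cC that by (intro add_mono mult_right_mono ennreal_leI) auto
  have est: "modulus k r ((deriv ^^ r) g) t p \<alpha> \<beta> \<le> inverse_bound k r \<phi> C t + ennreal (C * w N * t ^ k) * best_approx ?m f p \<alpha> \<beta>"
    if "approx_rate_hyp r N p \<alpha> \<beta> \<phi> f" "g \<in> B_rep p r \<alpha> \<beta>" "ae_eq f g" "0 < t" "t \<le> 1/2" for N \<phi> f g t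
    unfolding w_def
  proof (rule main)
    have "max N ?m < 2 ^ max N ?m" by (rule less_exp)
    then have le: "max N ?m \<le> 2 ^ Suc (max N ?m)" unfolding power_Suc by linarith
    then show "k + r \<le> 2 ^ Suc (max N ?m)" by linarith
    show "approx_rate_hyp r (2 ^ Suc (max N ?m)) p \<alpha> \<beta> \<phi> f"
      using that(1) le unfolding approx_rate_hyp_def by (meson max.boundedE order_trans)
  qed (use that in auto)
  show "\<exists>c>0. \<forall>N\<ge>1. \<exists>cN>0. \<forall>\<phi> f. approx_rate_hyp r N p \<alpha> \<beta> \<phi> f \<longrightarrow>
       (\<forall>g\<in>B_rep p r \<alpha> \<beta>. ae_eq f g \<longrightarrow> (\<forall>t\<in>{0<..1/2}.
          modulus k r ((deriv ^^ r) g) t p \<alpha> \<beta>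
            \<le> inverse_bound k r \<phi> c t + ennreal (cN * t ^ k) * best_approx (k + r) f p \<alpha> \<beta> \<and>
          (N \<le> k + r \<longrightarrow>
             modulus k r ((deriv ^^ r) g) t p \<alpha> \<beta> \<le> inverse_bound k r \<phi> c t)))"
  proof (rule exI[of _ c], intro conjI allI impI)
    fix N :: nat
    show "\<exists>cN>0. \<forall>\<phi> f. approx_rate_hyp r N p \<alpha> \<beta> \<phi> f \<longrightarrow>
       (\<forall>g\<in>B_rep p r \<alpha> \<beta>. ae_eq f g \<longrightarrow> (\<forall>t\<in>{0<..1/2}.
          modulus k r ((deriv ^^ r) g) t p \<alpha> \<beta>
            \<le> inverse_bound k r \<phi> c t + ennreal (cN * t ^ k) * best_approx (k + r) f p \<alpha> \<beta> \<and>
          (N \<le> k + r \<longrightarrow>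
             modulus k r ((deriv ^^ r) g) t p \<alpha> \<beta> \<le> inverse_bound k r \<phi> c t)))"
    proof (intro exI[of _ "C * w N"] conjI allI impI ballI)
      show "0 < C * w N" using C w by simp
      fix \<phi> f g and t :: real
      assume hyp: "approx_rate_hyp r N p \<alpha> \<beta> \<phi> f" and g: "g \<in> B_rep p r \<alpha> \<beta>" "ae_eq f g" and "t \<in> {0<..1/2}"
      then have t: "0 < t" "t \<le> 1/2" by auto
      show "modulus k r ((deriv ^^ r) g) t p \<alpha> \<beta> \<le> inverse_bound k r \<phi> c t + ennreal (C * w N * t ^ k) * best_approx (k + r) f p \<alpha> \<beta>"
        by (rule order_trans[OF est[OF hyp g t] add_right_mono[OF mono[OF t(1)]]])
      assume N: "N \<le> k + r"
      have \<phi>: "mono_on {0..} \<phi>" "\<And>t. 0 \<le> t \<Longrightarrow> 0 \<le> \<phi> t" using hyp by (auto simp: approx_rate_hyp_def Phi_class_def)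
      let ?T = "\<lambda>t. \<integral>\<^sup>+u\<in>{t..1}. ennreal (\<phi> u / u ^ (?m + 1)) \<partial>lborel"
      have "best_approx ?m f p \<alpha> \<beta> \<le> ennreal (\<phi> (1 / (real ?m + 1)))" using hyp N unfolding approx_rate_hyp_def by blast
      \<comment> \<open>k \<ge> 1 gives 1/(k+r+1) \<le> 1/2, and [1/2, 1] is contained in [t, 1]; in
        this way the second integral absorbs the best approximation.\<close>
      also have "\<dots> \<le> ennreal (\<phi> (1/2))"
        using k by (intro ennreal_leI mono_onD[OF \<phi>(1)]) (auto simp: field_simps)
      also have "\<dots> \<le> ennreal (2 ^ (?m + 1) * (1/2) ^ ?m) * ?T (1/2)"
        by (intro phi_le_integral \<phi>) auto
      also have "\<dots> \<le> ennreal (2 ^ (?m + 1)) * ?T t"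
      proof (rule mult_mono)
        have "(1/2) ^ ?m \<le> (1::real)" by (intro power_le_one) auto
        then have "2 ^ (?m + 1) * (1/2) ^ ?m \<le> (2::real) ^ (?m + 1)" by (intro mult_left_le) auto
        then show "ennreal (2 ^ (?m + 1) * (1/2) ^ ?m) \<le> ennreal (2 ^ (?m + 1))" by (rule ennreal_leI)
        have "indicator {1/2..1} u \<le> (indicator {t..1} u :: ennreal)" for u using t by (auto split: split_indicator)
        then show "?T (1/2) \<le> ?T t" by (intro nn_integral_mono mult_left_mono) auto
      qed auto
      finally have E: "best_approx ?m f p \<alpha> \<beta> \<le> ennreal (2 ^ (?m + 1)) * ?T t" .
      \<comment> \<open>For N \<le> k + r the hypothesis also holds with k + r as starting degree;
        restarting there makes the constant independent of N.\<close>
      have "approx_rate_hyp r ?m p \<alpha> \<beta> \<phi> f" using hyp N by (auto simp: approx_rate_hyp_def)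
      from est[OF this g t] have "modulus k r ((deriv ^^ r) g) t p \<alpha> \<beta> \<le> inverse_bound k r \<phi> C t + ennreal (C * w ?m * t ^ k) * best_approx ?m f p \<alpha> \<beta>" .
      also have "\<dots> \<le> inverse_bound k r \<phi> C t + ennreal (C * w ?m * t ^ k) * (ennreal (2 ^ (?m + 1)) * ?T t)"
        by (intro add_left_mono mult_left_mono E) auto
      also have "ennreal (C * w ?m * t ^ k) * (ennreal (2 ^ (?m + 1)) * ?T t) = ennreal ((C * w ?m * 2 ^ (?m + 1)) * t ^ k) * ?T t"
        using C w[of ?m] t by (simp add: ennreal_mult[symmetric] mult.assoc[symmetric]) (simp add: mult_ac)
      also have "inverse_bound k r \<phi> C t + \<dots> \<le> inverse_bound k r \<phi> c t"
      proof -
        have "ennreal (c * t ^ k) = ennreal (C * t ^ k) + ennreal ((C * w ?m * 2 ^ (?m + 1)) * t ^ k)"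
          using C w[of ?m] t unfolding c_def distrib_right by (intro ennreal_plus) auto
        moreover have "ennreal C * Y \<le> ennreal c * Y" for Y using cC by (intro mult_right_mono ennreal_leI) auto
        ultimately show ?thesis unfolding inverse_bound_def by (simp add: distrib_right add.assoc add_right_mono)
      qed
      finally show "modulus k r ((deriv ^^ r) g) t p \<alpha> \<beta> \<le> inverse_bound k r \<phi> c t" .
    qed
  qed (rule cC(2))
qed

end
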